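(* Let $p,\sigma\in L_2(0,\pi)$ be complex-valued, let $f_1,f_2$ be entire functions, let $\{\lambda_n\}_{n\ge1}$ be a subspectrum of the boundary value problem $L(p,\sigma)$, put $\lambda_0:=0$, and let $\{v_k\}_{k=0}^\infty$ be the sequence constructed from $\{\lambda_n\}_{n\ge 1}$ and $f_1,f_2$. Suppose that for every $n\in\mathbb N$ the functions $f_1$ and $f_2$ do not vanish simultaneously at $\lambda_n$. Consider the functional system $$\mathcal E=\{e^{<\nu>}(t,\lambda_n)\}_{n\in\mathbb S_\lambda,\ \nu=0,\dots,m_{\lambda,n}-1},\qquad e(t,\lambda)=\exp(i\lambda t).$$ (i) If $\mathcal E$ is complete in $L_2(-2\pi,2\pi)$, then $\{v_k\}_{k=0}^\infty$ is complete in $\mathcal H$. (ii) If $\mathcal E$ is a Riesz basis in $L_2(-2\pi,2\pi)$, $\operatorname{Im}\lambda_n=O(1)$ as $n\to\infty$, and there is $n_0\in\mathbb N$ such that $m_{\lambda,n}=1$ for all $n\ge n_0$, then $\{v_k\}_{k=0}^\infty$ is an unconditional basis in $\mathcal H$.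
   Context: All functions are complex-valued. The boundary value problem. For $p,\sigma\in L_2(0,\pi)$ and entire functions $f_1,f_2$, $L(p,\sigma)$ denotes the problem $$\ell y+2\lambda p(x)y=\lambda^2y,\quad x\in(0,\pi),\qquad \ell y:=-(y^{[1]})'-\sigma(x)y^{[1]}-\sigma^2(x)y,\qquad y^{[1]}:=y'-\sigma y,$$ $$y(0)=0,\qquad f_1(\lambda)y^{[1]}(\pi)+f_2(\lambda)y(\pi)=0,$$ where solutions satisfy $y,y^{[1]}\in AC[0,\pi]$ and $\ell y\in L_2(0,\pi)$. (This is the regularized form of $-y''+qy+2\lambda py=\lambda^2y$ with $q=\sigma'\in W_2^{-1}(0,\pi)$.) Let $S(x,\lambda)$ be the unique solution of the differential equation with $S(0,\lambda)=0$, $S^{[1]}(0,\lambda)=1$. The functions $S(\pi,\lambda)$, $S^{[1]}(\pi,\lambda)$ are entire in $\lambda$. The characteristic function of $L(p,\sigma)$ is $\Delta(\lambda)=f_1(\lambda)S^{[1]}(\pi,\lambda)+f_2(\lambda)S(\pi,\lambda)$; its zeros are the eigenvalues. Subspectrum. A sequence $\{\lambda_k\}_{k\ge1}$ of complex numbers is called a subspectrum of $L(p,\sigma)$ if $\Delta(\lambda_k)=0$ for all $k\ge 1$ and each value occurs in the sequence at most as many times as its multiplicity as a zero of $\Delta$. Index notation. With $\lambda_0:=0$, put $\mathbb S_\lambda=\{n\ge0:\lambda_n\ne\lambda_k\ \forall k,\ 0\le k<n\}$, $m_{\lambda,n}=\#\{k\ge0:\lambda_k=\lambda_n\}$. It is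 assumed throughout that equal values are consecutive: $\lambda_n=\lambda_{n+1}=\dots=\lambda_{n+m_{\lambda,n}-1}$ for $n\in\mathbb S_\lambda$. The sequence $\{v_k\}$. Let $\mathcal H=L_2(-\pi,\pi)\oplus L_2(-\pi,\pi)$ with scalar product $(g,h)_{\mathcal H}=\int_{-\pi}^\pi(\overline{g_1}h_1+\overline{g_2}h_2)\,dt$ for $g=[g_1,g_2]$, $h=[h_1,h_2]$. Denote $f^{<j>}(z)=\frac1{j!}\frac{d^j}{d\lambda^j}f(\lambda)\big|_{\lambda=z}$ (derivatives with respect to the spectral variable $\lambda$; so $e^{<\nu>}(t,\lambda_n)=\frac{(it)^\nu}{\nu!}e^{i\lambda_nt}$), and $$v(t,\lambda)=[\lambda f_1(\lambda)e^{i\lambda t},\ f_2(\lambda)e^{i\lambda t}],\quad t\in(-\pi,\pi).$$ For $n\in\mathbb S_\lambda$ and $0\le\nu\le m_{\lambda,n}-1$ put $v_{n+\nu}(t)=v^{<\nu>}(t,\lambda_n)$ if $n+\nu>0$, and $v_0(t)=[0,1]$. The index $n+\nu$ runs over all nonnegative integers. "Complete" means that the closed linear span is the whole space. An unconditional basis is a Schauder basis that remains a basis under every permutation of its elements. *)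

theory Defs
  imports
    "HOL-Analysis.Analysis"
    "HOL-Library.Function_Algebras"
    "HOL-Library.Landau_Symbols"
    "HOL-Library.Extended_Nat"
begin

section \<open>Hilbert spaces of functions, bases\<close>

text \<open>
  The elements of \<open>L\<^sub>2\<close> are represented by functions, so the form \<open>ip\<close> below is only
  semidefinite, and equality in \<open>L\<^sub>2\<close> (equality almost everywhere) is written
  \<open>hnorm X (f - g) = 0\<close>. Vector addition is the pointwise (componentwise) one of the type
  class; the scalars are complex. The form \<open>ip\<close> is antilinear in its first argument.
\<close>

record 'v ip_space =
  carrier :: "'v set"
  scale :: "complex \<Rightarrow> 'v \<Rightarrow> 'v"
  ip :: "'v \<Rightarrow> 'v \<Rightarrow> complex"

definition hnorm :: "'v ip_space \<Rightarrow> 'v \<Rightarrow> real" where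
  "hnorm X f = sqrt (Re (ip X f f))"

definition lincomb ::
    "('v :: ab_group_add) ip_space \<Rightarrow> ('i \<Rightarrow> 'v) \<Rightarrow> ('i \<Rightarrow> complex) \<Rightarrow> 'i set \<Rightarrow> 'v" where
  "lincomb X x c F = (\<Sum>j\<in>F. scale X (c j) (x j))"

definition complete_system ::
    "('v :: ab_group_add) ip_space \<Rightarrow> 'i set \<Rightarrow> ('i \<Rightarrow> 'v) \<Rightarrow> bool" where
  "complete_system X J x \<longleftrightarrow>
     (\<forall>j\<in>J. x j \<in> carrier X) \<and>
     (\<forall>f\<in>carrier X. \<forall>\<epsilon>>0. \<exists>F c. finite F \<and> F \<subseteq> J \<and> hnorm X (f - lincomb X x c F) < \<epsilon>)"

definition orthonormal_basis ::
    "('v :: ab_group_add) ip_space \<Rightarrow> 'i set \<Rightarrow> ('i \<Rightarrow> 'v) \<Rightarrow> bool" where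
  "orthonormal_basis X J e \<longleftrightarrow>
     complete_system X J e \<and>
     (\<forall>i\<in>J. \<forall>j\<in>J. ip X (e i) (e j) = (if i = j then 1 else 0))"

definition bounded_operator ::
    "('v :: ab_group_add) ip_space \<Rightarrow> ('v \<Rightarrow> 'v) \<Rightarrow> bool" where
  "bounded_operator X T \<longleftrightarrow>
     (\<forall>f\<in>carrier X. T f \<in> carrier X) \<and>
     (\<forall>f\<in>carrier X. \<forall>g\<in>carrier X. hnorm X (T (f + g) - (T f + T g)) = 0) \<and>
     (\<forall>c. \<forall>f\<in>carrier X. hnorm X (T (scale X c f) - scale X c (T f)) = 0) \<and>
     (\<exists>K. \<forall>f\<in>carrier X. hnorm X (T f) \<le> K * hnorm X f)"

text \<open>A Riesz basis is the image of an orthonormal basis under a bounded operator with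
  bounded inverse.\<close>

definition riesz_basis ::
    "('v :: ab_group_add) ip_space \<Rightarrow> 'i set \<Rightarrow> ('i \<Rightarrow> 'v) \<Rightarrow> bool" where
  "riesz_basis X J x \<longleftrightarrow>
     (\<forall>j\<in>J. x j \<in> carrier X) \<and>
     (\<exists>e T R. orthonormal_basis X J e \<and> bounded_operator X T \<and> bounded_operator X R \<and>
        (\<forall>f\<in>carrier X. hnorm X (R (T f) - f) = 0 \<and> hnorm X (T (R f) - f) = 0) \<and>
        (\<forall>j\<in>J. hnorm X (x j - T (e j)) = 0))"

definition schauder_basis ::
    "('v :: ab_group_add) ip_space \<Rightarrow> (nat \<Rightarrow> 'v) \<Rightarrow> bool" where
  "schauder_basis X x \<longleftrightarrow>
     (\<forall>k. x k \<in> carrier X) \<and>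
     (\<forall>f\<in>carrier X. \<exists>!c. (\<lambda>N. hnorm X (f - lincomb X x c {..<N})) \<longlonglongrightarrow> 0)"

definition unconditional_basis ::
    "('v :: ab_group_add) ip_space \<Rightarrow> (nat \<Rightarrow> 'v) \<Rightarrow> bool" where
  "unconditional_basis X x \<longleftrightarrow>
     (\<forall>\<pi> :: nat \<Rightarrow> nat. bij \<pi> \<longrightarrow> schauder_basis X (\<lambda>k. x (\<pi> k)))"

definition sq_integrable :: "real \<Rightarrow> real \<Rightarrow> (real \<Rightarrow> complex) set" where
  "sq_integrable a b =
     {f \<in> borel_measurable (lebesgue_on {a<..<b}).
        integrable (lebesgue_on {a<..<b}) (\<lambda>t. (cmod (f t))\<^sup>2)}"

definition L2 :: "real \<Rightarrow> real \<Rightarrow> (real \<Rightarrow> complex) ip_space" where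
  "L2 a b = \<lparr> carrier = sq_integrable a b,
              scale = (\<lambda>c f t. c * f t),
              ip = (\<lambda>g h. LINT t|lebesgue_on {a<..<b}. cnj (g t) * h t) \<rparr>"

definition direct_sum :: "'v ip_space \<Rightarrow> 'w ip_space \<Rightarrow> ('v \<times> 'w) ip_space" where
  "direct_sum X Y = \<lparr> carrier = carrier X \<times> carrier Y,
                      scale = (\<lambda>c (f, g). (scale X c f, scale Y c g)),
                      ip = (\<lambda>(f, g) (f', g'). ip X f f' + ip Y g g') \<rparr>"

definition \<H> :: "((real \<Rightarrow> complex) \<times> (real \<Rightarrow> complex)) ip_space" where
  "\<H> = direct_sum (L2 (- pi) pi) (L2 (- pi) pi)"


section \<open>The boundary value problem\<close>

definition abs_cont :: "real \<Rightarrow> real \<Rightarrow> (real \<Rightarrow> complex) \<Rightarrow> bool" where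
  "abs_cont a b f \<longleftrightarrow>
     (\<forall>\<epsilon>>0. \<exists>\<delta>>0. \<forall>D :: (real \<times> real) set.
        finite D \<and> (\<forall>(u, v)\<in>D. a \<le> u \<and> u \<le> v \<and> v \<le> b) \<and>
        disjoint_family_on (\<lambda>(u, v). {u<..<v}) D \<and> (\<Sum>(u, v)\<in>D. v - u) < \<delta>
        \<longrightarrow> (\<Sum>(u, v)\<in>D. cmod (f v - f u)) < \<epsilon>)"

text \<open>The quasi-derivative \<open>y' - \<sigma> y\<close> is defined almost everywhere only. Requiring it to be
  absolutely continuous means that it has an absolutely continuous representative, which is
  carried along as a second function \<open>y1\<close>. Absolutely continuous functions are differentiable
  almost everywhere, so \<open>vector_derivative\<close> is their derivative almost everywhere.\<close>

definition quasi_derivative ::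
    "(real \<Rightarrow> complex) \<Rightarrow> (real \<Rightarrow> complex) \<Rightarrow> (real \<Rightarrow> complex) \<Rightarrow> bool" where
  "quasi_derivative \<sigma> y y1 \<longleftrightarrow>
     (AE x in lebesgue_on {0<..<pi}. y1 x = vector_derivative y (at x) - \<sigma> x * y x)"

definition ell ::
    "(real \<Rightarrow> complex) \<Rightarrow> (real \<Rightarrow> complex) \<Rightarrow> (real \<Rightarrow> complex) \<Rightarrow> real \<Rightarrow> complex" where
  "ell \<sigma> y y1 x = - vector_derivative y1 (at x) - \<sigma> x * y1 x - (\<sigma> x)\<^sup>2 * y x"

definition is_solution ::
    "(real \<Rightarrow> complex) \<Rightarrow> (real \<Rightarrow> complex) \<Rightarrow> complex \<Rightarrow>
     (real \<Rightarrow> complex) \<Rightarrow> (real \<Rightarrow> complex) \<Rightarrow> bool" where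
  "is_solution p \<sigma> z y y1 \<longleftrightarrow>
     abs_cont 0 pi y \<and> abs_cont 0 pi y1 \<and> quasi_derivative \<sigma> y y1 \<and>
     ell \<sigma> y y1 \<in> sq_integrable 0 pi \<and>
     (AE x in lebesgue_on {0<..<pi}. ell \<sigma> y y1 x + 2 * z * p x * y x = z\<^sup>2 * y x)"

text \<open>The pair \<open>(S(\<cdot>, z), S\<^bsup>[1]\<^esup>(\<cdot>, z))\<close>. Both functions are determined on \<open>[0, \<pi>]\<close> by the
  conditions; their values elsewhere are arbitrary and never used.\<close>

definition S_pair ::
    "(real \<Rightarrow> complex) \<Rightarrow> (real \<Rightarrow> complex) \<Rightarrow> complex \<Rightarrow>
     (real \<Rightarrow> complex) \<times> (real \<Rightarrow> complex)" where
  "S_pair p \<sigma> z = (SOME (y, y1). is_solution p \<sigma> z y y1 \<and> y 0 = 0 \<and> y1 0 = 1)"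

definition char_fun ::
    "(real \<Rightarrow> complex) \<Rightarrow> (real \<Rightarrow> complex) \<Rightarrow> (complex \<Rightarrow> complex) \<Rightarrow> (complex \<Rightarrow> complex) \<Rightarrow>
     complex \<Rightarrow> complex" where
  "char_fun p \<sigma> f1 f2 z =
     f1 z * snd (S_pair p \<sigma> z) pi + f2 z * fst (S_pair p \<sigma> z) pi"


section \<open>Subspectra and the associated systems of functions\<close>

definition ecard :: "'a set \<Rightarrow> enat" where
  "ecard A = (if finite A then enat (card A) else \<infinity>)"

text \<open>The multiplicity of a zero of an entire function; it is \<open>\<infinity>\<close> if the function vanishes
  identically.\<close>

definition zero_multiplicity :: "(complex \<Rightarrow> complex) \<Rightarrow> complex \<Rightarrow> enat" where
  "zero_multiplicity f z = (INF j\<in>{j. (deriv ^^ j) f z \<noteq> 0}. enat j)"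

text \<open>The members of a subspectrum are \<open>lam k\<close> for \<open>k \<ge> 1\<close>; the value \<open>lam 0\<close> is not one.\<close>

definition subspectrum ::
    "(real \<Rightarrow> complex) \<Rightarrow> (real \<Rightarrow> complex) \<Rightarrow> (complex \<Rightarrow> complex) \<Rightarrow> (complex \<Rightarrow> complex) \<Rightarrow>
     (nat \<Rightarrow> complex) \<Rightarrow> bool" where
  "subspectrum p \<sigma> f1 f2 lam \<longleftrightarrow>
     (\<forall>k\<ge>1. char_fun p \<sigma> f1 f2 (lam k) = 0) \<and>
     (\<forall>z. ecard {k. k \<ge> 1 \<and> lam k = z} \<le> zero_multiplicity (char_fun p \<sigma> f1 f2) z)"

definition S_index :: "(nat \<Rightarrow> complex) \<Rightarrow> nat set" where
  "S_index lam = {n. \<forall>k<n. lam n \<noteq> lam k}"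

definition mult_at :: "(nat \<Rightarrow> complex) \<Rightarrow> nat \<Rightarrow> enat" where
  "mult_at lam n = ecard {k. lam k = lam n}"

definition equal_consecutive :: "(nat \<Rightarrow> complex) \<Rightarrow> bool" where
  "equal_consecutive lam \<longleftrightarrow>
     (\<forall>n\<in>S_index lam. \<forall>\<nu>. enat \<nu> < mult_at lam n \<longrightarrow> lam (n + \<nu>) = lam n)"

definition taylor_coeff :: "nat \<Rightarrow> (complex \<Rightarrow> complex) \<Rightarrow> complex \<Rightarrow> complex" where
  "taylor_coeff j f z = (deriv ^^ j) f z / fact j"

definition E_index :: "(nat \<Rightarrow> complex) \<Rightarrow> (nat \<times> nat) set" where
  "E_index lam = {(n, \<nu>). n \<in> S_index lam \<and> enat \<nu> < mult_at lam n}"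

definition E_system :: "(nat \<Rightarrow> complex) \<Rightarrow> nat \<times> nat \<Rightarrow> real \<Rightarrow> complex" where
  "E_system lam = (\<lambda>(n, \<nu>) t. taylor_coeff \<nu> (\<lambda>z. exp (\<i> * z * of_real t)) (lam n))"

definition v_coeff ::
    "(complex \<Rightarrow> complex) \<Rightarrow> (complex \<Rightarrow> complex) \<Rightarrow> nat \<Rightarrow> complex \<Rightarrow>
     (real \<Rightarrow> complex) \<times> (real \<Rightarrow> complex)" where
  "v_coeff f1 f2 \<nu> w =
     ((\<lambda>t. taylor_coeff \<nu> (\<lambda>z. z * f1 z * exp (\<i> * z * of_real t)) w),
      (\<lambda>t. taylor_coeff \<nu> (\<lambda>z. f2 z * exp (\<i> * z * of_real t)) w))"

text \<open>If equal values are consecutive, every index \<open>k\<close> is uniquely \<open>n + \<nu>\<close> with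
  \<open>n \<in> S_index lam\<close> and \<open>\<nu> < mult_at lam n\<close>, namely with \<open>n\<close> the first index at which the value
  \<open>lam k\<close> occurs.\<close>

definition v_seq ::
    "(complex \<Rightarrow> complex) \<Rightarrow> (complex \<Rightarrow> complex) \<Rightarrow> (nat \<Rightarrow> complex) \<Rightarrow> nat \<Rightarrow>
     (real \<Rightarrow> complex) \<times> (real \<Rightarrow> complex)" where
  "v_seq f1 f2 lam k =
     (if k = 0 then ((\<lambda>t. 0), (\<lambda>t. 1))
      else let n = (LEAST n. lam n = lam k) in v_coeff f1 f2 (k - n) (lam n))"

lemma v_seq_eq:
  assumes "equal_consecutive lam" "n \<in> S_index lam" "enat \<nu> < mult_at lam n" "n + \<nu> > 0"
  shows "v_seq f1 f2 lam (n + \<nu>) = v_coeff f1 f2 \<nu> (lam n)"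
proof -
  have eq: "lam (n + \<nu>) = lam n"
    using assms by (auto simp: equal_consecutive_def)
  have "(LEAST m. lam m = lam (n + \<nu>)) = n"
    using assms(2) eq by (intro Least_equality) (auto simp: S_index_def not_less[symmetric])
  then show ?thesis
    using assms(4) by (auto simp: v_seq_def Let_def)
qed

end

theory Submission
  imports Defs "HOL-Complex_Analysis.Complex_Analysis"
begin

text \<open>Let \<open>Y\<close>, \<open>Y1\<close> be the two components of \<open>S\<close> and \<open>U, W = Y1 \<plusminus> i z Y\<close>. At \<open>x = \<pi>\<close> these are
  \<open>exp (\<plusminus>(i z \<pi> - ph \<pi>))\<close> up to remainders \<open>\<kappa>u\<close>, \<open>\<kappa>w\<close>, and the crucial estimate (which takes the place of
  transformation operators) bounds \<open>\<Sum>j c j * \<kappa> (\<mu> j)\<close> by the norm of \<open>\<Sum>j c j * exp (i \<mu> j t)\<close> in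
  \<open>L\<^sub>2(-\<pi>, \<pi>)\<close>.

  (i) A bounded functional on \<open>\<H>\<close> that annihilates \<open>v\<close> has two components; let \<open>H1\<close>, \<open>H2\<close> be their
  values on \<open>exp (i z t)\<close>. The entire function \<open>D = z Y H1 - Y1 H2\<close> vanishes at every \<open>lam n\<close> with its
  multiplicity, and by the estimate \<open>exp (i z t) \<mapsto> D z\<close> extends to a bounded functional on
  \<open>L\<^sub>2(-2\<pi>, 2\<pi>)\<close>; as the exponentials are complete there, \<open>D = 0\<close>. Then \<open>H1 / Y1 = H2 / (z Y)\<close> is
  entire, bounded and decaying along the imaginary axis, hence zero by Liouville's theorem.

  (ii) An isomorphism of \<open>L\<^sub>2(-2\<pi>, 2\<pi>)\<close> onto \<open>\<H>\<close> carries the exponentials to a Riesz basis. For large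
  \<open>n\<close>, \<open>v n\<close> is a nonzero multiple of a vector whose distance from the corresponding basis element is
  controlled by \<open>\<kappa>u (lam n)\<close> and \<open>\<kappa>w (lam n)\<close>, and the estimate makes these square summable. A complete
  system quadratically close to a Riesz basis is a Riesz basis: a far tail is a small perturbation,
  and the finitely many other elements are exchanged one by one.\<close>

section \<open>Absolutely continuous functions\<close>

text \<open>The doubled interval comes from the factors \<open>z * Y z pi\<close> and
  \<open>Y1 z pi\<close>: their main terms contain \<open>exp (\<plusminus> \<i> z pi)\<close>, so
  they shift functions on (-pi, pi) by pi in both directions. The determinant \<open>D\<close> is
  forced: where \<open>\<Delta>\<close> vanishes, \<open>(f1, f2)\<close> is a nonzero multiple of
  \<open>(Y, - Y1)\<close>, and annihilation of \<open>v\<close> turns into \<open>D = 0\<close>; at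
  multiple zeros, identities for \<open>f1 * D\<close> and \<open>f2 * D\<close> do the same to the
  right order. The artificial value \<open>lam 0 = 0\<close> is matched by
  \<open>v 0 = (0, 1)\<close>, which gives \<open>H2 0 = 0\<close> and so \<open>D 0 = 0\<close>.

  The remainder estimate allows arbitrary coefficients because it is used in three ways: one
  exponential gives growth off the real axis, conjugated remainders as coefficients give square
  summability by duality, and coefficients \<open>c \<mu> * exp (\<i> \<mu> t)\<close> give a
  mapping bound between the two intervals. The size of \<open>f1\<close>, \<open>f2\<close> at
  \<open>lam n\<close> is not controlled, so Riesz bounds are established only after scalars have
  been divided out; an unconditional basis survives such a rescaling.\<close>

definition has_density :: "real \<Rightarrow> real \<Rightarrow> (real \<Rightarrow> 'a::euclidean_space) \<Rightarrow> (real \<Rightarrow> 'a) \<Rightarrow> bool" where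
  "has_density a b f F \<longleftrightarrow>
     F absolutely_integrable_on {a..b} \<and> (\<forall>x\<in>{a..b}. f x = f a + integral {a..x} F)"

text \<open>Indexed families instead of sets of pairs, so that degenerate intervals may repeat:
  cutting all intervals at a point, or subdividing each of them, then only changes the endpoint
  functions or the index set.\<close>

definition nonoverlapping :: "real \<Rightarrow> real \<Rightarrow> 'i set \<Rightarrow> ('i \<Rightarrow> real) \<Rightarrow> ('i \<Rightarrow> real) \<Rightarrow> bool" where
  "nonoverlapping a b I l r \<longleftrightarrow>
     finite I \<and> (\<forall>i\<in>I. a \<le> l i \<and> l i \<le> r i \<and> r i \<le> b) \<and>
     disjoint_family_on (\<lambda>i. {l i<..<r i}) I"

lemma sum_length_le:
  assumes "finite I" "disjoint_family_on (\<lambda>i. {l i<..<r i}) I"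
    and "\<And>i. i \<in> I \<Longrightarrow> l i \<le> r i" and "\<And>i. i \<in> I \<Longrightarrow> {l i<..<r i} \<subseteq> U"
    and "U \<in> sets lborel" and "emeasure lborel U \<le> ennreal e" and "0 \<le> e"
  shows "(\<Sum>i\<in>I. r i - l i) \<le> (e::real)"
proof -
  have "ennreal (\<Sum>i\<in>I. r i - l i) = (\<Sum>i\<in>I. ennreal (r i - l i))"
    using assms(3) by (subst sum_ennreal) auto
  also have "\<dots> = (\<Sum>i\<in>I. emeasure lborel {l i<..<r i})"
    using assms(3) by (intro sum.cong) auto
  also have "\<dots> = emeasure lborel (\<Union>i\<in>I. {l i<..<r i})"
    using assms(1,2) by (intro sum_emeasure) auto
  also have "\<dots> \<le> emeasure lborel U"
    using assms(4,5) by (intro emeasure_mono) auto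
  also have "\<dots> \<le> ennreal e" by fact
  finally show ?thesis using assms(7) by (simp add: ennreal_le_iff)
qed

lemma nonoverlapping_sum_length:
  assumes "nonoverlapping a b I l r" "a \<le> b"
  shows "(\<Sum>i\<in>I. r i - l i) \<le> b - a"
  using assms unfolding nonoverlapping_def
proof (intro sum_length_le[where U="{a..b}"], goal_cases)
  case (4 i)
  then have "a \<le> l i" "r i \<le> b" by auto
  then show ?case by auto
qed (auto simp: less_imp_le)

text \<open>\<open>abs_cont\<close> speaks about sets of pairs, whereas an indexed family may list
  the same degenerate pair several times. Degenerate intervals contribute nothing to either sum, and
  the others are pairwise different because equal nondegenerate intervals would overlap.\<close>

lemma abs_cont_indexed:
  assumes "abs_cont a b f" and "\<epsilon> > 0"
  shows "\<exists>\<delta>>0. \<forall>(I::'i set) l r. nonoverlapping a b I l r \<and> (\<Sum>i\<in>I. r i - l i) < \<delta> \<longrightarrow>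
           (\<Sum>i\<in>I. cmod (f (r i) - f (l i))) < \<epsilon>"
proof -
  from assms(1)[unfolded abs_cont_def, rule_format, OF assms(2)]
  obtain \<delta> where "\<delta> > 0" and \<delta>: "\<And>D. finite D \<Longrightarrow> (\<forall>(u, v)\<in>D. a \<le> u \<and> u \<le> v \<and> v \<le> b) \<Longrightarrow>
        disjoint_family_on (\<lambda>(u, v). {u<..<v}) D \<Longrightarrow> (\<Sum>(u, v)\<in>D. v - u) < \<delta> \<Longrightarrow>
        (\<Sum>(u, v)\<in>D. cmod (f v - f u)) < \<epsilon>"
    by blast
  have "(\<Sum>i\<in>I. cmod (f (r i) - f (l i))) < \<epsilon>"
    if "nonoverlapping a b I l r" "(\<Sum>i\<in>I. r i - l i) < \<delta>" for I :: "'i set" and l r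
  proof -
    define I' where "I' = {i\<in>I. l i < r i}"
    have fin: "finite I" and I: "\<And>i. i \<in> I \<Longrightarrow> a \<le> l i \<and> l i \<le> r i \<and> r i \<le> b"
      and dis: "\<And>i j. i \<in> I \<Longrightarrow> j \<in> I \<Longrightarrow> i \<noteq> j \<Longrightarrow> {l i<..<r i} \<inter> {l j<..<r j} = {}"
      using that(1) by (auto simp: nonoverlapping_def disjoint_family_on_def)
    have inj: "inj_on (\<lambda>i. (l i, r i)) I'"
    proof (rule inj_onI, rule ccontr)
      fix i j assume ij: "i \<in> I'" "j \<in> I'" "(l i, r i) = (l j, r j)" "i \<noteq> j"
      then have "{l i<..<r i} = {}" using dis[of i j] by (auto simp: I'_def)
      then show False using ij by (auto simp: I'_def)
    qed
    have sum_eq: "(\<Sum>i\<in>I. g (r i) - h (l i)) = (\<Sum>i\<in>I'. g (r i) - h (l i))"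
      if "\<And>x. g x = h x" for g h :: "real \<Rightarrow> real"
      using that fin I unfolding I'_def by (intro sum.mono_neutral_right) (auto simp: less_le)
    have "(\<Sum>i\<in>I. cmod (f (r i) - f (l i))) = (\<Sum>i\<in>I'. cmod (f (r i) - f (l i)))"
      using fin I unfolding I'_def by (intro sum.mono_neutral_right) (auto simp: less_le)
    also have "\<dots> = (\<Sum>(u, v)\<in>(\<lambda>i. (l i, r i)) ` I'. cmod (f v - f u))"
      by (subst sum.reindex[OF inj]) simp
    also have "\<dots> < \<epsilon>"
    proof (rule \<delta>)
      show "finite ((\<lambda>i. (l i, r i)) ` I')" using fin by (simp add: I'_def)
      show "\<forall>(u, v)\<in>(\<lambda>i. (l i, r i)) ` I'. a \<le> u \<and> u \<le> v \<and> v \<le> b"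
        using I by (auto simp: I'_def)
      show "disjoint_family_on (\<lambda>(u, v). {u<..<v}) ((\<lambda>i. (l i, r i)) ` I')"
        using dis unfolding disjoint_family_on_def I'_def by (clarsimp; metis)
      have "(\<Sum>(u, v)\<in>(\<lambda>i. (l i, r i)) ` I'. v - u) = (\<Sum>i\<in>I'. r i - l i)"
        by (subst sum.reindex[OF inj]) simp
      also have "\<dots> = (\<Sum>i\<in>I. r i - l i)" by (rule sum_eq[symmetric]) auto
      finally show "(\<Sum>(u, v)\<in>(\<lambda>i. (l i, r i)) ` I'. v - u) < \<delta>" using that(2) by simp
    qed
    finally show ?thesis .
  qed
  then show ?thesis using \<open>\<delta> > 0\<close> by blast
qed

text \<open>The Stieltjes measure of \<open>g\<close> is absolutely continuous with respect to
  Lebesgue measure, and its Radon-Nikodym derivative is the density. The index type in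
  \<open>ac\<close> is \<open>real set\<close> because the intervals supplied by the covering lemma
  serve as their own indices.\<close>

lemma mono_absolutely_continuous_density:
  fixes g :: "real \<Rightarrow> real"
  assumes "a < b"
    and mono: "\<And>x y. a \<le> x \<Longrightarrow> x \<le> y \<Longrightarrow> y \<le> b \<Longrightarrow> g x \<le> g y"
    and ac: "\<And>\<epsilon>. \<epsilon> > 0 \<Longrightarrow> \<exists>\<delta>>0. \<forall>(I::real set set) l r. nonoverlapping a b I l r \<and> (\<Sum>i\<in>I. r i - l i) < \<delta> \<longrightarrow>
           (\<Sum>i\<in>I. g (r i) - g (l i)) < \<epsilon>"
  shows "\<exists>h. has_density a b g h"
proof -
  \<comment> \<open>Constant continuation makes \<open>G\<close> monotone and continuous on the
    whole line, and its Stieltjes measure has no mass outside \<open>{a..b}\<close>.\<close>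
  define G where "G x = g (max a (min b x))" for x
  have G_mono: "G x \<le> G y" if "x \<le> y" for x y
    unfolding G_def using that \<open>a < b\<close> by (intro mono) auto
  have G_in: "G x = g x" if "a \<le> x" "x \<le> b" for x using that by (auto simp: G_def)
  have g_cont: "continuous_on {a..b} g"
  proof (unfold continuous_on_iff, intro ballI allI impI)
    fix x \<epsilon> :: real assume x: "x \<in> {a..b}" and "\<epsilon> > 0"
    then obtain \<delta> where \<delta>: "\<delta> > 0" "\<And>(I::real set set) l r. nonoverlapping a b I l r \<Longrightarrow> (\<Sum>i\<in>I. r i - l i) < \<delta> \<Longrightarrow>
           (\<Sum>i\<in>I. g (r i) - g (l i)) < \<epsilon>" using ac[of \<epsilon>] by blast
    have *: "g v - g u < \<epsilon>" if "a \<le> u" "u \<le> v" "v \<le> b" "v - u < \<delta>" for u v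
      using \<delta>(2)[of "{{}}" "\<lambda>_. u" "\<lambda>_. v"] that by (auto simp: nonoverlapping_def disjoint_family_on_def)
    show "\<exists>d>0. \<forall>x'\<in>{a..b}. dist x' x < d \<longrightarrow> dist (g x') (g x) < \<epsilon>"
    proof (intro exI conjI ballI impI)
      show "\<delta> > 0" by fact
      fix y assume y: "y \<in> {a..b}" "dist y x < \<delta>"
      show "dist (g y) (g x) < \<epsilon>"
        using *[of x y] *[of y x] mono[of x y] mono[of y x] x y
        by (cases "x \<le> y") (auto simp: dist_real_def abs_if split: if_splits)
    qed
  qed
  have G_cont: "continuous_on UNIV G"
    unfolding G_def
    by (rule continuous_on_compose2[OF g_cont, of UNIV "\<lambda>x. max a (min b x)"])
      (use \<open>a < b\<close> in \<open>auto intro!: continuous_on_max continuous_on_min continuous_on_const continuous_on_id\<close>)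
  define \<mu> where "\<mu> = interval_measure G"
  have G_rc: "continuous (at_right x) G" for x
    using G_cont by (simp add: continuous_on_eq_continuous_at continuous_at_imp_continuous_at_within)
  have [simp]: "sets \<mu> = sets borel" by (simp add: \<mu>_def)
  have Ioc: "emeasure \<mu> {x<..y} = ennreal (G y - G x)" if "x \<le> y" for x y
    unfolding \<mu>_def using that G_mono G_rc by (intro emeasure_interval_measure_Ioc) auto
  have Icc: "emeasure \<mu> {x..y} = ennreal (G y - G x)" if "x \<le> y" for x y
    unfolding \<mu>_def using that G_mono G_cont by (intro emeasure_interval_measure_Icc) auto
  have out1: "emeasure \<mu> {..a} = 0"
  proof -
    have "emeasure \<mu> (\<Union>n::nat. {a - real n..a}) = 0"
      by (intro emeasure_UN_eq_0) (auto simp: Icc G_def image_subset_iff)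
    moreover have "(\<Union>n::nat. {a - real n..a}) = {..a}"
    proof (intro equalityI subsetI)
      fix x assume "x \<in> {..a}"
      moreover obtain n where "a - x \<le> real n" using real_arch_simple by blast
      ultimately show "x \<in> (\<Union>n::nat. {a - real n..a})" by (auto intro!: exI[of _ n])
    qed auto
    ultimately show ?thesis by simp
  qed
  have out2: "emeasure \<mu> {b..} = 0"
  proof -
    have "emeasure \<mu> (\<Union>n::nat. {b..b + real n}) = 0"
      using \<open>a < b\<close> by (intro emeasure_UN_eq_0) (auto simp: Icc G_def image_subset_iff)
    moreover have "(\<Union>n::nat. {b..b + real n}) = {b..}"
    proof (intro equalityI subsetI)
      fix x assume "x \<in> {b..}"
      moreover obtain n where "x - b \<le> real n" using real_arch_simple by blast
      ultimately show "x \<in> (\<Union>n::nat. {b..b + real n})" by (auto intro!: exI[of _ n])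
    qed auto
    ultimately show ?thesis by simp
  qed
  \<comment> \<open>A null set is enclosed in an open \<open>U\<close> of small measure and covered
    by countably many nonoverlapping intervals inside \<open>U\<close>. Absolute continuity bounds
    the measure of each finite subfamily, and continuity from below bounds the whole.\<close>
  have small: "emeasure \<mu> (N \<inter> {a..b}) \<le> ennreal \<epsilon>" if N: "N \<in> null_sets lborel" and "\<epsilon> > 0" for N \<epsilon>
  proof (cases "N \<inter> {a..b} = {}")
    case False
    obtain \<delta> where \<delta>: "\<delta> > 0" "\<And>(I::real set set) l r. nonoverlapping a b I l r \<Longrightarrow> (\<Sum>i\<in>I. r i - l i) < \<delta> \<Longrightarrow>
           (\<Sum>i\<in>I. g (r i) - g (l i)) < \<epsilon>" using ac[OF \<open>\<epsilon> > 0\<close>] by blast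
    have NB: "N \<in> sets borel" "emeasure lborel N = 0" using N by (auto simp: null_sets_def)
    obtain U where U: "open U" "N \<subseteq> U" "emeasure lborel (U - N) < ennreal (\<delta>/2)"
      using outer_regular_lborel[OF NB(1), of "\<delta>/2"] \<delta>(1) by auto
    have "emeasure lborel U = emeasure lborel (U - N) + emeasure lborel N"
      using U NB by (subst plus_emeasure) (auto simp: Un_absorb2)
    then have eU: "emeasure lborel U \<le> ennreal (\<delta>/2)" using U(3) NB(2) by simp
    \<comment> \<open>The gauge sends points of \<open>U\<close> to \<open>U\<close>. Every tag lies
      in \<open>N\<close>, hence in \<open>U\<close>, so each covering interval is contained in
      \<open>U\<close>.\<close>
    obtain \<D> where D: "countable \<D>" "\<Union>\<D> \<subseteq> cbox a b"
      "\<And>K. K \<in> \<D> \<Longrightarrow> interior K \<noteq> {} \<and> (\<exists>c d. K = cbox c d)"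
      "pairwise (\<lambda>A B. interior A \<inter> interior B = {}) \<D>"
      "\<And>K. K \<in> \<D> \<Longrightarrow> \<exists>x \<in> (N \<inter> {a..b}) \<inter> K. K \<subseteq> (if x \<in> U then U else UNIV)"
      "N \<inter> {a..b} \<subseteq> \<Union>\<D>"
    proof (rule covering_lemma[of "N \<inter> {a..b}" a b "\<lambda>x. if x \<in> U then U else UNIV"])
      show "gauge (\<lambda>x. if x \<in> U then U else UNIV)" using U(1) by (simp add: gauge_def)
    qed (use \<open>a < b\<close> in \<open>simp_all add: box_real cbox_interval\<close>)
    have D_borel: "K \<in> sets borel" if KD: "K \<in> \<D>" for K
    proof -
      obtain c d where "K = cbox c d" using D(3)[OF KD] by blast
      then show ?thesis by simp
    qed
    have DU: "K \<subseteq> U" if "K \<in> \<D>" for K using D(5)[OF that] U(2) by (auto split: if_splits)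
    define l r where "l K = Inf K" and "r K = Sup K" for K :: "real set"
    have Klr: "K = {l K..r K} \<and> l K \<le> r K" if "K \<in> \<D>" for K
    proof -
      obtain c d where "K = cbox c d" "interior K \<noteq> {}" using D(3)[OF \<open>K \<in> \<D>\<close>] by blast
      then show ?thesis by (auto simp: l_def r_def cInf_atLeastAtMost cSup_atLeastAtMost)
    qed
    have no: "nonoverlapping a b \<F> l r" if "\<F> \<subseteq> \<D>" "finite \<F>" for \<F>
      unfolding nonoverlapping_def
    proof (intro conjI ballI)
      show "disjoint_family_on (\<lambda>i. {l i<..<r i}) \<F>"
        unfolding disjoint_family_on_def
      proof (intro ballI impI)
        fix A B assume AB: "A \<in> \<F>" "B \<in> \<F>" "A \<noteq> B"
        then have "interior A \<inter> interior B = {}" using D(4) that by (auto simp: pairwise_def)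
        moreover have "interior A = {l A<..<r A}" "interior B = {l B<..<r B}"
          using Klr AB that by (metis interior_atLeastAtMost_real subset_iff)+
        ultimately show "{l A<..<r A} \<inter> {l B<..<r B} = {}" by simp
      qed
      fix K assume "K \<in> \<F>"
      then have "K \<in> \<D>" using that by auto
      then have "K = {l K..r K} \<and> l K \<le> r K" "K \<subseteq> cbox a b" using Klr D(2) by auto
      then have "{l K..r K} \<subseteq> {a..b}" "l K \<le> r K" by auto
      then show "a \<le> l K" "l K \<le> r K" "r K \<le> b" by auto
    qed (use that in auto)
    have finF: "emeasure \<mu> (\<Union>\<F>) \<le> ennreal \<epsilon>" if "\<F> \<subseteq> \<D>" "finite \<F>" for \<F>
    proof -
      note noF = no[OF that]
      have "emeasure \<mu> (\<Union>\<F>) \<le> (\<Sum>K\<in>\<F>. emeasure \<mu> K)"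
        using emeasure_subadditive_finite[of \<F> "\<lambda>K. K" \<mu>] that D(3) by force
      also have "\<dots> = (\<Sum>K\<in>\<F>. ennreal (g (r K) - g (l K)))"
      proof (intro sum.cong refl)
        fix K assume K: "K \<in> \<F>"
        then have "K \<in> \<D>" using that by auto
        then have "emeasure \<mu> K = ennreal (G (r K) - G (l K))" using Klr Icc by metis
        then show "emeasure \<mu> K = ennreal (g (r K) - g (l K))"
          using noF K by (auto simp: nonoverlapping_def G_in)
      qed
      also have "\<dots> = ennreal (\<Sum>K\<in>\<F>. g (r K) - g (l K))"
        using noF mono by (intro sum_ennreal) (auto simp: nonoverlapping_def)
      also have "\<dots> \<le> ennreal \<epsilon>"
      proof (intro ennreal_leI less_imp_le \<delta>(2) noF)
        have "(\<Sum>K\<in>\<F>. r K - l K) \<le> \<delta>/2"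
        proof (rule sum_length_le[where U=U])
          show "{l K<..<r K} \<subseteq> U" if "K \<in> \<F>" for K
          proof -
            have "K \<in> \<D>" using that \<open>\<F> \<subseteq> \<D>\<close> by auto
            then have "{l K..r K} \<subseteq> U" using Klr DU by metis
            then show ?thesis by auto
          qed
        qed (use noF U eU \<delta>(1) in \<open>auto simp: nonoverlapping_def\<close>)
        then show "(\<Sum>K\<in>\<F>. r K - l K) < \<delta>" using \<delta>(1) by linarith
      qed
      finally show ?thesis .
    qed
    have "\<D> \<noteq> {}" using False D(6) by auto
    then obtain K :: "nat \<Rightarrow> real set" where K: "range K = \<D>" using D(1) by (metis uncountable_def)
    have "(SUP n. emeasure \<mu> (\<Union>i\<le>n. K i)) = emeasure \<mu> (\<Union>n::nat. \<Union>i\<le>n. K i)"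
    proof (rule SUP_emeasure_incseq)
      have "K i \<in> sets borel" for i
      proof -
        have "K i \<in> \<D>" using K by blast
        then show ?thesis by (rule D_borel)
      qed
      then show "range (\<lambda>n. \<Union>i\<le>n. K i) \<subseteq> sets \<mu>" by auto
      show "incseq (\<lambda>n. \<Union>i\<le>n. K i)" by (auto simp: incseq_def intro: order.trans)
    qed
    moreover have "(\<Union>n::nat. \<Union>i\<le>n. K i) = \<Union>\<D>" using K by blast
    moreover have "emeasure \<mu> (\<Union>i\<le>n. K i) \<le> ennreal \<epsilon>" for n
      using finF[of "K ` {..n}"] K by auto
    ultimately have "emeasure \<mu> (\<Union>\<D>) \<le> ennreal \<epsilon>" by (metis SUP_least)
    moreover have "emeasure \<mu> (N \<inter> {a..b}) \<le> emeasure \<mu> (\<Union>\<D>)"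
    proof (rule emeasure_mono[OF D(6)])
      have "\<Union>\<D> \<in> sets borel"
        using D(1) D_borel by (intro sets.countable_Union subsetI) auto
      then show "\<Union>\<D> \<in> sets \<mu>" by simp
    qed
    ultimately show ?thesis by simp
  qed simp
  have "absolutely_continuous lborel \<mu>"
    unfolding absolutely_continuous_def
  proof
    fix N :: "real set" assume N: "N \<in> null_sets lborel"
    then have NB: "N \<in> sets borel" by (auto simp: null_sets_def)
    have "emeasure \<mu> (N \<inter> {a..b}) = 0"
    proof (rule ccontr)
      assume *: "emeasure \<mu> (N \<inter> {a..b}) \<noteq> 0"
      have "emeasure \<mu> (N \<inter> {a..b}) \<le> 0"
        by (rule ennreal_le_epsilon) (use small[OF N] in auto)
      with * show False by simp
    qed
    moreover have "emeasure \<mu> N \<le> emeasure \<mu> ((N \<inter> {a..b}) \<union> ({..a} \<union> {b..}))"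
      using NB by (intro emeasure_mono) auto
    moreover have "\<dots> \<le> emeasure \<mu> (N \<inter> {a..b}) + (emeasure \<mu> {..a} + emeasure \<mu> {b..})"
      using NB by (intro order.trans[OF emeasure_subadditive] add_mono order.refl) (auto intro!: emeasure_subadditive)
    ultimately have "emeasure \<mu> N = 0" using out1 out2 by simp
    then show "N \<in> null_sets \<mu>" using NB by auto
  qed
  then obtain f where f: "f \<in> borel_measurable lborel" "density lborel f = \<mu>"
    using sigma_finite_measure.Radon_Nikodym[OF sigma_finite_lborel, of \<mu>] by auto
  have fI: "(\<integral>\<^sup>+t. f t * indicator {a..x} t \<partial>lborel) = ennreal (g x - g a)" if "a \<le> x" "x \<le> b" for x
    using emeasure_density[OF f(1), of "{a..x}"] Icc[OF that(1)] f(2) that \<open>a < b\<close> G_in by auto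
  define h where "h t = enn2real (f t)" for t
  have hm: "h \<in> borel_measurable lborel" unfolding h_def using f(1) by measurable
  have "AE t in lborel. f t * indicator {a..b} t \<noteq> \<infinity>"
    using fI[of b] \<open>a < b\<close> f(1) by (intro nn_integral_noteq_infinite) auto
  then have fin: "AE t in lborel. t \<in> {a..b} \<longrightarrow> f t = ennreal (h t)"
    by eventually_elim (auto simp: h_def less_top)
  have hI: "(\<integral>\<^sup>+t. ennreal (h t * indicator {a..x} t) \<partial>lborel) = ennreal (g x - g a)" if "a \<le> x" "x \<le> b" for x
  proof -
    have "(\<integral>\<^sup>+t. ennreal (h t * indicator {a..x} t) \<partial>lborel) = (\<integral>\<^sup>+t. f t * indicator {a..x} t \<partial>lborel)"
      using fin that by (intro nn_integral_cong_AE) (auto simp: indicator_def elim!: eventually_mono)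
    then show ?thesis using fI[OF that] by simp
  qed
  have hb: "has_bochner_integral lborel (\<lambda>t. h t * indicator {a..x} t) (g x - g a)" if "a \<le> x" "x \<le> b" for x
  proof (rule has_bochner_integral_nn_integral)
    show "(\<lambda>t. h t * indicator {a..x} t) \<in> borel_measurable lborel" using hm by measurable
    show "AE t in lborel. 0 \<le> h t * indicator {a..x} t" by (simp add: h_def)
  qed (use hI[OF that] mono[of a x] that in auto)
  then have hs: "set_integrable lborel {a..x} h" "(LINT t:{a..x}|lborel. h t) = g x - g a" if "a \<le> x" "x \<le> b" for x
    using that unfolding set_integrable_def set_lebesgue_integral_def
    by (auto simp: has_bochner_integral_iff mult.commute)
  have h_int: "h absolutely_integrable_on {a..b}"
  proof (rule nonnegative_absolutely_integrable_1)
    show "h integrable_on {a..b}"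
      using set_borel_integral_eq_integral(1)[OF hs(1)[of b]] \<open>a < b\<close> by simp
  qed (simp add: h_def)
  have "g x = g a + integral {a..x} h" if "x \<in> {a..b}" for x
  proof -
    have "a \<le> x" "x \<le> b" using that by auto
    then show ?thesis using set_borel_integral_eq_integral(2)[OF hs(1)] hs(2)[of x] by simp
  qed
  then show ?thesis unfolding has_density_def using h_int by (intro exI[of _ h] conjI ballI)
qed

lemma has_densityD: "has_density a b f F \<Longrightarrow> F absolutely_integrable_on {a..b}"
  by (simp add: has_density_def)

lemma has_density_eq: "has_density a b f F \<Longrightarrow> x \<in> {a..b} \<Longrightarrow> f x = f a + integral {a..x} F"
  by (simp only: has_density_def)

lemma has_densityI:
  "F absolutely_integrable_on {a..b} \<Longrightarrow> (\<And>x. x \<in> {a..b} \<Longrightarrow> f x = f a + integral {a..x} F) \<Longrightarrow> has_density a b f F"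
  by (simp only: has_density_def) blast

lemma nonoverlapping_mono:
  assumes "nonoverlapping x y I l r" "a \<le> x" "y \<le> b"
  shows "nonoverlapping a b I l r"
proof -
  have "a \<le> l i \<and> l i \<le> r i \<and> r i \<le> b" if "i \<in> I" for i
  proof -
    have "x \<le> l i" "l i \<le> r i" "r i \<le> y" using assms(1) that by (auto simp: nonoverlapping_def)
    then show ?thesis using assms(2,3) by linarith
  qed
  then show ?thesis using assms(1) by (simp add: nonoverlapping_def)
qed

lemma has_density_linear:
  assumes "has_density a b f F" "bounded_linear L"
  shows "has_density a b (\<lambda>x. L (f x)) (\<lambda>x. L (F x))"
proof -
  interpret L: bounded_linear L by fact
  note F = has_densityD[OF assms(1)] and eq = has_density_eq[OF assms(1)]
  have "L (f x) = L (f a) + integral {a..x} (\<lambda>x. L (F x))" if "x \<in> {a..b}" for x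
  proof -
    have "F integrable_on {a..x}"
      using F that by (intro integrable_on_subinterval[OF set_lebesgue_integral_eq_integral(1)[OF F]]) auto
    then have "integral {a..x} (L \<circ> F) = L (integral {a..x} F)"
      using integral_linear assms(2) by blast
    then show ?thesis unfolding o_def by (subst eq[OF that]) (simp add: L.add)
  qed
  moreover have "(L \<circ> F) absolutely_integrable_on {a..b}"
    by (rule absolutely_integrable_linear[OF F assms(2)])
  ultimately show ?thesis by (intro has_densityI) (simp_all only: o_def)
qed

lemma has_density_add:
  assumes "has_density a b f F" "has_density a b g G"
  shows "has_density a b (\<lambda>x. f x + g x) (\<lambda>x. F x + G x)"
proof -
  note F = has_densityD[OF assms(1)] has_densityD[OF assms(2)]
  have "integral {a..x} (\<lambda>x. F x + G x) = integral {a..x} F + integral {a..x} G" if "x \<in> {a..b}" for x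
    using F that by (intro integral_add integrable_on_subinterval[OF set_lebesgue_integral_eq_integral(1)]) auto
  then have "f x + g x = f a + g a + integral {a..x} (\<lambda>x. F x + G x)" if "x \<in> {a..b}" for x
    using has_density_eq[OF assms(1) that] has_density_eq[OF assms(2) that] that by simp
  then show ?thesis by (intro has_densityI set_integral_add F)
qed

lemma has_density_diff:
  assumes "has_density a b f F" "has_density a b g G"
  shows "has_density a b (\<lambda>x. f x - g x) (\<lambda>x. F x - G x)"
  using has_density_add[OF assms(1) has_density_linear[OF assms(2), of uminus]]
  by (simp add: bounded_linear_minus)

text \<open>Jordan decomposition: the variation \<open>V a\<close> and the differences
  \<open>V a - Re f\<close>, \<open>V a - Im f\<close> are monotone and absolutely continuous, so
  each has a density. The bound \<open>bd\<close> makes the variation finite; it is available on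
  short intervals.\<close>

lemma short_abs_cont_density:
  fixes f :: "real \<Rightarrow> complex"
  assumes "a < b" and ac: "abs_cont a b f"
    and bd: "\<And>(I::nat set) l r. nonoverlapping a b I l r \<Longrightarrow> (\<Sum>i\<in>I. cmod (f (r i) - f (l i))) < 1"
  shows "\<exists>F. has_density a b f F"
proof -
  define S where "S x y = {(\<Sum>i\<in>I. cmod (f (r i) - f (l i))) | (I::nat set) l r. nonoverlapping x y I l r}" for x y
  define V where "V x y = Sup (S x y)" for x y
  have no_mono: "nonoverlapping a b I l r" if "nonoverlapping x y I l r" "a \<le> x" "y \<le> b" for x y and I :: "nat set" and l r
    using that by (rule nonoverlapping_mono)
  have bdd: "bdd_above (S x y)" if "a \<le> x" "y \<le> b" for x y
    using bd no_mono that unfolding S_def bdd_above_def by (intro exI[of _ 1]) (auto intro: less_imp_le)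
  have ne: "S x y \<noteq> {}" for x y
  proof -
    have "nonoverlapping x y ({}::nat set) (\<lambda>_. x) (\<lambda>_. x)"
      by (simp add: nonoverlapping_def disjoint_family_on_def)
    then show ?thesis unfolding S_def by blast
  qed
  have V_ge: "(\<Sum>i\<in>I. cmod (f (r i) - f (l i))) \<le> V x y" if "nonoverlapping x y I l r" "a \<le> x" "y \<le> b"
    for I :: "nat set" and l r x y
    unfolding V_def using that bdd by (intro cSup_upper) (auto simp: S_def)
  \<comment> \<open>A family in [a, x] is extended by the interval [x, y] under a new index.\<close>
  have V_super: "V a x + cmod (f y - f x) \<le> V a y" if "a \<le> x" "x \<le> y" "y \<le> b" for x y
  proof -
    have "V a x \<le> V a y - cmod (f y - f x)"
      unfolding V_def[of a x]
    proof (rule cSup_least[OF ne])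
      fix s assume "s \<in> S a x"
      then obtain I l r where I: "nonoverlapping a x (I::nat set) l r" and s: "s = (\<Sum>i\<in>I. cmod (f (r i) - f (l i)))"
        by (auto simp: S_def)
      obtain j where j: "j \<notin> I" using I ex_new_if_finite[of I] by (auto simp: nonoverlapping_def)
      define l' r' where "l' = l(j := x)" and "r' = r(j := y)"
      have "nonoverlapping a y (insert j I) l' r'"
        using I j that unfolding nonoverlapping_def l'_def r'_def disjoint_family_on_def
        by (fastforce split: if_splits)
      from V_ge[OF this] have "(\<Sum>i\<in>insert j I. cmod (f (r' i) - f (l' i))) \<le> V a y" using that by simp
      moreover have "(\<Sum>i\<in>insert j I. cmod (f (r' i) - f (l' i))) = cmod (f y - f x) + s"
      proof -
        have "(\<Sum>i\<in>I. cmod (f (r' i) - f (l' i))) = s"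
          unfolding s l'_def r'_def using j by (intro sum.cong) auto
        then show ?thesis using I j by (subst sum.insert) (auto simp: nonoverlapping_def l'_def r'_def)
      qed
      ultimately show "s \<le> V a y - cmod (f y - f x)" by simp
    qed
    then show ?thesis by simp
  qed
  have V_sub: "V a y \<le> V a x + V x y" if "a \<le> x" "x \<le> y" "y \<le> b" for x y
    unfolding V_def[of a y]
  proof (rule cSup_least[OF ne])
    fix s assume "s \<in> S a y"
    then obtain I l r where I: "nonoverlapping a y (I::nat set) l r" and s: "s = (\<Sum>i\<in>I. cmod (f (r i) - f (l i)))"
      by (auto simp: S_def)
    \<comment> \<open>Every interval is cut at \<open>x\<close> into two, one of which may
      degenerate to a point.\<close>
    have 1: "nonoverlapping a x I (\<lambda>i. min (l i) x) (\<lambda>i. min (r i) x)"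
      using I that unfolding nonoverlapping_def disjoint_family_on_def by (auto simp: min_le_iff_disj) (fastforce+)?
    have 2: "nonoverlapping x y I (\<lambda>i. max (l i) x) (\<lambda>i. max (r i) x)"
      using I that unfolding nonoverlapping_def disjoint_family_on_def by (auto simp: le_max_iff_disj) (fastforce+)?
    have "s \<le> (\<Sum>i\<in>I. cmod (f (min (r i) x) - f (min (l i) x)) + cmod (f (max (r i) x) - f (max (l i) x)))"
      unfolding s
    proof (rule sum_mono)
      fix i assume "i \<in> I"
      then have "l i \<le> r i" using I by (auto simp: nonoverlapping_def)
      moreover have "cmod (f (r i) - f (l i)) \<le> cmod (f (r i) - f x) + cmod (f x - f (l i))"
        using norm_triangle_ineq[of "f (r i) - f x" "f x - f (l i)"] by simp
      ultimately show "cmod (f (r i) - f (l i)) \<le> cmod (f (min (r i) x) - f (min (l i) x)) + cmod (f (max (r i) x) - f (max (l i) x))"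
        by (cases "r i \<le> x"; cases "l i \<le> x") (auto simp: min_def max_def)
    qed
    also have "\<dots> \<le> V a x + V x y"
      using V_ge[OF 1] V_ge[OF 2] that by (simp add: sum.distrib)
    finally show "s \<le> V a x + V x y" .
  qed
  \<comment> \<open>In each interval a nearly optimal subfamily is chosen; together they form one
    family over \<open>Sigma I J\<close>, no longer in total than the given one. The slack
    \<open>\<eta>\<close> is paid once per interval, and the 1 in its denominator covers the empty
    family.\<close>
  have V_ac: "\<exists>\<delta>>0. \<forall>(I::real set set) l r. nonoverlapping a b I l r \<and> (\<Sum>i\<in>I. r i - l i) < \<delta> \<longrightarrow>
           (\<Sum>i\<in>I. V a (r i) - V a (l i)) < \<epsilon>" if eps: "\<epsilon> > 0" for \<epsilon>
  proof -
    obtain \<delta> where \<delta>: "\<delta> > 0" "\<And>(K::(real set \<times> nat) set) l r. nonoverlapping a b K l r \<Longrightarrow> (\<Sum>i\<in>K. r i - l i) < \<delta> \<Longrightarrow>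
       (\<Sum>i\<in>K. cmod (f (r i) - f (l i))) < \<epsilon>/2"
      using abs_cont_indexed[OF ac half_gt_zero[OF eps]] by blast
    have "(\<Sum>i\<in>I. V a (r i) - V a (l i)) < \<epsilon>"
      if I: "nonoverlapping a b I l r" and len: "(\<Sum>i\<in>I. r i - l i) < \<delta>" for I :: "real set set" and l r
    proof -
      have fin: "finite I" and lr: "\<And>i. i \<in> I \<Longrightarrow> a \<le> l i \<and> l i \<le> r i \<and> r i \<le> b"
        and dis: "\<And>i j. i \<in> I \<Longrightarrow> j \<in> I \<Longrightarrow> i \<noteq> j \<Longrightarrow> {l i<..<r i} \<inter> {l j<..<r j} = {}"
        using I by (auto simp: nonoverlapping_def disjoint_family_on_def)
      define \<eta> where "\<eta> = \<epsilon> / (2 * (real (card I) + 1))"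
      have \<eta>: "\<eta> > 0" using \<open>\<epsilon> > 0\<close> by (simp add: \<eta>_def)
      have "\<forall>i\<in>I. \<exists>J l' r'. nonoverlapping (l i) (r i) (J::nat set) l' r' \<and>
              V (l i) (r i) < (\<Sum>j\<in>J. cmod (f (r' j) - f (l' j))) + \<eta>"
      proof
        fix i assume "i \<in> I"
        have "V (l i) (r i) - \<eta> < Sup (S (l i) (r i))" using \<eta> by (simp add: V_def)
        then obtain s where "s \<in> S (l i) (r i)" "V (l i) (r i) - \<eta> < s"
          using less_cSupD[OF ne] by blast
        then show "\<exists>J l' r'. nonoverlapping (l i) (r i) (J::nat set) l' r' \<and>
              V (l i) (r i) < (\<Sum>j\<in>J. cmod (f (r' j) - f (l' j))) + \<eta>"
          by (auto simp: S_def algebra_simps)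
      qed
      then obtain J L R where J: "\<And>i. i \<in> I \<Longrightarrow> nonoverlapping (l i) (r i) (J i :: nat set) (L i) (R i)"
        and VJ: "\<And>i. i \<in> I \<Longrightarrow> V (l i) (r i) < (\<Sum>j\<in>J i. cmod (f (R i j) - f (L i j))) + \<eta>"
        by metis
      have finJ: "\<And>i. i \<in> I \<Longrightarrow> finite (J i)" using J by (auto simp: nonoverlapping_def)
      have no: "nonoverlapping a b (Sigma I J) (\<lambda>(i,j). L i j) (\<lambda>(i,j). R i j)"
        unfolding nonoverlapping_def
      proof (intro conjI)
        show "finite (Sigma I J)" using fin finJ by auto
        show "\<forall>ij\<in>Sigma I J. a \<le> (case ij of (i, j) \<Rightarrow> L i j) \<and> (case ij of (i, j) \<Rightarrow> L i j) \<le> (case ij of (i, j) \<Rightarrow> R i j)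
            \<and> (case ij of (i, j) \<Rightarrow> R i j) \<le> b"
          using J lr unfolding nonoverlapping_def by (fastforce intro: order.trans)
        show "disjoint_family_on (\<lambda>ij. {(case ij of (i, j) \<Rightarrow> L i j)<..<(case ij of (i, j) \<Rightarrow> R i j)}) (Sigma I J)"
          unfolding disjoint_family_on_def
        proof (intro ballI impI)
          fix p q assume pq: "p \<in> Sigma I J" "q \<in> Sigma I J" "p \<noteq> q"
          obtain i j i' j' where p: "p = (i, j)" and q: "q = (i', j')" by fastforce
          then have *: "i \<in> I" "j \<in> J i" "i' \<in> I" "j' \<in> J i'" "i = i' \<longrightarrow> j \<noteq> j'" using pq by auto
          have "{L i j<..<R i j} \<inter> {L i' j'<..<R i' j'} = {}"
          proof (cases "i = i'")
            case True
            then show ?thesis using J[of i] * by (auto simp: nonoverlapping_def disjoint_family_on_def)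
          next
            case False
            have "l i \<le> L i j" "R i j \<le> r i" "l i' \<le> L i' j'" "R i' j' \<le> r i'"
              using J[of i] J[of i'] * by (auto simp: nonoverlapping_def)
            then have "{L i j<..<R i j} \<subseteq> {l i<..<r i}" "{L i' j'<..<R i' j'} \<subseteq> {l i'<..<r i'}" by auto
            then show ?thesis using dis[of i i'] * False by blast
          qed
          then show "{(case p of (i, j) \<Rightarrow> L i j)<..<(case p of (i, j) \<Rightarrow> R i j)} \<inter>
              {(case q of (i, j) \<Rightarrow> L i j)<..<(case q of (i, j) \<Rightarrow> R i j)} = {}" by (simp add: p q)
        qed
      qed
      have "(\<Sum>k\<in>Sigma I J. (case k of (i,j) \<Rightarrow> R i j) - (case k of (i,j) \<Rightarrow> L i j)) = (\<Sum>i\<in>I. \<Sum>j\<in>J i. R i j - L i j)"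
        using fin finJ by (subst sum.Sigma) (auto intro!: sum.cong)
      also have "\<dots> \<le> (\<Sum>i\<in>I. r i - l i)"
        using lr by (intro sum_mono nonoverlapping_sum_length J) auto
      finally have "(\<Sum>k\<in>Sigma I J. cmod (f (case k of (i,j) \<Rightarrow> R i j) - f (case k of (i,j) \<Rightarrow> L i j))) < \<epsilon>/2"
        using len by (intro \<delta>(2)[OF no]) simp
      also have "(\<Sum>k\<in>Sigma I J. cmod (f (case k of (i,j) \<Rightarrow> R i j) - f (case k of (i,j) \<Rightarrow> L i j)))
          = (\<Sum>i\<in>I. \<Sum>j\<in>J i. cmod (f (R i j) - f (L i j)))"
        using fin finJ by (subst sum.Sigma) (auto intro!: sum.cong)
      finally have 1: "(\<Sum>i\<in>I. \<Sum>j\<in>J i. cmod (f (R i j) - f (L i j))) < \<epsilon>/2" .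
      have "(\<Sum>i\<in>I. V a (r i) - V a (l i)) \<le> (\<Sum>i\<in>I. (\<Sum>j\<in>J i. cmod (f (R i j) - f (L i j))) + \<eta>)"
      proof (rule sum_mono)
        fix i assume "i \<in> I"
        then show "V a (r i) - V a (l i) \<le> (\<Sum>j\<in>J i. cmod (f (R i j) - f (L i j))) + \<eta>"
          using V_sub[of "l i" "r i"] VJ[of i] lr[of i] by auto
      qed
      also have "\<dots> < \<epsilon>/2 + real (card I) * \<eta>" using 1 by (simp add: sum.distrib)
      also have "real (card I) * \<eta> \<le> \<epsilon>/2"
        using \<open>\<epsilon> > 0\<close> unfolding \<eta>_def by (simp add: divide_simps)
      finally show ?thesis by simp
    qed
    then show ?thesis using \<delta>(1) by blast
  qed
  \<comment> \<open>Increments of \<open>V a - g\<close> lie between 0 and twice those of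
    \<open>V a\<close> as soon as \<open>g\<close> is dominated by \<open>f\<close>. The instances
    are 0, \<open>Re f\<close> and \<open>Im f\<close>.\<close>
  have dens: "\<exists>h. has_density a b (\<lambda>x. V a x - g x) h"
    if g: "\<And>x y. \<bar>g y - g x\<bar> \<le> cmod (f y - f x)" for g :: "real \<Rightarrow> real"
  proof (rule mono_absolutely_continuous_density[OF \<open>a < b\<close>])
    show "V a x - g x \<le> V a y - g y" if "a \<le> x" "x \<le> y" "y \<le> b" for x y
      using g[of y x] V_super[OF that] by linarith
    fix \<epsilon> :: real assume "\<epsilon> > 0"
    from V_ac[OF half_gt_zero[OF this]]
    obtain \<delta> where \<delta>: "\<delta> > 0" "\<And>(I::real set set) l r. nonoverlapping a b I l r \<Longrightarrow> (\<Sum>i\<in>I. r i - l i) < \<delta> \<Longrightarrow>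
           (\<Sum>i\<in>I. V a (r i) - V a (l i)) < \<epsilon>/2" by blast
    have "(\<Sum>i\<in>I. (V a (r i) - g (r i)) - (V a (l i) - g (l i))) < \<epsilon>"
      if I: "nonoverlapping a b I l r" "(\<Sum>i\<in>I. r i - l i) < \<delta>" for I :: "real set set" and l r
    proof -
      have "(\<Sum>i\<in>I. (V a (r i) - g (r i)) - (V a (l i) - g (l i))) \<le> (\<Sum>i\<in>I. 2 * (V a (r i) - V a (l i)))"
      proof (rule sum_mono)
        fix i assume "i \<in> I"
        then have "a \<le> l i" "l i \<le> r i" "r i \<le> b" using I by (auto simp: nonoverlapping_def)
        from V_super[OF this] abs_le_D2[OF g[of "r i" "l i"]]
        show "(V a (r i) - g (r i)) - (V a (l i) - g (l i)) \<le> 2 * (V a (r i) - V a (l i))"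
          by (simp add: algebra_simps)
      qed
      also have "\<dots> < \<epsilon>" using \<delta>(2)[OF I] by (simp only: sum_distrib_left[symmetric])
      finally show ?thesis .
    qed
    then show "\<exists>\<delta>>0. \<forall>(I::real set set) l r. nonoverlapping a b I l r \<and> (\<Sum>i\<in>I. r i - l i) < \<delta> \<longrightarrow>
           (\<Sum>i\<in>I. (V a (r i) - g (r i)) - (V a (l i) - g (l i))) < \<epsilon>" using \<delta>(1) by blast
  qed
  obtain h0 where h0: "has_density a b (\<lambda>x. V a x - 0) h0" using dens[of "\<lambda>_. 0"] by auto
  obtain h1 where h1: "has_density a b (\<lambda>x. V a x - Re (f x)) h1"
    using dens[of "\<lambda>x. Re (f x)"] by (metis abs_Re_le_cmod minus_complex.sel(1))
  obtain h2 where h2: "has_density a b (\<lambda>x. V a x - Im (f x)) h2"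
    using dens[of "\<lambda>x. Im (f x)"] by (metis abs_Im_le_cmod minus_complex.sel(2))
  have re: "has_density a b (\<lambda>x. Re (f x)) (\<lambda>x. h0 x - h1 x)" using has_density_diff[OF h0 h1] by simp
  have im: "has_density a b (\<lambda>x. Im (f x)) (\<lambda>x. h0 x - h2 x)" using has_density_diff[OF h0 h2] by simp
  have "has_density a b (\<lambda>x. of_real (Re (f x)) + \<i> * of_real (Im (f x))) (\<lambda>x. of_real (h0 x - h1 x) + \<i> * of_real (h0 x - h2 x))"
    by (intro has_density_add has_density_linear[OF re] has_density_linear[OF im] bounded_linear_const_mult bounded_linear_of_real)
  moreover have "(\<lambda>x. of_real (Re (f x)) + \<i> * of_real (Im (f x))) = f" by (auto simp: complex_eq_iff)
  ultimately show ?thesis by auto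
qed

lemma has_density_combine:
  assumes "has_density a b f F" "has_density b c f G" "a \<le> b" "b \<le> c"
  shows "\<exists>H. has_density a c f H"
proof -
  define H where "H x = (if x \<le> b then F x else G x)" for x
  note F = has_densityD[OF assms(1)] has_densityD[OF assms(2)]
  have 1: "H absolutely_integrable_on {a..b}"
    using F(1) by (rule absolutely_integrable_spike[of _ _ "{}"]) (auto simp: H_def)
  have 2: "H absolutely_integrable_on {b..c}"
    using F(2) by (rule absolutely_integrable_spike[of _ _ "{b}"]) (auto simp: H_def)
  have H: "H absolutely_integrable_on {a..c}"
    using absolutely_integrable_on_combine[OF 1 2] assms by auto
  have i1: "integral {a..x} H = integral {a..x} F" if "x \<le> b" for x
    using that by (intro integral_cong) (auto simp: H_def)
  have i2: "integral {b..x} H = integral {b..x} G" for x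
    by (intro integral_spike[of "{b}"]) (auto simp: H_def)
  have "f x = f a + integral {a..x} H" if x: "x \<in> {a..c}" for x
  proof (cases "x \<le> b")
    case True
    then have "x \<in> {a..b}" using x by simp
    then show ?thesis using i1[OF True] by (simp only: has_density_eq[OF assms(1) \<open>x \<in> {a..b}\<close>])
  next
    case False
    have "H integrable_on {a..x}"
      using x by (intro integrable_on_subinterval[OF set_lebesgue_integral_eq_integral(1)[OF H]]) auto
    then have "integral {a..x} H = integral {a..b} H + integral {b..x} H"
      using False assms(3) by (intro Henstock_Kurzweil_Integration.integral_combine[symmetric]) auto
    moreover have "f b = f a + integral {a..b} F" using assms(3) by (intro has_density_eq[OF assms(1)]) simp
    moreover have "f x = f b + integral {b..x} G" using x False by (intro has_density_eq[OF assms(2)]) simp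
    ultimately show ?thesis using i1[of b] i2 by (simp only: order.refl add.assoc)
  qed
  then show ?thesis using H has_densityI by blast
qed

lemma abs_cont_subinterval:
  assumes "abs_cont a b f" "a \<le> c" "d \<le> b"
  shows "abs_cont c d f"
  unfolding abs_cont_def
proof (intro allI impI)
  fix \<epsilon> :: real assume "\<epsilon> > 0"
  from assms(1)[unfolded abs_cont_def, rule_format, OF this]
  obtain \<delta> where "\<delta> > 0" and \<delta>: "\<And>D. finite D \<Longrightarrow> (\<forall>(u, v)\<in>D. a \<le> u \<and> u \<le> v \<and> v \<le> b) \<Longrightarrow>
        disjoint_family_on (\<lambda>(u, v). {u<..<v}) D \<Longrightarrow> (\<Sum>(u, v)\<in>D. v - u) < \<delta> \<Longrightarrow>
        (\<Sum>(u, v)\<in>D. cmod (f v - f u)) < \<epsilon>"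
    by blast
  show "\<exists>\<delta>>0. \<forall>D. finite D \<and> (\<forall>(u, v)\<in>D. c \<le> u \<and> u \<le> v \<and> v \<le> d) \<and>
      disjoint_family_on (\<lambda>(u, v). {u<..<v}) D \<and> (\<Sum>(u, v)\<in>D. v - u) < \<delta> \<longrightarrow>
      (\<Sum>(u, v)\<in>D. cmod (f v - f u)) < \<epsilon>"
  proof (intro exI[of _ \<delta>] conjI allI impI \<delta>)
    fix D :: "(real \<times> real) set"
    assume "finite D \<and> (\<forall>(u, v)\<in>D. c \<le> u \<and> u \<le> v \<and> v \<le> d) \<and>
      disjoint_family_on (\<lambda>(u, v). {u<..<v}) D \<and> (\<Sum>(u, v)\<in>D. v - u) < \<delta>"
    then show "\<forall>(u, v)\<in>D. a \<le> u \<and> u \<le> v \<and> v \<le> b"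
      using assms(2,3) by (auto intro: order.trans)
  qed (use \<open>\<delta> > 0\<close> in auto)
qed

text \<open>Pieces shorter than the \<open>\<delta>\<close> that belongs to the value 1 have
  variation below 1, so the short case applies to them; Bolzano's bisection principle glues the
  pieces.\<close>

theorem abs_cont_imp_density:
  fixes f :: "real \<Rightarrow> complex"
  assumes "a \<le> b" "abs_cont a b f"
  shows "\<exists>F. has_density a b f F"
proof -
  obtain \<delta> where \<delta>: "\<delta> > 0" "\<And>(I::nat set) l r. nonoverlapping a b I l r \<Longrightarrow> (\<Sum>i\<in>I. r i - l i) < \<delta> \<Longrightarrow>
       (\<Sum>i\<in>I. cmod (f (r i) - f (l i))) < 1"
    using abs_cont_indexed[OF assms(2) zero_less_one] by blast
  define P where "P u v \<longleftrightarrow> a \<le> u \<and> u \<le> v \<and> v \<le> b \<longrightarrow> (\<exists>F. has_density u v f F)" for u v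
  have "P a b" using \<open>a \<le> b\<close>
  proof (induction rule: Bolzano)
    case (trans u v w)
    then show ?case unfolding P_def by (meson has_density_combine order.trans)
  next
    case (local x)
    have "P u v" if uv: "v - u < \<delta>" for u v
      unfolding P_def
    proof (intro impI)
      assume *: "a \<le> u \<and> u \<le> v \<and> v \<le> b"
      show "\<exists>F. has_density u v f F"
      proof (cases "u = v")
        case True
        then show ?thesis by (auto intro!: exI[of _ "\<lambda>_. 0"] has_densityI)
      next
        case False
        show ?thesis
        proof (rule short_abs_cont_density)
          show "abs_cont u v f" using abs_cont_subinterval assms(2) * by blast
          fix I :: "nat set" and l r assume I: "nonoverlapping u v I l r"
          then have "nonoverlapping a b I l r"
            by (rule nonoverlapping_mono) (use * in auto)
          then show "(\<Sum>i\<in>I. cmod (f (r i) - f (l i))) < 1"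
            using nonoverlapping_sum_length[OF I] uv * by (intro \<delta>(2)) auto
        qed (use * False in auto)
      qed
    qed
    then show ?case using \<delta>(1) by blast
  qed
  then show ?thesis using assms(1) by (simp add: P_def)
qed

section \<open>Almost everywhere derivatives, and the way back to absolute continuity\<close>

lemma indefinite_integral_right_derivative:
  fixes F :: "real \<Rightarrow> 'a::euclidean_space"
  assumes "\<And>u v. F integrable_on cbox u v"
  obtains N where "negligible N"
    "\<And>x e. \<lbrakk>x \<notin> N; 0 < e\<rbrakk> \<Longrightarrow> \<exists>d>0. \<forall>h. 0 < h \<and> h < d \<longrightarrow> norm (integral {x..x + h} F - h *\<^sub>R F x) \<le> e * h"
proof -
  obtain N where N: "negligible N" "\<And>x e. \<lbrakk>x \<notin> N; 0 < e\<rbrakk> \<Longrightarrow>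
               \<exists>d>0. \<forall>h. 0 < h \<and> h < d \<longrightarrow>
                         norm (integral (cbox x (x + h *\<^sub>R One)) F /\<^sub>R h ^ DIM(real) - F x) < e"
    using integrable_ccontinuous_explicit[of F] assms by blast
  have "\<exists>d>0. \<forall>h. 0 < h \<and> h < d \<longrightarrow> norm (integral {x..x + h} F - h *\<^sub>R F x) \<le> e * h"
    if xe: "x \<notin> N" "0 < e" for x e
  proof -
    obtain d where d: "d > 0" "\<And>h. 0 < h \<Longrightarrow> h < d \<Longrightarrow>
        norm (integral (cbox x (x + h *\<^sub>R One)) F /\<^sub>R h ^ DIM(real) - F x) < e"
      using N(2)[OF xe] by blast
    have "norm (integral {x..x + h} F - h *\<^sub>R F x) \<le> e * h" if h: "0 < h" "h < d" for h
    proof -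
      have "integral {x..x + h} F - h *\<^sub>R F x = h *\<^sub>R (integral {x..x + h} F /\<^sub>R h - F x)"
        using h by (simp add: scaleR_diff_right)
      then have "norm (integral {x..x + h} F - h *\<^sub>R F x) = h * norm (integral {x..x + h} F /\<^sub>R h - F x)"
        using h by simp
      also have "\<dots> \<le> h * e"
        using d(2)[OF h] h by (intro mult_left_mono) (auto simp: cbox_interval)
      finally show ?thesis by (simp add: mult.commute)
    qed
    then show ?thesis using d(1) by blast
  qed
  then show ?thesis using N(1) that by blast
qed

text \<open>The differentiation theorem controls increments to the right only, so it is applied to
  \<open>G\<close> and to the reflection \<open>\<lambda>x. G (- x)\<close>. Outside both
  exceptional sets the two one-sided estimates combine.\<close>

theorem has_density_AE_derivative:
  fixes F :: "real \<Rightarrow> 'a::euclidean_space"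
  assumes "has_density a b f F"
  obtains N where "negligible N" "\<And>x. x \<in> {a<..<b} - N \<Longrightarrow> (f has_vector_derivative F x) (at x)"
proof -
  define G where "G x = (if x \<in> {a..b} then F x else 0)" for x
  have FI: "F integrable_on {a..b}" using has_densityD[OF assms] by (rule set_lebesgue_integral_eq_integral(1))
  have "G integrable_on UNIV" unfolding G_def by (subst integrable_restrict_UNIV) (rule FI)
  then have GI: "G integrable_on cbox u v" for u v by (rule integrable_on_subcbox) auto
  have GI': "(\<lambda>x. G (- x)) integrable_on cbox u v" for u v
    using GI[of "-v" "-u"] Henstock_Kurzweil_Integration.integrable_reflect_real[where f=G and a="-v" and b="-u"] by (simp add: cbox_interval)
  obtain N1 where N1: "negligible N1"
    "\<And>x e. \<lbrakk>x \<notin> N1; 0 < e\<rbrakk> \<Longrightarrow> \<exists>d>0. \<forall>h. 0 < h \<and> h < d \<longrightarrow> norm (integral {x..x + h} G - h *\<^sub>R G x) \<le> e * h"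
    using indefinite_integral_right_derivative[of G] GI by blast
  obtain N2 where N2: "negligible N2"
    "\<And>x e. \<lbrakk>x \<notin> N2; 0 < e\<rbrakk> \<Longrightarrow> \<exists>d>0. \<forall>h. 0 < h \<and> h < d \<longrightarrow> norm (integral {x..x + h} (\<lambda>x. G (- x)) - h *\<^sub>R G (- x)) \<le> e * h"
    using indefinite_integral_right_derivative[of "\<lambda>x. G (- x)"] GI' by blast
  have neg: "negligible (N1 \<union> uminus ` N2)"
    using N1(1) N2(1)
    by (intro negligible_Un negligible_differentiable_image_negligible) (auto intro!: derivative_intros)
  have "(f has_vector_derivative F x) (at x)" if x: "x \<in> {a<..<b} - (N1 \<union> uminus ` N2)" for x
  proof -
    have xab: "a < x" "x < b" and Gx: "G x = F x" using x by (auto simp: G_def)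
    have diff: "f v - f u = integral {u..v} G" if "a \<le> u" "u \<le> v" "v \<le> b" for u v
    proof -
      have "F integrable_on {a..v}" using that by (intro integrable_on_subinterval[OF FI]) auto
      then have "integral {a..v} F = integral {a..u} F + integral {u..v} F"
        using that by (intro Henstock_Kurzweil_Integration.integral_combine[symmetric]) auto
      moreover have "integral {u..v} F = integral {u..v} G"
        using that by (intro integral_cong) (auto simp: G_def)
      moreover have "f v = f a + integral {a..v} F" "f u = f a + integral {a..u} F"
        using that by (auto intro!: has_density_eq[OF assms])
      ultimately show ?thesis by simp
    qed
    have "x \<notin> N1" "- x \<notin> N2" using x by (auto simp: image_iff)
    have "\<exists>d>0. \<forall>y. norm (y - x) < d \<longrightarrow> norm (f y - f x - (y - x) *\<^sub>R F x) \<le> e * norm (y - x)" if e: "e > 0" for e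
    proof -
      obtain d1 where d1: "d1 > 0" "\<And>h. 0 < h \<Longrightarrow> h < d1 \<Longrightarrow> norm (integral {x..x + h} G - h *\<^sub>R G x) \<le> e * h"
        using N1(2)[OF \<open>x \<notin> N1\<close> e] by blast
      obtain d2 where d2: "d2 > 0" "\<And>h. 0 < h \<Longrightarrow> h < d2 \<Longrightarrow>
          norm (integral {-x..-x + h} (\<lambda>x. G (- x)) - h *\<^sub>R G (- (-x))) \<le> e * h"
        using N2(2)[OF \<open>-x \<notin> N2\<close> e] by blast
      define d where "d = min (min d1 d2) (min (x - a) (b - x))"
      have "d > 0" using d1 d2 xab by (simp add: d_def)
      moreover have "norm (f y - f x - (y - x) *\<^sub>R F x) \<le> e * norm (y - x)" if y: "norm (y - x) < d" for y
      proof -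
        consider "y = x" | "y > x" | "y < x" by linarith
        then show ?thesis
        proof cases
          case 2
          then show ?thesis using y d1(2)[of "y - x"] diff[of x y] xab by (simp add: d_def Gx)
        next
          case 3
          have "integral {-x..-x + (x - y)} (\<lambda>x. G (- x)) = integral {y..x} G"
            using integral_reflect_real[of x y G] by simp
          then have "norm (f x - f y - (x - y) *\<^sub>R F x) \<le> e * (x - y)"
            using 3 y d2(2)[of "x - y"] diff[of y x] xab by (simp add: d_def Gx)
          moreover have "f y - f x - (y - x) *\<^sub>R F x = - (f x - f y - (x - y) *\<^sub>R F x)"
            by (simp add: algebra_simps)
          ultimately show ?thesis using 3 by (simp only: norm_minus_cancel) simp
        qed simp
      qed
      ultimately show ?thesis by blast
    qed
    then show ?thesis unfolding has_vector_derivative_def has_derivative_at_alt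
      by (auto intro: bounded_linear_scaleR_left)
  qed
  with neg that show ?thesis by blast
qed

lemma nonoverlapping_integral_le:
  fixes g :: "real \<Rightarrow> real"
  assumes g: "g integrable_on {a..b}" and pos: "\<And>x. x \<in> {a..b} \<Longrightarrow> 0 \<le> g x"
    and I: "nonoverlapping a b I l r"
  shows "(\<Sum>i\<in>I. integral {l i..r i} g) \<le> integral {a..b} g"
proof -
  have fin: "finite I" and lr: "\<And>i. i \<in> I \<Longrightarrow> a \<le> l i \<and> l i \<le> r i \<and> r i \<le> b"
    and dis: "\<And>i j. i \<in> I \<Longrightarrow> j \<in> I \<Longrightarrow> i \<noteq> j \<Longrightarrow> {l i<..<r i} \<inter> {l j<..<r j} = {}"
    using I by (auto simp: nonoverlapping_def disjoint_family_on_def)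
  have int_eq: "{l i<..<r i} \<inter> {a..b} = {l i<..<r i}" if "i \<in> I" for i
    using lr[OF that] by auto
  have "(\<Sum>i\<in>I. integral {l i..r i} g) = (\<Sum>i\<in>I. integral {a..b} (\<lambda>x. if x \<in> {l i<..<r i} then g x else 0))"
  proof (rule sum.cong)
    fix i assume i: "i \<in> I"
    have "integral {l i..r i} g = integral {l i<..<r i} g"
      using integral_open_interval_real[of "l i" "r i" g] by simp
    also have "\<dots> = integral {a..b} (\<lambda>x. if x \<in> {l i<..<r i} then g x else 0)"
      by (simp only: integral_restrict_Int int_eq[OF i])
    finally show "integral {l i..r i} g = integral {a..b} (\<lambda>x. if x \<in> {l i<..<r i} then g x else 0)" .
  qed simp
  also have "\<dots> = integral {a..b} (\<lambda>x. \<Sum>i\<in>I. if x \<in> {l i<..<r i} then g x else 0)"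
  proof (rule integral_sum[symmetric, OF fin])
    fix i assume i: "i \<in> I"
    have "g integrable_on {l i..r i}" using lr[OF i] by (intro integrable_on_subinterval[OF g]) auto
    then have "g integrable_on {l i<..<r i}" by (simp add: integrable_on_open_interval_real)
    then show "(\<lambda>x. if x \<in> {l i<..<r i} then g x else 0) integrable_on {a..b}"
      by (simp only: integrable_restrict_Int int_eq[OF i])
  qed
  also have "\<dots> \<le> integral {a..b} g"
  proof (rule integral_le)
    show "(\<lambda>x. \<Sum>i\<in>I. if x \<in> {l i<..<r i} then g x else 0) integrable_on {a..b}"
    proof (intro integrable_sum fin)
      fix i assume i: "i \<in> I"
      have "g integrable_on {l i..r i}" using lr[OF i] by (intro integrable_on_subinterval[OF g]) auto
      then have "g integrable_on {l i<..<r i}" by (simp add: integrable_on_open_interval_real)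
      then show "(\<lambda>x. if x \<in> {l i<..<r i} then g x else 0) integrable_on {a..b}"
        by (simp only: integrable_restrict_Int int_eq[OF i])
    qed
    fix x assume x: "x \<in> {a..b}"
    show "(\<Sum>i\<in>I. if x \<in> {l i<..<r i} then g x else 0) \<le> g x"
    proof (cases "\<exists>j\<in>I. x \<in> {l j<..<r j}")
      case True
      then obtain j where j: "j \<in> I" "x \<in> {l j<..<r j}" by blast
      have "(\<Sum>i\<in>I. if x \<in> {l i<..<r i} then g x else 0) = (\<Sum>i\<in>{j}. if x \<in> {l i<..<r i} then g x else 0)"
      proof (intro sum.mono_neutral_right ballI)
        fix i assume "i \<in> I - {j}"
        then have "x \<notin> {l i<..<r i}" using dis[of i j] j by blast
        then show "(if x \<in> {l i<..<r i} then g x else 0) = 0" by (rule if_not_P)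
      qed (use fin j in auto)
      then show ?thesis using j by simp
    next
      case False
      then have "(\<Sum>i\<in>I. if x \<in> {l i<..<r i} then g x else 0) = 0" by (intro sum.neutral) auto
      then show ?thesis using pos[OF x] by simp
    qed
  qed (rule g)
  finally show ?thesis .
qed

text \<open>The part of the norm of \<open>F\<close> above a suitable level \<open>n\<close> has
  integral below \<open>\<epsilon>/2\<close>, and the part below the level contributes at most
  \<open>n\<close> times the total length; this fixes \<open>\<delta>\<close>.\<close>

theorem has_density_imp_abs_cont:
  fixes F :: "real \<Rightarrow> complex"
  assumes "has_density a b f F" "a \<le> b"
  shows "abs_cont a b f"
  unfolding abs_cont_def
proof (intro allI impI)
  fix \<epsilon> :: real assume \<epsilon>: "\<epsilon> > 0"
  note F = has_densityD[OF assms(1)]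
  have FI: "F integrable_on {a..b}" using F by (rule set_lebesgue_integral_eq_integral(1))
  have nF: "(\<lambda>x. norm (F x)) absolutely_integrable_on {a..b}" using F by (rule set_integrable_norm)
  have mF: "(\<lambda>x. min (norm (F x)) (real n)) absolutely_integrable_on {a..b}" for n
    by (intro absolutely_integrable_min_1 nF absolutely_integrable_on_const) simp
  have nFI: "(\<lambda>x. norm (F x)) integrable_on {a..b}" using nF by (rule set_lebesgue_integral_eq_integral(1))
  have mFI: "(\<lambda>x. min (norm (F x)) (real n)) integrable_on {a..b}" for n
    using mF by (rule set_lebesgue_integral_eq_integral(1))
  have "(\<lambda>n. integral {a..b} (\<lambda>x. min (norm (F x)) (real n))) \<longlonglongrightarrow> integral {a..b} (\<lambda>x. norm (F x))"
  proof (rule dominated_convergence(2)[OF mFI nFI])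
    fix x
    have "eventually (\<lambda>n. min (norm (F x)) (real n) = norm (F x)) sequentially"
      using eventually_ge_at_top[of "nat \<lceil>norm (F x)\<rceil>"]
      by eventually_elim (simp add: min_def; linarith)
    then show "(\<lambda>n. min (norm (F x)) (real n)) \<longlonglongrightarrow> norm (F x)" by (rule tendsto_eventually)
  qed auto
  then obtain n where n: "\<bar>integral {a..b} (\<lambda>x. min (norm (F x)) (real n)) - integral {a..b} (\<lambda>x. norm (F x))\<bar> < \<epsilon>/2"
    using half_gt_zero[OF \<epsilon>] unfolding LIMSEQ_iff by (metis order.refl real_norm_def)
  define g where "g x = norm (F x) - min (norm (F x)) (real n)" for x
  have gI: "g integrable_on {a..b}" unfolding g_def by (intro integrable_diff nFI mFI)
  have gint: "integral {a..b} g < \<epsilon>/2"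
    unfolding g_def using n by (subst integral_diff[OF nFI mFI]) linarith
  define \<delta> where "\<delta> = \<epsilon> / (2 * (real n + 1))"
  have "\<delta> > 0" using \<epsilon> by (simp add: \<delta>_def)
  moreover have "(\<Sum>(u, v)\<in>D. cmod (f v - f u)) < \<epsilon>"
    if D: "finite D \<and> (\<forall>(u, v)\<in>D. a \<le> u \<and> u \<le> v \<and> v \<le> b) \<and>
        disjoint_family_on (\<lambda>(u, v). {u<..<v}) D \<and> (\<Sum>(u, v)\<in>D. v - u) < \<delta>" for D :: "(real \<times> real) set"
  proof -
    have no: "nonoverlapping a b D fst snd"
      using D unfolding nonoverlapping_def by (auto simp: case_prod_unfold)
    have "cmod (f v - f u) \<le> integral {u..v} g + real n * (v - u)" if uv: "(u, v) \<in> D" for u v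
    proof -
      have uv: "a \<le> u" "u \<le> v" "v \<le> b" using D uv by auto
      have sub: "h integrable_on {u..v}" if "h integrable_on {a..b}" for h :: "real \<Rightarrow> 'b::banach"
        using uv by (intro integrable_on_subinterval[OF that]) auto
      have "F integrable_on {a..v}" using uv by (intro integrable_on_subinterval[OF FI]) auto
      then have "integral {a..v} F = integral {a..u} F + integral {u..v} F"
        using uv by (intro Henstock_Kurzweil_Integration.integral_combine[symmetric]) auto
      moreover have "f v = f a + integral {a..v} F" "f u = f a + integral {a..u} F"
        using uv by (auto intro!: has_density_eq[OF assms(1)])
      ultimately have "cmod (f v - f u) = cmod (integral {u..v} F)" by simp
      also have "\<dots> \<le> integral {u..v} (\<lambda>x. g x + real n)"
        by (intro integral_norm_bound_integral sub FI integrable_add gI integrable_const_ivl)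
          (auto simp: g_def min_def)
      also have "\<dots> = integral {u..v} g + real n * (v - u)"
        using uv by (subst integral_add) (auto intro: sub gI)
      finally show ?thesis .
    qed
    then have "(\<Sum>(u, v)\<in>D. cmod (f v - f u)) \<le> (\<Sum>(u, v)\<in>D. integral {u..v} g + real n * (v - u))"
      by (intro sum_mono) auto
    also have "\<dots> = (\<Sum>i\<in>D. integral {fst i..snd i} g) + real n * (\<Sum>(u, v)\<in>D. v - u)"
      by (simp add: case_prod_unfold sum.distrib sum_distrib_left)
    also have "\<dots> \<le> integral {a..b} g + real n * \<delta>"
      using nonoverlapping_integral_le[OF gI _ no] D
      by (intro add_mono mult_left_mono) (auto simp: g_def)
    also have "\<dots> < \<epsilon>/2 + \<epsilon>/2"
    proof -
      have "real n * \<delta> \<le> \<epsilon>/2" using \<epsilon> unfolding \<delta>_def by (simp add: divide_simps)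
      then show ?thesis using gint by linarith
    qed
    finally show ?thesis by simp
  qed
  ultimately show "\<exists>\<delta>>0. \<forall>D. finite D \<and> (\<forall>(u, v)\<in>D. a \<le> u \<and> u \<le> v \<and> v \<le> b) \<and>
      disjoint_family_on (\<lambda>(u, v). {u<..<v}) D \<and> (\<Sum>(u, v)\<in>D. v - u) < \<delta> \<longrightarrow>
      (\<Sum>(u, v)\<in>D. cmod (f v - f u)) < \<epsilon>" by blast
qed

lemma has_density_cong:
  assumes "has_density a b f F" "negligible N" "\<And>x. x \<in> {a<..<b} - N \<Longrightarrow> G x = F x"
  shows "has_density a b f G"
proof (rule has_densityI)
  have neg: "negligible (N \<union> {a, b})" using assms(2) by simp
  show "G absolutely_integrable_on {a..b}"
    using assms(3) by (intro absolutely_integrable_spike[OF has_densityD[OF assms(1)] neg]) auto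
  fix x assume x: "x \<in> {a..b}"
  have "integral {a..x} F = integral {a..x} G"
    using x assms(3) by (intro integral_spike[OF neg]) auto
  then show "f x = f a + integral {a..x} G" using has_density_eq[OF assms(1) x] by (simp only:)
qed

text \<open>Some density exists and is the derivative almost everywhere, so it equals
  \<open>F\<close> off a null set. With this, product and chain rules for densities reduce to the
  pointwise rules.\<close>

theorem abs_cont_has_density:
  fixes f :: "real \<Rightarrow> complex"
  assumes "a \<le> b" "abs_cont a b f" "negligible N"
    and "\<And>x f'. x \<in> {a<..<b} - N \<Longrightarrow> (f has_vector_derivative f') (at x) \<Longrightarrow> F x = f'"
  shows "has_density a b f F"
proof -
  obtain G where G: "has_density a b f G" using abs_cont_imp_density[OF assms(1,2)] by blast
  obtain M where M: "negligible M" "\<And>x. x \<in> {a<..<b} - M \<Longrightarrow> (f has_vector_derivative G x) (at x)"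
    using has_density_AE_derivative[OF G] by blast
  have "negligible (M \<union> N)" using M(1) assms(3) by simp
  from has_density_cong[OF G this] show ?thesis using assms(4) M(2) by blast
qed

lemma has_density_continuous:
  assumes "has_density a b f F"
  shows "continuous_on {a..b} f"
proof -
  have "F integrable_on {a..b}" using has_densityD[OF assms] by (rule set_lebesgue_integral_eq_integral(1))
  then have "continuous_on {a..b} (\<lambda>x. f a + integral {a..x} F)"
    by (intro continuous_intros indefinite_integral_continuous_1)
  then show ?thesis by (rule continuous_on_eq) (rule has_density_eq[OF assms, symmetric])
qed

text \<open>Products and exponentials inherit absolute continuity through their increments, by
  Lipschitz estimates on a bounded range; the second function makes room for the two factors of a
  product.\<close>

lemma abs_cont_dominated:
  fixes h :: "real \<Rightarrow> complex"
  assumes f: "abs_cont a b f" and g: "abs_cont a b g" and "C \<ge> 0"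
    and le: "\<And>u v. a \<le> u \<Longrightarrow> u \<le> v \<Longrightarrow> v \<le> b \<Longrightarrow> cmod (h v - h u) \<le> C * (cmod (f v - f u) + cmod (g v - g u))"
  shows "abs_cont a b h"
  unfolding abs_cont_def
proof (intro allI impI)
  fix \<epsilon> :: real assume \<epsilon>: "\<epsilon> > 0"
  define \<eta> where "\<eta> = \<epsilon> / (2 * (C + 1))"
  have \<eta>: "\<eta> > 0" using \<epsilon> \<open>C \<ge> 0\<close> by (simp add: \<eta>_def)
  from f[unfolded abs_cont_def, rule_format, OF \<eta>] obtain \<delta>1 where \<delta>1: "\<delta>1 > 0"
    "\<And>D. finite D \<and> (\<forall>(u, v)\<in>D. a \<le> u \<and> u \<le> v \<and> v \<le> b) \<and>
      disjoint_family_on (\<lambda>(u, v). {u<..<v}) D \<and> (\<Sum>(u, v)\<in>D. v - u) < \<delta>1 \<Longrightarrow>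
      (\<Sum>(u, v)\<in>D. cmod (f v - f u)) < \<eta>" by blast
  from g[unfolded abs_cont_def, rule_format, OF \<eta>] obtain \<delta>2 where \<delta>2: "\<delta>2 > 0"
    "\<And>D. finite D \<and> (\<forall>(u, v)\<in>D. a \<le> u \<and> u \<le> v \<and> v \<le> b) \<and>
      disjoint_family_on (\<lambda>(u, v). {u<..<v}) D \<and> (\<Sum>(u, v)\<in>D. v - u) < \<delta>2 \<Longrightarrow>
      (\<Sum>(u, v)\<in>D. cmod (g v - g u)) < \<eta>" by blast
  have "(\<Sum>(u, v)\<in>D. cmod (h v - h u)) < \<epsilon>"
    if D: "finite D \<and> (\<forall>(u, v)\<in>D. a \<le> u \<and> u \<le> v \<and> v \<le> b) \<and>
        disjoint_family_on (\<lambda>(u, v). {u<..<v}) D \<and> (\<Sum>(u, v)\<in>D. v - u) < min \<delta>1 \<delta>2" for D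
  proof -
    have "(\<Sum>(u, v)\<in>D. cmod (h v - h u)) \<le> (\<Sum>(u, v)\<in>D. C * (cmod (f v - f u) + cmod (g v - g u)))"
      using D le by (intro sum_mono) auto
    also have "\<dots> = C * ((\<Sum>(u, v)\<in>D. cmod (f v - f u)) + (\<Sum>(u, v)\<in>D. cmod (g v - g u)))"
      by (simp add: case_prod_unfold sum.distrib sum_distrib_left[symmetric])
    also have "\<dots> \<le> C * (\<eta> + \<eta>)"
      using \<delta>1(2)[of D] \<delta>2(2)[of D] D \<open>C \<ge> 0\<close> by (intro mult_left_mono add_mono) auto
    also have "\<dots> < \<epsilon>" using \<epsilon> \<open>C \<ge> 0\<close> unfolding \<eta>_def by (simp add: divide_simps)
    finally show ?thesis .
  qed
  then show "\<exists>\<delta>>0. \<forall>D. finite D \<and> (\<forall>(u, v)\<in>D. a \<le> u \<and> u \<le> v \<and> v \<le> b) \<and>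
      disjoint_family_on (\<lambda>(u, v). {u<..<v}) D \<and> (\<Sum>(u, v)\<in>D. v - u) < \<delta> \<longrightarrow>
      (\<Sum>(u, v)\<in>D. cmod (h v - h u)) < \<epsilon>"
    using \<delta>1(1) \<delta>2(1) by (intro exI[of _ "min \<delta>1 \<delta>2"]) auto
qed

lemma has_density_bounded:
  fixes f :: "real \<Rightarrow> 'a::euclidean_space"
  assumes "has_density a b f F"
  obtains M where "M > 0" "\<And>x. x \<in> {a..b} \<Longrightarrow> norm (f x) \<le> M"
  using compact_imp_bounded[OF compact_continuous_image[OF has_density_continuous[OF assms] compact_Icc]]
  by (auto simp: bounded_pos that)

theorem has_density_mult:
  fixes f g :: "real \<Rightarrow> complex"
  assumes "a \<le> b" and f: "has_density a b f F" and g: "has_density a b g G"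
  shows "has_density a b (\<lambda>x. f x * g x) (\<lambda>x. F x * g x + f x * G x)"
proof -
  obtain M1 where M1: "M1 > 0" "\<And>x. x \<in> {a..b} \<Longrightarrow> norm (f x) \<le> M1"
    using has_density_bounded[OF f] by blast
  obtain M2 where M2: "M2 > 0" "\<And>x. x \<in> {a..b} \<Longrightarrow> norm (g x) \<le> M2"
    using has_density_bounded[OF g] by blast
  have ac: "abs_cont a b (\<lambda>x. f x * g x)"
  proof (rule abs_cont_dominated[OF has_density_imp_abs_cont[OF f \<open>a \<le> b\<close>] has_density_imp_abs_cont[OF g \<open>a \<le> b\<close>], of "M1 + M2"])
    fix u v assume uv: "a \<le> u" "u \<le> v" "v \<le> b"
    have "f v * g v - f u * g u = (f v - f u) * g v + f u * (g v - g u)" by (simp add: algebra_simps)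
    then have "cmod (f v * g v - f u * g u) \<le> cmod (f v - f u) * cmod (g v) + cmod (f u) * cmod (g v - g u)"
      by (metis norm_mult norm_triangle_ineq)
    also have "\<dots> \<le> cmod (f v - f u) * M2 + M1 * cmod (g v - g u)"
      using M1(1) M1(2)[of u] M2(2)[of v] uv by (intro add_mono mult_mono) auto
    also have "\<dots> \<le> (M1 + M2) * (cmod (f v - f u) + cmod (g v - g u))"
      using M1(1) M2(1) by (simp add: algebra_simps)
    finally show "cmod (f v * g v - f u * g u) \<le> (M1 + M2) * (cmod (f v - f u) + cmod (g v - g u))" .
  qed (use M1(1) M2(1) in auto)
  obtain N1 where N1: "negligible N1" "\<And>x. x \<in> {a<..<b} - N1 \<Longrightarrow> (f has_vector_derivative F x) (at x)"
    using has_density_AE_derivative[OF f] by blast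
  obtain N2 where N2: "negligible N2" "\<And>x. x \<in> {a<..<b} - N2 \<Longrightarrow> (g has_vector_derivative G x) (at x)"
    using has_density_AE_derivative[OF g] by blast
  show ?thesis
  proof (rule abs_cont_has_density[OF \<open>a \<le> b\<close> ac])
    show "negligible (N1 \<union> N2)" using N1(1) N2(1) by simp
    fix x f' assume x: "x \<in> {a<..<b} - (N1 \<union> N2)" "((\<lambda>x. f x * g x) has_vector_derivative f') (at x)"
    have "((\<lambda>x. f x * g x) has_vector_derivative (f x * G x + F x * g x)) (at x)"
      using N1(2)[of x] N2(2)[of x] x(1) by (intro has_vector_derivative_mult) auto
    then show "F x * g x + f x * G x = f'"
      using vector_derivative_unique_at[OF x(2)] by simp
  qed
qed

lemma exp_lipschitz_on_bounded:
  fixes z w :: complex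
  assumes "cmod z \<le> M" "cmod w \<le> M"
  shows "cmod (exp z - exp w) \<le> exp M * cmod (z - w)"
proof (rule field_differentiable_bound[of "cball 0 M" exp exp])
  show "cmod (exp x) \<le> exp M" if "x \<in> cball 0 M" for x
    using that norm_exp[of x] by (auto intro: order.trans)
qed (use assms in \<open>auto intro!: derivative_eq_intros\<close>)

theorem has_density_exp:
  fixes f :: "real \<Rightarrow> complex"
  assumes "a \<le> b" and f: "has_density a b f F"
  shows "has_density a b (\<lambda>x. exp (f x)) (\<lambda>x. F x * exp (f x))"
proof -
  obtain M where M: "M > 0" "\<And>x. x \<in> {a..b} \<Longrightarrow> norm (f x) \<le> M"
    using has_density_bounded[OF f] by blast
  have ac: "abs_cont a b (\<lambda>x. exp (f x))"
  proof (rule abs_cont_dominated[OF has_density_imp_abs_cont[OF f \<open>a \<le> b\<close>] has_density_imp_abs_cont[OF f \<open>a \<le> b\<close>], of "exp M"])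
    fix u v assume uv: "a \<le> u" "u \<le> v" "v \<le> b"
    have "cmod (exp (f v) - exp (f u)) \<le> exp M * cmod (f v - f u)"
      using M(2) uv by (intro exp_lipschitz_on_bounded) auto
    then show "cmod (exp (f v) - exp (f u)) \<le> exp M * (cmod (f v - f u) + cmod (f v - f u))"
      by (rule order.trans) (intro mult_left_mono, auto)
  qed auto
  obtain N where N: "negligible N" "\<And>x. x \<in> {a<..<b} - N \<Longrightarrow> (f has_vector_derivative F x) (at x)"
    using has_density_AE_derivative[OF f] by blast
  show ?thesis
  proof (rule abs_cont_has_density[OF \<open>a \<le> b\<close> ac N(1)])
    fix x f' assume x: "x \<in> {a<..<b} - N" "((\<lambda>x. exp (f x)) has_vector_derivative f') (at x)"
    have "((exp \<circ> f) has_vector_derivative (F x * exp (f x))) (at x)"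
      using N(2)[of x] x(1) by (intro field_vector_diff_chain_at) auto
    then show "F x * exp (f x) = f'"
      using vector_derivative_unique_at[OF x(2)] by (simp add: o_def)
  qed
qed

lemma has_density_real_exp:
  fixes f :: "real \<Rightarrow> real"
  assumes "a \<le> b" and f: "has_density a b f F"
  shows "has_density a b (\<lambda>x. exp (f x)) (\<lambda>x. F x * exp (f x))"
proof -
  have "has_density a b (\<lambda>x. Re (exp (complex_of_real (f x)))) (\<lambda>x. Re (complex_of_real (F x) * exp (complex_of_real (f x))))"
    by (rule has_density_linear[OF has_density_exp[OF assms(1) has_density_linear[OF f bounded_linear_of_real]] bounded_linear_Re])
  then show ?thesis by (simp add: exp_of_real flip: of_real_mult)
qed

section \<open>Integral inequalities of Gronwall type\<close>

lemma absolutely_integrable_mult_continuous: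
  fixes f g :: "real \<Rightarrow> 'a::{real_normed_field, euclidean_space}"
  assumes f: "f absolutely_integrable_on {a..b}" and g: "continuous_on {a..b} g"
  shows "(\<lambda>x. f x * g x) absolutely_integrable_on {a..b}"
proof -
  obtain M where M: "\<And>x. x \<in> {a..b} \<Longrightarrow> norm (g x) \<le> M"
    using compact_imp_bounded[OF compact_continuous_image[OF g compact_Icc]] by (meson bounded_iff imageI)
  show ?thesis
  proof (rule measurable_bounded_by_integrable_imp_absolutely_integrable)
    have "f \<in> borel_measurable (lebesgue_on {a..b})" "g \<in> borel_measurable (lebesgue_on {a..b})"
      using f g by (auto intro: absolutely_integrable_imp_borel_measurable continuous_imp_measurable_on_sets_lebesgue)
    then show "(\<lambda>x. f x * g x) \<in> borel_measurable (lebesgue_on {a..b})" by measurable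
    have "(\<lambda>x. norm (f x)) integrable_on {a..b}"
      using f by (simp add: absolutely_integrable_on_def)
    then show "(\<lambda>x. norm (f x) * M) integrable_on {a..b}" by (rule integrable_on_mult_left)
    show "norm (f x * g x) \<le> norm (f x) * M" if "x \<in> {a..b}" for x
      using M[OF that] by (simp add: norm_mult mult_left_mono)
  qed auto
qed

lemma AE_lebesgue_on_negligible:
  assumes "S \<in> sets lebesgue"
  shows "(AE x in lebesgue_on S. P x) \<longleftrightarrow> (\<exists>N. negligible N \<and> (\<forall>x\<in>S - N. P x))"
proof -
  have "(AE x in lebesgue_on S. P x) \<longleftrightarrow> (AE x in lebesgue. x \<in> S \<longrightarrow> P x)"
    using assms by (intro AE_restrict_space_iff) auto
  also have "\<dots> \<longleftrightarrow> (\<exists>N. negligible N \<and> (\<forall>x\<in>S - N. P x))"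
  proof
    assume "AE x in lebesgue. x \<in> S \<longrightarrow> P x"
    then obtain N where N: "\<And>x. x \<in> space lebesgue - N \<Longrightarrow> x \<in> S \<longrightarrow> P x" "N \<in> null_sets lebesgue"
      using AE_E3 by blast
    then show "\<exists>N. negligible N \<and> (\<forall>x\<in>S - N. P x)"
      by (intro exI[of _ N]) (auto simp: negligible_iff_null_sets)
  next
    assume "\<exists>N. negligible N \<and> (\<forall>x\<in>S - N. P x)"
    then obtain N where N: "negligible N" "\<forall>x\<in>S - N. P x" by blast
    then show "AE x in lebesgue. x \<in> S \<longrightarrow> P x"
      by (intro AE_I'[of N]) (auto simp: negligible_iff_null_sets)
  qed
  finally show ?thesis .
qed

text \<open>Links the two settings: \<open>L2\<close> lives on open intervals, the integral
  equations on closed ones.\<close>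

lemma integrable_on_Icc_Ioo:
  "f absolutely_integrable_on {a..b::real} \<longleftrightarrow> f absolutely_integrable_on {a<..<b}"
  for f :: "real \<Rightarrow> 'a::euclidean_space"
proof (rule absolutely_integrable_spike_set_eq)
  show "negligible {x \<in> {a..b} - {a<..<b}. f x \<noteq> 0}"
    by (rule negligible_subset[of "{a,b}"]) auto
  show "negligible {x \<in> {a<..<b} - {a..b}. f x \<noteq> 0}"
    by (rule negligible_subset[of "{}"]) auto
qed

lemma sq_integrable_measurable: "f \<in> sq_integrable a b \<Longrightarrow> f \<in> borel_measurable (lebesgue_on {a<..<b})"
  by (simp add: sq_integrable_def)

lemma sq_integrable_square:
  "f \<in> sq_integrable a b \<Longrightarrow> (\<lambda>x. (cmod (f x))\<^sup>2) integrable_on {a<..<b}"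
  unfolding sq_integrable_def by (auto intro!: integrable_on_lebesgue_on)

lemma sq_integrable_absolutely_integrable:
  assumes "f \<in> sq_integrable a b"
  shows "f absolutely_integrable_on {a..b}" "(\<lambda>x. (f x)\<^sup>2) absolutely_integrable_on {a..b}"
proof -
  note m = sq_integrable_measurable[OF assms] and s = sq_integrable_square[OF assms]
  have "(\<lambda>x. 1 + (cmod (f x))\<^sup>2) integrable_on {a<..<b}"
    by (intro integrable_add s) (simp only: integrable_on_open_interval_real integrable_const_ivl)
  moreover have "cmod (f x) \<le> 1 + (cmod (f x))\<^sup>2" for x
  proof -
    have "0 \<le> (cmod (f x) - 1/2)\<^sup>2 + 3/4" by simp
    then show "cmod (f x) \<le> 1 + (cmod (f x))\<^sup>2" by (simp add: power2_eq_square algebra_simps)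
  qed
  ultimately have "f absolutely_integrable_on {a<..<b}"
    by (intro measurable_bounded_by_integrable_imp_absolutely_integrable[OF m]) auto
  then show "f absolutely_integrable_on {a..b}" by (simp add: integrable_on_Icc_Ioo)
  have "(\<lambda>x. (f x)\<^sup>2) absolutely_integrable_on {a<..<b}"
  proof (rule measurable_bounded_by_integrable_imp_absolutely_integrable[OF _ _ s])
    show "(\<lambda>x. (f x)\<^sup>2) \<in> borel_measurable (lebesgue_on {a<..<b})" using m by measurable
  qed (auto simp: norm_power)
  then show "(\<lambda>x. (f x)\<^sup>2) absolutely_integrable_on {a..b}" by (simp add: integrable_on_Icc_Ioo)
qed

lemma has_density_integral:
  "F absolutely_integrable_on {a..b} \<Longrightarrow> has_density a b (\<lambda>x. c + integral {a..x} F) F"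
  by (rule has_densityI) auto

text \<open>\<open>exp (c * Q x) / c\<close> is an antiderivative of the integrand, as
  \<open>k\<close> is the density of \<open>Q\<close>.\<close>

lemma integral_exp_weight:
  fixes k :: "real \<Rightarrow> real"
  assumes k: "k absolutely_integrable_on {0..T}"
  defines "Q \<equiv> \<lambda>x. integral {0..x} k"
  assumes x: "0 \<le> x" "x \<le> T" and c: "c \<noteq> 0"
  shows "((\<lambda>s. k s * exp (c * Q s)) has_integral (exp (c * Q x) - 1) / c) {0..x}"
proof -
  have "has_density 0 T Q k" unfolding Q_def using has_density_integral[OF k, of 0] by simp
  then have "has_density 0 T (\<lambda>x. c * Q x) (\<lambda>x. c * k x)"
    by (rule has_density_linear) (rule bounded_linear_mult_right)
  then have d: "has_density 0 T (\<lambda>x. exp (c * Q x)) (\<lambda>x. c * k x * exp (c * Q x))"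
    using x by (intro has_density_real_exp) auto
  have "(\<lambda>x. c * k x * exp (c * Q x)) integrable_on {0..x}"
    using x by (intro integrable_on_subinterval[OF set_lebesgue_integral_eq_integral(1)[OF has_densityD[OF d]]]) auto
  moreover have "integral {0..x} (\<lambda>x. c * k x * exp (c * Q x)) = exp (c * Q x) - 1"
    using has_density_eq[OF d, of x] x by (simp add: Q_def)
  ultimately have "((\<lambda>x. c * k x * exp (c * Q x)) has_integral exp (c * Q x) - 1) {0..x}"
    by (metis integrable_integral)
  from has_integral_mult_right[OF this, of "1/c"] show ?thesis
    using c by (simp add: field_simps)
qed

text \<open>The family \<open>\<phi> x i\<close>, \<open>i \<in> I x\<close>, is estimated in the weighted norm with weight
  \<open>exp (-2 Q x)\<close>, in which the Volterra operator has norm at most \<open>1/2\<close>.\<close>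

lemma gronwall_family:
  fixes k :: "real \<Rightarrow> real" and \<phi> :: "real \<Rightarrow> 'i \<Rightarrow> real"
  assumes k: "k absolutely_integrable_on {0..T}" and k0: "\<And>s. s \<in> {0..T} \<Longrightarrow> 0 \<le> k s"
  defines "Q \<equiv> \<lambda>x. integral {0..x} k"
  assumes bdd: "\<And>x i. x \<in> {0..T} \<Longrightarrow> i \<in> I x \<Longrightarrow> \<phi> x i \<le> M" and A: "0 \<le> A"
    and step: "\<And>B x i. 0 \<le> B \<Longrightarrow> (\<And>s j. s \<in> {0..x} \<Longrightarrow> j \<in> I s \<Longrightarrow> \<phi> s j \<le> B * exp (2 * Q s)) \<Longrightarrow>
        x \<in> {0..T} \<Longrightarrow> i \<in> I x \<Longrightarrow> \<phi> x i \<le> A + B * integral {0..x} (\<lambda>s. k s * exp (2 * Q s))"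
    and x: "x \<in> {0..T}" and i: "i \<in> I x"
  shows "\<phi> x i \<le> 2 * A * exp (2 * Q x)"
proof -
  define W where "W = {\<phi> x i * exp (- 2 * Q x) | x i. x \<in> {0..T} \<and> i \<in> I x}"
  define B where "B = max 0 (Sup W)"
  have Q0: "0 \<le> Q s" if "s \<in> {0..T}" for s
    unfolding Q_def using k0 that by (intro integral_nonneg integrable_on_subinterval[OF set_lebesgue_integral_eq_integral(1)[OF k]]) auto
  have "w \<le> max 0 M" if w: "w \<in> W" for w
  proof -
    obtain y j where y: "y \<in> {0..T}" "j \<in> I y" "w = \<phi> y j * exp (- 2 * Q y)" using w unfolding W_def by blast
    have "w \<le> max 0 M * exp (- 2 * Q y)" using bdd[OF y(1,2)] y(3) by (intro order.trans[OF eq_refl mult_right_mono]) auto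
    also have "\<dots> \<le> max 0 M * 1" using Q0[OF y(1)] by (intro mult_left_mono) auto
    finally show ?thesis by simp
  qed
  then have bW: "bdd_above W" by (auto simp: bdd_above_def)
  have neW: "W \<noteq> {}" using x i by (auto simp: W_def)
  have B0: "0 \<le> B" by (simp add: B_def)
  have phiB: "\<phi> y j \<le> B * exp (2 * Q y)" if "y \<in> {0..T}" "j \<in> I y" for y j
  proof -
    have "\<phi> y j * exp (- 2 * Q y) \<le> B"
      unfolding B_def using that by (intro max.coboundedI2 cSup_upper[OF _ bW]) (auto simp: W_def)
    then have "\<phi> y j * exp (- 2 * Q y) * exp (2 * Q y) \<le> B * exp (2 * Q y)" by (intro mult_right_mono) auto
    then show ?thesis by (simp add: mult.assoc flip: exp_add)
  qed
  \<comment> \<open>The a priori bound \<open>M\<close> makes the supremum of the weighted family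
    finite; it then reproduces itself as \<open>A + B / 2\<close>, hence is at most
    \<open>2 * A\<close>.\<close>
  have "w \<le> A + B / 2" if w: "w \<in> W" for w
  proof -
    obtain y j where y: "y \<in> {0..T}" "j \<in> I y" "w = \<phi> y j * exp (- 2 * Q y)" using w unfolding W_def by blast
    have "\<phi> y j \<le> A + B * integral {0..y} (\<lambda>s. k s * exp (2 * Q s))"
      by (rule step[OF B0 _ y(1,2)]) (use phiB y in auto)
    also have "integral {0..y} (\<lambda>s. k s * exp (2 * Q s)) = (exp (2 * Q y) - 1) / 2"
      unfolding Q_def using y(1) by (intro integral_unique integral_exp_weight[OF k]) auto
    finally have "\<phi> y j \<le> A + B * ((exp (2 * Q y) - 1) / 2)" .
    also have "\<dots> \<le> A * exp (2 * Q y) + B * (exp (2 * Q y) / 2)"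
      using A B0 Q0[OF y(1)] by (intro add_mono mult_left_mono) (auto simp: mult_le_cancel_left1)
    finally have "\<phi> y j \<le> (A + B / 2) * exp (2 * Q y)" by (simp add: algebra_simps)
    then have "\<phi> y j * exp (- 2 * Q y) \<le> (A + B / 2) * exp (2 * Q y) * exp (- 2 * Q y)"
      by (intro mult_right_mono) auto
    then show ?thesis using y(3) by (simp add: mult.assoc flip: exp_add)
  qed
  then have "Sup W \<le> A + B / 2" by (intro cSup_least neW)
  then have "B \<le> 2 * A" using A B0 unfolding B_def by (auto simp: max_def split: if_splits)
  then have "B * exp (2 * Q x) \<le> 2 * A * exp (2 * Q x)" by simp
  then show ?thesis using phiB[OF x i] by linarith
qed

text \<open>Here the weight is \<open>exp (2 * Q x)\<close>, and the maximum \<open>B\<close> of the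
  weighted function, attained at some \<open>x\<close> by continuity, satisfies
  \<open>B \<le> A * exp (2 * Q x) + B / 2\<close>.\<close>

lemma gronwall_backward:
  fixes k \<phi> :: "real \<Rightarrow> real"
  assumes k: "k absolutely_integrable_on {0..T}" and k0: "\<And>s. s \<in> {0..T} \<Longrightarrow> 0 \<le> k s"
    and "0 \<le> T" and \<phi>: "continuous_on {0..T} \<phi>" and \<phi>0: "\<And>x. x \<in> {0..T} \<Longrightarrow> 0 \<le> \<phi> x" and A: "0 \<le> A"
    and le: "\<And>x. x \<in> {0..T} \<Longrightarrow> \<phi> x \<le> A + integral {x..T} (\<lambda>s. k s * \<phi> s)"
  shows "\<phi> 0 \<le> 2 * A * exp (2 * integral {0..T} k)"
proof -
  define Q where "Q x = integral {0..x} k" for x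
  have dQ: "has_density 0 T Q k" unfolding Q_def using has_density_integral[OF k, of 0] by simp
  then have cQ: "continuous_on {0..T} Q" by (rule has_density_continuous)
  have Q0: "0 \<le> Q s" if "s \<in> {0..T}" for s
    unfolding Q_def using k0 that by (intro integral_nonneg integrable_on_subinterval[OF set_lebesgue_integral_eq_integral(1)[OF k]]) auto
  have "\<exists>x\<in>{0..T}. \<forall>y\<in>{0..T}. \<phi> y * exp (2 * Q y) \<le> \<phi> x * exp (2 * Q x)"
    using \<open>0 \<le> T\<close> \<phi> cQ by (intro continuous_attains_sup) (auto intro!: continuous_intros)
  then obtain x where x: "x \<in> {0..T}" "\<And>y. y \<in> {0..T} \<Longrightarrow> \<phi> y * exp (2 * Q y) \<le> \<phi> x * exp (2 * Q x)"
    by blast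
  define B where "B = \<phi> x * exp (2 * Q x)"
  have B0: "0 \<le> B" using \<phi>0[OF x(1)] by (simp add: B_def)
  have phiB: "\<phi> y \<le> B * exp (- 2 * Q y)" if "y \<in> {0..T}" for y
  proof -
    have "\<phi> y * exp (2 * Q y) * exp (- 2 * Q y) \<le> B * exp (- 2 * Q y)"
      using x(2)[OF that] unfolding B_def by (intro mult_right_mono) auto
    then show ?thesis by (simp add: mult.assoc flip: exp_add)
  qed
  have w: "((\<lambda>s. k s * exp (- 2 * Q s)) has_integral (exp (- 2 * Q y) - 1) / (- 2)) {0..y}" if "y \<in> {0..T}" for y
    unfolding Q_def using that by (intro integral_exp_weight[OF k]) auto
  have wT: "(\<lambda>s. k s * exp (- 2 * Q s)) integrable_on {0..T}" using w[of T] \<open>0 \<le> T\<close> by auto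
  have kphi: "(\<lambda>s. k s * \<phi> s) integrable_on {0..T}"
    using set_lebesgue_integral_eq_integral(1)[OF absolutely_integrable_mult_continuous[OF k \<phi>]] .
  have "\<phi> x \<le> A + integral {x..T} (\<lambda>s. k s * \<phi> s)" by (rule le[OF x(1)])
  also have "integral {x..T} (\<lambda>s. k s * \<phi> s) \<le> integral {x..T} (\<lambda>s. B * (k s * exp (- 2 * Q s)))"
  proof (rule integral_le)
    show "(\<lambda>s. k s * \<phi> s) integrable_on {x..T}" using x(1) by (intro integrable_on_subinterval[OF kphi]) auto
    show "(\<lambda>s. B * (k s * exp (- 2 * Q s))) integrable_on {x..T}"
      using x(1) by (intro integrable_on_mult_right integrable_on_subinterval[OF wT]) auto
    fix s assume "s \<in> {x..T}"
    then have s: "s \<in> {0..T}" using x(1) by auto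
    show "k s * \<phi> s \<le> B * (k s * exp (- 2 * Q s))"
      using mult_left_mono[OF phiB[OF s] k0[OF s]] by (simp add: algebra_simps)
  qed
  also have "\<dots> = B * integral {x..T} (\<lambda>s. k s * exp (- 2 * Q s))" by simp
  also have "integral {x..T} (\<lambda>s. k s * exp (- 2 * Q s)) = (exp (- 2 * Q x) - exp (- 2 * Q T)) / 2"
  proof -
    have "integral {0..x} (\<lambda>s. k s * exp (- 2 * Q s)) + integral {x..T} (\<lambda>s. k s * exp (- 2 * Q s))
        = integral {0..T} (\<lambda>s. k s * exp (- 2 * Q s))"
      using x(1) by (intro Henstock_Kurzweil_Integration.integral_combine wT) auto
    moreover have "integral {0..x} (\<lambda>s. k s * exp (- 2 * Q s)) = (exp (- 2 * Q x) - 1) / (- 2)"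
      "integral {0..T} (\<lambda>s. k s * exp (- 2 * Q s)) = (exp (- 2 * Q T) - 1) / (- 2)"
      using w[OF x(1)] w[of T] \<open>0 \<le> T\<close> by (auto intro!: integral_unique)
    ultimately show ?thesis by (simp add: field_simps)
  qed
  also have "B * ((exp (- 2 * Q x) - exp (- 2 * Q T)) / 2) \<le> B * (exp (- 2 * Q x) / 2)"
    using B0 by (intro mult_left_mono) auto
  finally have "\<phi> x \<le> A + B * (exp (- 2 * Q x) / 2)" by simp
  then have "B \<le> (A + B * (exp (- 2 * Q x) / 2)) * exp (2 * Q x)"
    unfolding B_def by (intro mult_right_mono) auto
  also have "\<dots> = A * exp (2 * Q x) + B / 2" by (simp add: algebra_simps flip: exp_add)
  finally have "B \<le> 2 * A * exp (2 * Q x)" by simp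
  also have "\<dots> \<le> 2 * A * exp (2 * Q T)"
  proof -
    have "integral {0..x} k \<le> integral {0..T} k"
      using x(1) k0 by (intro integral_subset_le integrable_on_subinterval[OF set_lebesgue_integral_eq_integral(1)[OF k]]) auto
    then show ?thesis using A by (intro mult_left_mono) (auto simp: Q_def)
  qed
  finally have "B \<le> 2 * A * exp (2 * Q T)" .
  moreover have "\<phi> 0 \<le> B" using phiB[of 0] \<open>0 \<le> T\<close> by (simp add: Q_def)
  ultimately show ?thesis by (simp add: Q_def)
qed

text \<open>Polynomials in \<open>z\<close> with coefficients continuous in \<open>x\<close> on
  [0, pi]. In this form holomorphy in \<open>z\<close> and stability under Volterra integration are
  structural inductions; \<open>cong\<close> restricts attention to \<open>x\<close> in
  [0, pi].\<close>

inductive polynomial_in :: "(complex \<Rightarrow> real \<Rightarrow> complex) \<Rightarrow> bool" where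
  const: "continuous_on {0..pi} c \<Longrightarrow> polynomial_in (\<lambda>z x. c x)"
| add: "polynomial_in f \<Longrightarrow> polynomial_in g \<Longrightarrow> polynomial_in (\<lambda>z x. f z x + g z x)"
| mult: "polynomial_in f \<Longrightarrow> polynomial_in (\<lambda>z x. z * f z x)"
| cong: "polynomial_in f \<Longrightarrow> (\<And>z x. x \<in> {0..pi} \<Longrightarrow> g z x = f z x) \<Longrightarrow> polynomial_in g"

lemma polynomial_in_continuous: "polynomial_in f \<Longrightarrow> continuous_on {0..pi} (f z)"
proof (induction rule: polynomial_in.induct)
  case (cong f g)
  then show ?case using continuous_on_cong[of "{0..pi}" "{0..pi}" "g z" "f z"] by simp
qed (auto intro: continuous_intros)

lemma polynomial_in_holomorphic: "polynomial_in f \<Longrightarrow> x \<in> {0..pi} \<Longrightarrow> (\<lambda>z. f z x) holomorphic_on UNIV"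
proof (induction rule: polynomial_in.induct)
  case (cong f g)
  have "(\<lambda>z. g z x) = (\<lambda>z. f z x)" using cong.hyps(2)[OF cong.prems] by (rule ext)
  then show ?case using cong.IH[OF cong.prems] by simp
qed (auto intro!: holomorphic_on_add holomorphic_on_mult holomorphic_on_ident holomorphic_on_const)

lemma polynomial_in_minus: "polynomial_in f \<Longrightarrow> polynomial_in (\<lambda>z x. - f z x)"
proof (induction rule: polynomial_in.induct)
  case (const c) then show ?case by (intro polynomial_in.const continuous_intros)
next
  case (add f g)
  from polynomial_in.add[OF add.IH] show ?case by (rule polynomial_in.cong) simp
next
  case (mult f)
  from polynomial_in.mult[OF mult.IH] show ?case by (rule polynomial_in.cong) simp
next
  case (cong f g)
  from cong.IH show ?case by (rule polynomial_in.cong) (simp add: cong.hyps)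
qed

lemma polynomial_in_scale: "polynomial_in f \<Longrightarrow> polynomial_in (\<lambda>z x. c * f z x)"
proof (induction rule: polynomial_in.induct)
  case (const g) then show ?case by (intro polynomial_in.const continuous_intros)
next
  case (add f g)
  from polynomial_in.add[OF add.IH] show ?case by (rule polynomial_in.cong) (simp add: algebra_simps)
next
  case (mult f)
  from polynomial_in.mult[OF mult.IH] show ?case by (rule polynomial_in.cong) simp
next
  case (cong f g)
  from cong.IH show ?case by (rule polynomial_in.cong) (simp add: cong.hyps)
qed

text \<open>Integration in \<open>x\<close> commutes with multiplication by \<open>z\<close>, so the
  induction only has to integrate the coefficients.\<close>

lemma polynomial_in_integral:
  assumes "polynomial_in f" and g: "g absolutely_integrable_on {0..pi}"
  shows "polynomial_in (\<lambda>z x. integral {0..x} (\<lambda>s. g s * f z s))"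
  using assms(1)
proof (induction rule: polynomial_in.induct)
  case (const c)
  have "(\<lambda>s. g s * c s) absolutely_integrable_on {0..pi}"
    by (rule absolutely_integrable_mult_continuous[OF g const])
  then show ?case
    by (intro polynomial_in.const indefinite_integral_continuous_1 set_lebesgue_integral_eq_integral(1))
next
  case (add f h)
  show ?case
  proof (rule polynomial_in.cong[OF polynomial_in.add[OF add.IH]])
    fix z :: complex and x assume x: "x \<in> {0..pi}"
    have "(\<lambda>s. g s * f z s) integrable_on {0..x}" "(\<lambda>s. g s * h z s) integrable_on {0..x}"
      using x add.hyps
      by (auto intro!: integrable_on_subinterval[OF set_lebesgue_integral_eq_integral(1)[OF absolutely_integrable_mult_continuous[OF g]]]
          polynomial_in_continuous)
    then show "integral {0..x} (\<lambda>s. g s * (f z s + h z s)) = integral {0..x} (\<lambda>s. g s * f z s) + integral {0..x} (\<lambda>s. g s * h z s)"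
      by (simp add: distrib_left integral_add)
  qed
next
  case (mult f)
  show ?case
  proof (rule polynomial_in.cong[OF polynomial_in.mult[OF mult.IH]])
    fix z :: complex and x assume x: "x \<in> {0..pi}"
    show "integral {0..x} (\<lambda>s. g s * (z * f z s)) = z * integral {0..x} (\<lambda>s. g s * f z s)"
      by (subst integral_mult_right[symmetric]) (simp add: mult_ac)
  qed
next
  case (cong f h)
  show ?case
  proof (rule polynomial_in.cong[OF cong.IH])
    fix z :: complex and x assume "x \<in> {0..pi}"
    then show "integral {0..x} (\<lambda>s. g s * h z s) = integral {0..x} (\<lambda>s. g s * f z s)"
      using cong.hyps by (intro integral_cong) auto
  qed
qed

section \<open>The solution \<open>S\<close>\<close>

locale pencil =
  fixes p \<sigma> :: "real \<Rightarrow> complex"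
  assumes p_sq: "p \<in> sq_integrable 0 pi" and \<sigma>_sq: "\<sigma> \<in> sq_integrable 0 pi"
begin

lemmas p_ai = sq_integrable_absolutely_integrable(1)[OF p_sq]
lemmas \<sigma>_ai = sq_integrable_absolutely_integrable(1)[OF \<sigma>_sq]
lemmas \<sigma>2_ai = sq_integrable_absolutely_integrable(2)[OF \<sigma>_sq]

text \<open>Solving the equation for the derivative of \<open>y1\<close> gives
  \<open>pot z * y - \<sigma> * y1\<close>. Together with \<open>y1 + \<sigma> * y\<close> for the
  derivative of \<open>y\<close> this is a first-order system with integrable coefficients, and
  \<open>sol\<close> is its integrated form.\<close>

definition pot :: "complex \<Rightarrow> real \<Rightarrow> complex" where
  "pot z x = 2 * z * p x - z\<^sup>2 - (\<sigma> x)\<^sup>2"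

definition sol :: "complex \<Rightarrow> (real \<Rightarrow> complex) \<Rightarrow> (real \<Rightarrow> complex) \<Rightarrow> bool" where
  "sol z y y1 \<longleftrightarrow> has_density 0 pi y (\<lambda>x. y1 x + \<sigma> x * y x) \<and>
     has_density 0 pi y1 (\<lambda>x. pot z x * y x - \<sigma> x * y1 x)"

lemma pot_ai: "pot z absolutely_integrable_on {0..pi}"
proof -
  have "(\<lambda>x. z\<^sup>2) absolutely_integrable_on {0..pi}" by (rule absolutely_integrable_on_const) simp
  moreover have "(\<lambda>x. 2 * z * p x) absolutely_integrable_on {0..pi}" using p_ai by (rule set_integrable_mult_right)
  ultimately have "(\<lambda>x. 2 * z * p x - z\<^sup>2 - (\<sigma> x)\<^sup>2) absolutely_integrable_on {0..pi}"
    by (intro set_integral_diff(1) \<sigma>2_ai)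
  then show ?thesis by (simp add: pot_def[abs_def])
qed

lemma is_solution_imp_sol:
  assumes "is_solution p \<sigma> z y y1"
  shows "sol z y y1"
proof -
  have ac: "abs_cont 0 pi y" "abs_cont 0 pi y1"
    and q: "AE x in lebesgue_on {0<..<pi}. y1 x = vector_derivative y (at x) - \<sigma> x * y x"
    and e: "AE x in lebesgue_on {0<..<pi}. ell \<sigma> y y1 x + 2 * z * p x * y x = z\<^sup>2 * y x"
    using assms by (auto simp: is_solution_def quasi_derivative_def)
  obtain N1 where N1: "negligible N1" "\<And>x. x \<in> {0<..<pi} - N1 \<Longrightarrow> y1 x = vector_derivative y (at x) - \<sigma> x * y x"
    using q by (subst (asm) AE_lebesgue_on_negligible) auto
  obtain N2 where N2: "negligible N2" "\<And>x. x \<in> {0<..<pi} - N2 \<Longrightarrow> ell \<sigma> y y1 x + 2 * z * p x * y x = z\<^sup>2 * y x"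
    using e by (subst (asm) AE_lebesgue_on_negligible) auto
  have "has_density 0 pi y (\<lambda>x. y1 x + \<sigma> x * y x)"
  proof (rule abs_cont_has_density[OF _ ac(1) N1(1)])
    fix x f' assume "x \<in> {0<..<pi} - N1" "(y has_vector_derivative f') (at x)"
    then show "y1 x + \<sigma> x * y x = f'" using N1(2)[of x] vector_derivative_at[of y f' x] by simp
  qed simp
  moreover have "has_density 0 pi y1 (\<lambda>x. pot z x * y x - \<sigma> x * y1 x)"
  proof (rule abs_cont_has_density[OF _ ac(2) N2(1)])
    fix x f' assume "x \<in> {0<..<pi} - N2" "(y1 has_vector_derivative f') (at x)"
    then have "- f' - \<sigma> x * y1 x - (\<sigma> x)\<^sup>2 * y x + 2 * z * p x * y x = z\<^sup>2 * y x"
      using N2(2)[of x] vector_derivative_at[of y1 f' x] by (simp add: ell_def)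
    then show "pot z x * y x - \<sigma> x * y1 x = f'" by (simp add: pot_def algebra_simps)
  qed simp
  ultimately show ?thesis by (simp add: sol_def)
qed

text \<open>For a solution of the system, \<open>ell\<close> equals
  \<open>z\<^sup>2 * y - 2 * z * p * y\<close> almost everywhere, which is square integrable because
  \<open>y\<close> is bounded and \<open>p\<close> is in \<open>L2\<close>.\<close>

lemma sol_imp_is_solution:
  assumes "sol z y y1"
  shows "is_solution p \<sigma> z y y1"
proof -
  have d: "has_density 0 pi y (\<lambda>x. y1 x + \<sigma> x * y x)" "has_density 0 pi y1 (\<lambda>x. pot z x * y x - \<sigma> x * y1 x)"
    using assms by (auto simp: sol_def)
  note c = has_density_continuous[OF d(1)]
  obtain N1 where N1: "negligible N1" "\<And>x. x \<in> {0<..<pi} - N1 \<Longrightarrow> (y has_vector_derivative y1 x + \<sigma> x * y x) (at x)"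
    using has_density_AE_derivative[OF d(1)] by blast
  obtain N2 where N2: "negligible N2" "\<And>x. x \<in> {0<..<pi} - N2 \<Longrightarrow> (y1 has_vector_derivative pot z x * y x - \<sigma> x * y1 x) (at x)"
    using has_density_AE_derivative[OF d(2)] by blast
  have ell: "ell \<sigma> y y1 x = z\<^sup>2 * y x - 2 * z * p x * y x" if "x \<in> {0<..<pi} - N2" for x
    using vector_derivative_at[OF N2(2)[OF that]] by (simp add: ell_def pot_def algebra_simps)
  define g where "g x = z\<^sup>2 * y x - 2 * z * p x * y x" for x
  have neg: "negligible ({x \<in> {0<..<pi}. ell \<sigma> y y1 x \<noteq> g x})"
    by (rule negligible_subset[OF N2(1)]) (use ell in \<open>auto simp: g_def\<close>)
  have ym: "y \<in> borel_measurable (lebesgue_on {0<..<pi})"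
    by (intro continuous_imp_measurable_on_sets_lebesgue continuous_on_subset[OF c]) auto
  have gm: "g \<in> borel_measurable (lebesgue_on {0<..<pi})"
    unfolding g_def using ym sq_integrable_measurable[OF p_sq] by measurable
  then have "g measurable_on {0<..<pi}" by (simp add: measurable_on_iff_borel_measurable)
  then have "ell \<sigma> y y1 measurable_on {0<..<pi}"
    by (rule measurable_on_spike[OF _ N2(1)]) (simp add: ell g_def)
  then have em: "ell \<sigma> y y1 \<in> borel_measurable (lebesgue_on {0<..<pi})" by (simp add: measurable_on_iff_borel_measurable)
  obtain M where M: "M > 0" "\<And>x. x \<in> {0..pi} \<Longrightarrow> norm (y x) \<le> M" using has_density_bounded[OF d(1)] by blast
  have g2: "(\<lambda>x. (cmod (g x))\<^sup>2) absolutely_integrable_on {0<..<pi}"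
  proof (rule measurable_bounded_by_integrable_imp_absolutely_integrable)
    show "(\<lambda>x. (cmod (g x))\<^sup>2) \<in> borel_measurable (lebesgue_on {0<..<pi})" using gm by measurable
    show "(\<lambda>x. (2 * (cmod (z\<^sup>2) * M)\<^sup>2) + (2 * (cmod (2 * z) * M)\<^sup>2) * (cmod (p x))\<^sup>2) integrable_on {0<..<pi}"
      by (intro integrable_add integrable_on_mult_right sq_integrable_square[OF p_sq])
        (simp only: integrable_on_open_interval_real integrable_const_ivl)
    fix x assume "x \<in> {0<..<pi}"
    then have Mx: "cmod (y x) \<le> M" using M(2) by auto
    have "cmod (g x) \<le> cmod (z\<^sup>2) * cmod (y x) + cmod (2 * z) * cmod (p x) * cmod (y x)"
      unfolding g_def by (rule order.trans[OF norm_triangle_ineq4]) (simp add: norm_mult)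
    also have "\<dots> \<le> cmod (z\<^sup>2) * M + cmod (2 * z) * M * cmod (p x)"
    proof -
      have "cmod (z\<^sup>2) * cmod (y x) \<le> cmod (z\<^sup>2) * M" by (intro mult_left_mono Mx) auto
      moreover have "cmod (2 * z) * cmod (p x) * cmod (y x) \<le> cmod (2 * z) * cmod (p x) * M"
        by (intro mult_left_mono Mx) auto
      moreover have "cmod (2 * z) * cmod (p x) * M = cmod (2 * z) * M * cmod (p x)" by (simp only: mult_ac)
      ultimately show ?thesis by linarith
    qed
    finally have "(cmod (g x))\<^sup>2 \<le> (cmod (z\<^sup>2) * M + cmod (2 * z) * M * cmod (p x))\<^sup>2" by (intro power_mono) auto
    also have "\<dots> \<le> 2 * (cmod (z\<^sup>2) * M)\<^sup>2 + 2 * (cmod (2 * z) * M * cmod (p x))\<^sup>2"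
    proof -
      have "0 \<le> (a - b)\<^sup>2" for a b :: real by simp
      from this[of "cmod (z\<^sup>2) * M" "cmod (2 * z) * M * cmod (p x)"]
      show ?thesis by (simp add: power2_sum power2_diff)
    qed
    finally show "norm ((cmod (g x))\<^sup>2) \<le> (2 * (cmod (z\<^sup>2) * M)\<^sup>2) + (2 * (cmod (2 * z) * M)\<^sup>2) * (cmod (p x))\<^sup>2"
      by (simp add: power_mult_distrib)
  qed auto
  have "(\<lambda>x. (cmod (ell \<sigma> y y1 x))\<^sup>2) absolutely_integrable_on {0<..<pi}"
    by (rule absolutely_integrable_spike[OF g2 N2(1)]) (simp add: ell g_def)
  then have "integrable (lebesgue_on {0<..<pi}) (\<lambda>x. (cmod (ell \<sigma> y y1 x))\<^sup>2)"
    unfolding set_integrable_def by (subst integrable_restrict_space) auto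
  then have "ell \<sigma> y y1 \<in> sq_integrable 0 pi" using em by (simp add: sq_integrable_def)
  moreover have "AE x in lebesgue_on {0<..<pi}. y1 x = vector_derivative y (at x) - \<sigma> x * y x"
    using N1 by (subst AE_lebesgue_on_negligible) (auto intro!: exI[of _ N1] simp: vector_derivative_at[OF N1(2)])
  moreover have "AE x in lebesgue_on {0<..<pi}. ell \<sigma> y y1 x + 2 * z * p x * y x = z\<^sup>2 * y x"
    using N2(1) ell by (subst AE_lebesgue_on_negligible) (auto intro!: exI[of _ N2])
  ultimately show ?thesis
    using has_density_imp_abs_cont[OF d(1)] has_density_imp_abs_cont[OF d(2)]
    by (simp add: is_solution_def quasi_derivative_def)
qed

section \<open>A priori bounds for the system, and uniqueness\<close>

definition kern :: "real \<Rightarrow> real \<Rightarrow> real" where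
  "kern R x = 1 + 2 * cmod (\<sigma> x) + (cmod (\<sigma> x))\<^sup>2 + 2 * R * cmod (p x) + R\<^sup>2"

lemma kern_ai: "kern R absolutely_integrable_on {0..pi}"
proof -
  have "(\<lambda>x. (cmod (\<sigma> x))\<^sup>2) absolutely_integrable_on {0..pi}"
    using set_integrable_norm[OF \<sigma>2_ai] by (simp add: norm_power)
  then show ?thesis unfolding kern_def[abs_def]
    by (intro set_integral_add(1) set_integrable_mult_right set_integrable_norm p_ai \<sigma>_ai absolutely_integrable_on_const) auto
qed

lemma kern_nonneg: "0 \<le> R \<Longrightarrow> 0 \<le> kern R x"
  by (simp add: kern_def)

text \<open>\<open>kern R\<close> majorizes the coefficient matrix in the sum norm, uniformly for
  \<open>cmod z \<le> R\<close>; its summand 1 accounts for \<open>b\<close> in the first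
  component.\<close>

lemma kern_bound:
  assumes "cmod z \<le> R"
  shows "cmod (b + \<sigma> x * a) + cmod (pot z x * a - \<sigma> x * b) \<le> kern R x * (cmod a + cmod b)"
proof -
  have R: "0 \<le> R" using assms norm_ge_zero order.trans by blast
  have "cmod (pot z x) \<le> cmod (2 * z * p x) + cmod (z\<^sup>2) + cmod ((\<sigma> x)\<^sup>2)"
    unfolding pot_def by (intro order.trans[OF norm_triangle_ineq4] add_right_mono) auto
  also have "\<dots> \<le> 2 * R * cmod (p x) + R\<^sup>2 + (cmod (\<sigma> x))\<^sup>2"
    using assms by (intro add_mono) (auto simp: norm_mult norm_power intro!: mult_right_mono power_mono)
  finally have pot: "cmod (pot z x) \<le> 2 * R * cmod (p x) + R\<^sup>2 + (cmod (\<sigma> x))\<^sup>2" .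
  have "cmod (b + \<sigma> x * a) + cmod (pot z x * a - \<sigma> x * b)
      \<le> (cmod b + cmod (\<sigma> x) * cmod a) + (cmod (pot z x) * cmod a + cmod (\<sigma> x) * cmod b)"
    by (intro add_mono order.trans[OF norm_triangle_ineq] order.trans[OF norm_triangle_ineq4]) (auto simp: norm_mult)
  also have "\<dots> \<le> (cmod b + cmod (\<sigma> x) * cmod a) + ((2 * R * cmod (p x) + R\<^sup>2 + (cmod (\<sigma> x))\<^sup>2) * cmod a + cmod (\<sigma> x) * cmod b)"
    using pot by (intro add_left_mono add_right_mono mult_right_mono) auto
  also have "\<dots> \<le> kern R x * (cmod a + cmod b)"
  proof -
    have "kern R x * (cmod a + cmod b) - ((cmod b + cmod (\<sigma> x) * cmod a) + ((2 * R * cmod (p x) + R\<^sup>2 + (cmod (\<sigma> x))\<^sup>2) * cmod a + cmod (\<sigma> x) * cmod b))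
       = cmod a + cmod (\<sigma> x) * cmod a + (cmod (\<sigma> x) + (cmod (\<sigma> x))\<^sup>2 + 2 * R * cmod (p x) + R\<^sup>2) * cmod b"
      unfolding kern_def by (simp add: algebra_simps)
    also have "\<dots> \<ge> 0" using R by (intro add_nonneg_nonneg mult_nonneg_nonneg) auto
    finally show ?thesis by simp
  qed
  finally show ?thesis .
qed

definition Q :: "real \<Rightarrow> real \<Rightarrow> real" where "Q R x = integral {0..x} (kern R)"

lemma Q_mono: "0 \<le> R \<Longrightarrow> x \<in> {0..pi} \<Longrightarrow> Q R x \<le> Q R pi"
  unfolding Q_def using kern_nonneg
  by (intro integral_subset_le integrable_on_subinterval[OF set_lebesgue_integral_eq_integral(1)[OF kern_ai]]) auto

lemma Q_nonneg: "0 \<le> R \<Longrightarrow> x \<in> {0..pi} \<Longrightarrow> 0 \<le> Q R x"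
  unfolding Q_def using kern_nonneg
  by (intro integral_nonneg integrable_on_subinterval[OF set_lebesgue_integral_eq_integral(1)[OF kern_ai]]) auto

lemma kern_weight:
  assumes "x \<in> {0..pi}"
  shows "((\<lambda>s. kern R s * exp (2 * Q R s)) has_integral (exp (2 * Q R x) - 1) / 2) {0..x}"
  unfolding Q_def using assms integral_exp_weight[OF kern_ai, of x 2] by simp

text \<open>In the norm weighted by \<open>exp (2 * Q R)\<close> the Volterra operator of the system
  has norm at most 1/2. Uniqueness and the geometric convergence of the Picard series both rest on
  this.\<close>

lemma volterra_bound:
  assumes z: "cmod z \<le> R" and x: "x \<in> {0..pi}" and "0 \<le> B"
    and a: "continuous_on {0..pi} a" and b: "continuous_on {0..pi} b"
    and le: "\<And>s. s \<in> {0..x} \<Longrightarrow> cmod (a s) + cmod (b s) \<le> B * exp (2 * Q R s)"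
  shows "cmod (integral {0..x} (\<lambda>s. b s + \<sigma> s * a s)) + cmod (integral {0..x} (\<lambda>s. pot z s * a s - \<sigma> s * b s))
      \<le> B * ((exp (2 * Q R x) - 1) / 2)"
proof -
  have R: "0 \<le> R" using z norm_ge_zero order.trans by blast
  have b': "b absolutely_integrable_on {0..pi}" using b by (simp add: absolutely_integrable_continuous_real)
  have i1: "(\<lambda>s. b s + \<sigma> s * a s) absolutely_integrable_on {0..pi}"
    by (intro set_integral_add(1) b' absolutely_integrable_mult_continuous[OF \<sigma>_ai a])
  have i2: "(\<lambda>s. pot z s * a s - \<sigma> s * b s) absolutely_integrable_on {0..pi}"
    by (intro set_integral_diff(1) absolutely_integrable_mult_continuous[OF \<sigma>_ai b] absolutely_integrable_mult_continuous[OF pot_ai a])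
  have sub: "f integrable_on {0..x}" if "f absolutely_integrable_on {0..pi}" for f :: "real \<Rightarrow> 'b::euclidean_space"
    using x by (intro integrable_on_subinterval[OF set_lebesgue_integral_eq_integral(1)[OF that]]) auto
  have "cmod (integral {0..x} (\<lambda>s. b s + \<sigma> s * a s)) + cmod (integral {0..x} (\<lambda>s. pot z s * a s - \<sigma> s * b s))
    \<le> integral {0..x} (\<lambda>s. cmod (b s + \<sigma> s * a s)) + integral {0..x} (\<lambda>s. cmod (pot z s * a s - \<sigma> s * b s))"
    by (intro add_mono integral_norm_bound_integral sub i1 i2 set_integrable_norm) auto
  also have "\<dots> = integral {0..x} (\<lambda>s. cmod (b s + \<sigma> s * a s) + cmod (pot z s * a s - \<sigma> s * b s))"
    by (intro integral_add[symmetric] sub i1 i2 set_integrable_norm)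
  also have "\<dots> \<le> integral {0..x} (\<lambda>s. B * (kern R s * exp (2 * Q R s)))"
  proof (rule integral_le)
    show "(\<lambda>s. cmod (b s + \<sigma> s * a s) + cmod (pot z s * a s - \<sigma> s * b s)) integrable_on {0..x}"
      by (intro integrable_add sub i1 i2 set_integrable_norm)
    show "(\<lambda>s. B * (kern R s * exp (2 * Q R s))) integrable_on {0..x}"
      using kern_weight[OF x] by (intro integrable_on_mult_right) auto
    fix s assume s: "s \<in> {0..x}"
    have "cmod (b s + \<sigma> s * a s) + cmod (pot z s * a s - \<sigma> s * b s) \<le> kern R s * (cmod (a s) + cmod (b s))"
      by (rule kern_bound[OF z])
    also have "\<dots> \<le> kern R s * (B * exp (2 * Q R s))"
      by (rule mult_left_mono[OF le[OF s] kern_nonneg[OF R]])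
    finally show "cmod (b s + \<sigma> s * a s) + cmod (pot z s * a s - \<sigma> s * b s) \<le> B * (kern R s * exp (2 * Q R s))"
      by (simp add: mult_ac)
  qed
  also have "\<dots> = B * ((exp (2 * Q R x) - 1) / 2)"
    using integral_unique[OF kern_weight[OF x]] by simp
  finally show ?thesis .
qed

text \<open>The difference of two solutions satisfies the homogeneous system with zero initial
  values, so the Gronwall estimate holds with \<open>A = 0\<close>; the family there consists of a
  single function.\<close>

lemma sol_unique:
  assumes "sol z y y1" "sol z w w1" "y 0 = w 0" "y1 0 = w1 0" and x: "x \<in> {0..pi}"
  shows "y x = w x" "y1 x = w1 x"
proof -
  define R where "R = cmod z"
  define d d1 where "d x = y x - w x" and "d1 x = y1 x - w1 x" for x
  have D: "has_density 0 pi d (\<lambda>x. d1 x + \<sigma> x * d x)" "has_density 0 pi d1 (\<lambda>x. pot z x * d x - \<sigma> x * d1 x)"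
    using has_density_diff[of 0 pi y _ w] has_density_diff[of 0 pi y1 _ w1] assms(1,2)
    unfolding sol_def d_def[abs_def] d1_def[abs_def] by (force simp: algebra_simps)+
  note c = has_density_continuous[OF D(1)] has_density_continuous[OF D(2)]
  obtain M1 where M1: "\<And>x. x \<in> {0..pi} \<Longrightarrow> norm (d x) \<le> M1" using has_density_bounded[OF D(1)] by blast
  obtain M2 where M2: "\<And>x. x \<in> {0..pi} \<Longrightarrow> norm (d1 x) \<le> M2" using has_density_bounded[OF D(2)] by blast
  have "cmod (d x) + cmod (d1 x) \<le> 2 * 0 * exp (2 * integral {0..x} (kern R))"
  proof (rule gronwall_family[OF kern_ai, where I="\<lambda>_. {()}" and \<phi>="\<lambda>x _. cmod (d x) + cmod (d1 x)" and M="M1 + M2"])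
    show "cmod (d x) + cmod (d1 x) \<le> M1 + M2" if "x \<in> {0..pi}" for x
      using M1[OF that] M2[OF that] by simp
    fix B x assume B: "0 \<le> B" and x: "x \<in> {0..pi}"
      and le: "\<And>s j. s \<in> {0..x} \<Longrightarrow> j \<in> {()} \<Longrightarrow> cmod (d s) + cmod (d1 s) \<le> B * exp (2 * integral {0..s} (kern R))"
    have "cmod (d x) + cmod (d1 x) = cmod (integral {0..x} (\<lambda>s. d1 s + \<sigma> s * d s)) + cmod (integral {0..x} (\<lambda>s. pot z s * d s - \<sigma> s * d1 s))"
      using assms(3,4) by (simp only: has_density_eq[OF D(1) x] has_density_eq[OF D(2) x]) (simp add: d_def d1_def)
    also have "\<dots> \<le> B * ((exp (2 * Q R x) - 1) / 2)"
      using le by (intro volterra_bound B x c) (auto simp: R_def Q_def)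
    finally show "cmod (d x) + cmod (d1 x) \<le> 0 + B * integral {0..x} (\<lambda>s. kern R s * exp (2 * integral {0..s} (kern R)))"
      using integral_unique[OF kern_weight[OF x, of R]] unfolding Q_def by (simp only: add_0)
  qed (use x in \<open>auto simp: R_def kern_nonneg\<close>)
  then have "cmod (d x) + cmod (d1 x) \<le> 0" by simp
  then have "cmod (d x) = 0" "cmod (d1 x) = 0" using norm_ge_zero[of "d x"] norm_ge_zero[of "d1 x"] by linarith+
  then show "y x = w x" "y1 x = w1 x" by (auto simp: d_def d1_def)
qed

text \<open>Terms of the Neumann series: each is the Volterra operator applied to the previous one,
  starting from the initial values 0 and 1. The solution is therefore their sum, not their
  limit.\<close>

fun pic :: "nat \<Rightarrow> (complex \<Rightarrow> real \<Rightarrow> complex) \<times> (complex \<Rightarrow> real \<Rightarrow> complex)" where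
  "pic 0 = (\<lambda>z x. 0, \<lambda>z x. 1)"
| "pic (Suc n) = (\<lambda>z x. integral {0..x} (\<lambda>s. snd (pic n) z s + \<sigma> s * fst (pic n) z s),
                  \<lambda>z x. integral {0..x} (\<lambda>s. pot z s * fst (pic n) z s - \<sigma> s * snd (pic n) z s))"

lemma pic_polynomial: "polynomial_in (fst (pic n)) \<and> polynomial_in (snd (pic n))"
proof (induction n)
  case 0
  show ?case using polynomial_in.const[of "\<lambda>_. 0"] polynomial_in.const[of "\<lambda>_. 1"] by simp
next
  case (Suc n)
  define a b where "a = fst (pic n)" and "b = snd (pic n)"
  have a: "polynomial_in a" and b: "polynomial_in b" using Suc by (auto simp: a_def b_def)
  have one: "(\<lambda>_. 1 :: complex) absolutely_integrable_on {0..pi}" by (rule absolutely_integrable_on_const) simp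
  have I: "(\<lambda>s. g s * f z s) integrable_on {0..x}"
    if "x \<in> {0..pi}" "g absolutely_integrable_on {0..pi}" "polynomial_in f" for g f z x
    using that polynomial_in_continuous[OF that(3)]
    by (intro integrable_on_subinterval[OF set_lebesgue_integral_eq_integral(1)[OF absolutely_integrable_mult_continuous]]) auto
  have "polynomial_in (\<lambda>z x. integral {0..x} (\<lambda>s. b z s + \<sigma> s * a z s))"
  proof (rule polynomial_in.cong)
    show "polynomial_in (\<lambda>z x. integral {0..x} (\<lambda>s. 1 * b z s) + integral {0..x} (\<lambda>s. \<sigma> s * a z s))"
      by (intro polynomial_in.add polynomial_in_integral a b one \<sigma>_ai)
    fix z x assume "x \<in> {0..pi}"
    from I[OF this one b, of z] I[OF this \<sigma>_ai a, of z]
    show "integral {0..x} (\<lambda>s. b z s + \<sigma> s * a z s) = integral {0..x} (\<lambda>s. 1 * b z s) + integral {0..x} (\<lambda>s. \<sigma> s * a z s)"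
      by (subst integral_add[symmetric]) auto
  qed
  moreover have "polynomial_in (\<lambda>z x. integral {0..x} (\<lambda>s. pot z s * a z s - \<sigma> s * b z s))"
  proof (rule polynomial_in.cong)
    show "polynomial_in (\<lambda>z x. 2 * (z * integral {0..x} (\<lambda>s. p s * a z s)) + - (z * (z * integral {0..x} (\<lambda>s. 1 * a z s)))
        + - integral {0..x} (\<lambda>s. (\<sigma> s)\<^sup>2 * a z s) + - integral {0..x} (\<lambda>s. \<sigma> s * b z s))"
      by (intro polynomial_in.add polynomial_in_minus polynomial_in.mult polynomial_in_scale polynomial_in_integral a b one \<sigma>_ai p_ai \<sigma>2_ai)
    fix z x assume x: "x \<in> {0..pi}"
    note i = I[OF x p_ai a, of z] I[OF x one a, of z] I[OF x \<sigma>2_ai a, of z] I[OF x \<sigma>_ai b, of z]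
    have "((\<lambda>s. 2 * z * (p s * a z s) - z * z * (1 * a z s) - (\<sigma> s)\<^sup>2 * a z s - \<sigma> s * b z s) has_integral
       (2 * z * integral {0..x} (\<lambda>s. p s * a z s) - z * z * integral {0..x} (\<lambda>s. 1 * a z s)
        - integral {0..x} (\<lambda>s. (\<sigma> s)\<^sup>2 * a z s) - integral {0..x} (\<lambda>s. \<sigma> s * b z s))) {0..x}"
      by (intro has_integral_diff has_integral_mult_right integrable_integral i)
    from integral_unique[OF this]
    show "integral {0..x} (\<lambda>s. pot z s * a z s - \<sigma> s * b z s) =
        2 * (z * integral {0..x} (\<lambda>s. p s * a z s)) + - (z * (z * integral {0..x} (\<lambda>s. 1 * a z s)))
        + - integral {0..x} (\<lambda>s. (\<sigma> s)\<^sup>2 * a z s) + - integral {0..x} (\<lambda>s. \<sigma> s * b z s)"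
      by (simp add: pot_def algebra_simps power2_eq_square)
  qed
  ultimately show ?case by (simp add: a_def b_def)
qed

lemmas pic_continuous =
  polynomial_in_continuous[OF conjunct1[OF pic_polynomial]] polynomial_in_continuous[OF conjunct2[OF pic_polynomial]]

lemma pic_bound:
  assumes "cmod z \<le> R" "x \<in> {0..pi}"
  shows "cmod (fst (pic n) z x) + cmod (snd (pic n) z x) \<le> (1/2)^n * exp (2 * Q R x)"
  using assms(2)
proof (induction n arbitrary: x)
  case 0
  have "0 \<le> R" using assms norm_ge_zero order.trans by blast
  then show ?case using Q_nonneg[OF _ 0] by simp
next
  case (Suc n)
  have "cmod (fst (pic (Suc n)) z x) + cmod (snd (pic (Suc n)) z x) \<le> (1/2)^n * ((exp (2 * Q R x) - 1) / 2)"
    unfolding pic.simps fst_conv snd_conv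
    by (rule volterra_bound[OF assms(1) Suc.prems]) (use Suc in \<open>auto intro!: pic_continuous\<close>)
  also have "\<dots> \<le> (1/2)^Suc n * exp (2 * Q R x)" by (simp add: field_simps)
  finally show ?case .
qed

definition Y :: "complex \<Rightarrow> real \<Rightarrow> complex" where "Y z x = (\<Sum>n. fst (pic n) z x)"
definition Y1 :: "complex \<Rightarrow> real \<Rightarrow> complex" where "Y1 z x = (\<Sum>n. snd (pic n) z x)"

lemma pic_bound':
  assumes "cmod z \<le> R" "x \<in> {0..pi}"
  shows "cmod (fst (pic n) z x) \<le> (1/2)^n * exp (2 * Q R pi)" "cmod (snd (pic n) z x) \<le> (1/2)^n * exp (2 * Q R pi)"
proof -
  have "0 \<le> R" using assms norm_ge_zero order.trans by blast
  then have "(1/2)^n * exp (2 * Q R x) \<le> (1/2)^n * exp (2 * Q R pi)" using Q_mono[OF _ assms(2)] by simp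
  then show "cmod (fst (pic n) z x) \<le> (1/2)^n * exp (2 * Q R pi)" "cmod (snd (pic n) z x) \<le> (1/2)^n * exp (2 * Q R pi)"
    using pic_bound[OF assms, of n] norm_ge_zero[of "fst (pic n) z x"] norm_ge_zero[of "snd (pic n) z x"] by linarith+
qed

lemma pic_uniform:
  "uniform_limit ({z. cmod z \<le> R} \<times> {0..pi}) (\<lambda>N (z, x). \<Sum>n<N. fst (pic n) z x) (\<lambda>(z, x). Y z x) sequentially"
  "uniform_limit ({z. cmod z \<le> R} \<times> {0..pi}) (\<lambda>N (z, x). \<Sum>n<N. snd (pic n) z x) (\<lambda>(z, x). Y1 z x) sequentially"
proof -
  have s: "summable (\<lambda>n. (1/2)^n * exp (2 * Q R pi))" by (intro summable_mult2 summable_geometric) simp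
  have "uniform_limit ({z. cmod z \<le> R} \<times> {0..pi}) (\<lambda>N zx. \<Sum>n<N. fst (pic n) (fst zx) (snd zx)) (\<lambda>zx. \<Sum>n. fst (pic n) (fst zx) (snd zx)) sequentially"
    by (rule Weierstrass_m_test[OF _ s]) (auto intro!: pic_bound')
  then show "uniform_limit ({z. cmod z \<le> R} \<times> {0..pi}) (\<lambda>N (z, x). \<Sum>n<N. fst (pic n) z x) (\<lambda>(z, x). Y z x) sequentially"
    by (simp add: Y_def case_prod_unfold)
  have "uniform_limit ({z. cmod z \<le> R} \<times> {0..pi}) (\<lambda>N zx. \<Sum>n<N. snd (pic n) (fst zx) (snd zx)) (\<lambda>zx. \<Sum>n. snd (pic n) (fst zx) (snd zx)) sequentially"
    by (rule Weierstrass_m_test[OF _ s]) (auto intro!: pic_bound')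
  then show "uniform_limit ({z. cmod z \<le> R} \<times> {0..pi}) (\<lambda>N (z, x). \<Sum>n<N. snd (pic n) z x) (\<lambda>(z, x). Y1 z x) sequentially"
    by (simp add: Y1_def case_prod_unfold)
qed

text \<open>Partial sums are polynomials in \<open>z\<close> and converge uniformly on bounded sets;
  near \<open>z\<close> the geometric bound is taken with \<open>R = cmod z + 1\<close>.\<close>

lemma Y_holomorphic:
  assumes "x \<in> {0..pi}"
  shows "(\<lambda>z. Y z x) holomorphic_on UNIV" "(\<lambda>z. Y1 z x) holomorphic_on UNIV"
proof -
  have sub: "(\<lambda>w. (w, x)) ` cball z 1 \<subseteq> {w. cmod w \<le> cmod z + 1} \<times> {0..pi}" for z
  proof (clarsimp simp: assms[simplified])
    fix w assume "dist z w \<le> 1"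
    then show "cmod w \<le> cmod z + 1" using norm_triangle_ineq2[of w z] by (simp add: dist_norm norm_minus_commute)
  qed
  have hol: "(\<lambda>z. G z x) holomorphic_on UNIV"
    if u: "\<And>R. uniform_limit ({z. cmod z \<le> R} \<times> {0..pi}) (\<lambda>N (z, x). \<Sum>n<N. g n z x) (\<lambda>(z, x). G z x) sequentially"
    and h: "\<And>n. polynomial_in (g n)" for g G
  proof (rule holomorphic_uniform_sequence[where f="\<lambda>N z. \<Sum>n<N. g n z x"])
    show "(\<lambda>z. \<Sum>n<N. g n z x) holomorphic_on UNIV" for N
      by (intro holomorphic_on_sum polynomial_in_holomorphic h assms)
    fix z :: complex
    have "uniform_limit (cball z 1) (\<lambda>N w. \<Sum>n<N. g n w x) (\<lambda>w. G w x) sequentially"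
      unfolding uniform_limit_iff
    proof (intro allI impI)
      fix e :: real assume "e > 0"
      from u[of "cmod z + 1", unfolded uniform_limit_iff, rule_format, OF this]
      show "\<forall>\<^sub>F N in sequentially. \<forall>w\<in>cball z 1. dist (\<Sum>n<N. g n w x) (G w x) < e"
        by eventually_elim (use sub[of z] in \<open>auto simp: image_subset_iff\<close>)
    qed
    then show "\<exists>d>0. cball z d \<subseteq> UNIV \<and> uniform_limit (cball z d) (\<lambda>N w. \<Sum>n<N. g n w x) (\<lambda>w. G w x) sequentially"
      by (intro exI[of _ 1]) auto
  qed auto
  show "(\<lambda>z. Y z x) holomorphic_on UNIV" "(\<lambda>z. Y1 z x) holomorphic_on UNIV"
    using hol[OF pic_uniform(1)] hol[OF pic_uniform(2)] pic_polynomial by auto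
qed

lemma Y_sol: "sol z (Y z) (Y1 z)" "Y z 0 = 0" "Y1 z 0 = 1"
proof -
  define R where "R = cmod z"
  have zx: "(z, x) \<in> {z. cmod z \<le> R} \<times> {0..pi}" if "x \<in> {0..pi}" for x using that by (simp add: R_def)
  have lim: "(\<lambda>N. \<Sum>n<N. fst (pic n) z x) \<longlonglongrightarrow> Y z x" "(\<lambda>N. \<Sum>n<N. snd (pic n) z x) \<longlonglongrightarrow> Y1 z x" if "x \<in> {0..pi}" for x
    using tendsto_uniform_limitI[OF pic_uniform(1) zx[OF that]] tendsto_uniform_limitI[OF pic_uniform(2) zx[OF that]] by auto
  have cY: "continuous_on {0..pi} (Y z)" "continuous_on {0..pi} (Y1 z)"
  proof -
    have sub: "(\<lambda>x. (z, x)) ` {0..pi} \<subseteq> {z. cmod z \<le> R} \<times> {0..pi}" by (auto simp: R_def)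
    have *: "continuous_on {0..pi} (G z)"
      if u: "uniform_limit ({z. cmod z \<le> R} \<times> {0..pi}) (\<lambda>N (z, x). \<Sum>n<N. g n z x) (\<lambda>(z, x). G z x) sequentially"
      and g: "\<And>n. continuous_on {0..pi} (g n z)"
      for g :: "nat \<Rightarrow> complex \<Rightarrow> real \<Rightarrow> complex" and G
    proof (rule uniform_limit_theorem[where f="\<lambda>N x. \<Sum>n<N. g n z x" and F=sequentially])
      show "uniform_limit {0..pi} (\<lambda>N x. \<Sum>n<N. g n z x) (G z) sequentially"
        unfolding uniform_limit_iff
      proof (intro allI impI)
        fix e :: real assume "e > 0"
        from u[unfolded uniform_limit_iff, rule_format, OF this]
        show "\<forall>\<^sub>F N in sequentially. \<forall>x\<in>{0..pi}. dist (\<Sum>n<N. g n z x) (G z x) < e"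
          by eventually_elim (use sub in \<open>auto simp: image_subset_iff\<close>)
      qed
      show "\<forall>\<^sub>F N in sequentially. continuous_on {0..pi} (\<lambda>x. \<Sum>n<N. g n z x)"
        by (intro always_eventually allI continuous_on_sum) (rule g)
    qed simp
    show "continuous_on {0..pi} (Y z)" "continuous_on {0..pi} (Y1 z)"
      using *[OF pic_uniform(1)] *[OF pic_uniform(2)] pic_continuous by auto
  qed
  \<comment> \<open>Each of the two partial sums is at most \<open>2 * exp (2 * Q R pi)\<close>, so
    4 times the exponential bounds them together. \<open>h\<close> then dominates the integrands
    uniformly in \<open>N\<close>.\<close>
  define h where "h = (\<lambda>x. kern R x * (4 * exp (2 * Q R pi)))"
  have hI: "h integrable_on {0..x}" if "x \<in> {0..pi}" for x
    unfolding h_def using that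
    by (intro integrable_on_mult_left integrable_on_subinterval[OF set_lebesgue_integral_eq_integral(1)[OF kern_ai]]) auto
  have R0: "0 \<le> R" by (simp add: R_def)
  have partial: "cmod (\<Sum>n<N. g n) \<le> 2 * E" if "\<And>n. cmod (g n) \<le> (1/2)^n * E" "0 \<le> E" for g :: "nat \<Rightarrow> complex" and E N
  proof -
    have "cmod (\<Sum>n<N. g n) \<le> (\<Sum>n<N. (1/2)^n * E)" by (intro sum_norm_le that)
    also have "\<dots> = (\<Sum>n<N. (1/2)^n) * E" by (simp add: sum_distrib_right)
    also have "(\<Sum>n<N. (1/2::real)^n) \<le> 2" by (subst sum_gp_strict) (simp add: field_simps)
    finally show ?thesis using that(2) by (simp add: mult_right_mono)
  qed
  define a b where "a N x = (\<Sum>n<N. fst (pic n) z x)" and "b N x = (\<Sum>n<N. snd (pic n) z x)" for N x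
  have ca: "continuous_on {0..pi} (a N)" "continuous_on {0..pi} (b N)" for N
    unfolding a_def[abs_def] b_def[abs_def] by (intro continuous_intros pic_continuous)+
  have dom: "cmod (b N x + \<sigma> x * a N x) \<le> h x" "cmod (pot z x * a N x - \<sigma> x * b N x) \<le> h x" if "x \<in> {0..pi}" for N x
  proof -
    have "cmod (a N x) \<le> 2 * exp (2 * Q R pi)" "cmod (b N x) \<le> 2 * exp (2 * Q R pi)"
      unfolding a_def b_def using that by (auto intro!: partial pic_bound' simp: R_def)
    then have "kern R x * (cmod (a N x) + cmod (b N x)) \<le> h x"
      unfolding h_def using kern_nonneg[OF R0] by (intro mult_left_mono) auto
    then show "cmod (b N x + \<sigma> x * a N x) \<le> h x" "cmod (pot z x * a N x - \<sigma> x * b N x) \<le> h x"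
      using kern_bound[of z R "b N x" x "a N x"] norm_ge_zero[of "b N x + \<sigma> x * a N x"]
        norm_ge_zero[of "pot z x * a N x - \<sigma> x * b N x"] unfolding R_def by linarith+
  qed
  have int: "(\<lambda>s. c s + \<sigma> s * d s) absolutely_integrable_on {0..pi}" "(\<lambda>s. pot z s * d s - \<sigma> s * c s) absolutely_integrable_on {0..pi}"
    if "continuous_on {0..pi} c" "continuous_on {0..pi} d" for c d
    using that
    by (auto intro: set_integral_add(1)[OF absolutely_integrable_continuous_real[OF that(1)] absolutely_integrable_mult_continuous[OF \<sigma>_ai that(2)]]
        set_integral_diff(1)[OF absolutely_integrable_mult_continuous[OF pot_ai that(2)] absolutely_integrable_mult_continuous[OF \<sigma>_ai that(1)]])
  have sub: "f integrable_on {0..x}" if "x \<in> {0..pi}" "f absolutely_integrable_on {0..pi}" for f :: "real \<Rightarrow> complex" and x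
    using that by (intro integrable_on_subinterval[OF set_lebesgue_integral_eq_integral(1)[OF that(2)]]) auto
  have rec: "a (Suc N) x = integral {0..x} (\<lambda>s. b N s + \<sigma> s * a N s)"
    "b (Suc N) x = 1 + integral {0..x} (\<lambda>s. pot z s * a N s - \<sigma> s * b N s)" if x: "x \<in> {0..pi}" for N x
  proof -
    have "a (Suc N) x = (\<Sum>n<N. integral {0..x} (\<lambda>s. snd (pic n) z s + \<sigma> s * fst (pic n) z s))"
      unfolding a_def by (subst sum.lessThan_Suc_shift) simp
    also have "\<dots> = integral {0..x} (\<lambda>s. \<Sum>n<N. snd (pic n) z s + \<sigma> s * fst (pic n) z s)"
      by (intro integral_sum[symmetric] sub x int pic_continuous) simp
    finally show "a (Suc N) x = integral {0..x} (\<lambda>s. b N s + \<sigma> s * a N s)"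
      by (simp add: a_def b_def sum.distrib sum_distrib_left)
    have "b (Suc N) x = 1 + (\<Sum>n<N. integral {0..x} (\<lambda>s. pot z s * fst (pic n) z s - \<sigma> s * snd (pic n) z s))"
      unfolding b_def by (subst sum.lessThan_Suc_shift) simp
    also have "(\<Sum>n<N. integral {0..x} (\<lambda>s. pot z s * fst (pic n) z s - \<sigma> s * snd (pic n) z s))
        = integral {0..x} (\<lambda>s. \<Sum>n<N. pot z s * fst (pic n) z s - \<sigma> s * snd (pic n) z s)"
      by (intro integral_sum[symmetric] sub x int pic_continuous) simp
    finally show "b (Suc N) x = 1 + integral {0..x} (\<lambda>s. pot z s * a N s - \<sigma> s * b N s)"
      by (simp add: a_def b_def sum_subtractf sum_distrib_left)
  qed
  have eq: "Y z x = integral {0..x} (\<lambda>s. Y1 z s + \<sigma> s * Y z s)"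
    "Y1 z x = 1 + integral {0..x} (\<lambda>s. pot z s * Y z s - \<sigma> s * Y1 z s)" if x: "x \<in> {0..pi}" for x
  proof -
    have limx: "(\<lambda>N. a N s) \<longlonglongrightarrow> Y z s" "(\<lambda>N. b N s) \<longlonglongrightarrow> Y1 z s" if "s \<in> {0..x}" for s
      using lim[of s] that x by (auto simp: a_def b_def)
    have "(\<lambda>N. integral {0..x} (\<lambda>s. b N s + \<sigma> s * a N s)) \<longlonglongrightarrow> integral {0..x} (\<lambda>s. Y1 z s + \<sigma> s * Y z s)"
      by (rule dominated_convergence(2)[OF sub[OF x int(1)[OF ca(2) ca(1)]] hI[OF x]])
        (use x dom in \<open>auto intro!: tendsto_intros limx\<close>)
    moreover have "(\<lambda>N. a (Suc N) x) \<longlonglongrightarrow> Y z x" using limx(1)[of x] x by (intro LIMSEQ_Suc) auto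
    ultimately show "Y z x = integral {0..x} (\<lambda>s. Y1 z s + \<sigma> s * Y z s)"
      using rec(1)[OF x] LIMSEQ_unique by simp
    have "(\<lambda>N. 1 + integral {0..x} (\<lambda>s. pot z s * a N s - \<sigma> s * b N s)) \<longlonglongrightarrow> 1 + integral {0..x} (\<lambda>s. pot z s * Y z s - \<sigma> s * Y1 z s)"
      by (intro tendsto_add tendsto_const dominated_convergence(2)[OF sub[OF x int(2)[OF ca(2) ca(1)]] hI[OF x]])
        (use x dom in \<open>auto intro!: tendsto_intros limx\<close>)
    moreover have "(\<lambda>N. b (Suc N) x) \<longlonglongrightarrow> Y1 z x" using limx(2)[of x] x by (intro LIMSEQ_Suc) auto
    ultimately show "Y1 z x = 1 + integral {0..x} (\<lambda>s. pot z s * Y z s - \<sigma> s * Y1 z s)"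
      using rec(2)[OF x] LIMSEQ_unique by simp
  qed
  show "Y z 0 = 0" "Y1 z 0 = 1" using eq[of 0] by auto
  then show "sol z (Y z) (Y1 z)"
    unfolding sol_def using eq by (auto intro!: has_densityI int cY)
qed

text \<open>\<open>S_pair\<close> is an arbitrary choice: existence makes it a solution, and
  uniqueness identifies it with the Picard solution on [0, pi].\<close>

lemma S_pair_eq:
  assumes "x \<in> {0..pi}"
  shows "fst (S_pair p \<sigma> z) x = Y z x" "snd (S_pair p \<sigma> z) x = Y1 z x"
proof -
  define P where "P = (\<lambda>(y, y1). is_solution p \<sigma> z y y1 \<and> y 0 = 0 \<and> y1 0 = 1)"
  have "P (Y z, Y1 z)" using Y_sol sol_imp_is_solution by (auto simp: P_def)
  then have "P (S_pair p \<sigma> z)" unfolding S_pair_def P_def[symmetric] by (rule someI)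
  then have "is_solution p \<sigma> z (fst (S_pair p \<sigma> z)) (snd (S_pair p \<sigma> z))"
    "fst (S_pair p \<sigma> z) 0 = 0" "snd (S_pair p \<sigma> z) 0 = 1" by (auto simp: P_def case_prod_unfold)
  from sol_unique[OF is_solution_imp_sol[OF this(1)] Y_sol(1)] this(2,3) Y_sol(2,3) assms
  show "fst (S_pair p \<sigma> z) x = Y z x" "snd (S_pair p \<sigma> z) x = Y1 z x" by auto
qed

end

section \<open>Dependence on the spectral parameter\<close>

lemma has_density_mult_const: "has_density a b (\<lambda>x. c * of_real x) (\<lambda>x. c)" for c :: complex
proof (rule has_densityI)
  show "(\<lambda>x. c) absolutely_integrable_on {a..b}" by (rule absolutely_integrable_on_const) simp
  show "c * of_real x = c * of_real a + integral {a..x} (\<lambda>x. c)" if "x \<in> {a..b}" for x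
    using that by (simp add: scaleR_conv_of_real algebra_simps)
qed

text \<open>Integrates \<open>g f \<le> N / (2 G) g^2 + G / (2 N) f^2\<close>. Upper bounds
  \<open>G\<close>, \<open>N\<close> for the norms and a majorant \<open>h\<close> of
  \<open>g^2\<close> are carried along in place of the norms themselves.\<close>

lemma integral_Cauchy_Schwarz_le:
  fixes g h f :: "real \<Rightarrow> real"
  assumes "(\<lambda>s. g s * f s) integrable_on S" "h integrable_on S" "(\<lambda>s. (f s)\<^sup>2) integrable_on S"
    and gh: "\<And>s. s \<in> S \<Longrightarrow> (g s)\<^sup>2 \<le> h s"
    and "integral S h \<le> G\<^sup>2" "integral S (\<lambda>s. (f s)\<^sup>2) \<le> N\<^sup>2" and G: "0 < G" and N: "0 < N"
  shows "integral S (\<lambda>s. g s * f s) \<le> G * N"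
proof -
  have "integral S (\<lambda>s. g s * f s) \<le> integral S (\<lambda>s. N / (2 * G) * h s + G / (2 * N) * (f s)\<^sup>2)"
  proof (rule integral_le)
    show "(\<lambda>s. N / (2 * G) * h s + G / (2 * N) * (f s)\<^sup>2) integrable_on S"
      by (intro integrable_add integrable_on_mult_right assms)
    fix s assume s: "s \<in> S"
    have "0 \<le> (N * g s - G * f s)\<^sup>2" by simp
    then have "2 * (N * G) * (g s * f s) \<le> N\<^sup>2 * (g s)\<^sup>2 + G\<^sup>2 * (f s)\<^sup>2"
      by (simp add: power2_diff power_mult_distrib algebra_simps)
    also have "\<dots> \<le> N\<^sup>2 * h s + G\<^sup>2 * (f s)\<^sup>2" using gh[OF s] by (simp add: mult_left_mono)
    finally have "g s * f s \<le> (N\<^sup>2 * h s + G\<^sup>2 * (f s)\<^sup>2) / (2 * (N * G))"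
      using G N by (simp add: pos_le_divide_eq mult.commute)
    also have "\<dots> = N / (2 * G) * h s + G / (2 * N) * (f s)\<^sup>2"
      using G N by (simp add: field_simps power2_eq_square)
    finally show "g s * f s \<le> N / (2 * G) * h s + G / (2 * N) * (f s)\<^sup>2" .
  qed (rule assms)
  also have "\<dots> = N / (2 * G) * integral S h + G / (2 * N) * integral S (\<lambda>s. (f s)\<^sup>2)"
    using assms by (subst integral_add) (auto intro: integrable_on_mult_right)
  also have "\<dots> \<le> N / (2 * G) * G\<^sup>2 + G / (2 * N) * N\<^sup>2"
    using assms by (intro add_mono mult_left_mono) auto
  also have "\<dots> = G * N" using G N by (simp add: field_simps power2_eq_square)
  finally show ?thesis .
qed

context pencil
begin

text \<open>\<open>U\<close> and \<open>W\<close> diagonalize the leading part of the system: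
  \<open>U' = \<i> (z - p) U + ...\<close> and \<open>W' = - \<i> (z - p) W + ...\<close>. The
  contribution of \<open>p\<close> to the diagonal does not decay as \<open>z\<close> grows, so its
  integral enters the main exponentials as the phase \<open>ph\<close>; \<open>\<kappa>u\<close> and
  \<open>\<kappa>w\<close> are what remains.\<close>

definition ph :: "real \<Rightarrow> complex" where "ph x = \<i> * integral {0..x} p"
definition U :: "complex \<Rightarrow> real \<Rightarrow> complex" where "U z x = Y1 z x + \<i> * z * Y z x"
definition W :: "complex \<Rightarrow> real \<Rightarrow> complex" where "W z x = Y1 z x - \<i> * z * Y z x"
definition \<kappa>u :: "complex \<Rightarrow> real \<Rightarrow> complex" where "\<kappa>u z x = U z x - exp (\<i> * z * of_real x - ph x)"
definition \<kappa>w :: "complex \<Rightarrow> real \<Rightarrow> complex" where "\<kappa>w z x = W z x - exp (ph x - \<i> * z * of_real x)"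

lemma density_Y: "has_density 0 pi (Y z) (\<lambda>x. Y1 z x + \<sigma> x * Y z x)"
  and density_Y1: "has_density 0 pi (Y1 z) (\<lambda>x. pot z x * Y z x - \<sigma> x * Y1 z x)"
  using Y_sol(1)[of z] by (auto simp: sol_def)

lemma density_U:
  "has_density 0 pi (U z) (\<lambda>s. \<i> * (z - p s) * U z s + (\<i> * p s - \<sigma> s) * W z s - (\<sigma> s)\<^sup>2 * Y z s)"
proof -
  have "has_density 0 pi (\<lambda>x. Y1 z x + \<i> * z * Y z x) (\<lambda>x. pot z x * Y z x - \<sigma> x * Y1 z x + \<i> * z * (Y1 z x + \<sigma> x * Y z x))"
    by (intro has_density_add density_Y1 has_density_linear[OF density_Y] bounded_linear_mult_right)
  then have "has_density 0 pi (U z) (\<lambda>x. pot z x * Y z x - \<sigma> x * Y1 z x + \<i> * z * (Y1 z x + \<sigma> x * Y z x))"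
    by (simp add: U_def[abs_def])
  then show ?thesis
    by (rule has_density_cong[OF _ negligible_empty]) (simp add: pot_def U_def W_def algebra_simps power2_eq_square)
qed

lemma density_W:
  "has_density 0 pi (W z) (\<lambda>s. \<i> * (p s - z) * W z s - (\<i> * p s + \<sigma> s) * U z s - (\<sigma> s)\<^sup>2 * Y z s)"
proof -
  have "has_density 0 pi (\<lambda>x. Y1 z x - \<i> * z * Y z x) (\<lambda>x. pot z x * Y z x - \<sigma> x * Y1 z x - \<i> * z * (Y1 z x + \<sigma> x * Y z x))"
    by (intro has_density_diff density_Y1 has_density_linear[OF density_Y] bounded_linear_mult_right)
  then have "has_density 0 pi (W z) (\<lambda>x. pot z x * Y z x - \<sigma> x * Y1 z x - \<i> * z * (Y1 z x + \<sigma> x * Y z x))"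
    by (simp add: W_def[abs_def])
  then show ?thesis
    by (rule has_density_cong[OF _ negligible_empty]) (simp add: pot_def U_def W_def algebra_simps power2_eq_square)
qed

lemma UW_0: "U z 0 = 1" "W z 0 = 1" "ph 0 = 0"
  by (simp_all add: U_def W_def Y_sol ph_def)

lemma density_ph: "has_density 0 pi ph (\<lambda>x. \<i> * p x)"
proof -
  have "has_density 0 pi (\<lambda>x. integral {0..x} p) p" using has_density_integral[OF p_ai, of 0] by simp
  from has_density_linear[OF this bounded_linear_mult_right, of "\<i>"] show ?thesis by (simp add: ph_def[abs_def])
qed

lemmas Y_cont = has_density_continuous[OF density_Y] and Y1_cont = has_density_continuous[OF density_Y1]
  and U_cont = has_density_continuous[OF density_U] and W_cont = has_density_continuous[OF density_W]
  and ph_cont = has_density_continuous[OF density_ph]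

lemma \<kappa>_cont: "continuous_on {0..pi} (\<kappa>u z)" "continuous_on {0..pi} (\<kappa>w z)"
  unfolding \<kappa>u_def[abs_def] \<kappa>w_def[abs_def] by (intro continuous_intros U_cont W_cont ph_cont)+

text \<open>Variation of constants with the integrating factor \<open>exp (f s)\<close>: its product
  with \<open>v\<close> has density \<open>exp (f s) * g s\<close>.\<close>

lemma duhamel:
  fixes f v F g :: "real \<Rightarrow> complex"
  assumes x: "x \<in> {0..pi}" and f: "has_density 0 pi f (\<lambda>s. F s)" and f0: "f 0 = 0"
    and v: "has_density 0 pi v (\<lambda>s. - F s * v s + g s)" and v0: "v 0 = 1"
  shows "v x - exp (- f x) = integral {0..x} (\<lambda>s. exp (f s - f x) * g s)"
proof -
  have "has_density 0 pi (\<lambda>s. exp (f s) * v s) (\<lambda>s. F s * exp (f s) * v s + exp (f s) * (- F s * v s + g s))"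
    by (rule has_density_mult[OF pi_ge_zero has_density_exp[OF pi_ge_zero f] v])
  then have "has_density 0 pi (\<lambda>s. exp (f s) * v s) (\<lambda>s. exp (f s) * g s)"
    by (rule has_density_cong[OF _ negligible_empty]) (simp add: algebra_simps)
  from has_density_eq[OF this x] have "exp (f x) * v x = 1 + integral {0..x} (\<lambda>s. exp (f s) * g s)"
    using f0 v0 by simp
  then have "exp (- f x) * (exp (f x) * v x) = exp (- f x) * (1 + integral {0..x} (\<lambda>s. exp (f s) * g s))" by simp
  then have "v x = exp (- f x) + exp (- f x) * integral {0..x} (\<lambda>s. exp (f s) * g s)"
    by (simp add: distrib_left mult.assoc[symmetric] flip: exp_add)
  also have "exp (- f x) * integral {0..x} (\<lambda>s. exp (f s) * g s) = integral {0..x} (\<lambda>s. exp (- f x) * (exp (f s) * g s))"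
    by (rule integral_mult_right[symmetric])
  also have "\<dots> = integral {0..x} (\<lambda>s. exp (f s - f x) * g s)"
    by (simp add: mult.assoc[symmetric] flip: exp_add)
  finally show ?thesis by simp
qed

text \<open>Variation of constants for \<open>U\<close>, with \<open>W\<close> in the integrand
  split into its main exponential, which acts as a source term, and \<open>\<kappa>w\<close>.
  Outside the exponentials no factor \<open>z\<close> remains, only the fixed coefficients
  \<open>p\<close>, \<open>\<sigma>\<close> and \<open>\<sigma>^2\<close>.\<close>

lemma \<kappa>u_eq:
  assumes x: "x \<in> {0..pi}"
  shows "\<kappa>u z x = integral {0..x} (\<lambda>s. exp (ph s - ph x + \<i> * z * of_real (x - s)) *
           ((\<i> * p s - \<sigma> s) * (exp (ph s - \<i> * z * of_real s) + \<kappa>w z s) - (\<sigma> s)\<^sup>2 * Y z s))"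
proof -
  define f where "f x = ph x - \<i> * z * of_real x" for x
  have f: "has_density 0 pi f (\<lambda>x. \<i> * p x - \<i> * z)"
    unfolding f_def by (intro has_density_diff density_ph has_density_mult_const)
  have v: "has_density 0 pi (U z) (\<lambda>s. - (\<i> * p s - \<i> * z) * U z s + ((\<i> * p s - \<sigma> s) * W z s - (\<sigma> s)\<^sup>2 * Y z s))"
    by (rule has_density_cong[OF density_U negligible_empty]) (simp add: algebra_simps)
  from duhamel[OF x f _ v] have "U z x - exp (- f x) = integral {0..x} (\<lambda>s. exp (f s - f x) * ((\<i> * p s - \<sigma> s) * W z s - (\<sigma> s)\<^sup>2 * Y z s))"
    by (simp add: f_def UW_0)
  then show ?thesis by (simp add: f_def \<kappa>u_def \<kappa>w_def algebra_simps)
qed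

lemma \<kappa>w_eq:
  assumes x: "x \<in> {0..pi}"
  shows "\<kappa>w z x = integral {0..x} (\<lambda>s. exp (ph x - ph s - \<i> * z * of_real (x - s)) *
           (- (\<i> * p s + \<sigma> s) * (exp (\<i> * z * of_real s - ph s) + \<kappa>u z s) - (\<sigma> s)\<^sup>2 * Y z s))"
proof -
  define f where "f x = \<i> * z * of_real x - ph x" for x
  have f: "has_density 0 pi f (\<lambda>x. \<i> * z - \<i> * p x)"
    unfolding f_def by (intro has_density_diff density_ph has_density_mult_const)
  have v: "has_density 0 pi (W z) (\<lambda>s. - (\<i> * z - \<i> * p s) * W z s + (- (\<i> * p s + \<sigma> s) * U z s - (\<sigma> s)\<^sup>2 * Y z s))"
    by (rule has_density_cong[OF density_W negligible_empty]) (simp add: algebra_simps)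
  from duhamel[OF x f _ v] have "W z x - exp (- f x) = integral {0..x} (\<lambda>s. exp (f s - f x) * (- (\<i> * p s + \<sigma> s) * U z s - (\<sigma> s)\<^sup>2 * Y z s))"
    by (simp add: f_def UW_0)
  then show ?thesis by (simp add: f_def \<kappa>u_def \<kappa>w_def algebra_simps)
qed

lemma Y_eq:
  assumes x: "x \<in> {0..pi}"
  shows "Y z x = integral {0..x} (\<lambda>s. (exp (\<i> * z * of_real s - ph s) + \<kappa>u z s + (exp (ph s - \<i> * z * of_real s) + \<kappa>w z s)) / 2 + \<sigma> s * Y z s)"
proof -
  have "Y z x = integral {0..x} (\<lambda>s. Y1 z s + \<sigma> s * Y z s)"
    using has_density_eq[OF density_Y x, of z] Y_sol(2)[of z] by simp
  also have "(\<lambda>s. Y1 z s + \<sigma> s * Y z s) = (\<lambda>s. (exp (\<i> * z * of_real s - ph s) + \<kappa>u z s + (exp (ph s - \<i> * z * of_real s) + \<kappa>w z s)) / 2 + \<sigma> s * Y z s)"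
    by (simp add: fun_eq_iff \<kappa>u_def \<kappa>w_def U_def W_def field_simps)
  finally show ?thesis .
qed

definition tot :: "real \<Rightarrow> real" where "tot s = 1 + cmod (p s) + 2 * cmod (\<sigma> s) + (cmod (\<sigma> s))\<^sup>2"

lemma tot_ai: "tot absolutely_integrable_on {0..pi}"
proof -
  have "(\<lambda>x. (cmod (\<sigma> x))\<^sup>2) absolutely_integrable_on {0..pi}"
    using set_integrable_norm[OF \<sigma>2_ai] by (simp add: norm_power)
  then show ?thesis unfolding tot_def[abs_def]
    by (intro set_integral_add(1) set_integrable_mult_right set_integrable_norm p_ai \<sigma>_ai absolutely_integrable_on_const) auto
qed

lemma ph_bound: obtains e0 where "1 \<le> e0" "\<And>s t. s \<in> {0..pi} \<Longrightarrow> t \<in> {0..pi} \<Longrightarrow> cmod (exp (ph s - ph t)) \<le> e0"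
   "\<And>s. s \<in> {0..pi} \<Longrightarrow> cmod (exp (ph s)) \<le> e0" "\<And>s. s \<in> {0..pi} \<Longrightarrow> cmod (exp (- ph s)) \<le> e0"
proof -
  obtain M where M: "M > 0" "\<And>x. x \<in> {0..pi} \<Longrightarrow> norm (ph x) \<le> M" using has_density_bounded[OF density_ph] by blast
  have e: "cmod (exp w) \<le> exp (2 * M)" if "cmod w \<le> 2 * M" for w
    using norm_exp[of w] that by (auto intro: order.trans)
  show ?thesis
  proof (rule that[of "exp (2 * M)"])
    show "1 \<le> exp (2 * M)" using M(1) by simp
    show "cmod (exp (ph s - ph t)) \<le> exp (2 * M)" if "s \<in> {0..pi}" "t \<in> {0..pi}" for s t
      using M(2)[OF that(1)] M(2)[OF that(2)] norm_triangle_ineq4[of "ph s" "ph t"] by (intro e) linarith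
    show "cmod (exp (ph s)) \<le> exp (2 * M)" "cmod (exp (- ph s)) \<le> exp (2 * M)" if "s \<in> {0..pi}" for s
    proof -
      have "cmod (ph s) \<le> 2 * M" "cmod (- ph s) \<le> 2 * M" using M(1) M(2)[OF that] by auto
      then show "cmod (exp (ph s)) \<le> exp (2 * M)" "cmod (exp (- ph s)) \<le> exp (2 * M)" by (blast intro: e)+
    qed
  qed
qed

end

text \<open>Substitution along the segment from \<open>a\<close> to \<open>a + c * x\<close>, in
  either direction; the Jacobian is at most 1 since \<open>\<bar>c\<bar>\<close> is at least 1. The
  segments will be pieces of characteristics.\<close>

lemma reflected_integral_bound:
  fixes f :: "real \<Rightarrow> real"
  assumes f: "continuous_on UNIV f" and f0: "\<And>t. 0 \<le> f t" and c: "c \<noteq> 0" "1 \<le> \<bar>c\<bar>"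
    and x: "0 \<le> x" and in1: "-pi \<le> a" "a \<le> pi" "-pi \<le> a + c * x" "a + c * x \<le> pi"
    and N: "integral {-pi..pi} f \<le> N"
  shows "integral {0..x} (\<lambda>s. f (a + c * s)) \<le> N"
proof -
  define l u where "l = min a (a + c * x)" and "u = max a (a + c * x)"
  have fi: "f integrable_on {l..u}" "f integrable_on {-pi..pi}"
    using f by (auto intro!: integrable_continuous_real continuous_on_subset[OF f])
  have "((\<lambda>s. f (c * s + a)) has_integral (1 / \<bar>c\<bar>) *\<^sub>R integral {l..u} f) ((\<lambda>t. (1 / c) *\<^sub>R t + - ((1 / c) *\<^sub>R a)) ` cbox l u)"
    using has_integral_affinity[OF integrable_integral[OF fi(1)[folded cbox_interval]] c(1), of a]
    by (simp add: cbox_interval)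
  moreover have "(\<lambda>t. (1 / c) *\<^sub>R t + - ((1 / c) *\<^sub>R a)) ` cbox l u = {0..x}"
  proof (cases "c > 0")
    case True
    then have "l = a" "u = a + c * x" using x by (auto simp: l_def u_def)
    then show ?thesis using True x
      by (subst image_affinity_cbox) (auto simp: field_simps cbox_interval)
  next
    case False
    then have cn: "c < 0" using c(1) by simp
    then have "l = a + c * x" "u = a" using mult_nonpos_nonneg[OF less_imp_le[OF cn] x] by (auto simp: l_def u_def)
    then show ?thesis using cn x
      by (subst image_affinity_cbox) (auto simp: field_simps cbox_interval mult_le_0_iff)
  qed
  ultimately have "integral {0..x} (\<lambda>s. f (a + c * s)) = (1 / \<bar>c\<bar>) * integral {l..u} f"
    by (simp add: integral_unique add.commute)
  also have "\<dots> \<le> 1 * integral {l..u} f"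
    using c(2) by (intro mult_right_mono integral_nonneg fi f0) auto
  also have "integral {l..u} f \<le> integral {-pi..pi} f"
    using in1 f0 by (intro integral_subset_le fi) (auto simp: l_def u_def)
  finally show ?thesis using N by simp
qed

context pencil
begin

text \<open>In the application \<open>T = exp (\<i> \<mu> \<tau>)\<close>, \<open>M\<close> is the
  Duhamel kernel and \<open>E\<close> the source exponential. The hypotheses say how products of
  exponentials merge: \<open>X\<close> and \<open>Z\<close> are exponentials of \<open>\<mu>\<close>
  at shifted values of \<open>\<tau>\<close>, while \<open>P\<close> and \<open>R\<close> contain
  only the phase.\<close>

lemma transport_identity:
  assumes "T * M * E = P * (R * X)" "T * M = P * Z"
  shows "c * T * (M * (g * (E + k) - s * y)) = P * (g * (R * (c * X) + c * Z * k) - s * (c * Z * y :: complex))"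
proof -
  have "c * T * (M * (g * (E + k) - s * y)) = c * g * (T * M * E) + c * g * k * (T * M) - c * s * y * (T * M)"
    by (simp add: algebra_simps)
  then show ?thesis unfolding assms(1) unfolding assms(2) by (simp add: algebra_simps)
qed

lemma transport_identity':
  assumes "T * A = P * X" "T * B = P' * X'"
  shows "c * T * ((A + k + (B + k')) / 2 + s * y) = (P * (c * X) + c * T * k + (P' * (c * X') + c * T * k')) / 2 + s * (c * T * y :: complex)"
proof -
  have "c * T * ((A + k + (B + k')) / 2 + s * y) = (c * (T * A) + c * T * k + (c * (T * B) + c * T * k')) / 2 + s * (c * T * y)"
    by (simp add: field_simps)
  then show ?thesis unfolding assms by (simp add: mult_ac)
qed

text \<open>Multiplying the equations for \<open>\<kappa>u\<close>, \<open>\<kappa>w\<close>, \<open>Y\<close> by \<open>exp (\<i> \<mu> \<tau>)\<close> and summing over the spectral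
  parameters gives a hyperbolic system in \<open>(x, \<tau>)\<close> with characteristics \<open>\<tau> \<plusminus> x = const\<close>; the bound
  is the estimate of its solution in the triangle \<open>\<bar>\<tau>\<bar> \<le> \<pi> - x\<close>.\<close>

theorem \<kappa>_functional_bound:
  "\<exists>C>0. \<forall>(F::'i set) c \<mu> N. finite F \<and> 0 < N \<and>
     integral {-pi..pi} (\<lambda>t. (cmod (\<Sum>j\<in>F. c j * exp (\<i> * \<mu> j * of_real t)))\<^sup>2) \<le> N\<^sup>2 \<longrightarrow>
     cmod (\<Sum>j\<in>F. c j * \<kappa>u (\<mu> j) pi) \<le> C * N \<and> cmod (\<Sum>j\<in>F. c j * \<kappa>w (\<mu> j) pi) \<le> C * N"
proof -
  obtain e0 where e0: "1 \<le> e0" "\<And>s t. s \<in> {0..pi} \<Longrightarrow> t \<in> {0..pi} \<Longrightarrow> cmod (exp (ph s - ph t)) \<le> e0"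
    "\<And>s. s \<in> {0..pi} \<Longrightarrow> cmod (exp (ph s)) \<le> e0" "\<And>s. s \<in> {0..pi} \<Longrightarrow> cmod (exp (- ph s)) \<le> e0"
    using ph_bound by blast
  define k where "k s = e0 * tot s" for s
  have k_ai: "k absolutely_integrable_on {0..pi}" unfolding k_def by (rule set_integrable_mult_right[OF tot_ai])
  have tot0: "0 \<le> tot s" for s by (simp add: tot_def)
  have k0: "0 \<le> k s" for s using tot0 e0(1) by (simp add: k_def)
  define Qk where "Qk x = integral {0..x} k" for x
  \<comment> \<open>Majorant of \<open>(cmod p + cmod \<sigma>)^2\<close>; the summand 1 makes it
    dominate also the constant factor 1 in the source terms of the equation for
    \<open>Y\<close>.\<close>
  define h where "h s = 2 * (cmod (p s))\<^sup>2 + 2 * (cmod (\<sigma> s))\<^sup>2 + 1" for s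
  have p2_ai: "(\<lambda>x. (cmod (p x))\<^sup>2) absolutely_integrable_on {0..pi}"
    using set_integrable_norm[OF sq_integrable_absolutely_integrable(2)[OF p_sq]] by (simp add: norm_power)
  have \<sigma>2n_ai: "(\<lambda>x. (cmod (\<sigma> x))\<^sup>2) absolutely_integrable_on {0..pi}"
    using set_integrable_norm[OF \<sigma>2_ai] by (simp add: norm_power)
  have h_ai: "h absolutely_integrable_on {0..pi}"
    unfolding h_def[abs_def] by (intro set_integral_add(1) set_integrable_mult_right p2_ai \<sigma>2n_ai absolutely_integrable_on_const) auto
  have h0: "0 \<le> h s" for s by (simp add: h_def)
  define G where "G = sqrt (integral {0..pi} h + 1)"
  have hi0: "0 \<le> integral {0..pi} h"
    using h0 by (intro integral_nonneg set_lebesgue_integral_eq_integral(1)[OF h_ai]) auto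
  have G: "0 < G" "G\<^sup>2 = integral {0..pi} h + 1" using hi0 by (auto simp: G_def)
  define g where "g s = cmod (p s) + cmod (\<sigma> s)" for s
  have g_ai: "g absolutely_integrable_on {0..pi}"
    unfolding g_def[abs_def] by (intro set_integral_add(1) set_integrable_norm p_ai \<sigma>_ai)
  have gh: "(g s)\<^sup>2 \<le> h s" and oneh: "1 \<le> h s" for s
  proof -
    have "0 \<le> (cmod (p s) - cmod (\<sigma> s))\<^sup>2" by simp
    then show "(g s)\<^sup>2 \<le> h s" "1 \<le> h s" by (auto simp: g_def h_def power2_sum power2_diff)
  qed
  \<comment> \<open>The source terms of \<open>\<kappa>u\<close> and \<open>\<kappa>w\<close> carry
    two phase factors, one from the kernel and one from the exponential; the equation for
    \<open>Y\<close> has two source terms with one phase factor each.\<close>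
  define A0 where "A0 = e0 * e0 * G + e0 * G"
  have A0: "0 < A0" using e0(1) G(1) by (auto simp: A0_def intro!: add_pos_pos mult_pos_pos)
  define C where "C = 2 * A0 * exp (2 * Qk pi)"
  have "C > 0" using A0 by (simp add: C_def)
  moreover have "cmod (\<Sum>j\<in>F. c j * \<kappa>u (\<mu> j) pi) \<le> C * N \<and> cmod (\<Sum>j\<in>F. c j * \<kappa>w (\<mu> j) pi) \<le> C * N"
    if fin: "finite F" and N: "0 < N"
      and FN: "integral {-pi..pi} (\<lambda>t. (cmod (\<Sum>j\<in>F. c j * exp (\<i> * \<mu> j * of_real t)))\<^sup>2) \<le> N\<^sup>2"
    for F :: "'i set" and c \<mu> N
  proof -
    define \<phi> where "\<phi> t = (\<Sum>j\<in>F. c j * exp (\<i> * \<mu> j * of_real t))" for t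
    have \<phi>c: "continuous_on S \<phi>" for S unfolding \<phi>_def[abs_def] by (intro continuous_intros)
    define Ku where "Ku x \<tau> = (\<Sum>j\<in>F. c j * exp (\<i> * \<mu> j * of_real \<tau>) * \<kappa>u (\<mu> j) x)" for x \<tau>
    define Kw where "Kw x \<tau> = (\<Sum>j\<in>F. c j * exp (\<i> * \<mu> j * of_real \<tau>) * \<kappa>w (\<mu> j) x)" for x \<tau>
    define Ky where "Ky x \<tau> = (\<Sum>j\<in>F. c j * exp (\<i> * \<mu> j * of_real \<tau>) * Y (\<mu> j) x)" for x \<tau>
    \<comment> \<open>The three unknowns are numbered 0, 1, 2 and paired with \<open>\<tau>\<close>,
      so that one Gronwall family contains them all; its index set \<open>I x\<close> is the section
      of the triangle at \<open>x\<close>.\<close>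
    define \<Phi> where "\<Phi> x i = (if fst i = (0::nat) then cmod (Ku x (snd i)) else if fst i = 1 then cmod (Kw x (snd i)) else cmod (Ky x (snd i)))"
      for x i
    define I where "I x = {i :: nat \<times> real. \<bar>snd i\<bar> \<le> pi - x}" for x
    have sub: "f integrable_on {0..x}" if "x \<in> {0..pi}" "f absolutely_integrable_on {0..pi}" for f :: "real \<Rightarrow> 'b::euclidean_space" and x
      using that by (intro integrable_on_subinterval[OF set_lebesgue_integral_eq_integral(1)[OF that(2)]]) auto
    have shift: "integral {0..x} (\<lambda>s. (cmod (\<phi> (a + d * s)))\<^sup>2) \<le> N\<^sup>2"
      if "d \<noteq> 0" "1 \<le> \<bar>d\<bar>" "0 \<le> x" "-pi \<le> a" "a \<le> pi" "-pi \<le> a + d * x" "a + d * x \<le> pi" for a d x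
      using FN that by (intro reflected_integral_bound) (auto intro!: continuous_intros \<phi>c simp: \<phi>_def[symmetric])
    have CS: "integral {0..x} (\<lambda>s. f s * cmod (\<phi> (a + d * s))) \<le> G * N"
      if "x \<in> {0..pi}" "f absolutely_integrable_on {0..pi}" "\<And>s. (f s)\<^sup>2 \<le> h s"
        "d \<noteq> 0" "1 \<le> \<bar>d\<bar>" "-pi \<le> a" "a \<le> pi" "-pi \<le> a + d * x" "a + d * x \<le> pi" for f a d x
    proof (rule integral_Cauchy_Schwarz_le[where h=h])
      show "(\<lambda>s. f s * cmod (\<phi> (a + d * s))) integrable_on {0..x}"
        by (intro sub that absolutely_integrable_mult_continuous continuous_intros continuous_on_compose2[OF \<phi>c[of UNIV]]) auto
      show "h integrable_on {0..x}" by (intro sub that h_ai)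
      show "(\<lambda>s. (cmod (\<phi> (a + d * s)))\<^sup>2) integrable_on {0..x}"
        by (intro integrable_continuous_real continuous_intros continuous_on_compose2[OF \<phi>c[of UNIV]]) auto
      have "integral {0..x} h \<le> integral {0..pi} h"
        using that(1) h0 by (intro integral_subset_le sub h_ai) auto
      then show "integral {0..x} h \<le> G\<^sup>2" using G by simp
      show "integral {0..x} (\<lambda>s. (cmod (\<phi> (a + d * s)))\<^sup>2) \<le> N\<^sup>2"
        by (rule shift) (use that in auto)
    qed (use that G N in auto)
    have phic: "(\<lambda>s. f s * cmod (\<phi> (a + d * s))) absolutely_integrable_on {0..pi}"
      if "f absolutely_integrable_on {0..pi}" for f a d
      by (intro that absolutely_integrable_mult_continuous continuous_intros continuous_on_compose2[OF \<phi>c[of UNIV]]) auto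
    have one_ai: "(\<lambda>s. 1 :: real) absolutely_integrable_on {0..pi}" by (rule absolutely_integrable_on_const) simp
    \<comment> \<open>One estimate for all three equations: two source terms along the lines
      \<open>a + d * s\<close> and \<open>a' + d' * s\<close>, plus the feedback of the unknowns
      already bounded by \<open>B * exp (2 * Qk s)\<close>.\<close>
    have final: "cmod (integral {0..x} J) \<le> A0 * N + B * integral {0..x} (\<lambda>s. k s * exp (2 * Qk s))"
      if x: "x \<in> {0..pi}" and J: "J integrable_on {0..x}" and f: "f absolutely_integrable_on {0..pi}" "\<And>s. (f s)\<^sup>2 \<le> h s"
        and d: "\<bar>d\<bar> \<ge> 1" "\<bar>d'\<bar> \<ge> 1" and a: "-pi \<le> a" "a \<le> pi" "-pi \<le> a + d * x" "a + d * x \<le> pi"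
           "-pi \<le> a'" "a' \<le> pi" "-pi \<le> a' + d' * x" "a' + d' * x \<le> pi"
        and w: "0 \<le> w" "w \<le> e0 * e0" "0 \<le> w'" "w' \<le> e0" and B: "0 \<le> B"
        and le: "\<And>s. s \<in> {0..x} \<Longrightarrow> cmod (J s) \<le> w * (f s * cmod (\<phi> (a + d * s))) + w' * (f s * cmod (\<phi> (a' + d' * s))) + B * (k s * exp (2 * Qk s))"
      for x J f a d a' d' w w' B
    proof -
      have wI: "(\<lambda>s. k s * exp (2 * Qk s)) integrable_on {0..x}"
        unfolding Qk_def using integral_exp_weight[OF k_ai, of x 2] x by auto
      have i: "(\<lambda>s. f s * cmod (\<phi> (a + d * s))) integrable_on {0..x}" "(\<lambda>s. f s * cmod (\<phi> (a' + d' * s))) integrable_on {0..x}"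
        by (intro sub x phic f)+
      have "cmod (integral {0..x} J) \<le> integral {0..x} (\<lambda>s. w * (f s * cmod (\<phi> (a + d * s))) + w' * (f s * cmod (\<phi> (a' + d' * s))) + B * (k s * exp (2 * Qk s)))"
        by (intro integral_norm_bound_integral J integrable_add integrable_on_mult_right i wI le)
      also have "\<dots> = w * integral {0..x} (\<lambda>s. f s * cmod (\<phi> (a + d * s))) + w' * integral {0..x} (\<lambda>s. f s * cmod (\<phi> (a' + d' * s)))
          + B * integral {0..x} (\<lambda>s. k s * exp (2 * Qk s))"
        by (simp add: integral_add integrable_add integrable_on_mult_right i wI del: Henstock_Kurzweil_Integration.integral_mult_right)
          (simp add: integral_mult_right)?
      also have "\<dots> \<le> e0 * e0 * (G * N) + e0 * (G * N) + B * integral {0..x} (\<lambda>s. k s * exp (2 * Qk s))"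
      proof (intro add_mono order.refl)
        have "w * integral {0..x} (\<lambda>s. f s * cmod (\<phi> (a + d * s))) \<le> w * (G * N)"
          using d w by (intro mult_left_mono CS x f a) auto
        also have "\<dots> \<le> e0 * e0 * (G * N)" using w G N by (intro mult_right_mono) auto
        finally show "w * integral {0..x} (\<lambda>s. f s * cmod (\<phi> (a + d * s))) \<le> e0 * e0 * (G * N)" .
        have "w' * integral {0..x} (\<lambda>s. f s * cmod (\<phi> (a' + d' * s))) \<le> w' * (G * N)"
          using d w by (intro mult_left_mono CS x f a) auto
        also have "\<dots> \<le> e0 * (G * N)" using w G N by (intro mult_right_mono) auto
        finally show "w' * integral {0..x} (\<lambda>s. f s * cmod (\<phi> (a' + d' * s))) \<le> e0 * (G * N)" .
      qed
      finally show ?thesis by (simp add: A0_def algebra_simps)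
    qed
    have bound: "\<Phi> x i \<le> 2 * (A0 * N) * exp (2 * Qk x)" if x: "x \<in> {0..pi}" and i: "i \<in> I x" for x i
    proof -
      \<comment> \<open>A crude bound depending on the chosen sum. It makes the supremum in the
        Gronwall argument finite, while the resulting estimate is free of it.\<close>
      obtain Mu where Mu: "\<And>j x. j \<in> F \<Longrightarrow> x \<in> {0..pi} \<Longrightarrow> cmod (\<kappa>u (\<mu> j) x) \<le> Mu \<and> cmod (\<kappa>w (\<mu> j) x) \<le> Mu \<and> cmod (Y (\<mu> j) x) \<le> Mu"
      proof -
        have "\<exists>M. \<forall>x\<in>{0..pi}. cmod (f x) \<le> M" if "continuous_on {0..pi} f" for f :: "real \<Rightarrow> complex"
          using compact_imp_bounded[OF compact_continuous_image[OF that compact_Icc]] by (meson bounded_iff imageI)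
        then have "\<forall>j. \<exists>M. \<forall>x\<in>{0..pi}. cmod (\<kappa>u (\<mu> j) x) \<le> M" "\<forall>j. \<exists>M. \<forall>x\<in>{0..pi}. cmod (\<kappa>w (\<mu> j) x) \<le> M"
          "\<forall>j. \<exists>M. \<forall>x\<in>{0..pi}. cmod (Y (\<mu> j) x) \<le> M"
          using \<kappa>_cont Y_cont by blast+
        then obtain m1 m2 m3 where m: "\<And>j x. x \<in> {0..pi} \<Longrightarrow> cmod (\<kappa>u (\<mu> j) x) \<le> m1 j" "\<And>j x. x \<in> {0..pi} \<Longrightarrow> cmod (\<kappa>w (\<mu> j) x) \<le> m2 j"
          "\<And>j x. x \<in> {0..pi} \<Longrightarrow> cmod (Y (\<mu> j) x) \<le> m3 j" by metis
        have mm: "\<bar>m j\<bar> \<le> (\<Sum>j\<in>F. \<bar>m j\<bar>)" if "j \<in> F" for j and m :: "'i \<Rightarrow> real" using fin that by (intro member_le_sum) auto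
        define S where "S = (\<Sum>j\<in>F. \<bar>m1 j\<bar>) + (\<Sum>j\<in>F. \<bar>m2 j\<bar>) + (\<Sum>j\<in>F. \<bar>m3 j\<bar>)"
        have pos: "0 \<le> (\<Sum>j\<in>F. \<bar>m j\<bar>)" for m :: "'i \<Rightarrow> real" by (intro sum_nonneg) auto
        show ?thesis
        proof (rule that[of S])
          fix j x assume j: "j \<in> F" and x: "x \<in> {0..pi}"
          show "cmod (\<kappa>u (\<mu> j) x) \<le> S \<and> cmod (\<kappa>w (\<mu> j) x) \<le> S \<and> cmod (Y (\<mu> j) x) \<le> S"
            unfolding S_def
            using m(1)[OF x, of j] m(2)[OF x, of j] m(3)[OF x, of j] mm[OF j, of m1] mm[OF j, of m2] mm[OF j, of m3] pos[of m1] pos[of m2] pos[of m3]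
            by linarith
        qed
      qed
      define M where "M = (\<Sum>j\<in>F. cmod (c j) * exp (cmod (\<mu> j) * pi) * Mu)"
      have sumM: "cmod (\<Sum>j\<in>F. c j * exp (\<i> * \<mu> j * of_real \<tau>) * v j) \<le> M" if \<tau>: "\<bar>\<tau>\<bar> \<le> pi" and v: "\<And>j. j \<in> F \<Longrightarrow> cmod (v j) \<le> Mu" for \<tau> v
        unfolding M_def
      proof (rule sum_norm_le)
        fix j assume j: "j \<in> F"
        have "cmod (exp (\<i> * \<mu> j * of_real \<tau>)) \<le> exp (cmod (\<mu> j) * pi)"
          using \<tau> by (intro order.trans[OF norm_exp]) (simp add: norm_mult mult_left_mono)
        then show "cmod (c j * exp (\<i> * \<mu> j * of_real \<tau>) * v j) \<le> cmod (c j) * exp (cmod (\<mu> j) * pi) * Mu"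
          unfolding norm_mult using v[OF j] by (intro mult_mono mult_left_mono) auto
      qed
      show ?thesis
        unfolding Qk_def
      proof (rule gronwall_family[OF k_ai k0, where \<phi>=\<Phi> and I=I and M=M])
        show "\<Phi> x i \<le> M" if "x \<in> {0..pi}" "i \<in> I x" for x i
          using that Mu unfolding \<Phi>_def Ku_def Kw_def Ky_def I_def by (auto intro!: sumM)
        show "0 \<le> A0 * N" using A0 N by simp
        fix B x i assume B: "0 \<le> B" and x: "x \<in> {0..pi}" and i: "i \<in> I x"
          and le': "\<And>s j. s \<in> {0..x} \<Longrightarrow> j \<in> I s \<Longrightarrow> \<Phi> s j \<le> B * exp (2 * integral {0..s} k)"
        define \<tau> where "\<tau> = snd i"
        have \<tau>: "\<bar>\<tau>\<bar> \<le> pi - x" using i by (simp add: I_def \<tau>_def)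
        have leu: "cmod (Ku s t) \<le> B * exp (2 * Qk s)" and lew: "cmod (Kw s t) \<le> B * exp (2 * Qk s)"
          and ley: "cmod (Ky s t) \<le> B * exp (2 * Qk s)" if "s \<in> {0..x}" "\<bar>t\<bar> \<le> pi - s" for s t
          using le'[OF that(1), of "(0, t)"] le'[OF that(1), of "(1, t)"] le'[OF that(1), of "(2, t)"] that(2)
          by (auto simp: \<Phi>_def I_def Qk_def)
        have ku: "cmod (Ku x \<tau>) \<le> A0 * N + B * integral {0..x} (\<lambda>s. k s * exp (2 * Qk s))"
        proof -
          define J where "J s = exp (ph s - ph x) * ((\<i> * p s - \<sigma> s) * (exp (ph s) * \<phi> ((\<tau> + x) + (-2) * s) + Kw s (\<tau> + x - s)) - (\<sigma> s)\<^sup>2 * Ky s (\<tau> + x - s))" for s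
          define Jj where "Jj j s = exp (ph s - ph x + \<i> * \<mu> j * of_real (x - s)) *
              ((\<i> * p s - \<sigma> s) * (exp (ph s - \<i> * \<mu> j * of_real s) + \<kappa>w (\<mu> j) s) - (\<sigma> s)\<^sup>2 * Y (\<mu> j) s)" for j s
          have Jj_ai: "Jj j absolutely_integrable_on {0..pi}" for j
          proof -
            have "(\<lambda>s. (\<i> * p s - \<sigma> s) * ((exp (ph s - \<i> * \<mu> j * of_real s) + \<kappa>w (\<mu> j) s) * exp (ph s - ph x + \<i> * \<mu> j * of_real (x - s)))
                - (\<sigma> s)\<^sup>2 * (Y (\<mu> j) s * exp (ph s - ph x + \<i> * \<mu> j * of_real (x - s)))) absolutely_integrable_on {0..pi}"
              by (intro set_integral_diff(1) absolutely_integrable_mult_continuous set_integrable_mult_right p_ai \<sigma>_ai \<sigma>2_ai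
                  continuous_intros ph_cont Y_cont \<kappa>_cont)
            then show ?thesis by (simp add: Jj_def[abs_def] algebra_simps)
          qed
          have Ji: "(\<lambda>s. \<Sum>j\<in>F. c j * exp (\<i> * \<mu> j * of_real \<tau>) * Jj j s) integrable_on {0..x}"
            by (intro integrable_sum fin integrable_on_mult_right sub x Jj_ai)
          have JJ: "(\<Sum>j\<in>F. c j * exp (\<i> * \<mu> j * of_real \<tau>) * Jj j s) = J s" for s
          proof -
            have e: "c j * exp (\<i> * \<mu> j * of_real \<tau>) * Jj j s = exp (ph s - ph x) * ((\<i> * p s - \<sigma> s) * (exp (ph s) * (c j * exp (\<i> * \<mu> j * of_real ((\<tau> + x) + (-2) * s)))
                 + c j * exp (\<i> * \<mu> j * of_real (\<tau> + x - s)) * \<kappa>w (\<mu> j) s) - (\<sigma> s)\<^sup>2 * (c j * exp (\<i> * \<mu> j * of_real (\<tau> + x - s)) * Y (\<mu> j) s))" for j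
              unfolding Jj_def by (rule transport_identity; simp add: algebra_simps flip: exp_add)
            show ?thesis unfolding e J_def \<phi>_def Kw_def Ky_def
              by (simp only: sum_distrib_left[symmetric] sum.distrib sum_subtractf)
          qed
          have "Ku x \<tau> = (\<Sum>j\<in>F. c j * exp (\<i> * \<mu> j * of_real \<tau>) * integral {0..x} (Jj j))"
            unfolding Ku_def Jj_def using \<kappa>u_eq[OF x] by simp
          also have "\<dots> = (\<Sum>j\<in>F. integral {0..x} (\<lambda>s. c j * exp (\<i> * \<mu> j * of_real \<tau>) * Jj j s))" by simp
          also have "\<dots> = integral {0..x} (\<lambda>s. \<Sum>j\<in>F. c j * exp (\<i> * \<mu> j * of_real \<tau>) * Jj j s)"
            by (intro integral_sum[symmetric] fin integrable_on_mult_right sub x Jj_ai)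
          finally have K: "Ku x \<tau> = integral {0..x} J" unfolding JJ .
          show ?thesis unfolding K
          proof (rule final[of x J g "-2" 1 "\<tau> + x" 0 "e0*e0" 0 B, OF x _ g_ai gh])
            show "J integrable_on {0..x}" using Ji unfolding JJ .
            fix s assume s: "s \<in> {0..x}"
            then have s': "s \<in> {0..pi}" using x by auto
            \<comment> \<open>The characteristic through \<open>(x, \<tau>)\<close> stays in the
              triangle as \<open>s\<close> decreases to 0.\<close>
            have t: "\<bar>\<tau> + x - s\<bar> \<le> pi - s" using \<tau> s by auto
            have "cmod (J s) \<le> e0 * (g s * (e0 * cmod (\<phi> ((\<tau> + x) + (-2) * s)) + B * exp (2 * Qk s)) + (cmod (\<sigma> s))\<^sup>2 * (B * exp (2 * Qk s)))"
              unfolding J_def norm_mult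
            proof (intro mult_mono e0(2) s' x order.trans[OF norm_triangle_ineq4] add_mono)
              show "cmod ((\<i> * p s - \<sigma> s) * (exp (ph s) * \<phi> ((\<tau> + x) + (-2) * s) + Kw s (\<tau> + x - s))) \<le> g s * (e0 * cmod (\<phi> ((\<tau> + x) + (-2) * s)) + B * exp (2 * Qk s))"
                unfolding norm_mult
              proof (intro mult_mono order.trans[OF norm_triangle_ineq] add_mono lew s t)
                show "cmod (\<i> * p s - \<sigma> s) \<le> g s" unfolding g_def by (rule order.trans[OF norm_triangle_ineq4]) (simp add: norm_mult)
                show "cmod (exp (ph s) * \<phi> (\<tau> + x + - 2 * s)) \<le> e0 * cmod (\<phi> (\<tau> + x + - 2 * s))"
                  unfolding norm_mult by (intro mult_right_mono e0(3) s') auto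
              qed (auto simp: g_def)
              show "cmod ((\<sigma> s)\<^sup>2 * Ky s (\<tau> + x - s)) \<le> (cmod (\<sigma> s))\<^sup>2 * (B * exp (2 * Qk s))"
                unfolding norm_mult norm_power by (intro mult_left_mono ley s t) auto
            qed (use e0(1) in auto)
            also have "\<dots> = e0 * e0 * (g s * cmod (\<phi> (\<tau> + x + - 2 * s))) + B * (e0 * (g s + (cmod (\<sigma> s))\<^sup>2) * exp (2 * Qk s))"
              by (simp add: algebra_simps)
            also have "\<dots> \<le> e0 * e0 * (g s * cmod (\<phi> (\<tau> + x + - 2 * s))) + B * (k s * exp (2 * Qk s))"
              using e0(1) B by (intro add_left_mono mult_left_mono mult_right_mono) (auto simp: k_def g_def tot_def)
            finally show "cmod (J s) \<le> e0 * e0 * (g s * cmod (\<phi> (\<tau> + x + - 2 * s))) + 0 * (g s * cmod (\<phi> (0 + 1 * s))) + B * (k s * exp (2 * Qk s))" by simp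
          qed (use \<tau> x B e0(1) in auto)
        qed
        have kw: "cmod (Kw x \<tau>) \<le> A0 * N + B * integral {0..x} (\<lambda>s. k s * exp (2 * Qk s))"
        proof -
          define J where "J s = exp (ph x - ph s) * (- (\<i> * p s + \<sigma> s) * (exp (- ph s) * \<phi> ((\<tau> - x) + 2 * s) + Ku s (\<tau> - x + s)) - (\<sigma> s)\<^sup>2 * Ky s (\<tau> - x + s))" for s
          define Jj where "Jj j s = exp (ph x - ph s - \<i> * \<mu> j * of_real (x - s)) *
              (- (\<i> * p s + \<sigma> s) * (exp (\<i> * \<mu> j * of_real s - ph s) + \<kappa>u (\<mu> j) s) - (\<sigma> s)\<^sup>2 * Y (\<mu> j) s)" for j s
          have Jj_ai: "Jj j absolutely_integrable_on {0..pi}" for j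
          proof -
            have "(\<lambda>s. (\<i> * p s + \<sigma> s) * (- (exp (\<i> * \<mu> j * of_real s - ph s) + \<kappa>u (\<mu> j) s) * exp (ph x - ph s - \<i> * \<mu> j * of_real (x - s)))
                - (\<sigma> s)\<^sup>2 * (Y (\<mu> j) s * exp (ph x - ph s - \<i> * \<mu> j * of_real (x - s)))) absolutely_integrable_on {0..pi}"
              by (intro set_integral_diff(1) set_integral_add(1) absolutely_integrable_mult_continuous set_integrable_mult_right p_ai \<sigma>_ai \<sigma>2_ai
                  continuous_intros ph_cont Y_cont \<kappa>_cont)
            then show ?thesis by (simp add: Jj_def[abs_def] algebra_simps)
          qed
          have Ji: "(\<lambda>s. \<Sum>j\<in>F. c j * exp (\<i> * \<mu> j * of_real \<tau>) * Jj j s) integrable_on {0..x}"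
            by (intro integrable_sum fin integrable_on_mult_right sub x Jj_ai)
          have JJ: "(\<Sum>j\<in>F. c j * exp (\<i> * \<mu> j * of_real \<tau>) * Jj j s) = J s" for s
          proof -
            have e: "c j * exp (\<i> * \<mu> j * of_real \<tau>) * Jj j s = exp (ph x - ph s) * (- (\<i> * p s + \<sigma> s) * (exp (- ph s) * (c j * exp (\<i> * \<mu> j * of_real ((\<tau> - x) + 2 * s)))
                 + c j * exp (\<i> * \<mu> j * of_real (\<tau> - x + s)) * \<kappa>u (\<mu> j) s) - (\<sigma> s)\<^sup>2 * (c j * exp (\<i> * \<mu> j * of_real (\<tau> - x + s)) * Y (\<mu> j) s))" for j
              unfolding Jj_def by (rule transport_identity; simp add: algebra_simps flip: exp_add)
            show ?thesis unfolding e J_def \<phi>_def Ku_def Ky_def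
              by (simp only: sum_distrib_left[symmetric] sum.distrib sum_subtractf)
          qed
          have "Kw x \<tau> = (\<Sum>j\<in>F. c j * exp (\<i> * \<mu> j * of_real \<tau>) * integral {0..x} (Jj j))"
            unfolding Kw_def Jj_def using \<kappa>w_eq[OF x] by simp
          also have "\<dots> = (\<Sum>j\<in>F. integral {0..x} (\<lambda>s. c j * exp (\<i> * \<mu> j * of_real \<tau>) * Jj j s))" by simp
          also have "\<dots> = integral {0..x} (\<lambda>s. \<Sum>j\<in>F. c j * exp (\<i> * \<mu> j * of_real \<tau>) * Jj j s)"
            by (intro integral_sum[symmetric] fin integrable_on_mult_right sub x Jj_ai)
          finally have K: "Kw x \<tau> = integral {0..x} J" unfolding JJ .
          show ?thesis unfolding K
          proof (rule final[of x J g 2 1 "\<tau> - x" 0 "e0*e0" 0 B, OF x _ g_ai gh])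
            show "J integrable_on {0..x}" using Ji unfolding JJ .
            fix s assume s: "s \<in> {0..x}"
            then have s': "s \<in> {0..pi}" using x by auto
            have t: "\<bar>\<tau> - x + s\<bar> \<le> pi - s" using \<tau> s by auto
            have "cmod (J s) \<le> e0 * (g s * (e0 * cmod (\<phi> ((\<tau> - x) + 2 * s)) + B * exp (2 * Qk s)) + (cmod (\<sigma> s))\<^sup>2 * (B * exp (2 * Qk s)))"
              unfolding J_def norm_mult
            proof (intro mult_mono e0(2) s' x order.trans[OF norm_triangle_ineq4] add_mono)
              show "cmod (- (\<i> * p s + \<sigma> s) * (exp (- ph s) * \<phi> ((\<tau> - x) + 2 * s) + Ku s (\<tau> - x + s))) \<le> g s * (e0 * cmod (\<phi> ((\<tau> - x) + 2 * s)) + B * exp (2 * Qk s))"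
                unfolding norm_mult
              proof (intro mult_mono order.trans[OF norm_triangle_ineq] add_mono leu s t)
                show "cmod (- (\<i> * p s + \<sigma> s)) \<le> g s" unfolding g_def norm_minus_cancel by (rule order.trans[OF norm_triangle_ineq]) (simp add: norm_mult)
                show "cmod (exp (- ph s) * \<phi> (\<tau> - x + 2 * s)) \<le> e0 * cmod (\<phi> (\<tau> - x + 2 * s))"
                  unfolding norm_mult by (intro mult_right_mono e0(4) s') auto
              qed (auto simp: g_def)
              show "cmod ((\<sigma> s)\<^sup>2 * Ky s (\<tau> - x + s)) \<le> (cmod (\<sigma> s))\<^sup>2 * (B * exp (2 * Qk s))"
                unfolding norm_mult norm_power by (intro mult_left_mono ley s t) auto
            qed (use e0(1) in auto)
            also have "\<dots> = e0 * e0 * (g s * cmod (\<phi> (\<tau> - x + 2 * s))) + B * (e0 * (g s + (cmod (\<sigma> s))\<^sup>2) * exp (2 * Qk s))"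
              by (simp add: algebra_simps)
            also have "\<dots> \<le> e0 * e0 * (g s * cmod (\<phi> (\<tau> - x + 2 * s))) + B * (k s * exp (2 * Qk s))"
              using e0(1) B by (intro add_left_mono mult_left_mono mult_right_mono) (auto simp: k_def g_def tot_def)
            finally show "cmod (J s) \<le> e0 * e0 * (g s * cmod (\<phi> (\<tau> - x + 2 * s))) + 0 * (g s * cmod (\<phi> (0 + 1 * s))) + B * (k s * exp (2 * Qk s))" by simp
          qed (use \<tau> x B e0(1) in auto)
        qed
        have ky: "cmod (Ky x \<tau>) \<le> A0 * N + B * integral {0..x} (\<lambda>s. k s * exp (2 * Qk s))"
        proof -
          define J where "J s = (exp (- ph s) * \<phi> (\<tau> + 1 * s) + Ku s \<tau> + (exp (ph s) * \<phi> (\<tau> + (-1) * s) + Kw s \<tau>)) / 2 + \<sigma> s * Ky s \<tau>" for s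
          define Jj where "Jj j s = (exp (\<i> * \<mu> j * of_real s - ph s) + \<kappa>u (\<mu> j) s + (exp (ph s - \<i> * \<mu> j * of_real s) + \<kappa>w (\<mu> j) s)) / 2 + \<sigma> s * Y (\<mu> j) s" for j s
          have Jj_ai: "Jj j absolutely_integrable_on {0..pi}" for j
            unfolding Jj_def[abs_def]
            by (intro set_integral_add(1) absolutely_integrable_mult_continuous \<sigma>_ai absolutely_integrable_continuous_real
                continuous_intros ph_cont Y_cont \<kappa>_cont) auto
          have Ji: "(\<lambda>s. \<Sum>j\<in>F. c j * exp (\<i> * \<mu> j * of_real \<tau>) * Jj j s) integrable_on {0..x}"
            by (intro integrable_sum fin integrable_on_mult_right sub x Jj_ai)
          have JJ: "(\<Sum>j\<in>F. c j * exp (\<i> * \<mu> j * of_real \<tau>) * Jj j s) = J s" for s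
          proof -
            have e: "c j * exp (\<i> * \<mu> j * of_real \<tau>) * Jj j s = (exp (- ph s) * (c j * exp (\<i> * \<mu> j * of_real (\<tau> + 1 * s))) + c j * exp (\<i> * \<mu> j * of_real \<tau>) * \<kappa>u (\<mu> j) s
                + (exp (ph s) * (c j * exp (\<i> * \<mu> j * of_real (\<tau> + (-1) * s))) + c j * exp (\<i> * \<mu> j * of_real \<tau>) * \<kappa>w (\<mu> j) s)) / 2
                + \<sigma> s * (c j * exp (\<i> * \<mu> j * of_real \<tau>) * Y (\<mu> j) s)" for j
              unfolding Jj_def by (rule transport_identity'; simp add: algebra_simps flip: exp_add)
            show ?thesis unfolding e J_def \<phi>_def Ku_def Kw_def Ky_def
              by (simp only: sum_distrib_left[symmetric] sum.distrib sum_divide_distrib[symmetric])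
          qed
          have "Ky x \<tau> = (\<Sum>j\<in>F. c j * exp (\<i> * \<mu> j * of_real \<tau>) * integral {0..x} (Jj j))"
            unfolding Ky_def Jj_def using Y_eq[OF x] by simp
          also have "\<dots> = (\<Sum>j\<in>F. integral {0..x} (\<lambda>s. c j * exp (\<i> * \<mu> j * of_real \<tau>) * Jj j s))" by simp
          also have "\<dots> = integral {0..x} (\<lambda>s. \<Sum>j\<in>F. c j * exp (\<i> * \<mu> j * of_real \<tau>) * Jj j s)"
            by (intro integral_sum[symmetric] fin integrable_on_mult_right sub x Jj_ai)
          finally have K: "Ky x \<tau> = integral {0..x} J" unfolding JJ .
          show ?thesis unfolding K
          proof (rule final[of x J "\<lambda>_. 1" 1 "-1" \<tau> \<tau> e0 e0 B, OF x _ one_ai])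
            show "J integrable_on {0..x}" using Ji unfolding JJ .
            show "1\<^sup>2 \<le> h s" for s using oneh by simp
            show "e0 \<le> e0 * e0" using e0(1) by simp
            fix s assume s: "s \<in> {0..x}"
            then have s': "s \<in> {0..pi}" using x by auto
            have t: "\<bar>\<tau>\<bar> \<le> pi - s" using \<tau> s by auto
            have "cmod (J s) \<le> ((e0 * cmod (\<phi> (\<tau> + 1 * s)) + B * exp (2 * Qk s)) + (e0 * cmod (\<phi> (\<tau> + (-1) * s)) + B * exp (2 * Qk s))) / 2 + cmod (\<sigma> s) * (B * exp (2 * Qk s))"
            proof -
              have half: "j \<le> ((A1 + B') + (A2 + B')) / 2 + q'"
                if "j \<le> n / 2 + q" "n \<le> n1 + n2" "n1 \<le> a1 + b1" "n2 \<le> a2 + b2" "a1 \<le> A1" "b1 \<le> B'" "a2 \<le> A2" "b2 \<le> B'" "q \<le> q'"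
                for j n q n1 n2 a1 b1 a2 b2 A1 A2 B' q' :: real using that by argo
              show ?thesis
              proof (rule half)
                show "cmod (J s) \<le> cmod ((exp (- ph s) * \<phi> (\<tau> + 1 * s) + Ku s \<tau>) + (exp (ph s) * \<phi> (\<tau> + (-1) * s) + Kw s \<tau>)) / 2 + cmod (\<sigma> s * Ky s \<tau>)"
                  unfolding J_def by (rule order.trans[OF norm_triangle_ineq]) (simp add: norm_divide)
                show "cmod (exp (- ph s) * \<phi> (\<tau> + 1 * s)) \<le> e0 * cmod (\<phi> (\<tau> + 1 * s))" "cmod (exp (ph s) * \<phi> (\<tau> + (-1) * s)) \<le> e0 * cmod (\<phi> (\<tau> + (-1) * s))"
                  unfolding norm_mult by (intro mult_right_mono e0 s'; simp)+
                show "cmod (\<sigma> s * Ky s \<tau>) \<le> cmod (\<sigma> s) * (B * exp (2 * Qk s))"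
                  unfolding norm_mult by (intro mult_left_mono ley s t) auto
              qed (rule norm_triangle_ineq leu[OF s t] lew[OF s t])+
            qed
            also have "\<dots> \<le> e0 * (1 * cmod (\<phi> (\<tau> + 1 * s))) + e0 * (1 * cmod (\<phi> (\<tau> + (-1) * s))) + B * ((1 + cmod (\<sigma> s)) * exp (2 * Qk s))"
              using e0(1) by (simp add: algebra_simps)
            also have "\<dots> \<le> e0 * (1 * cmod (\<phi> (\<tau> + 1 * s))) + e0 * (1 * cmod (\<phi> (\<tau> + (-1) * s))) + B * (k s * exp (2 * Qk s))"
            proof -
              have "1 * (1 + cmod (\<sigma> s)) \<le> e0 * tot s" using e0(1) by (intro mult_mono) (auto simp: tot_def)
              then show ?thesis using B by (intro add_left_mono mult_left_mono mult_right_mono) (auto simp: k_def)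
            qed
            finally show "cmod (J s) \<le> e0 * (1 * cmod (\<phi> (\<tau> + 1 * s))) + e0 * (1 * cmod (\<phi> (\<tau> + -1 * s))) + B * (k s * exp (2 * Qk s))" .
          qed (use \<tau> x B e0(1) in auto)
        qed
        show "\<Phi> x i \<le> A0 * N + B * integral {0..x} (\<lambda>s. k s * exp (2 * integral {0..s} k))"
          using ku kw ky unfolding \<Phi>_def Qk_def \<tau>_def by (simp split: if_split)
      qed (use x i in auto)
    qed
    \<comment> \<open>At \<open>x = pi\<close> the triangle has shrunk to \<open>\<tau> = 0\<close>,
      where \<open>Ku\<close> and \<open>Kw\<close> are the sums to be bounded.\<close>
    have "(0::nat, 0::real) \<in> I pi" "(1::nat, 0::real) \<in> I pi" by (auto simp: I_def)
    from bound[OF _ this(1)] bound[OF _ this(2)] show ?thesis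
      by (simp add: \<Phi>_def Ku_def Kw_def C_def algebra_simps)
  qed
  ultimately show ?thesis by blast
qed

end

section \<open>Values at the right endpoint: lower bounds and growth\<close>

lemma has_density_norm_backward:
  fixes f :: "real \<Rightarrow> complex"
  assumes f: "has_density a b f F" and x: "x \<in> {a..b}"
  shows "cmod (f x) \<le> cmod (f b) + integral {x..b} (\<lambda>s. cmod (F s))"
proof -
  have FI: "F integrable_on {a..b}" using has_densityD[OF f] by (rule set_lebesgue_integral_eq_integral(1))
  have nF: "(\<lambda>s. cmod (F s)) integrable_on {a..b}"
    using has_densityD[OF f] by (intro set_lebesgue_integral_eq_integral(1) set_integrable_norm)
  have "integral {a..x} F + integral {x..b} F = integral {a..b} F"
    using x by (intro Henstock_Kurzweil_Integration.integral_combine FI) auto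
  moreover have "f x = f a + integral {a..x} F" "f b = f a + integral {a..b} F"
    using x by (auto intro!: has_density_eq[OF f])
  ultimately have "f x = f b - integral {x..b} F" by (simp add: algebra_simps)
  then have "cmod (f x) \<le> cmod (f b) + cmod (integral {x..b} F)" by (simp add: norm_triangle_ineq4)
  also have "cmod (integral {x..b} F) \<le> integral {x..b} (\<lambda>s. cmod (F s))"
    using x by (intro integral_norm_bound_integral integrable_on_subinterval[OF FI] integrable_on_subinterval[OF nF]) auto
  finally show ?thesis by simp
qed

lemma exp_square_integral:
  assumes "Im z \<noteq> 0"
  shows "integral {-pi..pi} (\<lambda>t. (cmod (exp (\<i> * z * of_real t)))\<^sup>2) \<le> exp (2 * pi * \<bar>Im z\<bar>) / \<bar>Im z\<bar>"
proof -
  define \<eta> where "\<eta> = Im z"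
  have eq: "(cmod (exp (\<i> * z * of_real t)))\<^sup>2 = exp (- (2 * \<eta> * t))" for t
  proof -
    have "(cmod (exp (\<i> * z * of_real t)))\<^sup>2 = exp (- (\<eta> * t)) ^ 2" by (simp add: \<eta>_def)
    then show ?thesis by (simp add: power2_eq_square flip: exp_add)
  qed
  have \<eta>: "\<eta> \<noteq> 0" using assms by (simp add: \<eta>_def)
  have "((\<lambda>t. exp (- (2 * \<eta> * t))) has_integral (- exp (- (2 * \<eta> * pi)) / (2 * \<eta>)) - (- exp (- (2 * \<eta> * (-pi))) / (2 * \<eta>))) {-pi..pi}"
    by (rule fundamental_theorem_of_calculus)
      (use \<eta> in \<open>auto intro!: derivative_eq_intros simp: has_real_derivative_iff_has_vector_derivative[symmetric]\<close>)
  then have "integral {-pi..pi} (\<lambda>t. (cmod (exp (\<i> * z * of_real t)))\<^sup>2) = (exp (2 * pi * \<eta>) - exp (- (2 * pi * \<eta>))) / (2 * \<eta>)"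
    unfolding eq by (intro integral_unique) (simp add: diff_divide_distrib mult_ac)
  also have "\<dots> \<le> exp (2 * pi * \<bar>\<eta>\<bar>) / \<bar>\<eta>\<bar>"
  proof (cases "\<eta> > 0")
    case True
    have "(exp (2 * pi * \<eta>) - exp (- (2 * pi * \<eta>))) \<le> 2 * exp (2 * pi * \<eta>)" using exp_gt_zero[of "2*pi*\<eta>"] exp_gt_zero[of "-(2*pi*\<eta>)"] by linarith
    then show ?thesis using True by (simp add: field_simps)
  next
    case False
    then have n: "\<eta> < 0" using \<eta> by simp
    have "(exp (- (2 * pi * \<eta>)) - exp (2 * pi * \<eta>)) \<le> 2 * exp (- (2 * pi * \<eta>))" using exp_gt_zero[of "2*pi*\<eta>"] exp_gt_zero[of "-(2*pi*\<eta>)"] by linarith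
    moreover have "(exp (2 * pi * \<eta>) - exp (- (2 * pi * \<eta>))) / (2 * \<eta>) = (exp (- (2 * pi * \<eta>)) - exp (2 * pi * \<eta>)) / (2 * (- \<eta>))"
      by (simp add: minus_divide_left)
    moreover have "(exp (- (2 * pi * \<eta>)) - exp (2 * pi * \<eta>)) / (2 * (- \<eta>)) \<le> 2 * exp (- (2 * pi * \<eta>)) / (2 * (- \<eta>))"
      using n calculation(1) by (intro divide_right_mono) auto
    moreover have "2 * exp (- (2 * pi * \<eta>)) / (2 * (- \<eta>)) = exp (2 * pi * \<bar>\<eta>\<bar>) / \<bar>\<eta>\<bar>"
      using n by (simp add: abs_of_neg)
    ultimately show ?thesis by (simp only:)
  qed
  finally show ?thesis by (simp add: \<eta>_def)
qed

context pencil
begin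

text \<open>The factors \<open>exp (\<plusminus> \<i> Re z x)\<close> remove the unbounded real part of \<open>z\<close> from the system for \<open>(U, W, Y)\<close>
  without changing absolute values, so Gronwall's inequality read from \<open>\<pi>\<close> to \<open>0\<close> is uniform in strips.\<close>

lemma strip_lower_bound:
  assumes R: "0 \<le> R"
  shows "\<exists>c>0. \<forall>z. \<bar>Im z\<bar> \<le> R \<longrightarrow> c \<le> cmod (U z pi) + cmod (W z pi) + cmod (Y z pi)"
proof -
  define k where "k s = R + 2 * tot s" for s
  have k_ai: "k absolutely_integrable_on {0..pi}"
    unfolding k_def by (intro set_integral_add(1) set_integrable_mult_right tot_ai absolutely_integrable_on_const) auto
  have k0: "0 \<le> k s" for s using R by (simp add: k_def tot_def)
  have "exp (- 2 * integral {0..pi} k) \<le> cmod (U z pi) + cmod (W z pi) + cmod (Y z pi)" if z: "\<bar>Im z\<bar> \<le> R" for z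
  proof -
    define m where "m \<epsilon> x = exp (\<epsilon> * \<i> * of_real (Re z) * of_real x)" for \<epsilon> x
    have dm: "has_density 0 pi (m \<epsilon>) (\<lambda>x. (\<epsilon> * \<i> * of_real (Re z)) * m \<epsilon> x)" for \<epsilon>
      unfolding m_def by (rule has_density_exp[OF pi_ge_zero has_density_mult_const])
    have mn: "cmod (m 1 x) = 1" "cmod (m (-1) x) = 1" for x by (simp_all add: m_def)
    note dU = has_density_mult[OF pi_ge_zero dm[of "-1"] density_U[of z]]
    note dW = has_density_mult[OF pi_ge_zero dm[of 1] density_W[of z]]
    define \<phi> where "\<phi> x = cmod (U z x) + cmod (W z x) + cmod (Y z x)" for x
    define D1 where "D1 s = (-1) * \<i> * of_real (Re z) * m (-1) s * U z s + m (-1) s * (\<i> * (z - p s) * U z s + (\<i> * p s - \<sigma> s) * W z s - (\<sigma> s)\<^sup>2 * Y z s)" for s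
    define D2 where "D2 s = 1 * \<i> * of_real (Re z) * m 1 s * W z s + m 1 s * (\<i> * (p s - z) * W z s - (\<i> * p s + \<sigma> s) * U z s - (\<sigma> s)\<^sup>2 * Y z s)" for s
    define D3 where "D3 s = Y1 z s + \<sigma> s * Y z s" for s
    have dU': "has_density 0 pi (\<lambda>x. m (-1) x * U z x) D1" using dU by (simp add: D1_def[abs_def])
    have dW': "has_density 0 pi (\<lambda>x. m 1 x * W z x) D2" using dW by (simp add: D2_def[abs_def])
    have dY': "has_density 0 pi (Y z) D3" using density_Y[of z] by (simp add: D3_def[abs_def])
    have imz: "cmod (\<i> * z - \<i> * of_real (Re z)) \<le> R"
    proof -
      have "\<i> * z - \<i> * of_real (Re z) = - of_real (Im z)" by (simp add: complex_eq_iff)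
      then show ?thesis using z by simp
    qed
    have n1: "cmod (D1 s) \<le> (R + cmod (p s)) * cmod (U z s) + (cmod (p s) + cmod (\<sigma> s)) * cmod (W z s) + (cmod (\<sigma> s))\<^sup>2 * cmod (Y z s)" for s
    proof -
      have "D1 s = m (-1) s * ((\<i> * z - \<i> * of_real (Re z) - \<i> * p s) * U z s + (\<i> * p s - \<sigma> s) * W z s - (\<sigma> s)\<^sup>2 * Y z s)"
        unfolding D1_def by (simp add: algebra_simps)
      then have "cmod (D1 s) = cmod ((\<i> * z - \<i> * of_real (Re z) - \<i> * p s) * U z s + (\<i> * p s - \<sigma> s) * W z s - (\<sigma> s)\<^sup>2 * Y z s)"
        by (simp add: norm_mult mn)
      also have "\<dots> \<le> cmod ((\<i> * z - \<i> * of_real (Re z) - \<i> * p s)) * cmod (U z s) + cmod (\<i> * p s - \<sigma> s) * cmod (W z s) + (cmod (\<sigma> s))\<^sup>2 * cmod (Y z s)"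
        by (rule order.trans[OF norm_triangle_ineq4] add_mono order.trans[OF norm_triangle_ineq])+ (simp_all add: norm_mult norm_power)
      also have "\<dots> \<le> (R + cmod (p s)) * cmod (U z s) + (cmod (p s) + cmod (\<sigma> s)) * cmod (W z s) + (cmod (\<sigma> s))\<^sup>2 * cmod (Y z s)"
      proof (intro add_mono mult_right_mono order.refl)
        show "cmod (\<i> * z - \<i> * of_real (Re z) - \<i> * p s) \<le> R + cmod (p s)"
          using imz norm_triangle_ineq4[of "\<i> * z - \<i> * of_real (Re z)" "\<i> * p s"] by (simp add: norm_mult)
        show "cmod (\<i> * p s - \<sigma> s) \<le> cmod (p s) + cmod (\<sigma> s)"
          using norm_triangle_ineq4[of "\<i> * p s" "\<sigma> s"] by (simp add: norm_mult)
      qed auto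
      finally show ?thesis .
    qed
    have n2: "cmod (D2 s) \<le> (R + cmod (p s)) * cmod (W z s) + (cmod (p s) + cmod (\<sigma> s)) * cmod (U z s) + (cmod (\<sigma> s))\<^sup>2 * cmod (Y z s)" for s
    proof -
      have "D2 s = m 1 s * (- ((\<i> * z - \<i> * of_real (Re z) - \<i> * p s) * W z s) - (\<i> * p s + \<sigma> s) * U z s - (\<sigma> s)\<^sup>2 * Y z s)"
        unfolding D2_def by (simp add: algebra_simps)
      then have "cmod (D2 s) = cmod (- ((\<i> * z - \<i> * of_real (Re z) - \<i> * p s) * W z s) - (\<i> * p s + \<sigma> s) * U z s - (\<sigma> s)\<^sup>2 * Y z s)"
        by (simp add: norm_mult mn)
      also have "\<dots> \<le> cmod ((\<i> * z - \<i> * of_real (Re z) - \<i> * p s)) * cmod (W z s) + cmod (\<i> * p s + \<sigma> s) * cmod (U z s) + (cmod (\<sigma> s))\<^sup>2 * cmod (Y z s)"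
        by (rule order.trans[OF norm_triangle_ineq4] add_mono)+ (simp_all add: norm_mult norm_power)
      also have "\<dots> \<le> (R + cmod (p s)) * cmod (W z s) + (cmod (p s) + cmod (\<sigma> s)) * cmod (U z s) + (cmod (\<sigma> s))\<^sup>2 * cmod (Y z s)"
      proof (intro add_mono mult_right_mono order.refl)
        show "cmod (\<i> * z - \<i> * of_real (Re z) - \<i> * p s) \<le> R + cmod (p s)"
          using imz norm_triangle_ineq4[of "\<i> * z - \<i> * of_real (Re z)" "\<i> * p s"] by (simp add: norm_mult)
        show "cmod (\<i> * p s + \<sigma> s) \<le> cmod (p s) + cmod (\<sigma> s)"
          using norm_triangle_ineq[of "\<i> * p s" "\<sigma> s"] by (simp add: norm_mult)
      qed auto
      finally show ?thesis .
    qed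
    have n3: "cmod (D3 s) \<le> cmod (U z s) + cmod (W z s) + cmod (\<sigma> s) * cmod (Y z s)" for s
    proof -
      have "Y1 z s = (U z s + W z s) / 2" by (simp add: U_def W_def)
      then have "cmod (Y1 z s) = cmod (U z s + W z s) / 2" by (simp only: norm_divide norm_numeral)
      then have "cmod (Y1 z s) \<le> (cmod (U z s) + cmod (W z s)) / 2"
        by (simp only:) (rule divide_right_mono[OF norm_triangle_ineq], simp)
      moreover have "d \<le> b + c + e" if "a \<le> (b + c) / 2" "d \<le> a + e" "0 \<le> b" "0 \<le> c" for a b c d e :: real
        using that by argo
      ultimately show ?thesis unfolding D3_def
        using norm_triangle_ineq[of "Y1 z s" "\<sigma> s * Y z s"] norm_ge_zero[of "U z s"] norm_ge_zero[of "W z s"]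
        unfolding norm_mult by blast
    qed
    have n: "cmod (D1 s) + cmod (D2 s) + cmod (D3 s) \<le> k s * \<phi> s" for s
    proof -
      have "k s * \<phi> s - ((R + cmod (p s)) * cmod (U z s) + (cmod (p s) + cmod (\<sigma> s)) * cmod (W z s) + (cmod (\<sigma> s))\<^sup>2 * cmod (Y z s)
         + ((R + cmod (p s)) * cmod (W z s) + (cmod (p s) + cmod (\<sigma> s)) * cmod (U z s) + (cmod (\<sigma> s))\<^sup>2 * cmod (Y z s))
         + (cmod (U z s) + cmod (W z s) + cmod (\<sigma> s) * cmod (Y z s)))
        = (1 + 3 * cmod (\<sigma> s) + 2 * (cmod (\<sigma> s))\<^sup>2) * (cmod (U z s) + cmod (W z s)) + (R + 2 + 2 * cmod (p s) + 3 * cmod (\<sigma> s)) * cmod (Y z s)"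
        by (simp add: k_def tot_def \<phi>_def algebra_simps)
      also have "\<dots> \<ge> 0" using R by (intro add_nonneg_nonneg mult_nonneg_nonneg) auto
      finally show ?thesis using n1[of s] n2[of s] n3[of s] by linarith
    qed
    have \<phi>c: "continuous_on {0..pi} \<phi>" unfolding \<phi>_def[abs_def] by (intro continuous_intros U_cont W_cont Y_cont)
    have "\<phi> 0 \<le> 2 * \<phi> pi * exp (2 * integral {0..pi} k)"
    proof (rule gronwall_backward[OF k_ai k0 pi_ge_zero \<phi>c])
      fix x :: real assume x: "x \<in> {0..pi}"
      have sub: "(\<lambda>s. cmod (D s)) integrable_on {x..pi}" if "has_density 0 pi f D" for f D :: "real \<Rightarrow> complex"
        using x has_densityD[OF that]
        by (intro integrable_on_subinterval[OF set_lebesgue_integral_eq_integral(1)[OF set_integrable_norm]]) auto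
      have "\<phi> x \<le> \<phi> pi + (integral {x..pi} (\<lambda>s. cmod (D1 s)) + integral {x..pi} (\<lambda>s. cmod (D2 s)) + integral {x..pi} (\<lambda>s. cmod (D3 s)))"
        using has_density_norm_backward[OF dU' x] has_density_norm_backward[OF dW' x] has_density_norm_backward[OF dY' x]
        unfolding norm_mult mn \<phi>_def by simp
      also have "integral {x..pi} (\<lambda>s. cmod (D1 s)) + integral {x..pi} (\<lambda>s. cmod (D2 s)) + integral {x..pi} (\<lambda>s. cmod (D3 s))
          = integral {x..pi} (\<lambda>s. cmod (D1 s) + cmod (D2 s) + cmod (D3 s))"
        by (simp add: integral_add integrable_add sub[OF dU'] sub[OF dW'] sub[OF dY'])
      also have "\<dots> \<le> integral {x..pi} (\<lambda>s. k s * \<phi> s)"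
      proof (rule integral_le)
        show "(\<lambda>s. k s * \<phi> s) integrable_on {x..pi}"
          using x by (intro integrable_on_subinterval[OF set_lebesgue_integral_eq_integral(1)[OF absolutely_integrable_mult_continuous[OF k_ai \<phi>c]]]) auto
      qed (auto intro!: integrable_add sub[OF dU'] sub[OF dW'] sub[OF dY'] n)
      finally show "\<phi> x \<le> \<phi> pi + integral {x..pi} (\<lambda>s. k s * \<phi> s)" by simp
    qed (auto simp: \<phi>_def)
    \<comment> \<open>The initial values \<open>U = W = 1\<close> and \<open>Y = 0\<close> supply
      the fixed positive quantity that bounds the data at \<open>pi\<close> from below.\<close>
    moreover have "\<phi> 0 = 2" by (simp add: \<phi>_def UW_0 Y_sol)
    ultimately have "1 \<le> \<phi> pi * exp (2 * integral {0..pi} k)" by simp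
    then have "exp (- 2 * integral {0..pi} k) * 1 \<le> exp (- 2 * integral {0..pi} k) * (\<phi> pi * exp (2 * integral {0..pi} k))"
      by (intro mult_left_mono) auto
    also have "\<dots> = \<phi> pi" by (simp add: mult.left_commute flip: exp_add)
    finally show ?thesis by (simp add: \<phi>_def)
  qed
  then show ?thesis by (intro exI[of _ "exp (- 2 * integral {0..pi} k)"]) auto
qed

text \<open>A common zero would make \<open>U\<close>, \<open>W\<close> and \<open>Y\<close> vanish
  at \<open>pi\<close> simultaneously, against the lower bound in the strip containing
  \<open>z\<close>. This later permits division by \<open>Y\<close> or by \<open>Y1\<close> at every
  point.\<close>

lemma Y_Y1_nonzero: "\<not> (Y z pi = 0 \<and> Y1 z pi = 0)"
proof
  assume "Y z pi = 0 \<and> Y1 z pi = 0"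
  then have "cmod (U z pi) + cmod (W z pi) + cmod (Y z pi) = 0" by (simp add: U_def W_def)
  then show False using strip_lower_bound[of "\<bar>Im z\<bar>"] by fastforce
qed

text \<open>The remainder estimate for a single exponential, whose norm on (-pi, pi) is bounded
  explicitly.\<close>

lemma \<kappa>_growth:
  "\<exists>C>0. \<forall>z. Im z \<noteq> 0 \<longrightarrow> cmod (\<kappa>u z pi) \<le> C * exp (pi * \<bar>Im z\<bar>) / sqrt \<bar>Im z\<bar> \<and>
     cmod (\<kappa>w z pi) \<le> C * exp (pi * \<bar>Im z\<bar>) / sqrt \<bar>Im z\<bar>"
proof -
  obtain C where C: "C > 0" "\<And>(F::unit set) c \<mu> N. finite F \<Longrightarrow> 0 < N \<Longrightarrow>
     integral {-pi..pi} (\<lambda>t. (cmod (\<Sum>j\<in>F. c j * exp (\<i> * \<mu> j * of_real t)))\<^sup>2) \<le> N\<^sup>2 \<Longrightarrow>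
     cmod (\<Sum>j\<in>F. c j * \<kappa>u (\<mu> j) pi) \<le> C * N \<and> cmod (\<Sum>j\<in>F. c j * \<kappa>w (\<mu> j) pi) \<le> C * N"
    using \<kappa>_functional_bound[where 'i=unit] by blast
  have "cmod (\<kappa>u z pi) \<le> C * exp (pi * \<bar>Im z\<bar>) / sqrt \<bar>Im z\<bar> \<and> cmod (\<kappa>w z pi) \<le> C * exp (pi * \<bar>Im z\<bar>) / sqrt \<bar>Im z\<bar>"
    if z: "Im z \<noteq> 0" for z
  proof -
    define N where "N = exp (pi * \<bar>Im z\<bar>) / sqrt \<bar>Im z\<bar>"
    have N: "0 < N" using z by (simp add: N_def)
    have "N\<^sup>2 = exp (2 * pi * \<bar>Im z\<bar>) / \<bar>Im z\<bar>"
      unfolding N_def by (simp add: power_divide power2_eq_square flip: exp_add)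
    then have "integral {-pi..pi} (\<lambda>t. (cmod (\<Sum>j\<in>{()}. 1 * exp (\<i> * z * of_real t)))\<^sup>2) \<le> N\<^sup>2"
      using exp_square_integral[OF z] by simp
    from C(2)[OF _ N this] show ?thesis by (simp add: N_def)
  qed
  then show ?thesis using C(1) by blast
qed

end

section \<open>Systems in semi-inner product spaces\<close>

text \<open>The linear laws are strict equalities and the form is only semidefinite: this describes
  \<open>L2\<close> before passing to classes modulo null functions. The same axioms serve for
  direct sums and for the scalars.\<close>

locale semi_ip =
  fixes X :: "('v :: ab_group_add) ip_space"
  assumes zero_closed: "0 \<in> carrier X"
    and add_closed: "f \<in> carrier X \<Longrightarrow> g \<in> carrier X \<Longrightarrow> f + g \<in> carrier X"
    and scale_closed: "f \<in> carrier X \<Longrightarrow> scale X c f \<in> carrier X"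
    and scale_add: "scale X c (f + g) = scale X c f + scale X c g"
    and add_scale: "scale X (c + d) f = scale X c f + scale X d f"
    and scale_scale: "scale X c (scale X d f) = scale X (c * d) f"
    and scale_one: "scale X 1 f = f"
    and ip_add: "f \<in> carrier X \<Longrightarrow> g \<in> carrier X \<Longrightarrow> h \<in> carrier X \<Longrightarrow> ip X f (g + h) = ip X f g + ip X f h"
    and ip_scale: "f \<in> carrier X \<Longrightarrow> g \<in> carrier X \<Longrightarrow> ip X f (scale X c g) = c * ip X f g"
    and ip_cnj: "f \<in> carrier X \<Longrightarrow> g \<in> carrier X \<Longrightarrow> ip X g f = cnj (ip X f g)"
    and ip_ge: "f \<in> carrier X \<Longrightarrow> 0 \<le> Re (ip X f f)"
begin

abbreviation N :: "'v \<Rightarrow> real" where "N \<equiv> hnorm X"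
abbreviation sc :: "complex \<Rightarrow> 'v \<Rightarrow> 'v" where "sc \<equiv> scale X"

lemma scale_zero_left: "sc 0 f = 0"
  using add_scale[of 0 0 f] by simp

lemma scale_zero_right: "sc c 0 = 0"
  using scale_add[of c 0 0] by simp

lemma scale_minus_one: "sc (-1) f = - f"
  using add_scale[of 1 "-1" f] by (simp add: scale_one scale_zero_left eq_neg_iff_add_eq_0 add.commute)

lemma scale_minus_left: "sc (- c) f = - sc c f"
  using scale_scale[of "-1" c f] by (simp add: scale_minus_one)

lemma scale_minus_right: "sc c (- f) = - sc c f"
proof -
  have "sc c (- f) = sc c (sc (-1) f)" by (simp only: scale_minus_one)
  also have "\<dots> = sc (- c) f" by (simp only: scale_scale) simp
  finally show ?thesis by (simp only: scale_minus_left)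
qed

lemma scale_diff: "sc c (f - g) = sc c f - sc c g"
  using scale_add[of c f "-g"] by (simp add: scale_minus_right)

lemma minus_closed: "f \<in> carrier X \<Longrightarrow> - f \<in> carrier X"
  using scale_closed[of f "-1"] by (simp add: scale_minus_one)

lemma diff_closed: "f \<in> carrier X \<Longrightarrow> g \<in> carrier X \<Longrightarrow> f - g \<in> carrier X"
  using add_closed[of f "-g"] minus_closed by simp

lemma sum_closed: "(\<And>i. i \<in> F \<Longrightarrow> x i \<in> carrier X) \<Longrightarrow> (\<Sum>i\<in>F. x i) \<in> carrier X"
  by (induction F rule: infinite_finite_induct) (auto intro: zero_closed add_closed)

lemma ip_add_left: "f \<in> carrier X \<Longrightarrow> g \<in> carrier X \<Longrightarrow> h \<in> carrier X \<Longrightarrow> ip X (g + h) f = ip X g f + ip X h f"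
  using ip_cnj[of f "g + h"] ip_cnj[of f g] ip_cnj[of f h] ip_add[of f g h] by (simp add: add_closed)

lemma ip_scale_left: "f \<in> carrier X \<Longrightarrow> g \<in> carrier X \<Longrightarrow> ip X (sc c g) f = cnj c * ip X g f"
  using ip_cnj[of f "sc c g"] ip_cnj[of f g] ip_scale[of f g c] by (simp add: scale_closed)

lemma ip_minus: "f \<in> carrier X \<Longrightarrow> g \<in> carrier X \<Longrightarrow> ip X f (- g) = - ip X f g"
  using ip_scale[of f g "-1"] by (simp add: scale_minus_one)

lemma ip_minus_left: "f \<in> carrier X \<Longrightarrow> g \<in> carrier X \<Longrightarrow> ip X (- g) f = - ip X g f"
  using ip_scale_left[of f g "-1"] by (simp add: scale_minus_one)

lemma ip_diff: "f \<in> carrier X \<Longrightarrow> g \<in> carrier X \<Longrightarrow> h \<in> carrier X \<Longrightarrow> ip X f (g - h) = ip X f g - ip X f h"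
  using ip_add[of f g "-h"] ip_minus[of f h] minus_closed by simp

lemma ip_diff_left: "f \<in> carrier X \<Longrightarrow> g \<in> carrier X \<Longrightarrow> h \<in> carrier X \<Longrightarrow> ip X (g - h) f = ip X g f - ip X h f"
  using ip_add_left[of f g "-h"] ip_minus_left[of f h] minus_closed by simp

lemma ip_self: "f \<in> carrier X \<Longrightarrow> ip X f f = of_real ((N f)\<^sup>2)"
  using ip_cnj[of f f] ip_ge[of f] by (simp add: hnorm_def complex_eq_iff)

lemma N_nonneg: "0 \<le> N f" if "f \<in> carrier X"
  using ip_ge[OF that] by (simp add: hnorm_def)

lemma Cauchy_Schwarz:
  assumes f: "f \<in> carrier X" and g: "g \<in> carrier X"
  shows "cmod (ip X f g) \<le> N f * N g"
proof -
  define \<gamma> where "\<gamma> = ip X f g"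
  have expand: "0 \<le> (N g)\<^sup>2 * t\<^sup>2 * (cmod \<gamma>)\<^sup>2 - 2 * t * (cmod \<gamma>)\<^sup>2 + (N f)\<^sup>2" for t :: real
  proof -
    define c where "c = of_real t * cnj \<gamma>"
    have "0 \<le> Re (ip X (f - sc c g) (f - sc c g))" by (intro ip_ge diff_closed scale_closed f g)
    also have "ip X (f - sc c g) (f - sc c g) = ip X f f - c * ip X f g - cnj c * (ip X g f - c * ip X g g)"
      using f g by (simp add: ip_diff ip_diff_left ip_scale ip_scale_left diff_closed scale_closed algebra_simps)
    also have "\<dots> = of_real ((N f)\<^sup>2) - of_real t * of_real ((cmod \<gamma>)\<^sup>2) - of_real t * of_real ((cmod \<gamma>)\<^sup>2)
        + of_real (t\<^sup>2) * of_real ((cmod \<gamma>)\<^sup>2) * of_real ((N g)\<^sup>2)"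
    proof -
      have gf: "ip X g f = cnj \<gamma>" using ip_cnj[OF f g] by (simp add: \<gamma>_def)
      have cc: "cnj \<gamma> * \<gamma> = of_real ((cmod \<gamma>)\<^sup>2)" using complex_norm_square[of \<gamma>] by (simp add: mult.commute)
      have "ip X f f - c * ip X f g - cnj c * (ip X g f - c * ip X g g)
          = ip X f f - of_real t * (cnj \<gamma> * \<gamma>) - of_real t * (cnj \<gamma> * \<gamma>) + of_real t * of_real t * (cnj \<gamma> * \<gamma>) * ip X g g"
        unfolding gf c_def \<gamma>_def[symmetric] by (simp add: algebra_simps)
      then show ?thesis unfolding cc ip_self[OF f] ip_self[OF g] by (simp add: power2_eq_square)
    qed
    also have "Re \<dots> = (N g)\<^sup>2 * t\<^sup>2 * (cmod \<gamma>)\<^sup>2 - 2 * t * (cmod \<gamma>)\<^sup>2 + (N f)\<^sup>2"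
      by (simp add: algebra_simps flip: of_real_mult of_real_add of_real_diff)
    finally show ?thesis .
  qed
  have "(cmod \<gamma>)\<^sup>2 \<le> (N f * N g)\<^sup>2"
  proof (cases "cmod \<gamma> = 0")
    case False
    then have \<gamma>: "0 < (cmod \<gamma>)\<^sup>2" by simp
    show ?thesis
    proof (cases "N g = 0")
      case True
      \<comment> \<open>With \<open>N g = 0\<close> the quadratic degenerates to a linear function
        of \<open>t\<close>, and this \<open>t\<close> gives it the value -1.\<close>
      from expand[of "((N f)\<^sup>2 + 1) / (2 * (cmod \<gamma>)\<^sup>2)"] True \<gamma> show ?thesis by simp
    next
      case False
      then have g0: "0 < (N g)\<^sup>2" by simp
      have "(N g)\<^sup>2 * (1 / (N g)\<^sup>2)\<^sup>2 = 1 / (N g)\<^sup>2" using False by (simp add: power2_eq_square)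
      with expand[of "1 / (N g)\<^sup>2"] have "0 \<le> (N f)\<^sup>2 - (cmod \<gamma>)\<^sup>2 / (N g)\<^sup>2" by simp
      then show ?thesis using g0 by (simp add: field_simps power_mult_distrib)
    qed
  qed simp
  then show ?thesis
    unfolding \<gamma>_def[symmetric] by (rule power2_le_imp_le) (intro mult_nonneg_nonneg N_nonneg f g)
qed

lemma N_add_sq:
  "f \<in> carrier X \<Longrightarrow> g \<in> carrier X \<Longrightarrow> (N (f + g))\<^sup>2 = (N f)\<^sup>2 + 2 * Re (ip X f g) + (N g)\<^sup>2"
proof -
  assume f: "f \<in> carrier X" and g: "g \<in> carrier X"
  have "ip X (f + g) (f + g) = ip X f f + (ip X f g + cnj (ip X f g)) + ip X g g"
    using f g ip_cnj[OF f g] by (simp add: ip_add ip_add_left add_closed)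
  then have "complex_of_real ((N (f + g))\<^sup>2) = of_real ((N f)\<^sup>2) + (ip X f g + cnj (ip X f g)) + of_real ((N g)\<^sup>2)"
    by (simp only: ip_self f g add_closed)
  then have "Re (complex_of_real ((N (f + g))\<^sup>2)) = Re (of_real ((N f)\<^sup>2) + (ip X f g + cnj (ip X f g)) + of_real ((N g)\<^sup>2))" by simp
  then show ?thesis by (simp del: of_real_power)
qed

lemma N_triangle: "f \<in> carrier X \<Longrightarrow> g \<in> carrier X \<Longrightarrow> N (f + g) \<le> N f + N g"
proof -
  assume f: "f \<in> carrier X" and g: "g \<in> carrier X"
  have "(N (f + g))\<^sup>2 \<le> (N f + N g)\<^sup>2"
    using N_add_sq[OF f g] Cauchy_Schwarz[OF f g] complex_Re_le_cmod[of "ip X f g"]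
    by (simp add: power2_sum)
  then show ?thesis by (rule power2_le_imp_le) (intro add_nonneg_nonneg N_nonneg f g)
qed

lemma N_scale: "f \<in> carrier X \<Longrightarrow> N (sc c f) = cmod c * N f"
proof -
  assume f: "f \<in> carrier X"
  have "ip X (sc c f) (sc c f) = of_real ((cmod c)\<^sup>2) * ip X f f"
    using f complex_norm_square[of c] by (simp add: ip_scale ip_scale_left scale_closed mult.commute mult.left_commute)
  then show ?thesis using ip_ge[OF f] by (simp add: hnorm_def real_sqrt_mult)
qed

lemma N_zero: "N 0 = 0"
  using N_scale[OF zero_closed, of 0] by (simp add: scale_zero_left)

lemma N_minus: "f \<in> carrier X \<Longrightarrow> N (- f) = N f"
  using N_scale[of f "-1"] by (simp add: scale_minus_one)

lemma N_diff_triangle: "f \<in> carrier X \<Longrightarrow> g \<in> carrier X \<Longrightarrow> N (f - g) \<le> N f + N g"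
  using N_triangle[of f "-g"] N_minus minus_closed by simp

lemma N_diff_commute: "f \<in> carrier X \<Longrightarrow> g \<in> carrier X \<Longrightarrow> N (f - g) = N (g - f)"
  using N_minus[of "f - g"] diff_closed by simp

lemma N_triangle_sub: "f \<in> carrier X \<Longrightarrow> g \<in> carrier X \<Longrightarrow> N f \<le> N g + N (f - g)"
  using N_triangle[of g "f - g"] diff_closed by simp

lemma N_sum_le: "(\<And>i. i \<in> F \<Longrightarrow> x i \<in> carrier X) \<Longrightarrow> N (\<Sum>i\<in>F. x i) \<le> (\<Sum>i\<in>F. N (x i))"
proof (induction F rule: infinite_finite_induct)
  case (insert j F)
  have "N (x j + (\<Sum>i\<in>F. x i)) \<le> N (x j) + N (\<Sum>i\<in>F. x i)"
    using insert by (intro N_triangle sum_closed) auto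
  then show ?case using insert by simp
qed (auto simp: N_zero)

lemma parallelogram:
  assumes f: "f \<in> carrier X" and g: "g \<in> carrier X"
  shows "(N (f + g))\<^sup>2 + (N (f - g))\<^sup>2 = 2 * (N f)\<^sup>2 + 2 * (N g)\<^sup>2"
  using N_add_sq[OF f g] N_add_sq[OF f minus_closed[OF g]] by (simp add: ip_minus f g N_minus)

abbreviation lc :: "('i \<Rightarrow> 'v) \<Rightarrow> ('i \<Rightarrow> complex) \<Rightarrow> 'i set \<Rightarrow> 'v" where "lc \<equiv> lincomb X"

lemma lc_closed: "(\<And>j. j \<in> F \<Longrightarrow> x j \<in> carrier X) \<Longrightarrow> lc x a F \<in> carrier X"
  unfolding lincomb_def by (intro sum_closed scale_closed)

lemma lc_add: "lc x (\<lambda>j. a j + b j) F = lc x a F + lc x b F"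
  by (simp add: lincomb_def add_scale sum.distrib)

lemma lc_scale: "lc x (\<lambda>j. c * a j) F = sc c (lc x a F)"
proof -
  have "sc c (\<Sum>j\<in>F. y j) = (\<Sum>j\<in>F. sc c (y j))" for y
    by (induction F rule: infinite_finite_induct) (auto simp: scale_zero_right scale_add)
  then show ?thesis by (simp add: lincomb_def scale_scale)
qed

lemma lc_minus: "lc x (\<lambda>j. - a j) F = - lc x a F"
  using lc_scale[of x "-1" a F] by (simp add: scale_minus_one)

lemma lc_diff: "lc x (\<lambda>j. a j - b j) F = lc x a F - lc x b F"
  using lc_add[of x a "\<lambda>j. - b j" F] by (simp add: lc_minus)

lemma lc_vec_add: "lc (\<lambda>j. x j + r j) a F = lc x a F + lc r a F"
  by (simp add: lincomb_def scale_add sum.distrib)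

lemma lc_mono_neutral: "finite G \<Longrightarrow> F \<subseteq> G \<Longrightarrow> (\<And>j. j \<in> G - F \<Longrightarrow> a j = 0) \<Longrightarrow> lc x a F = lc x a G"
  unfolding lincomb_def by (intro sum.mono_neutral_left) (auto simp: scale_zero_left)

lemma lc_cong: "(\<And>j. j \<in> F \<Longrightarrow> a j = b j) \<Longrightarrow> (\<And>j. j \<in> F \<Longrightarrow> x j = y j) \<Longrightarrow> lc x a F = lc y b F"
  unfolding lincomb_def by (intro sum.cong) auto

lemma lc_extend: "finite G \<Longrightarrow> F \<subseteq> G \<Longrightarrow> lc x a F = lc x (\<lambda>j. if j \<in> F then a j else 0) G"
  by (subst lc_mono_neutral[symmetric, of G F]) (auto intro: lc_cong)

lemma lc_insert: "finite F \<Longrightarrow> k \<notin> F \<Longrightarrow> lc x a (insert k F) = sc (a k) (x k) + lc x a F"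
  by (simp add: lincomb_def)

lemma lc_remove: "finite F \<Longrightarrow> k \<in> F \<Longrightarrow> lc x a F = sc (a k) (x k) + lc x a (F - {k})"
  unfolding lincomb_def by (rule sum.remove)

lemma N_lc_le: "(\<And>j. j \<in> F \<Longrightarrow> r j \<in> carrier X) \<Longrightarrow> N (lc r a F) \<le> L2_set (\<lambda>j. cmod (a j)) F * L2_set (\<lambda>j. N (r j)) F"
proof -
  assume r: "\<And>j. j \<in> F \<Longrightarrow> r j \<in> carrier X"
  have "N (lc r a F) \<le> (\<Sum>j\<in>F. N (sc (a j) (r j)))"
    unfolding lincomb_def by (intro N_sum_le scale_closed r)
  also have "\<dots> = (\<Sum>j\<in>F. \<bar>cmod (a j)\<bar> * \<bar>N (r j)\<bar>)"
    using r by (intro sum.cong) (auto simp: N_scale N_nonneg)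
  also have "\<dots> \<le> L2_set (\<lambda>j. cmod (a j)) F * L2_set (\<lambda>j. N (r j)) F" by (rule L2_set_mult_ineq)
  finally show ?thesis .
qed

section \<open>Closed spans, completeness and bounded functionals\<close>

definition in_closed_span :: "('i \<Rightarrow> 'v) \<Rightarrow> 'i set \<Rightarrow> 'v \<Rightarrow> bool" where
  "in_closed_span z K f \<longleftrightarrow> (\<forall>\<epsilon>>0. \<exists>F a. finite F \<and> F \<subseteq> K \<and> N (f - lc z a F) < \<epsilon>)"

lemma complete_system_iff:
  "complete_system X K z \<longleftrightarrow> (\<forall>j\<in>K. z j \<in> carrier X) \<and> (\<forall>f\<in>carrier X. in_closed_span z K f)"
  by (simp add: complete_system_def in_closed_span_def)

lemma in_closed_span_member: "k \<in> K \<Longrightarrow> in_closed_span z K (z k)"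
  unfolding in_closed_span_def
  by (intro allI impI exI[of _ "{k}"] exI[of _ "\<lambda>_. 1"]) (simp add: lincomb_def scale_one N_zero)

lemma in_closed_span_scale:
  assumes f: "f \<in> carrier X" "in_closed_span z K f" and z: "\<And>k. k \<in> K \<Longrightarrow> z k \<in> carrier X"
  shows "in_closed_span z K (sc c f)"
  unfolding in_closed_span_def
proof (intro allI impI)
  fix \<epsilon> :: real assume "\<epsilon> > 0"
  then have "\<epsilon> / (cmod c + 1) > 0" by (simp add: add_nonneg_pos)
  then obtain F a where F: "finite F" "F \<subseteq> K" "N (f - lc z a F) < \<epsilon> / (cmod c + 1)"
    using f(2) unfolding in_closed_span_def by blast
  have cl: "f - lc z a F \<in> carrier X" using F z by (intro diff_closed f lc_closed) auto
  have "N (sc c f - lc z (\<lambda>j. c * a j) F) = cmod c * N (f - lc z a F)"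
    using N_scale[OF cl, of c] by (simp add: lc_scale scale_diff)
  also have "\<dots> \<le> (cmod c + 1) * N (f - lc z a F)" using N_nonneg[OF cl] by (intro mult_right_mono) auto
  also have "\<dots> < \<epsilon>" using F(3) by (simp add: pos_less_divide_eq add_nonneg_pos mult.commute)
  finally show "\<exists>F a. finite F \<and> F \<subseteq> K \<and> N (sc c f - lc z a F) < \<epsilon>" using F by blast
qed

lemma in_closed_span_add:
  assumes f: "f \<in> carrier X" "in_closed_span z K f" and g: "g \<in> carrier X" "in_closed_span z K g"
    and z: "\<And>k. k \<in> K \<Longrightarrow> z k \<in> carrier X"
  shows "in_closed_span z K (f + g)"
  unfolding in_closed_span_def
proof (intro allI impI)
  fix \<epsilon> :: real assume "\<epsilon> > 0"
  then have e2: "\<epsilon> / 2 > 0" by simp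
  obtain F a where F: "finite F" "F \<subseteq> K" "N (f - lc z a F) < \<epsilon> / 2"
    using f(2) e2 unfolding in_closed_span_def by blast
  obtain G b where G: "finite G" "G \<subseteq> K" "N (g - lc z b G) < \<epsilon> / 2"
    using g(2) e2 unfolding in_closed_span_def by blast
  define a' where "a' j = (if j \<in> F then a j else 0)" for j
  define b' where "b' j = (if j \<in> G then b j else 0)" for j
  have "lc z a F = lc z a' (F \<union> G)" "lc z b G = lc z b' (F \<union> G)"
    unfolding a'_def b'_def using F G by (auto intro!: lc_extend)
  then have "f + g - lc z (\<lambda>j. a' j + b' j) (F \<union> G) = (f - lc z a F) + (g - lc z b G)"
    by (simp add: lc_add algebra_simps)
  also have "N \<dots> \<le> N (f - lc z a F) + N (g - lc z b G)"
    using F G z by (intro N_triangle diff_closed f g lc_closed) auto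
  also have "\<dots> < \<epsilon>" using F G by simp
  finally show "\<exists>F a. finite F \<and> F \<subseteq> K \<and> N (f + g - lc z a F) < \<epsilon>"
    using F G by (intro exI[of _ "F \<union> G"] exI[of _ "\<lambda>j. a' j + b' j"]) auto
qed

lemma in_closed_span_zero: "in_closed_span z K 0"
  unfolding in_closed_span_def by (intro allI impI exI[of _ "{}"]) (simp add: lincomb_def N_zero)

lemma in_closed_span_lc:
  assumes "finite F" "\<And>j. j \<in> F \<Longrightarrow> y j \<in> carrier X \<and> in_closed_span z K (y j)" "\<And>k. k \<in> K \<Longrightarrow> z k \<in> carrier X"
  shows "in_closed_span z K (lc y a F)"
  using assms(1,2)
proof (induction F)
  case empty
  then show ?case by (simp add: lincomb_def in_closed_span_zero)
next
  case (insert j F)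
  have "in_closed_span z K (sc (a j) (y j) + lc y a F)"
    using insert assms(3) by (intro in_closed_span_add in_closed_span_scale scale_closed lc_closed) auto
  then show ?case using insert by (simp add: lc_insert)
qed

lemma in_closed_span_limit:
  assumes f: "f \<in> carrier X" and z: "\<And>k. k \<in> K \<Longrightarrow> z k \<in> carrier X"
    and "\<And>\<epsilon>. \<epsilon> > 0 \<Longrightarrow> \<exists>g\<in>carrier X. in_closed_span z K g \<and> N (f - g) < \<epsilon>"
  shows "in_closed_span z K f"
  unfolding in_closed_span_def
proof (intro allI impI)
  fix \<epsilon> :: real assume "\<epsilon> > 0"
  then have e2: "\<epsilon> / 2 > 0" by simp
  obtain g where g: "g \<in> carrier X" "in_closed_span z K g" "N (f - g) < \<epsilon> / 2" using assms(3)[OF e2] by blast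
  obtain F a where F: "finite F" "F \<subseteq> K" "N (g - lc z a F) < \<epsilon> / 2"
    using g(2) e2 unfolding in_closed_span_def by blast
  have cl: "lc z a F \<in> carrier X" using F z by (intro lc_closed) auto
  have "N ((f - g) + (g - lc z a F)) \<le> N (f - g) + N (g - lc z a F)"
    by (intro N_triangle diff_closed f g cl)
  then have "N (f - lc z a F) < \<epsilon>" using g(3) F(3) by simp
  then show "\<exists>F a. finite F \<and> F \<subseteq> K \<and> N (f - lc z a F) < \<epsilon>" using F by blast
qed

lemma complete_system_trans:
  assumes c: "complete_system X K y" and z: "\<And>k. k \<in> K' \<Longrightarrow> z k \<in> carrier X"
    and y: "\<And>k. k \<in> K \<Longrightarrow> in_closed_span z K' (y k)"
  shows "complete_system X K' z"
  unfolding complete_system_iff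
proof (intro conjI ballI z)
  fix f assume f: "f \<in> carrier X"
  show "in_closed_span z K' f"
  proof (rule in_closed_span_limit[OF f z])
    fix \<epsilon> :: real assume "\<epsilon> > 0"
    then obtain F a where F: "finite F" "F \<subseteq> K" "N (f - lc y a F) < \<epsilon>"
      using c f unfolding complete_system_iff in_closed_span_def by blast
    have yc: "y j \<in> carrier X" if "j \<in> K" for j using c that by (auto simp: complete_system_iff)
    have "in_closed_span z K' (lc y a F)" using F y yc z by (intro in_closed_span_lc) auto
    then show "\<exists>g\<in>carrier X. in_closed_span z K' g \<and> N (f - g) < \<epsilon>"
      using F yc by (intro bexI[of _ "lc y a F"] lc_closed) auto
  qed auto
qed

definition bounded_functional :: "('v \<Rightarrow> complex) \<Rightarrow> bool" where
  "bounded_functional L \<longleftrightarrow>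
     (\<forall>f\<in>carrier X. \<forall>g\<in>carrier X. L (f + g) = L f + L g) \<and>
     (\<forall>c. \<forall>f\<in>carrier X. L (sc c f) = c * L f) \<and>
     (\<exists>K\<ge>0. \<forall>f\<in>carrier X. cmod (L f) \<le> K * N f)"

text \<open>No completeness of the space is needed: a vector at positive distance \<open>d\<close> from the span is
  separated by \<open>h \<mapsto> lim ip (g n) h\<close>, where \<open>g n\<close> is the Cauchy sequence of differences between the
  vector and a minimizing sequence.\<close>

theorem complete_system_functional:
  assumes x: "\<And>j. j \<in> J \<Longrightarrow> x j \<in> carrier X"
    and L: "\<And>L f. bounded_functional L \<Longrightarrow> (\<And>j. j \<in> J \<Longrightarrow> L (x j) = 0) \<Longrightarrow> f \<in> carrier X \<Longrightarrow> L f = 0"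
  shows "complete_system X J x"
proof (rule ccontr)
  assume "\<not> complete_system X J x"
  then obtain f \<epsilon> where f: "f \<in> carrier X" and \<epsilon>: "\<epsilon> > 0"
    and far: "\<And>F a. finite F \<Longrightarrow> F \<subseteq> J \<Longrightarrow> \<epsilon> \<le> N (f - lc x a F)"
    using x unfolding complete_system_iff in_closed_span_def by (auto simp: not_less)
  define M where "M = {lc x a F | F a. finite F \<and> F \<subseteq> J}"
  have Mc: "m \<in> carrier X" if "m \<in> M" for m using that x by (auto simp: M_def intro!: lc_closed)
  have M0: "0 \<in> M" unfolding M_def by (auto intro!: exI[of _ "{}"] simp: lincomb_def)
  have Madd: "m + m' \<in> M" if m: "m \<in> M" "m' \<in> M" for m m'
  proof -
    obtain F a G b where F: "finite F" "F \<subseteq> J" "m = lc x a F" and G: "finite G" "G \<subseteq> J" "m' = lc x b G"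
      using m by (auto simp: M_def)
    define a' where "a' j = (if j \<in> F then a j else 0)" for j
    define b' where "b' j = (if j \<in> G then b j else 0)" for j
    have "m = lc x a' (F \<union> G)" "m' = lc x b' (F \<union> G)"
      unfolding a'_def b'_def using F G by (auto intro!: lc_extend)
    then have "m + m' = lc x (\<lambda>j. a' j + b' j) (F \<union> G)" by (simp add: lc_add)
    then show ?thesis unfolding M_def using F G by blast
  qed
  have Msc: "sc c m \<in> M" if mM: "m \<in> M" for m c
  proof -
    obtain F a where "finite F" "F \<subseteq> J" "m = lc x a F" using mM by (auto simp: M_def)
    then show ?thesis unfolding M_def by (intro CollectI exI[of _ F] exI[of _ "\<lambda>j. c * a j"]) (simp add: lc_scale)
  qed
  have dM: "\<epsilon> \<le> N (f - m)" if "m \<in> M" for m using that far by (auto simp: M_def)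
  define D where "D = {N (f - m) | m. m \<in> M}"
  define d where "d = Inf D"
  have bD: "bdd_below D" using dM by (auto simp: D_def bdd_below_def)
  have neD: "D \<noteq> {}" using M0 by (auto simp: D_def)
  have d\<epsilon>: "\<epsilon> \<le> d" unfolding d_def using dM by (intro cInf_greatest neD) (auto simp: D_def)
  have d0: "0 < d" using \<epsilon> d\<epsilon> by simp
  have dle: "d \<le> N (f - m)" if "m \<in> M" for m unfolding d_def using that by (intro cInf_lower bD) (auto simp: D_def)
  have "\<exists>m\<in>M. N (f - m) < d + 1 / (real n + 1)" for n
  proof -
    have "Inf D < d + 1 / (real n + 1)" by (simp add: d_def add_nonneg_pos)
    then obtain s where "s \<in> D" "s < d + 1 / (real n + 1)" using cInf_lessD[OF neD] by blast
    then show ?thesis by (auto simp: D_def)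
  qed
  then obtain m where m: "\<And>n. m n \<in> M" "\<And>n. N (f - m n) < d + 1 / (real n + 1)" by metis
  define g where "g n = f - m n" for n
  have gc: "g n \<in> carrier X" for n unfolding g_def by (intro diff_closed f Mc m)
  \<comment> \<open>The excess of \<open>(N (g n))^2\<close> over \<open>d^2\<close> is at most
    \<open>q n\<close>, which tends to 0. It controls both the Cauchy differences and the failure of
    orthogonality.\<close>
  define q where "q n = 2 * d / (real n + 1) + (1 / (real n + 1))\<^sup>2" for n :: nat
  have gq: "(N (g n))\<^sup>2 \<le> d\<^sup>2 + q n" for n
  proof -
    have "(N (g n))\<^sup>2 \<le> (d + 1 / (real n + 1))\<^sup>2"
      using m(2)[of n] N_nonneg[OF gc] unfolding g_def[symmetric] by (intro power_mono) auto
    also have "\<dots> = d\<^sup>2 + q n" by (simp add: q_def power2_sum)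
    finally show ?thesis .
  qed
  have q0: "q \<longlonglongrightarrow> 0"
  proof -
    have "(\<lambda>n. 1 / (real n + 1)) \<longlonglongrightarrow> 0" using LIMSEQ_inverse_real_of_nat by (simp add: inverse_eq_divide add.commute)
    then have "(\<lambda>n. 2 * d * (1 / (real n + 1)) + (1 / (real n + 1))\<^sup>2) \<longlonglongrightarrow> 2 * d * 0 + 0\<^sup>2" by (intro tendsto_intros)
    then show ?thesis by (simp add: q_def[abs_def])
  qed
  \<comment> \<open>Parallelogram law: half of \<open>g n + g k\<close> is \<open>f\<close> minus an
    element of the span, so its norm is at least \<open>d\<close>.\<close>
  have gd: "(N (g n - g k))\<^sup>2 \<le> 2 * q n + 2 * q k" for n k
  proof -
    have "g n + g k = sc 2 (f - sc (1/2) (m n + m k))"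
      unfolding g_def scale_diff scale_scale using add_scale[of 1 1 f] by (simp add: scale_one algebra_simps)
    then have "N (g n + g k) = 2 * N (f - sc (1/2) (m n + m k))"
      using N_scale[of "f - sc (1/2) (m n + m k)" 2] by (simp add: diff_closed f Mc Msc Madd m)
    also have "\<dots> \<ge> 2 * d" using dle[OF Msc[OF Madd[OF m(1) m(1)]]] by simp
    finally have "(2 * d)\<^sup>2 \<le> (N (g n + g k))\<^sup>2" using d0 by (intro power_mono) auto
    then show ?thesis using parallelogram[OF gc gc, of n k] gq[of n] gq[of k] by (simp add: power_mult_distrib)
  qed
  have conv: "convergent (\<lambda>n. ip X (g n) h)" if h: "h \<in> carrier X" for h
  proof (rule Cauchy_convergent, rule metric_CauchyI)
    fix e :: real assume e: "e > 0"
    define e' where "e' = (e / (N h + 1))\<^sup>2 / 4"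
    have Nh: "0 < N h + 1" using N_nonneg[OF h] by simp
    have e': "e' > 0" using e Nh by (simp add: e'_def)
    obtain n0 where n0: "\<And>n. n \<ge> n0 \<Longrightarrow> q n < e'" using order_tendstoD(2)[OF q0 e'] by (auto simp: eventually_sequentially)
    have "dist (ip X (g n) h) (ip X (g k) h) < e" if "n \<ge> n0" "k \<ge> n0" for n k
    proof -
      have "(N (g n - g k))\<^sup>2 < (e / (N h + 1))\<^sup>2" using gd[of n k] n0[OF that(1)] n0[OF that(2)] by (simp add: e'_def)
      then have l: "N (g n - g k) < e / (N h + 1)" by (rule power_less_imp_less_base) (use e Nh in auto)
      have "dist (ip X (g n) h) (ip X (g k) h) = cmod (ip X (g n - g k) h)"
        by (simp add: dist_norm ip_diff_left h gc)
      also have "\<dots> \<le> N (g n - g k) * N h" by (intro Cauchy_Schwarz diff_closed gc h)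
      also have "\<dots> \<le> N (g n - g k) * (N h + 1)" by (intro mult_left_mono N_nonneg diff_closed gc) auto
      also have "\<dots> < e" using l Nh by (simp add: pos_less_divide_eq)
      finally show ?thesis .
    qed
    then show "\<exists>n0. \<forall>n\<ge>n0. \<forall>k\<ge>n0. dist (ip X (g n) h) (ip X (g k) h) < e" by blast
  qed
  define L where "L h = lim (\<lambda>n. ip X (g n) h)" for h
  have Llim: "(\<lambda>n. ip X (g n) h) \<longlonglongrightarrow> L h" if "h \<in> carrier X" for h
    unfolding L_def using conv[OF that] by (simp add: convergent_LIMSEQ_iff)
  have gb: "N (g n) \<le> d + 1" for n
  proof -
    have "1 / (real n + 1) \<le> 1" by simp
    then show ?thesis using m(2)[of n] unfolding g_def by linarith
  qed
  have bf: "bounded_functional L"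
    unfolding bounded_functional_def
  proof (intro conjI ballI allI)
    fix h h' assume h: "h \<in> carrier X" "h' \<in> carrier X"
    have "(\<lambda>n. ip X (g n) (h + h')) \<longlonglongrightarrow> L h + L h'"
      using tendsto_add[OF Llim[OF h(1)] Llim[OF h(2)]] by (simp add: ip_add gc h)
    then show "L (h + h') = L h + L h'" using Llim[OF add_closed[OF h]] LIMSEQ_unique by blast
  next
    fix c h assume h: "h \<in> carrier X"
    have "(\<lambda>n. ip X (g n) (sc c h)) \<longlonglongrightarrow> c * L h"
      using tendsto_mult_left[OF Llim[OF h], of c] by (simp add: ip_scale gc h)
    then show "L (sc c h) = c * L h" using Llim[OF scale_closed[OF h]] LIMSEQ_unique by blast
  next
    have "cmod (L h) \<le> (d + 1) * N h" if h: "h \<in> carrier X" for h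
    proof (rule tendsto_upperbound[OF tendsto_norm[OF Llim[OF h]]])
      have "cmod (ip X (g n) h) \<le> (d + 1) * N h" for n
        by (rule order.trans[OF Cauchy_Schwarz[OF gc h] mult_right_mono[OF gb N_nonneg[OF h]]])
      then show "\<forall>\<^sub>F n in sequentially. cmod (ip X (g n) h) \<le> (d + 1) * N h" by simp
    qed simp
    then show "\<exists>K\<ge>0. \<forall>f\<in>carrier X. cmod (L f) \<le> K * N f" using d0 by (intro exI[of _ "d + 1"]) auto
  qed
  \<comment> \<open>Near orthogonality: moving \<open>m n\<close> by the best multiple of
    \<open>h\<close> would lower the squared distance by
    \<open>(cmod (ip X (g n) h))^2 / (N h)^2\<close>, yet cannot bring it below
    \<open>d^2\<close>.\<close>
  have orth: "(cmod (ip X (g n) h))\<^sup>2 \<le> q n * (N h)\<^sup>2" if h: "h \<in> M" for n h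
  proof (cases "N h = 0")
    case True
    then show ?thesis using Cauchy_Schwarz[OF gc[of n] Mc[OF h]] by simp
  next
    case False
    have hc: "h \<in> carrier X" by (rule Mc[OF h])
    define \<gamma> where "\<gamma> = ip X (g n) h"
    define t where "t = - cnj \<gamma> / of_real ((N h)\<^sup>2)"
    have "m n + sc (- t) h \<in> M" by (intro Madd m Msc h)
    then have "d \<le> N (f - (m n + sc (- t) h))" by (rule dle)
    also have "f - (m n + sc (- t) h) = g n + sc t h" by (simp add: g_def scale_minus_left)
    finally have "d\<^sup>2 \<le> (N (g n + sc t h))\<^sup>2" using d0 by (intro power_mono) auto
    also have "\<dots> = (N (g n))\<^sup>2 + 2 * Re (t * \<gamma>) + (cmod t * N h)\<^sup>2"
      by (simp add: N_add_sq gc hc scale_closed ip_scale N_scale \<gamma>_def)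
    also have "t * \<gamma> = of_real (- (cmod \<gamma>)\<^sup>2 / (N h)\<^sup>2)"
      using complex_norm_square[of \<gamma>] by (simp add: t_def mult.commute)
    also have "(cmod t * N h)\<^sup>2 = (cmod \<gamma>)\<^sup>2 / (N h)\<^sup>2"
    proof -
      have "cmod t = cmod \<gamma> / \<bar>(N h)\<^sup>2\<bar>"
        by (simp only: t_def norm_divide norm_minus_cancel complex_mod_cnj norm_of_real)
      then have "cmod t = cmod \<gamma> / (N h)\<^sup>2" by simp
      then show ?thesis using False by (simp add: field_simps power2_eq_square)
    qed
    finally have "(cmod \<gamma>)\<^sup>2 / (N h)\<^sup>2 \<le> (N (g n))\<^sup>2 - d\<^sup>2" by simp
    also have "\<dots> \<le> q n" using gq[of n] by simp
    finally show ?thesis using False by (simp add: \<gamma>_def pos_divide_le_eq)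
  qed
  have sq0: "s \<longlonglongrightarrow> 0" if s: "\<And>n. (cmod (s n))\<^sup>2 \<le> q n * C" for s :: "nat \<Rightarrow> complex" and C
  proof -
    have "(\<lambda>n. (cmod (s n))\<^sup>2) \<longlonglongrightarrow> 0"
    proof (rule tendsto_sandwich[OF _ _ tendsto_const])
      show "(\<lambda>n. q n * C) \<longlonglongrightarrow> 0" using tendsto_mult_left_zero[OF q0] .
    qed (use s in auto)
    then have "(\<lambda>n. sqrt ((cmod (s n))\<^sup>2)) \<longlonglongrightarrow> sqrt 0" by (intro tendsto_real_sqrt)
    then show ?thesis by (simp add: tendsto_norm_zero_iff)
  qed
  have "L (x j) = 0" if "j \<in> J" for j
  proof -
    have "x j \<in> M" unfolding M_def using that
      by (auto intro!: exI[of _ "{j}"] exI[of _ "\<lambda>_. 1"] simp: lincomb_def scale_one)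
    from sq0[OF orth[OF this]] Llim[OF x[OF that]] show ?thesis using LIMSEQ_unique by blast
  qed
  from L[OF bf this f] have "L f = 0" .
  \<comment> \<open>Since \<open>f = m n + g n\<close>, vanishing of this limit makes
    \<open>L f\<close> the limit of \<open>(N (g n))^2\<close>, which is at least
    \<open>d^2\<close>. Near orthogonality is applied to the varying element \<open>m n\<close>,
    whose norm stays bounded.\<close>
  have "(\<lambda>n. ip X (g n) (m n)) \<longlonglongrightarrow> 0"
  proof (rule sq0)
    fix n
    have "N (m n) \<le> N f + N (g n)" using N_diff_triangle[OF f gc, of n] by (simp add: g_def)
    also have "\<dots> \<le> N f + (d + 1)" using gb by simp
    finally have "(N (m n))\<^sup>2 \<le> (N f + (d + 1))\<^sup>2" using N_nonneg[OF Mc[OF m(1)]] by (intro power_mono) auto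
    moreover have "0 \<le> q n" using d0 by (simp add: q_def)
    ultimately show "(cmod (ip X (g n) (m n)))\<^sup>2 \<le> q n * (N f + (d + 1))\<^sup>2"
      using orth[OF m(1)[of n], of n] by (meson mult_left_mono order.trans)
  qed
  moreover have "ip X (g n) f = ip X (g n) (m n) + of_real ((N (g n))\<^sup>2)" for n
  proof -
    have "f = m n + g n" by (simp add: g_def)
    then have "ip X (g n) f = ip X (g n) (m n + g n)" by simp
    then show ?thesis by (simp add: ip_add gc Mc m ip_self)
  qed
  ultimately have "(\<lambda>n. ip X (g n) f - ip X (g n) (m n)) \<longlonglongrightarrow> 0" using Llim[OF f] \<open>L f = 0\<close> tendsto_diff by fastforce
  then have "(\<lambda>n. complex_of_real ((N (g n))\<^sup>2)) \<longlonglongrightarrow> 0" using \<open>\<And>n. ip X (g n) f = _\<close> by simp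
  from tendsto_Re[OF this] have "(\<lambda>n. (N (g n))\<^sup>2) \<longlonglongrightarrow> 0" by (simp only: Re_complex_of_real zero_complex.sel)
  then have "\<forall>\<^sub>F n in sequentially. (N (g n))\<^sup>2 < d\<^sup>2"
    by (rule order_tendstoD(2)) (use d0 in simp)
  then obtain n where "(N (g n))\<^sup>2 < d\<^sup>2" using eventually_happens'[OF sequentially_bot] by blast
  moreover have "d\<^sup>2 \<le> (N (g n))\<^sup>2" using dle[OF m(1)] d0 by (intro power_mono) (auto simp: g_def)
  ultimately show False by simp
qed

section \<open>Riesz bounds and bases\<close>

abbreviation l2 :: "('i \<Rightarrow> complex) \<Rightarrow> 'i set \<Rightarrow> real" where "l2 a F \<equiv> L2_set (\<lambda>j. cmod (a j)) F"

text \<open>Completeness together with the lower and the upper bound is the coordinate form of the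
  Riesz property; perturbation is carried out in it, without the operators of
  \<open>riesz_basis\<close>.\<close>

definition lower_riesz :: "'i set \<Rightarrow> ('i \<Rightarrow> 'v) \<Rightarrow> real \<Rightarrow> bool" where
  "lower_riesz K z c \<longleftrightarrow> (\<forall>F a. finite F \<and> F \<subseteq> K \<longrightarrow> c * l2 a F \<le> N (lc z a F))"

definition upper_riesz :: "'i set \<Rightarrow> ('i \<Rightarrow> 'v) \<Rightarrow> real \<Rightarrow> bool" where
  "upper_riesz K z C \<longleftrightarrow> (\<forall>F a. finite F \<and> F \<subseteq> K \<longrightarrow> N (lc z a F) \<le> C * l2 a F)"

lemma N_zero_cong:
  assumes "f \<in> carrier X" "g \<in> carrier X" "N (f - g) = 0"
  shows "N f = N g"
  using N_triangle_sub[OF assms(1,2)] N_triangle_sub[OF assms(2,1)] N_diff_commute[OF assms(1,2)] assms(3) by linarith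

lemma N_orthonormal:
  assumes e: "\<And>j. j \<in> F \<Longrightarrow> e j \<in> carrier X" and "finite F"
    and on: "\<And>i j. i \<in> F \<Longrightarrow> j \<in> F \<Longrightarrow> ip X (e i) (e j) = (if i = j then 1 else 0)"
  shows "N (lc e a F) = l2 a F"
proof -
  have ips: "ip X f (lc e b G) = (\<Sum>j\<in>G. b j * ip X f (e j))" if "f \<in> carrier X" "finite G" "G \<subseteq> F" for f b G
    using that(2,3)
  proof (induction G)
    case empty
    then show ?case using ip_scale[OF that(1) zero_closed, of 0] by (simp add: lincomb_def scale_zero_left)
  next
    case (insert k G)
    have "ip X f (sc (b k) (e k) + lc e b G) = ip X f (sc (b k) (e k)) + ip X f (lc e b G)"
      using insert e by (intro ip_add that scale_closed lc_closed) auto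
    then show ?case using insert e that by (simp add: lc_insert ip_scale subset_iff)
  qed
  have c: "lc e a F \<in> carrier X" by (intro lc_closed e)
  have "ip X (lc e a F) (lc e a F) = (\<Sum>j\<in>F. a j * ip X (lc e a F) (e j))" by (rule ips) (use assms c in auto)
  also have "\<dots> = (\<Sum>j\<in>F. a j * cnj (a j))"
  proof (rule sum.cong)
    fix j assume j: "j \<in> F"
    have "ip X (lc e a F) (e j) = cnj (ip X (e j) (lc e a F))" by (rule ip_cnj) (use c e j in auto)
    also have "ip X (e j) (lc e a F) = (\<Sum>i\<in>F. a i * ip X (e j) (e i))" by (rule ips) (use assms e j in auto)
    also have "\<dots> = (\<Sum>i\<in>F. if j = i then a i else 0)" using on j by (intro sum.cong) auto
    also have "\<dots> = a j" using assms(2) j by simp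
    finally show "a j * ip X (lc e a F) (e j) = a j * cnj (a j)" by simp
  qed simp
  also have "\<dots> = of_real (\<Sum>j\<in>F. (cmod (a j))\<^sup>2)"
    unfolding of_real_sum by (intro sum.cong refl) (simp only: complex_norm_square)
  finally have "ip X (lc e a F) (lc e a F) = of_real (\<Sum>j\<in>F. (cmod (a j))\<^sup>2)" .
  then show ?thesis by (simp add: hnorm_def L2_set_def)
qed

text \<open>\<open>T\<close> carries combinations of the orthonormal basis to combinations of
  \<open>x\<close>; boundedness of \<open>T\<close> and of its inverse gives the upper and the lower
  bound. As operators are linear only up to vectors of norm 0, this correspondence is proved by
  induction in \<open>lcT\<close>.\<close>

lemma riesz_basis_bounds:
  fixes x :: "'i \<Rightarrow> 'v"
  assumes "riesz_basis X J x"
  shows "complete_system X J x" "\<exists>c>0. lower_riesz J x c" "\<exists>C>0. upper_riesz J x C"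
proof -
  obtain e T R where x: "\<And>j. j \<in> J \<Longrightarrow> x j \<in> carrier X" and on: "orthonormal_basis X J e"
    and T: "bounded_operator X T" and R: "bounded_operator X R"
    and inv: "\<And>f. f \<in> carrier X \<Longrightarrow> N (R (T f) - f) = 0 \<and> N (T (R f) - f) = 0"
    and xT: "\<And>j. j \<in> J \<Longrightarrow> N (x j - T (e j)) = 0"
    using assms unfolding riesz_basis_def by blast
  have e: "e j \<in> carrier X" if "j \<in> J" for j using on that by (auto simp: orthonormal_basis_def complete_system_iff)
  have Tc: "T f \<in> carrier X" if "f \<in> carrier X" for f using T that by (auto simp: bounded_operator_def)
  have Rc: "R f \<in> carrier X" if "f \<in> carrier X" for f using R that by (auto simp: bounded_operator_def)
  obtain KT where KT: "\<And>f. f \<in> carrier X \<Longrightarrow> N (T f) \<le> KT * N f" using T unfolding bounded_operator_def by blast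
  obtain KR where KR: "\<And>f. f \<in> carrier X \<Longrightarrow> N (R f) \<le> KR * N f" using R unfolding bounded_operator_def by blast
  have add: "N (T (f + g) - (T f + T g)) = 0" if "f \<in> carrier X" "g \<in> carrier X" for f g
    using T that by (auto simp: bounded_operator_def)
  have scl: "N (T (sc c f) - sc c (T f)) = 0" if "f \<in> carrier X" for c f
    using T that by (auto simp: bounded_operator_def)
  have zero_add: "N (f + g) = 0" if "f \<in> carrier X" "g \<in> carrier X" "N f = 0" "N g = 0" for f g
    using N_triangle[OF that(1,2)] N_nonneg[OF add_closed[OF that(1,2)]] that by simp
  have zero_scale: "N (sc c f) = 0" if "f \<in> carrier X" "N f = 0" for c f using that by (simp add: N_scale)
  have Tz: "N (T 0) = 0"
    using KT[OF zero_closed] N_nonneg[OF Tc[OF zero_closed]] by (simp add: N_zero)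
  have lcT: "N (T (lc e a F) - lc x a F) = 0" if "finite F" "F \<subseteq> J" for a F
    using that
  proof (induction F)
    case empty
    then show ?case using Tz by (simp add: lincomb_def)
  next
    case (insert k F)
    then have k: "k \<in> J" and F: "F \<subseteq> J" by auto
    have cl: "lc e a F \<in> carrier X" "lc x a F \<in> carrier X" using F e x by (auto intro!: lc_closed)
    have sk: "sc (a k) (e k) \<in> carrier X" by (intro scale_closed e k)
    have "T (lc e a (insert k F)) - lc x a (insert k F) =
      (T (sc (a k) (e k) + lc e a F) - (T (sc (a k) (e k)) + T (lc e a F))) +
      ((T (sc (a k) (e k)) - sc (a k) (T (e k))) + (- sc (a k) (x k - T (e k)) + (T (lc e a F) - lc x a F)))"
      using insert.hyps by (simp add: lc_insert scale_diff)
    also have "N \<dots> = 0"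
    proof (intro zero_add)
      show "N (- sc (a k) (x k - T (e k))) = 0"
        using zero_scale[OF diff_closed[OF x[OF k] Tc[OF e[OF k]]] xT[OF k]] by (simp add: N_minus scale_closed diff_closed x k Tc e)
    qed (intro add scl insert.IH F sk cl e k add_closed diff_closed minus_closed scale_closed Tc x)+
    finally show ?case .
  qed
  have norm_e: "N (lc e a F) = l2 a F" if "finite F" "F \<subseteq> J" for a F
  proof (rule N_orthonormal[OF _ that(1)])
    show "e j \<in> carrier X" if "j \<in> F" for j using e \<open>F \<subseteq> J\<close> that by auto
    show "ip X (e i) (e j) = (if i = j then 1 else 0)" if "i \<in> F" "j \<in> F" for i j
      using on \<open>F \<subseteq> J\<close> that unfolding orthonormal_basis_def by blast
  qed
  have norm_x: "N (lc x a F) = N (T (lc e a F))" if "finite F" "F \<subseteq> J" for a F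
    using lcT[OF that, of a] that e x by (intro N_zero_cong[symmetric]) (auto intro!: Tc lc_closed)
  have "N (lc x a F) \<le> (\<bar>KT\<bar> + 1) * l2 a F" if F: "finite F" "F \<subseteq> J" for a F
  proof -
    have c: "lc e a F \<in> carrier X" using F e by (intro lc_closed) auto
    have "N (T (lc e a F)) \<le> KT * N (lc e a F)" by (rule KT[OF c])
    also have "\<dots> \<le> (\<bar>KT\<bar> + 1) * N (lc e a F)" using N_nonneg[OF c] by (intro mult_right_mono) auto
    finally show ?thesis using norm_x[OF F] norm_e[OF F] by simp
  qed
  then show "\<exists>C>0. upper_riesz J x C" unfolding upper_riesz_def by (intro exI[of _ "\<bar>KT\<bar> + 1"]) auto
  have "1 / (\<bar>KR\<bar> + 1) * l2 a F \<le> N (lc x a F)" if F: "finite F" "F \<subseteq> J" for a F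
  proof -
    have c: "lc e a F \<in> carrier X" using F e by (intro lc_closed) auto
    have "N (lc e a F) = N (R (T (lc e a F)))"
      using inv[OF c] by (intro N_zero_cong[symmetric] Rc Tc c) auto
    also have "\<dots> \<le> KR * N (T (lc e a F))" by (intro KR Tc c)
    also have "\<dots> \<le> (\<bar>KR\<bar> + 1) * N (T (lc e a F))" using N_nonneg[OF Tc[OF c]] by (intro mult_right_mono) auto
    finally show ?thesis using norm_x[OF F] norm_e[OF F] by (simp add: pos_divide_le_eq mult.commute)
  qed
  then show "\<exists>c>0. lower_riesz J x c" unfolding lower_riesz_def by (intro exI[of _ "1 / (\<bar>KR\<bar> + 1)"]) auto
  show "complete_system X J x"
    unfolding complete_system_iff
  proof (intro conjI ballI x)
    fix f assume f: "f \<in> carrier X"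
    show "in_closed_span x J f"
      unfolding in_closed_span_def
    proof (intro allI impI)
      fix \<epsilon> :: real assume \<epsilon>: "\<epsilon> > 0"
      define \<delta> where "\<delta> = \<epsilon> / (\<bar>KT\<bar> + 1)"
      have "\<delta> > 0" using \<epsilon> by (simp add: \<delta>_def)
      then obtain F a where F: "finite F" "F \<subseteq> J" "N (R f - lc e a F) < \<delta>"
        using on Rc[OF f] unfolding orthonormal_basis_def complete_system_iff in_closed_span_def by blast
      have c: "lc e a F \<in> carrier X" "lc x a F \<in> carrier X" using F e x by (auto intro!: lc_closed)
      define g where "g = R f - lc e a F"
      have g: "g \<in> carrier X" unfolding g_def by (intro diff_closed Rc f c)
      have "T (g + lc e a F) - (T g + T (lc e a F)) = T (R f) - (T g + T (lc e a F))" by (simp add: g_def)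
      then have z1: "N (T (R f) - (T g + T (lc e a F))) = 0" using add[OF g c(1)] by simp
      have "f - lc x a F = - (T (R f) - f) + ((T (R f) - (T g + T (lc e a F))) + ((T (lc e a F) - lc x a F) + T g))"
        by simp
      also have "N \<dots> \<le> N (- (T (R f) - f)) + (N (T (R f) - (T g + T (lc e a F))) + (N (T (lc e a F) - lc x a F) + N (T g)))"
        by (intro order.trans[OF N_triangle] add_mono order.refl add_closed diff_closed minus_closed Tc Rc f g c)
      also have "\<dots> = N (T g)" using inv[OF f] z1 lcT[OF F(1,2), of a] by (simp add: N_minus diff_closed Tc Rc f del: minus_diff_eq)
      also have "\<dots> \<le> KT * N g" by (rule KT[OF g])
      also have "\<dots> \<le> (\<bar>KT\<bar> + 1) * N g" using N_nonneg[OF g] by (intro mult_right_mono) auto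
      also have "\<dots> < \<epsilon>" using F(3) by (simp add: g_def \<delta>_def pos_less_divide_eq mult.commute)
      finally show "\<exists>F a. finite F \<and> F \<subseteq> J \<and> N (f - lc x a F) < \<epsilon>" using F by blast
    qed
  qed
qed

lemma l2_mono: "finite G \<Longrightarrow> F \<subseteq> G \<Longrightarrow> l2 a F \<le> l2 a G"
  unfolding L2_set_def by (intro real_sqrt_le_mono sum_mono2) auto

lemma member_le_l2: "finite F \<Longrightarrow> j \<in> F \<Longrightarrow> cmod (a j) \<le> l2 a F"
  using member_le_L2_set[of F j "\<lambda>j. cmod (a j)"] by simp

text \<open>The lower bound makes the coefficients of approximating sums Cauchy in the l2 norm,
  uniformly over initial segments. The upper bound turns l2 convergence back into convergence of
  partial sums, and the lower bound gives uniqueness.\<close>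

theorem riesz_unconditional:
  fixes g :: "nat \<Rightarrow> 'v"
  assumes complete: "complete_system X UNIV g" and c: "0 < c" "lower_riesz UNIV g c" and C: "0 < C" "upper_riesz UNIV g C"
  shows "schauder_basis X g"
  unfolding schauder_basis_def
proof (intro conjI allI ballI)
  have gc: "g k \<in> carrier X" for k using complete by (auto simp: complete_system_iff)
  then show "g k \<in> carrier X" for k .
  fix f assume f: "f \<in> carrier X"
  have low: "c * l2 a F \<le> N (lc g a F)" if "finite F" for a F using c(2) that by (auto simp: lower_riesz_def)
  have up: "N (lc g a F) \<le> C * l2 a F" if "finite F" for a F using C(2) that by (auto simp: upper_riesz_def)
  have lcc: "lc g a F \<in> carrier X" for a F by (intro lc_closed gc)
  have "\<exists>M a. (\<forall>j\<ge>M. a j = 0) \<and> N (f - lc g a {..<M}) < 1 / (real n + 1)" for n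
  proof -
    have "(0::real) < 1 / (real n + 1)" by simp
    then obtain F a where F: "finite F" "N (f - lc g a F) < 1 / (real n + 1)"
      using complete f unfolding complete_system_iff in_closed_span_def by blast
    obtain M where M: "F \<subseteq> {..<M}" using F(1) by (meson finite_nat_iff_bounded)
    show ?thesis using F M lc_extend[of "{..<M}" F g a]
      by (intro exI[of _ M] exI[of _ "\<lambda>j. if j \<in> F then a j else 0"]) auto
  qed
  then obtain M a where M: "\<And>n j. j \<ge> M n \<Longrightarrow> a n j = 0" and a: "\<And>n. N (f - lc g (a n) {..<M n}) < 1 / (real n + 1)"
    by metis
  have aM: "N (f - lc g (a n) {..<K}) < 1 / (real n + 1)" if "K \<ge> M n" for n K
    using a[of n] lc_mono_neutral[of "{..<K}" "{..<M n}" "a n" g] M[of n] that by auto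
  have diff: "l2 (\<lambda>j. a n j - a m j) {..<K} \<le> (1 / (real n + 1) + 1 / (real m + 1)) / c" for n m K
  proof -
    define K' where "K' = max K (max (M n) (M m))"
    have "c * l2 (\<lambda>j. a n j - a m j) {..<K} \<le> c * l2 (\<lambda>j. a n j - a m j) {..<K'}"
      using c(1) by (intro mult_left_mono l2_mono) (auto simp: K'_def)
    also have "\<dots> \<le> N (lc g (\<lambda>j. a n j - a m j) {..<K'})" by (intro low) simp
    also have "lc g (\<lambda>j. a n j - a m j) {..<K'} = (f - lc g (a m) {..<K'}) - (f - lc g (a n) {..<K'})"
      by (simp add: lc_diff)
    also have "N \<dots> \<le> N (f - lc g (a m) {..<K'}) + N (f - lc g (a n) {..<K'})"
      by (intro N_diff_triangle diff_closed f lcc)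
    also have "\<dots> \<le> 1 / (real m + 1) + 1 / (real n + 1)"
      by (rule add_mono; rule less_imp_le; rule aM) (auto simp: K'_def)
    finally show ?thesis by (simp only: pos_le_divide_eq[OF c(1)] ac_simps)
  qed
  have lim0: "(\<lambda>n. (1 / (real n + 1)) / c) \<longlonglongrightarrow> 0"
  proof -
    have "(\<lambda>n. 1 / (real n + 1)) \<longlonglongrightarrow> 0" using LIMSEQ_inverse_real_of_nat by (simp add: inverse_eq_divide add.commute)
    then have "(\<lambda>n. (1 / (real n + 1)) / c) \<longlonglongrightarrow> 0 / c" by (intro tendsto_divide tendsto_const) (use c in auto)
    then show ?thesis by simp
  qed
  have "convergent (\<lambda>n. a n j)" for j
  proof (rule Cauchy_convergent, rule metric_CauchyI)
    fix e :: real assume e: "e > 0"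
    then obtain n0 where n0: "\<And>n. n \<ge> n0 \<Longrightarrow> (1 / (real n + 1)) / c < e / 2"
      using order_tendstoD(2)[OF lim0, of "e/2"] by (auto simp: eventually_sequentially)
    have "dist (a n j) (a m j) < e" if "n \<ge> n0" "m \<ge> n0" for n m
    proof -
      have "dist (a n j) (a m j) \<le> l2 (\<lambda>j. a n j - a m j) {..<Suc j}"
        using member_le_l2[of "{..<Suc j}" j "\<lambda>j. a n j - a m j"] by (simp add: dist_norm)
      also have "\<dots> \<le> (1 / (real n + 1) + 1 / (real m + 1)) / c" by (rule diff)
      also have "\<dots> < e" using n0[OF that(1)] n0[OF that(2)] by (simp add: add_divide_distrib)
      finally show ?thesis .
    qed
    then show "\<exists>n0. \<forall>n\<ge>n0. \<forall>m\<ge>n0. dist (a n j) (a m j) < e" by blast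
  qed
  then obtain b where b: "\<And>j. (\<lambda>n. a n j) \<longlonglongrightarrow> b j" unfolding convergent_def by metis
  have ab: "l2 (\<lambda>j. a n j - b j) {..<K} \<le> (1 / (real n + 1)) / c" for n K
  proof (rule tendsto_le[OF sequentially_bot])
    show "(\<lambda>m. (1 / (real n + 1)) / c + (1 / (real m + 1)) / c) \<longlonglongrightarrow> (1 / (real n + 1)) / c"
      using tendsto_add[OF tendsto_const lim0] by simp
    show "(\<lambda>m. l2 (\<lambda>j. a n j - a m j) {..<K}) \<longlonglongrightarrow> l2 (\<lambda>j. a n j - b j) {..<K}"
      unfolding L2_set_def by (intro tendsto_intros b)
    show "\<forall>\<^sub>F m in sequentially. l2 (\<lambda>j. a n j - a m j) {..<K} \<le> (1 / (real n + 1)) / c + (1 / (real m + 1)) / c"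
      using diff by (simp add: add_divide_distrib)
  qed
  show "\<exists>!d. (\<lambda>K. N (f - lc g d {..<K})) \<longlonglongrightarrow> 0"
  proof (rule ex1I)
    show *: "(\<lambda>K. N (f - lc g b {..<K})) \<longlonglongrightarrow> 0"
    proof (rule LIMSEQ_I)
      fix e :: real assume e: "e > 0"
      \<comment> \<open>With accuracy \<open>q\<close> for the approximating sum the total error
        stays below \<open>q * (1 + C / c)\<close>: the sum itself plus the change from
        \<open>a n\<close> to the limit coefficients.\<close>
      define q where "q = e / (1 + C / c)"
      have q: "q > 0" using e C c by (simp add: q_def add_pos_pos)
      obtain n :: nat where n: "1 / (real n + 1) < q"
        using reals_Archimedean[OF q] by (auto simp: inverse_eq_divide add.commute)
      have "norm (N (f - lc g b {..<K}) - 0) < e" if "K \<ge> M n" for K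
      proof -
        have "f - lc g b {..<K} = (f - lc g (a n) {..<K}) + lc g (\<lambda>j. a n j - b j) {..<K}" by (simp add: lc_diff)
        also have "N \<dots> \<le> N (f - lc g (a n) {..<K}) + N (lc g (\<lambda>j. a n j - b j) {..<K})"
          by (intro N_triangle diff_closed f lcc)
        also have "N (lc g (\<lambda>j. a n j - b j) {..<K}) \<le> C * ((1 / (real n + 1)) / c)"
          by (rule order.trans[OF up mult_left_mono[OF ab]]) (use C in auto)
        also have "N (f - lc g (a n) {..<K}) < 1 / (real n + 1)" by (rule aM[OF that])
        finally have "N (f - lc g b {..<K}) < 1 / (real n + 1) + C * ((1 / (real n + 1)) / c)" by simp
        also have "\<dots> = (1 / (real n + 1)) * (1 + C / c)"
        proof -
          have "u + C * (u / c) = u * (1 + C / c)" for u by (simp add: algebra_simps)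
          then show ?thesis .
        qed
        also have "\<dots> \<le> q * (1 + C / c)" using n C c by (intro mult_right_mono) auto
        also have "\<dots> = e" using C c by (simp add: q_def add_pos_pos less_imp_neq[THEN not_sym])
        finally show ?thesis using N_nonneg[OF diff_closed[OF f lcc]] by simp
      qed
      then show "\<exists>no. \<forall>K\<ge>no. norm (N (f - lc g b {..<K}) - 0) < e" by blast
    qed
    fix d assume d: "(\<lambda>K. N (f - lc g d {..<K})) \<longlonglongrightarrow> 0"
    show "d = b"
    proof
      fix j
      have "(\<lambda>K. N (f - lc g b {..<K}) + N (f - lc g d {..<K})) \<longlonglongrightarrow> 0 + 0"
        by (intro tendsto_add d *)
      moreover have "\<forall>\<^sub>F K in sequentially. c * cmod (d j - b j) \<le> N (f - lc g b {..<K}) + N (f - lc g d {..<K})"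
        using eventually_gt_at_top[of j]
      proof eventually_elim
        case (elim K)
        have "c * cmod (d j - b j) \<le> c * l2 (\<lambda>j. d j - b j) {..<K}"
          using c(1) elim member_le_l2[of "{..<K}" j "\<lambda>j. d j - b j"] by (intro mult_left_mono) auto
        also have "\<dots> \<le> N (lc g (\<lambda>j. d j - b j) {..<K})" by (intro low) simp
        also have "lc g (\<lambda>j. d j - b j) {..<K} = (f - lc g b {..<K}) - (f - lc g d {..<K})" by (simp add: lc_diff)
        also have "N \<dots> \<le> N (f - lc g b {..<K}) + N (f - lc g d {..<K})" by (intro N_diff_triangle diff_closed f lcc)
        finally show ?case .
      qed
      ultimately have "c * cmod (d j - b j) \<le> 0 + 0" by (rule tendsto_lowerbound) simp
      then show "d j = b j" using c(1) by (simp add: mult_le_0_iff)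
    qed
  qed
qed

section \<open>Exchange and perturbation of Riesz systems\<close>

lemma not_in_closed_span_distance:
  assumes "\<not> in_closed_span z K h"
  obtains d where "d > 0" "\<And>F a. finite F \<Longrightarrow> F \<subseteq> K \<Longrightarrow> d \<le> N (h - lc z a F)"
  using assms unfolding in_closed_span_def by (auto simp: not_less)

text \<open>Steinitz exchange with bounds. The distance \<open>d\<close> from \<open>z j\<close> to
  the span without \<open>z i\<close> bounds the coefficient of \<open>z j\<close>, which gives the
  lower bound. It also keeps the coefficient of \<open>z i\<close> in good approximations of
  \<open>z j\<close> away from 0, so that \<open>z i\<close> can be solved for.\<close>

lemma exchange:
  assumes compl: "complete_system X K z" and c: "0 < c" "lower_riesz K z c"
    and i: "i \<in> K" and j: "j \<notin> K" and zj: "z j \<in> carrier X"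
    and far: "\<not> in_closed_span z (K - {i}) (z j)"
  defines "K' \<equiv> insert j (K - {i})"
  shows "complete_system X K' z" "\<exists>c'>0. lower_riesz K' z c'"
proof -
  obtain d where d: "d > 0" "\<And>F a. finite F \<Longrightarrow> F \<subseteq> K - {i} \<Longrightarrow> d \<le> N (z j - lc z a F)"
    using not_in_closed_span_distance[OF far] by blast
  have zc: "z k \<in> carrier X" if "k \<in> K" for k using compl that by (auto simp: complete_system_iff)
  have zc': "z k \<in> carrier X" if "k \<in> K'" for k using that zc zj by (auto simp: K'_def)
  show "\<exists>c'>0. lower_riesz K' z c'"
  proof -
    \<comment> \<open>If the combination has norm \<open>n\<close>, the coefficient of
      \<open>z j\<close> is at most \<open>n / d\<close>, and the rest has norm at most
      \<open>n + n / d * N (z j)\<close>; \<open>B\<close> collects the two contributions.\<close>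
    define B where "B = 1 / d + (1 + N (z j) / d) / c"
    have B: "B > 0" using d(1) c(1) N_nonneg[OF zj] by (simp add: B_def add_pos_nonneg)
    have "l2 a F \<le> B * N (lc z a F)" if F: "finite F" "F \<subseteq> K'" for F a
    proof (cases "j \<in> F")
      case False
      then have FK: "F \<subseteq> K" using F by (auto simp: K'_def)
      have cl: "lc z a F \<in> carrier X" using FK zc by (intro lc_closed) auto
      have "c * l2 a F \<le> N (lc z a F)" using c(2) F(1) FK by (auto simp: lower_riesz_def)
      then have "l2 a F \<le> (1 / c) * N (lc z a F)" using c(1) by (simp add: field_simps)
      also have "\<dots> \<le> B * N (lc z a F)"
        using d(1) c(1) N_nonneg[OF zj] N_nonneg[OF cl] by (intro mult_right_mono) (auto simp: B_def add_divide_distrib)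
      finally show ?thesis .
    next
      case True
      define G where "G = F - {j}"
      have G: "finite G" "G \<subseteq> K - {i}" "G \<subseteq> K" "j \<notin> G" using F j by (auto simp: G_def K'_def)
      have cG: "lc z b G \<in> carrier X" for b using G zc by (intro lc_closed) auto
      have eq: "lc z a F = sc (a j) (z j) + lc z a G" unfolding G_def by (rule lc_remove[OF F(1) True])
      define n where "n = N (lc z a F)"
      have n0: "0 \<le> n" unfolding n_def eq by (intro N_nonneg add_closed scale_closed zj cG)
      have aj: "cmod (a j) * d \<le> n"
      proof (cases "a j = 0")
        case False
        have "lc z a F = sc (a j) (z j - lc z (\<lambda>k. - (1 / a j) * a k) G)"
          unfolding eq scale_diff lc_scale scale_scale using False by (simp add: scale_minus_one)
        then have "n = cmod (a j) * N (z j - lc z (\<lambda>k. - (1 / a j) * a k) G)"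
          unfolding n_def by (simp add: N_scale diff_closed zj cG)
        then show ?thesis using d(2)[OF G(1,2)] by (simp add: mult_left_mono)
      qed (simp add: n0)
      then have aj': "cmod (a j) \<le> n / d" using d(1) by (simp add: pos_le_divide_eq)
      have "lc z a G = lc z a F - sc (a j) (z j)" by (simp add: eq)
      then have "N (lc z a G) \<le> n + cmod (a j) * N (z j)"
        unfolding n_def using N_diff_triangle[of "lc z a F" "sc (a j) (z j)"]
        by (simp add: N_scale zj scale_closed eq add_closed cG)
      also have "\<dots> \<le> n + n / d * N (z j)" using aj' N_nonneg[OF zj] by (intro add_left_mono mult_right_mono) auto
      finally have "c * l2 a G \<le> n + n / d * N (z j)"
        using c(2) G(1,3) unfolding lower_riesz_def by (meson order.trans)
      then have "l2 a G \<le> (n + n / d * N (z j)) / c" using c(1) by (simp add: pos_le_divide_eq mult.commute)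
      moreover have "l2 a F \<le> cmod (a j) + l2 a G"
      proof -
        have "F = insert j G" using True by (auto simp: G_def)
        then have "l2 a F = sqrt ((cmod (a j))\<^sup>2 + (l2 a G)\<^sup>2)" using G by (simp add: L2_set_insert)
        also have "\<dots> \<le> cmod (a j) + l2 a G" by (intro sqrt_sum_squares_le_sum) (auto simp: L2_set_nonneg)
        finally show ?thesis .
      qed
      ultimately have "l2 a F \<le> n / d + (n + n / d * N (z j)) / c" using aj' by linarith
      also have "\<dots> = B * n" by (simp add: B_def field_simps add_divide_distrib)
      finally show ?thesis by (simp add: n_def)
    qed
    then have "lower_riesz K' z (1 / B)"
      unfolding lower_riesz_def using B by (auto simp: field_simps)
    then show ?thesis using B by (intro exI[of _ "1 / B"]) auto
  qed
  show "complete_system X K' z"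
  proof (rule complete_system_trans[OF compl])
    show "z k \<in> carrier X" if "k \<in> K'" for k by (rule zc'[OF that])
    fix k assume k: "k \<in> K"
    show "in_closed_span z K' (z k)"
    proof (cases "k = i")
      case False
      then show ?thesis using k by (intro in_closed_span_member) (auto simp: K'_def)
    next
      case True
      show ?thesis
        unfolding in_closed_span_def True
      proof (intro allI impI)
        fix \<epsilon> :: real assume \<epsilon>: "\<epsilon> > 0"
        define Z where "Z = N (z i) + 1"
        have Z: "Z > 0" using N_nonneg[OF zc[OF i]] by (simp add: Z_def)
        \<comment> \<open>The first entry keeps the coefficient of \<open>z i\<close> above
          \<open>d / (2 * Z)\<close>; the second makes the error smaller than
          \<open>\<epsilon>\<close> after division by that coefficient.\<close>
        define \<delta> where "\<delta> = min (d / 2) (\<epsilon> * d / (4 * Z))"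
        have \<delta>: "\<delta> > 0" using d(1) \<epsilon> Z by (simp add: \<delta>_def)
        obtain F a where F: "finite F" "F \<subseteq> K" "N (z j - lc z a F) < \<delta>"
          using compl zj \<delta> unfolding complete_system_iff in_closed_span_def by blast
        define b where "b k = (if k \<in> F then a k else 0)" for k
        define F' where "F' = insert i F"
        have F': "finite F'" "F' \<subseteq> K" "i \<in> F'" using F i by (auto simp: F'_def)
        have "lc z a F = lc z b F'" unfolding b_def using F by (intro lc_extend) (auto simp: F'_def)
        define G where "G = F' - {i}"
        have G: "finite G" "G \<subseteq> K - {i}" using F' by (auto simp: G_def)
        have cG: "lc z b' G \<in> carrier X" for b' using G zc by (intro lc_closed) auto
        have eq: "lc z a F = sc (b i) (z i) + lc z b G"
          unfolding \<open>lc z a F = lc z b F'\<close> G_def by (rule lc_remove[OF F'(1,3)])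
        define \<rho> where "\<rho> = z j - lc z a F"
        have \<rho>c: "\<rho> \<in> carrier X" unfolding \<rho>_def eq by (intro diff_closed zj add_closed scale_closed zc i cG)
        have "d \<le> N (z j - lc z b G)" by (rule d(2)[OF G])
        also have "z j - lc z b G = \<rho> + sc (b i) (z i)" by (simp add: \<rho>_def eq)
        also have "N \<dots> \<le> N \<rho> + cmod (b i) * N (z i)"
          using N_triangle[OF \<rho>c scale_closed[OF zc[OF i]], of "b i"] by (simp add: N_scale zc i)
        also have "N \<rho> < d / 2" using F(3) by (simp add: \<rho>_def \<delta>_def)
        finally have "d / 2 < cmod (b i) * N (z i)" by simp
        also have "\<dots> \<le> cmod (b i) * Z" by (intro mult_left_mono) (auto simp: Z_def)
        finally have bi: "d / (2 * Z) < cmod (b i)" using Z by (simp add: pos_divide_less_eq mult_ac)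
        have bi0: "0 < cmod (b i)" using bi d(1) Z by (meson divide_pos_pos less_trans mult_pos_pos zero_less_numeral)
        define e where "e k = (if k = j then 1 / b i else - (1 / b i) * b k)" for k
        have jG: "j \<notin> G" using G j by auto
        have "lc z e (insert j G) = sc (1 / b i) (z j) + lc z e G" using G jG by (simp add: lc_insert e_def)
        also have "lc z e G = lc z (\<lambda>k. - (1 / b i) * b k) G" using jG by (intro lc_cong) (auto simp: e_def)
        also have "\<dots> = sc (- (1 / b i)) (lc z b G)" by (rule lc_scale)
        finally have "z i - lc z e (insert j G) = sc (- (1 / b i)) \<rho>"
          unfolding \<rho>_def eq scale_diff scale_add scale_scale using bi0 by (simp add: scale_one scale_minus_left scale_minus_one)
        then have "N (z i - lc z e (insert j G)) = N \<rho> / cmod (b i)"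
          using N_scale[OF \<rho>c, of "- (1 / b i)"] by (simp add: norm_divide)
        also have "\<dots> < \<epsilon>"
        proof -
          have "N \<rho> < \<epsilon> * d / (4 * Z)" using F(3) by (simp add: \<rho>_def \<delta>_def)
          also have "\<dots> \<le> \<epsilon> * (d / (2 * Z))" using \<epsilon> d(1) Z by (simp add: field_simps)
          also have "\<dots> \<le> \<epsilon> * cmod (b i)" using \<epsilon> bi by (intro mult_left_mono) auto
          finally show ?thesis using bi0 by (simp add: pos_divide_less_eq)
        qed
        finally show "\<exists>F a. finite F \<and> F \<subseteq> K' \<and> N (z i - lc z a F) < \<epsilon>"
          using G by (intro exI[of _ "insert j G"] exI[of _ e]) (auto simp: K'_def)
      qed
    qed
  qed
qed

text \<open>\<open>Inl\<close> indexes the old system and \<open>Inr\<close> the new one; as many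
  new elements are missing as old ones are left. By the lower bound a remaining old element is
  outside the closed span of the others. As the new elements together are complete, one of them is
  outside that span too, and it replaces the old one.\<close>

lemma exchange_all:
  fixes z :: "nat + nat \<Rightarrow> 'v"
  assumes gcompl: "complete_system X UNIV (\<lambda>k. z (Inr k))"
    and "complete_system X (Inl ` I \<union> Inr ` J) z" "\<exists>c>0. lower_riesz (Inl ` I \<union> Inr ` J) z c"
    and "finite I" "finite (- J)" "card (- J) = card I"
  shows "\<exists>c>0. lower_riesz (range Inr) z c"
  using assms(2-)
proof (induction "card I" arbitrary: I J)
  case 0
  then have "I = {}" "J = UNIV" by auto
  then show ?case using 0 by auto
next
  case (Suc n)
  then obtain i where i: "i \<in> I" by (metis card.empty ex_in_conv nat.distinct(1))
  let ?K = "Inl ` I \<union> Inr ` J"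
  obtain c where c: "c > 0" "lower_riesz ?K z c" using Suc.prems by blast
  have zc: "z k \<in> carrier X" if "k \<in> ?K" for k using Suc.prems(1) that unfolding complete_system_iff by blast
  have gc: "z (Inr k) \<in> carrier X" for k using gcompl by (auto simp: complete_system_iff)
  have iK: "Inl i \<in> ?K" using i by auto
  have "\<exists>j\<in>-J. \<not> in_closed_span z (?K - {Inl i}) (z (Inr j))"
  proof (rule ccontr)
    assume "\<not> ?thesis"
    then have all: "in_closed_span z (?K - {Inl i}) (z (Inr j))" for j
      by (cases "j \<in> J") (auto intro!: in_closed_span_member)
    have "complete_system X (?K - {Inl i}) z"
      by (rule complete_system_trans[OF gcompl]) (use all zc in auto)
    then have "in_closed_span z (?K - {Inl i}) (z (Inl i))" using zc[OF iK] unfolding complete_system_iff by blast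
    from this[unfolded in_closed_span_def, rule_format, OF c(1)]
    obtain F a where F: "finite F" "F \<subseteq> ?K - {Inl i}" "N (z (Inl i) - lc z a F) < c" by blast
    define b where "b k = (if k = Inl i then 1 else - a k)" for k
    have iF: "Inl i \<notin> F" using F by auto
    have "lc z b (insert (Inl i) F) = z (Inl i) + lc z b F" using F iF by (simp add: lc_insert b_def scale_one)
    also have "lc z b F = lc z (\<lambda>k. - a k) F" using iF by (intro lc_cong) (auto simp: b_def)
    finally have "lc z b (insert (Inl i) F) = z (Inl i) - lc z a F" by (simp add: lc_minus)
    moreover have "c * l2 b (insert (Inl i) F) \<le> N (lc z b (insert (Inl i) F))"
      using c(2)[unfolded lower_riesz_def, rule_format, of "insert (Inl i) F" b] F i by auto
    moreover have "1 \<le> l2 b (insert (Inl i) F)"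
      using member_le_l2[of "insert (Inl i) F" "Inl i" b] F by (simp add: b_def)
    then have "c * 1 \<le> c * l2 b (insert (Inl i) F)" using c(1) by (intro mult_left_mono) auto
    ultimately show False using F(3) by simp
  qed
  then obtain j where j: "j \<notin> J" "\<not> in_closed_span z (?K - {Inl i}) (z (Inr j))" by auto
  have jK: "Inr j \<notin> ?K" using j by auto
  note ex = exchange[OF Suc.prems(1) c iK jK gc j(2)]
  have K': "insert (Inr j) (?K - {Inl i}) = Inl ` (I - {i}) \<union> Inr ` (insert j J)" by auto
  show ?case
  proof (rule Suc.hyps(1))
    show "n = card (I - {i})" using Suc.hyps(2) i Suc.prems(3) by simp
    show "complete_system X (Inl ` (I - {i}) \<union> Inr ` (insert j J)) z" using ex(1) by (simp only: K')
    show "\<exists>c>0. lower_riesz (Inl ` (I - {i}) \<union> Inr ` (insert j J)) z c" using ex(2) by (simp only: K')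
    have "- insert j J = - J - {j}" by auto
    then show "finite (- insert j J)" "card (- insert j J) = card (I - {i})" using Suc.prems i j by auto
  qed (use Suc.prems in auto)
qed

theorem quadratically_close_riesz:
  fixes x g :: "nat \<Rightarrow> 'v"
  assumes xcompl: "complete_system X UNIV x" and c: "0 < c" "lower_riesz UNIV x c" and C: "0 < C" "upper_riesz UNIV x C"
    and gcompl: "complete_system X UNIV g"
    and close: "summable (\<lambda>k. (N (g (k + N0) - x (k + N0)))\<^sup>2)"
  shows "(\<exists>c>0. lower_riesz UNIV g c) \<and> (\<exists>C>0. upper_riesz UNIV g C)"
proof -
  have xc: "x k \<in> carrier X" and gc: "g k \<in> carrier X" for k using xcompl gcompl by (auto simp: complete_system_iff)
  define r where "r k = g k - x k" for k
  have rc: "r k \<in> carrier X" for k unfolding r_def by (intro diff_closed gc xc)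
  have sr: "summable (\<lambda>k. (N (r k))\<^sup>2)" using close summable_iff_shift[of "\<lambda>k. (N (r k))\<^sup>2" N0] by (simp add: r_def)
  have low: "c * l2 a F \<le> N (lc x a F)" and up: "N (lc x a F) \<le> C * l2 a F" if "finite F" for a F
    using c(2) C(2) that by (auto simp: lower_riesz_def upper_riesz_def)
  have r_all: "N (lc r a F) \<le> sqrt (\<Sum>k. (N (r k))\<^sup>2) * l2 a F" if "finite F" for a F
  proof -
    have "N (lc r a F) \<le> l2 a F * L2_set (\<lambda>j. N (r j)) F" by (intro N_lc_le rc)
    also have "\<dots> \<le> l2 a F * sqrt (\<Sum>k. (N (r k))\<^sup>2)"
    proof (rule mult_left_mono)
      show "L2_set (\<lambda>j. N (r j)) F \<le> sqrt (\<Sum>k. (N (r k))\<^sup>2)"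
        unfolding L2_set_def by (intro real_sqrt_le_mono sum_le_suminf sr that) auto
    qed (rule L2_set_nonneg)
    finally show ?thesis by (simp only: mult.commute)
  qed
  have geq: "lc g a F = lc x a F + lc r a F" for a F
  proof -
    have "g = (\<lambda>j. x j + r j)" by (simp add: r_def fun_eq_iff)
    then show ?thesis by (simp add: lc_vec_add)
  qed
  have lcx: "lc x a F \<in> carrier X" and lcr: "lc r a F \<in> carrier X" for a F by (intro lc_closed xc rc)+
  have "\<exists>C>0. upper_riesz UNIV g C"
  proof -
    have "N (lc g a F) \<le> (C + sqrt (\<Sum>k. (N (r k))\<^sup>2)) * l2 a F" if "finite F" for a F
      using N_triangle[OF lcx[of a F] lcr[of a F]] up[OF that, of a] r_all[OF that, of a] by (simp add: geq algebra_simps)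
    then show ?thesis
      unfolding upper_riesz_def using C(1) suminf_nonneg[OF sr]
      by (intro exI[of _ "C + sqrt (\<Sum>k. (N (r k))\<^sup>2)"]) (auto intro: add_pos_nonneg)
  qed
  moreover have "\<exists>c>0. lower_riesz UNIV g c"
  proof -
    \<comment> \<open>\<open>n\<close> is chosen so that the tail of the differences costs at most
      half of the lower bound \<open>c\<close>; \<open>h\<close> keeps \<open>x\<close> before
      \<open>n\<close> and takes \<open>g\<close> from there on.\<close>
    have "(c/2)\<^sup>2 > 0" using c(1) by simp
    then obtain n where n: "norm (\<Sum>k. (N (r (k + n)))\<^sup>2) < (c/2)\<^sup>2"
      using suminf_exist_split[OF _ sr] by blast
    define h where "h k = (if k < n then x k else g k)" for k
    have hc: "h k \<in> carrier X" for k by (simp add: h_def xc gc)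
    define s where "s k = h k - x k" for k
    have sc': "s k \<in> carrier X" for k unfolding s_def by (intro diff_closed hc xc)
    have s0: "s k = (if k < n then 0 else r k)" for k by (simp add: s_def h_def r_def)
    have small: "N (lc s a F) \<le> c / 2 * l2 a F" if F: "finite F" for a F
    proof -
      have "N (lc s a F) \<le> l2 a F * L2_set (\<lambda>j. N (s j)) F" by (intro N_lc_le sc')
      also have "\<dots> \<le> l2 a F * (c / 2)"
      proof (rule mult_left_mono[OF _ L2_set_nonneg])
        have "(\<Sum>j\<in>F. (N (s j))\<^sup>2) = (\<Sum>j\<in>{j\<in>F. n \<le> j}. (N (r j))\<^sup>2)"
          using F by (intro sum.mono_neutral_cong_right) (auto simp: s0 N_zero)
        also have "\<dots> = (\<Sum>k\<in>(\<lambda>j. j - n) ` {j\<in>F. n \<le> j}. (N (r (k + n)))\<^sup>2)"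
          by (subst sum.reindex) (auto simp: inj_on_def)
        also have "\<dots> \<le> (\<Sum>k. (N (r (k + n)))\<^sup>2)"
          using F sr by (intro sum_le_suminf) (auto simp: summable_iff_shift[of "\<lambda>k. (N (r k))\<^sup>2"])
        also have "\<dots> \<le> (c/2)\<^sup>2" using n by simp
        finally have "sqrt (\<Sum>j\<in>F. (N (s j))\<^sup>2) \<le> sqrt ((c/2)\<^sup>2)" by (rule real_sqrt_le_mono)
        then show "L2_set (\<lambda>j. N (s j)) F \<le> c / 2" using c(1) by (simp add: L2_set_def)
      qed
      finally show ?thesis by (simp only: mult.commute)
    qed
    have heq: "lc h a F = lc x a F + lc s a F" for a F
    proof -
      have "h = (\<lambda>j. x j + s j)" by (simp add: s_def fun_eq_iff)
      then show ?thesis by (simp add: lc_vec_add)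
    qed
    have lch: "lc h a F \<in> carrier X" and lcs: "lc s a F \<in> carrier X" for a F by (intro lc_closed hc sc')+
    have hlow: "lower_riesz UNIV h (c/2)"
      unfolding lower_riesz_def
    proof (intro allI impI)
      fix F a assume F: "finite F \<and> F \<subseteq> (UNIV::nat set)"
      have "lc x a F = lc h a F - lc s a F" by (simp add: heq)
      then have "N (lc x a F) \<le> N (lc h a F) + N (lc s a F)" using N_diff_triangle[OF lch lcs] by simp
      then show "c / 2 * l2 a F \<le> N (lc h a F)" using low[of F a] small[of F a] F by simp
    qed
    text \<open>Each vector is at distance at most half its norm from the span of \<open>h\<close>; since the distance does
      not change when an element of the span is subtracted, it vanishes.\<close>
    have hcompl: "complete_system X UNIV h"
      unfolding complete_system_iff
    proof (intro conjI ballI hc)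
      fix f assume f: "f \<in> carrier X"
      \<comment> \<open>With error \<open>t / 8\<close> in the expansion along \<open>x\<close>,
        that expansion has norm at most \<open>9/8 * t\<close>, and replacing \<open>x\<close> by
        \<open>h\<close> costs half of it: \<open>1/8 + 9/16 \<le> 3/4\<close>.\<close>
      have step: "\<exists>F a. finite F \<and> N (u - lc h a F) \<le> 3/4 * t" if u: "u \<in> carrier X" "N u \<le> t" and t: "t > 0" for u t
      proof -
        have "t / 8 > 0" using t by simp
        then obtain F a where F: "finite F" "N (u - lc x a F) < t / 8"
          using xcompl u(1) unfolding complete_system_iff in_closed_span_def by blast
        have "N (lc x a F) \<le> N u + N (u - lc x a F)"
          using N_triangle_sub[OF lcx u(1), of a F] N_diff_commute[OF lcx u(1), of a F] by simp
        then have "N (lc x a F) \<le> 9/8 * t" using u F by simp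
        moreover have "N (lc s a F) \<le> 1/2 * N (lc x a F)" using small[OF F(1), of a] low[OF F(1), of a] by simp
        moreover have "N (u - lc h a F) \<le> N (u - lc x a F) + N (lc s a F)"
          using N_diff_triangle[OF diff_closed[OF u(1) lcx] lcs, of a F a F] by (simp add: heq diff_diff_eq)
        ultimately have "N (u - lc h a F) \<le> 3/4 * t" using F(2) t by simp
        then show ?thesis using F(1) by blast
      qed
      have iter: "\<exists>F a. finite F \<and> N (f - lc h a F) \<le> (3/4)^m * (N f + 1)" for m
      proof (induction m)
        case 0
        then show ?case by (intro exI[of _ "{}"] exI[of _ "\<lambda>_. 0"]) (simp add: lincomb_def)
      next
        case (Suc m)
        then obtain F a where F: "finite F" "N (f - lc h a F) \<le> (3/4)^m * (N f + 1)" by blast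
        obtain G b where G: "finite G" "N (f - lc h a F - lc h b G) \<le> 3/4 * ((3/4)^m * (N f + 1))"
          using step[OF diff_closed[OF f lch] F(2)] N_nonneg[OF f] by (auto intro: add_nonneg_pos)
        have "lc h a F + lc h b G = lc h (\<lambda>j. (if j \<in> F then a j else 0) + (if j \<in> G then b j else 0)) (F \<union> G)"
          unfolding lc_add using lc_extend[of "F \<union> G" F h a] lc_extend[of "F \<union> G" G h b] F(1) G(1) by simp
        then show ?case using F(1) G by (intro exI[of _ "F \<union> G"] exI[of _ "\<lambda>j. (if j \<in> F then a j else 0) + (if j \<in> G then b j else 0)"])
            (simp add: diff_diff_eq)
      qed
      show "in_closed_span h UNIV f"
        unfolding in_closed_span_def
      proof (intro allI impI)
        fix \<epsilon> :: real assume \<epsilon>: "\<epsilon> > 0"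
        have "(\<lambda>m. (3/4::real)^m * (N f + 1)) \<longlonglongrightarrow> 0 * (N f + 1)" by (intro tendsto_mult tendsto_const LIMSEQ_realpow_zero) auto
        then have "\<forall>\<^sub>F m in sequentially. (3/4::real)^m * (N f + 1) < \<epsilon>" by (rule order_tendstoD(2)) (use \<epsilon> in simp)
        then obtain m where "(3/4::real)^m * (N f + 1) < \<epsilon>" using eventually_happens'[OF sequentially_bot] by blast
        moreover obtain F a where "finite F" "N (f - lc h a F) \<le> (3/4)^m * (N f + 1)" using iter by blast
        ultimately show "\<exists>F a. finite F \<and> F \<subseteq> UNIV \<and> N (f - lc h a F) < \<epsilon>" by (meson le_less_trans subset_UNIV)
      qed
    qed
    \<comment> \<open>The elements of \<open>h\<close> under indices that remember their origin, so
      that the first \<open>n\<close> of them can be exchanged.\<close>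
    define z where "z = case_sum x g"
    let ?K = "Inl ` {..<n} \<union> Inr ` {n..} :: (nat + nat) set"
    define \<pi> where "\<pi> k = (if k < n then Inl k else Inr k :: nat + nat)" for k
    have z\<pi>: "z (\<pi> k) = h k" for k by (simp add: z_def \<pi>_def h_def)
    have bij: "bij_betw \<pi> UNIV ?K" by (rule bij_betwI[where g="case_sum id id"]) (auto simp: \<pi>_def)
    have lcz: "lc z a (\<pi> ` F) = lc h (\<lambda>k. a (\<pi> k)) F" for a F
    proof -
      have "inj_on \<pi> F" using bij by (meson bij_betw_def inj_on_subset subset_UNIV)
      then show ?thesis unfolding lincomb_def by (simp add: sum.reindex z\<pi>)
    qed
    have zc: "complete_system X ?K z"
    proof (rule complete_system_trans[OF hcompl])
      show "z k \<in> carrier X" if "k \<in> ?K" for k using that by (auto simp: z_def xc gc)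
      fix k
      have "\<pi> k \<in> ?K" by (auto simp: \<pi>_def)
      from in_closed_span_member[OF this, of z] show "in_closed_span z ?K (h k)" by (simp only: z\<pi>)
    qed
    have zl: "lower_riesz ?K z (c/2)"
      unfolding lower_riesz_def
    proof (intro allI impI)
      fix F a assume F: "finite F \<and> F \<subseteq> ?K"
      then have "F \<subseteq> range \<pi>" using bij by (simp add: bij_betw_def)
      then obtain G where G: "F = \<pi> ` G" by (meson subset_imageE)
      have inj: "inj_on \<pi> G" using bij by (meson bij_betw_def inj_on_subset subset_UNIV)
      have "finite G" using F G inj by (simp add: finite_image_iff)
      then have "c / 2 * l2 (\<lambda>k. a (\<pi> k)) G \<le> N (lc h (\<lambda>k. a (\<pi> k)) G)" using hlow by (simp add: lower_riesz_def)
      then show "c / 2 * l2 a F \<le> N (lc z a F)"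
        unfolding G lcz by (simp add: L2_set_def sum.reindex[OF inj])
    qed
    have "\<exists>c>0. lower_riesz (range Inr) z c"
    proof (rule exchange_all[of z "{..<n}" "{n..}"])
      show "complete_system X UNIV (\<lambda>k. z (Inr k))" using gcompl by (simp add: z_def)
      have "- {n..} = {..<n}" by auto
      then show "finite (- {n..})" "card (- {n..}) = card {..<n}" by auto
    qed (use zc zl c(1) in \<open>auto intro!: exI[of _ "c/2"]\<close>)
    then obtain c' where c': "c' > 0" "lower_riesz (range Inr) z c'" by blast
    have "lower_riesz UNIV g c'"
      unfolding lower_riesz_def
    proof (intro allI impI)
      fix F and a :: "nat \<Rightarrow> complex" assume F: "finite F \<and> F \<subseteq> (UNIV::nat set)"
      define b :: "nat + nat \<Rightarrow> complex" where "b = case_sum (\<lambda>_. 0) a"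
      have "c' * l2 b (Inr ` F) \<le> N (lc z b (Inr ` F))" using c'(2) F by (auto simp: lower_riesz_def)
      moreover have "lc z b (Inr ` F) = lc g a F" unfolding lincomb_def by (subst sum.reindex) (auto simp: z_def b_def)
      moreover have "l2 b (Inr ` F) = l2 a F" unfolding L2_set_def by (subst sum.reindex) (auto simp: b_def)
      ultimately show "c' * l2 a F \<le> N (lc g a F)" by simp
    qed
    then show ?thesis using c'(1) by blast
  qed
  ultimately show ?thesis by blast
qed

lemma schauder_scale:
  fixes g :: "nat \<Rightarrow> 'v"
  assumes g: "schauder_basis X g" and w: "\<And>k. w k \<noteq> 0"
  shows "schauder_basis X (\<lambda>k. sc (w k) (g k))"
  unfolding schauder_basis_def
proof (intro conjI allI ballI)
  have gc: "g k \<in> carrier X" for k using g by (simp add: schauder_basis_def)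
  show "sc (w k) (g k) \<in> carrier X" for k by (intro scale_closed gc)
  fix f assume f: "f \<in> carrier X"
  have eq: "lc (\<lambda>k. sc (w k) (g k)) d F = lc g (\<lambda>k. d k * w k) F" for d F
    by (simp add: lincomb_def scale_scale)
  have ex1: "\<exists>!d. (\<lambda>K. N (f - lc g d {..<K})) \<longlonglongrightarrow> 0"
    using g f unfolding schauder_basis_def by blast
  then obtain b where b: "(\<lambda>K. N (f - lc g b {..<K})) \<longlonglongrightarrow> 0" by (elim ex1E)
  have uniq: "d = b" if "(\<lambda>K. N (f - lc g d {..<K})) \<longlonglongrightarrow> 0" for d
    using ex1 by (elim ex1E) (use b that in metis)
  show "\<exists>!d. (\<lambda>K. N (f - lc (\<lambda>k. sc (w k) (g k)) d {..<K})) \<longlonglongrightarrow> 0"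
  proof (rule ex1I)
    show "(\<lambda>K. N (f - lc (\<lambda>k. sc (w k) (g k)) (\<lambda>k. b k / w k) {..<K})) \<longlonglongrightarrow> 0"
      unfolding eq using b w by simp
    fix d assume "(\<lambda>K. N (f - lc (\<lambda>k. sc (w k) (g k)) d {..<K})) \<longlonglongrightarrow> 0"
    then have "(\<lambda>k. d k * w k) = b" unfolding eq by (rule uniq)
    then show "d = (\<lambda>k. b k / w k)" using w by (intro ext) (simp add: eq_divide_eq fun_eq_iff)
  qed
qed

text \<open>Arbitrary nonzero factors \<open>w k\<close> may destroy the two-sided bounds, but they
  only rescale the coefficients of a Schauder expansion. The bounds for \<open>g\<close> are
  invariant under permutations, so every rearrangement is covered.\<close>

theorem unconditional_basisI:
  fixes g :: "nat \<Rightarrow> 'v"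
  assumes complete: "complete_system X UNIV g" and c: "0 < c" "lower_riesz UNIV g c" and C: "0 < C" "upper_riesz UNIV g C"
    and w: "\<And>k. w k \<noteq> 0"
  shows "unconditional_basis X (\<lambda>k. sc (w k) (g k))"
  unfolding unconditional_basis_def
proof (intro allI impI)
  fix \<pi> :: "nat \<Rightarrow> nat" assume \<pi>: "bij \<pi>"
  have inj: "inj_on \<pi> F" for F using \<pi> by (meson bij_def inj_on_subset subset_UNIV)
  define b where "b a k = a (inv \<pi> k)" for a :: "nat \<Rightarrow> complex" and k
  have b\<pi>: "b a (\<pi> k) = a k" for a k using \<pi> by (simp add: b_def bij_def)
  have lcp: "lc (\<lambda>k. g (\<pi> k)) a F = lc g (b a) (\<pi> ` F)" for a F
    unfolding lincomb_def by (simp add: sum.reindex[OF inj] b\<pi>)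
  have l2p: "l2 a F = l2 (b a) (\<pi> ` F)" for a F
    unfolding L2_set_def by (simp add: sum.reindex[OF inj] b\<pi>)
  have "schauder_basis X (\<lambda>k. g (\<pi> k))"
  proof (rule riesz_unconditional[OF _ c(1) _ C(1)])
    have "c * l2 a F \<le> N (lc (\<lambda>k. g (\<pi> k)) a F)" "N (lc (\<lambda>k. g (\<pi> k)) a F) \<le> C * l2 a F" if "finite F" for a F
      using c(2)[unfolded lower_riesz_def, rule_format, of "\<pi> ` F" "b a"]
        C(2)[unfolded upper_riesz_def, rule_format, of "\<pi> ` F" "b a"] that
      unfolding lcp l2p[of a F, symmetric] by auto
    then show "lower_riesz UNIV (\<lambda>k. g (\<pi> k)) c" "upper_riesz UNIV (\<lambda>k. g (\<pi> k)) C"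
      unfolding lower_riesz_def upper_riesz_def by blast+
    show "complete_system X UNIV (\<lambda>k. g (\<pi> k))"
    proof (rule complete_system_trans[OF complete])
      fix k
      have "g (\<pi> (inv \<pi> k)) = g k" using \<pi> by (simp add: bij_def surj_f_inv_f)
      then show "in_closed_span (\<lambda>k. g (\<pi> k)) UNIV (g k)"
        using in_closed_span_member[of "inv \<pi> k" UNIV "\<lambda>k. g (\<pi> k)"] by simp
      show "g (\<pi> k) \<in> carrier X" using complete unfolding complete_system_iff by blast
    qed
  qed
  then show "schauder_basis X (\<lambda>k. sc (w (\<pi> k)) (g (\<pi> k)))" by (rule schauder_scale) (rule w)
qed

end

section \<open>Exponentials in \<open>L\<^sub>2\<close>\<close>

lemma sq_integrable_add:
  assumes "f \<in> sq_integrable a b" "g \<in> sq_integrable a b"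
  shows "f + g \<in> sq_integrable a b"
proof -
  note [measurable] = assms[THEN sq_integrable_measurable]
  have i: "integrable (lebesgue_on {a<..<b}) (\<lambda>t. 2 * (cmod (f t))\<^sup>2 + 2 * (cmod (g t))\<^sup>2)"
    using assms by (auto simp: sq_integrable_def)
  have "integrable (lebesgue_on {a<..<b}) (\<lambda>t. (cmod (f t + g t))\<^sup>2)"
  proof (rule Bochner_Integration.integrable_bound[OF i])
    show "(\<lambda>t. (cmod (f t + g t))\<^sup>2) \<in> borel_measurable (lebesgue_on {a<..<b})" by measurable
    have "(cmod (f t + g t))\<^sup>2 \<le> 2 * (cmod (f t))\<^sup>2 + 2 * (cmod (g t))\<^sup>2" for t
    proof -
      have "(cmod (f t + g t))\<^sup>2 \<le> (cmod (f t) + cmod (g t))\<^sup>2" by (intro power_mono norm_triangle_ineq) auto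
      moreover have "0 \<le> (cmod (f t) - cmod (g t))\<^sup>2" by simp
      ultimately show ?thesis unfolding power2_sum power2_diff by linarith
    qed
    then show "AE t in lebesgue_on {a<..<b}. norm ((cmod (f t + g t))\<^sup>2) \<le> norm (2 * (cmod (f t))\<^sup>2 + 2 * (cmod (g t))\<^sup>2)" by simp
  qed
  then show ?thesis unfolding sq_integrable_def plus_fun_def by (auto intro!: borel_measurable_add simp: assms[THEN sq_integrable_measurable])
qed

lemma sq_integrable_scale: "f \<in> sq_integrable a b \<Longrightarrow> (\<lambda>t. c * f t) \<in> sq_integrable a b"
  by (auto simp: sq_integrable_def norm_mult power_mult_distrib)

lemma sq_integrable_ip:
  assumes "f \<in> sq_integrable a b" "g \<in> sq_integrable a b"
  shows "integrable (lebesgue_on {a<..<b}) (\<lambda>t. cnj (f t) * g t)"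
proof -
  note m = assms[THEN sq_integrable_measurable]
  have i: "integrable (lebesgue_on {a<..<b}) (\<lambda>t. (cmod (f t))\<^sup>2 + (cmod (g t))\<^sup>2)"
    using assms by (auto simp: sq_integrable_def)
  show ?thesis
  proof (rule Bochner_Integration.integrable_bound[OF i])
    show "(\<lambda>t. cnj (f t) * g t) \<in> borel_measurable (lebesgue_on {a<..<b})"
      using measurable_compose[OF m(1) borel_measurable_continuous_onI[of cnj]] m(2)
      by (intro borel_measurable_times) (auto intro: continuous_intros)
    have "cmod (f t) * cmod (g t) \<le> (cmod (f t))\<^sup>2 + (cmod (g t))\<^sup>2" for t
    proof -
      have "0 \<le> (cmod (f t) - cmod (g t))\<^sup>2" "0 \<le> cmod (f t) * cmod (g t)" by auto
      then show ?thesis unfolding power2_diff by linarith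
    qed
    then show "AE t in lebesgue_on {a<..<b}. norm (cnj (f t) * g t) \<le> norm ((cmod (f t))\<^sup>2 + (cmod (g t))\<^sup>2)"
      by (simp add: norm_mult)
  qed
qed

lemma L2_simps [simp]:
  "carrier (L2 a b) = sq_integrable a b" "scale (L2 a b) c f = (\<lambda>t. c * f t)"
  "ip (L2 a b) g h = (LINT t|lebesgue_on {a<..<b}. cnj (g t) * h t)"
  by (simp_all add: L2_def)

interpretation L2: semi_ip "L2 a b" for a b
proof
  show "0 \<in> carrier (L2 a b)" by (simp add: sq_integrable_def zero_fun_def)
  fix f g h :: "real \<Rightarrow> complex" and c d :: complex
  show "scale (L2 a b) c (f + g) = scale (L2 a b) c f + scale (L2 a b) c g"
    "scale (L2 a b) (c + d) f = scale (L2 a b) c f + scale (L2 a b) d f"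
    "scale (L2 a b) c (scale (L2 a b) d f) = scale (L2 a b) (c * d) f" "scale (L2 a b) 1 f = f"
    by (auto simp: fun_eq_iff algebra_simps)
  assume f: "f \<in> carrier (L2 a b)"
  show "scale (L2 a b) c f \<in> carrier (L2 a b)" using f by (simp add: sq_integrable_scale)
  show "0 \<le> Re (ip (L2 a b) f f)"
  proof -
    have "(LINT t|lebesgue_on {a<..<b}. cnj (f t) * f t) = (LINT t|lebesgue_on {a<..<b}. of_real ((cmod (f t))\<^sup>2))"
      by (intro Bochner_Integration.integral_cong refl) (simp only: complex_norm_square mult.commute)
    also have "\<dots> = of_real (LINT t|lebesgue_on {a<..<b}. (cmod (f t))\<^sup>2)" by (rule integral_complex_of_real)
    finally show ?thesis by (simp add: integral_nonneg_AE)
  qed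
  assume g: "g \<in> carrier (L2 a b)"
  show "f + g \<in> carrier (L2 a b)" using f g by (simp add: sq_integrable_add)
  show "ip (L2 a b) f (scale (L2 a b) c g) = c * ip (L2 a b) f g"
    by (simp add: mult.left_commute[of _ c])
  show "ip (L2 a b) g f = cnj (ip (L2 a b) f g)"
    by (simp add: mult.commute flip: Bochner_Integration.integral_cnj)
  assume h: "h \<in> carrier (L2 a b)"
  show "ip (L2 a b) f (g + h) = ip (L2 a b) f g + ip (L2 a b) f h"
    using f g h by (simp add: distrib_left Bochner_Integration.integral_add sq_integrable_ip)
qed

lemma hnorm_L2_sq:
  assumes "f \<in> sq_integrable a b"
  shows "(hnorm (L2 a b) f)\<^sup>2 = integral {a..b} (\<lambda>t. (cmod (f t))\<^sup>2)"
proof -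
  have "complex_of_real ((hnorm (L2 a b) f)\<^sup>2) = ip (L2 a b) f f" using L2.ip_self[of f a b] assms by simp
  also have "\<dots> = (LINT t|lebesgue_on {a<..<b}. of_real ((cmod (f t))\<^sup>2))"
    unfolding L2_simps by (intro Bochner_Integration.integral_cong refl) (simp only: complex_norm_square mult.commute)
  also have "\<dots> = of_real (LINT t|lebesgue_on {a<..<b}. (cmod (f t))\<^sup>2)" by (rule integral_complex_of_real)
  finally have "(hnorm (L2 a b) f)\<^sup>2 = (LINT t|lebesgue_on {a<..<b}. (cmod (f t))\<^sup>2)" by (simp only: of_real_eq_iff)
  also have "\<dots> = integral {a<..<b} (\<lambda>t. (cmod (f t))\<^sup>2)"
    using assms by (intro lebesgue_integral_eq_integral) (auto simp: sq_integrable_def)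
  also have "\<dots> = integral {a..b} (\<lambda>t. (cmod (f t))\<^sup>2)" by (rule integral_open_interval_real[symmetric])
  finally show ?thesis .
qed

lemma continuous_sq_integrable:
  assumes "continuous_on UNIV f"
  shows "f \<in> sq_integrable a b"
proof -
  have "(\<lambda>t. (cmod (f t))\<^sup>2) absolutely_integrable_on {a..b}"
    by (intro absolutely_integrable_continuous_real continuous_intros continuous_on_subset[OF assms]) auto
  then have "(\<lambda>t. (cmod (f t))\<^sup>2) absolutely_integrable_on {a<..<b}" by (simp only: integrable_on_Icc_Ioo)
  then have "integrable (lebesgue_on {a<..<b}) (\<lambda>t. (cmod (f t))\<^sup>2)"
    unfolding set_integrable_def by (subst integrable_restrict_space) auto
  moreover have "f \<in> borel_measurable (lebesgue_on {a<..<b})"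
    by (intro continuous_imp_measurable_on_sets_lebesgue continuous_on_subset[OF assms]) auto
  ultimately show ?thesis by (simp add: sq_integrable_def)
qed

lemma hnorm_L2_le:
  assumes f: "continuous_on UNIV f" and "a \<le> b" and M: "\<And>t. t \<in> {a..b} \<Longrightarrow> cmod (f t) \<le> M"
  shows "hnorm (L2 a b) f \<le> M * sqrt (b - a)"
proof (rule power2_le_imp_le)
  have M0: "0 \<le> M" by (rule order.trans[OF norm_ge_zero M[of a]]) (use \<open>a \<le> b\<close> in simp)
  have "(hnorm (L2 a b) f)\<^sup>2 = integral {a..b} (\<lambda>t. (cmod (f t))\<^sup>2)" by (rule hnorm_L2_sq[OF continuous_sq_integrable[OF f]])
  also have "\<dots> \<le> integral {a..b} (\<lambda>t. M\<^sup>2)"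
    by (intro integral_le integrable_continuous_real continuous_intros continuous_on_subset[OF f] power_mono M) auto
  also have "\<dots> = (M * sqrt (b - a))\<^sup>2" using \<open>a \<le> b\<close> by (simp add: power_mult_distrib mult.commute)
  finally show "(hnorm (L2 a b) f)\<^sup>2 \<le> (M * sqrt (b - a))\<^sup>2" .
  show "0 \<le> M * sqrt (b - a)" using M0 \<open>a \<le> b\<close> by simp
qed

section \<open>Direct sums and the scalar field\<close>

lemma direct_sum_simps [simp]:
  "carrier (direct_sum X Y) = carrier X \<times> carrier Y"
  "scale (direct_sum X Y) c (f, g) = (scale X c f, scale Y c g)"
  "ip (direct_sum X Y) (f, g) (f', g') = ip X f f' + ip Y g g'"
  by (simp_all add: direct_sum_def)

lemma semi_ip_direct_sum:
  assumes "semi_ip X" "semi_ip Y"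
  shows "semi_ip (direct_sum X Y)"
proof -
  interpret X: semi_ip X by fact
  interpret Y: semi_ip Y by fact
  show ?thesis
  proof
    show "0 \<in> carrier (direct_sum X Y)" by (simp add: zero_prod_def X.zero_closed Y.zero_closed)
    fix f g h :: "'a \<times> 'b" and c d :: complex
    obtain f1 f2 g1 g2 h1 h2 where [simp]: "f = (f1, f2)" "g = (g1, g2)" "h = (h1, h2)" by (cases f, cases g, cases h)
    show "scale (direct_sum X Y) c (f + g) = scale (direct_sum X Y) c f + scale (direct_sum X Y) c g"
      "scale (direct_sum X Y) (c + d) f = scale (direct_sum X Y) c f + scale (direct_sum X Y) d f"
      "scale (direct_sum X Y) c (scale (direct_sum X Y) d f) = scale (direct_sum X Y) (c * d) f"
      "scale (direct_sum X Y) 1 f = f"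
      by (simp_all add: X.scale_add Y.scale_add X.add_scale Y.add_scale X.scale_scale Y.scale_scale X.scale_one Y.scale_one)
    assume f: "f \<in> carrier (direct_sum X Y)"
    show "scale (direct_sum X Y) c f \<in> carrier (direct_sum X Y)" using f by (simp add: X.scale_closed Y.scale_closed)
    show "0 \<le> Re (ip (direct_sum X Y) f f)" using f by (simp add: X.ip_ge Y.ip_ge)
    assume g: "g \<in> carrier (direct_sum X Y)"
    show "f + g \<in> carrier (direct_sum X Y)" using f g by (simp add: X.add_closed Y.add_closed)
    show "ip (direct_sum X Y) f (scale (direct_sum X Y) c g) = c * ip (direct_sum X Y) f g"
      using f g by (simp add: X.ip_scale Y.ip_scale distrib_left)
    show "ip (direct_sum X Y) g f = cnj (ip (direct_sum X Y) f g)"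
      using f g X.ip_cnj[of f1 g1] Y.ip_cnj[of f2 g2] by simp
    assume h: "h \<in> carrier (direct_sum X Y)"
    show "ip (direct_sum X Y) f (g + h) = ip (direct_sum X Y) f g + ip (direct_sum X Y) f h"
      using f g h by (simp add: X.ip_add Y.ip_add)
  qed
qed

lemma hnorm_direct_sum:
  assumes "semi_ip X" "semi_ip Y" "f \<in> carrier X" "g \<in> carrier Y"
  shows "(hnorm (direct_sum X Y) (f, g))\<^sup>2 = (hnorm X f)\<^sup>2 + (hnorm Y g)\<^sup>2"
proof -
  interpret X: semi_ip X by fact
  interpret Y: semi_ip Y by fact
  show ?thesis using X.ip_ge[OF assms(3)] Y.ip_ge[OF assms(4)] by (simp add: hnorm_def)
qed

lemma hnorm_direct_sum_le:
  assumes "semi_ip X" "semi_ip Y" "f \<in> carrier X" "g \<in> carrier Y"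
  shows "hnorm (direct_sum X Y) (f, g) \<le> hnorm X f + hnorm Y g"
    and "hnorm X f \<le> hnorm (direct_sum X Y) (f, g)" and "hnorm Y g \<le> hnorm (direct_sum X Y) (f, g)"
proof -
  interpret X: semi_ip X by fact
  interpret Y: semi_ip Y by fact
  interpret XY: semi_ip "direct_sum X Y" by (rule semi_ip_direct_sum) fact+
  have n: "0 \<le> hnorm X f" "0 \<le> hnorm Y g" "0 \<le> hnorm (direct_sum X Y) (f, g)"
    using X.N_nonneg[OF assms(3)] Y.N_nonneg[OF assms(4)] XY.N_nonneg[of "(f, g)"] assms(3,4) by auto
  note eq = hnorm_direct_sum[OF assms]
  have "(hnorm (direct_sum X Y) (f, g))\<^sup>2 \<le> (hnorm X f + hnorm Y g)\<^sup>2" using n by (simp add: eq power2_sum)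
  then show "hnorm (direct_sum X Y) (f, g) \<le> hnorm X f + hnorm Y g" by (rule power2_le_imp_le) (use n in simp)
  show "hnorm X f \<le> hnorm (direct_sum X Y) (f, g)" by (rule power2_le_imp_le) (use n eq in auto)
  show "hnorm Y g \<le> hnorm (direct_sum X Y) (f, g)" by (rule power2_le_imp_le) (use n eq in auto)
qed

lemma lincomb_direct_sum:
  assumes "semi_ip X" "semi_ip Y"
  shows "lincomb (direct_sum X Y) (\<lambda>j. (x j, y j)) c F = (lincomb X x c F, lincomb Y y c F)"
  by (induction F rule: infinite_finite_induct) (auto simp: lincomb_def zero_prod_def)

interpretation H: semi_ip \<H>
  unfolding \<H>_def by (intro semi_ip_direct_sum L2.semi_ip_axioms)

text \<open>The scalars as a space of the same kind, so that pairs of a function and a value of a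
  functional form a direct sum; graphs of functionals live there.\<close>

definition Csp :: "complex ip_space" where
  "Csp = \<lparr>carrier = UNIV, scale = (*), ip = (\<lambda>a b. cnj a * b)\<rparr>"

lemma Csp_simps [simp]: "carrier Csp = UNIV" "scale Csp = (*)" "ip Csp a b = cnj a * b"
  by (simp_all add: Csp_def)

interpretation Csp: semi_ip Csp
  by unfold_locales (auto simp: algebra_simps)

lemma hnorm_Csp [simp]: "hnorm Csp z = cmod z"
  by (simp add: hnorm_def cmod_def power2_eq_square)

section \<open>Exponentials and their derivatives in the spectral parameter\<close>

definition ex :: "nat \<Rightarrow> complex \<Rightarrow> real \<Rightarrow> complex" where
  "ex \<nu> z t = (\<i> * of_real t) ^ \<nu> / fact \<nu> * exp (\<i> * z * of_real t)"

lemma ex_0: "ex 0 z t = exp (\<i> * z * of_real t)"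
  by (simp add: ex_def)

lemma taylor_coeff_exp: "taylor_coeff \<nu> (\<lambda>z. exp (\<i> * z * of_real t)) z = ex \<nu> z t"
proof -
  have "(deriv ^^ \<nu>) (\<lambda>z. exp (\<i> * z * of_real t)) = (\<lambda>z. (\<i> * of_real t) ^ \<nu> * exp (\<i> * z * of_real t))"
  proof (induction \<nu>)
    case (Suc \<nu>)
    have "deriv (\<lambda>z. (\<i> * of_real t) ^ \<nu> * exp (\<i> * z * of_real t)) z = (\<i> * of_real t) ^ Suc \<nu> * exp (\<i> * z * of_real t)" for z
      by (rule DERIV_imp_deriv) (auto intro!: derivative_eq_intros)
    then show ?case by (intro ext) (simp only: funpow.simps o_apply Suc.IH)
  qed simp
  then show ?thesis by (simp add: taylor_coeff_def ex_def)
qed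

lemma ex_continuous: "continuous_on S (ex \<nu> z)"
  unfolding ex_def[abs_def] by (intro continuous_intros) auto

lemma ex_sq_integrable: "ex \<nu> z \<in> sq_integrable a b"
  by (rule continuous_sq_integrable[OF ex_continuous])

text \<open>The second-order Taylor remainder of \<open>exp\<close> at
  \<open>w = \<i> * h * t\<close>. The factor \<open>of_nat (Suc \<nu>)\<close> reflects the
  division by factorials in \<open>ex\<close>.\<close>

lemma ex_quotient_bound:
  assumes "a \<le> b"
  shows "\<exists>K\<ge>0. \<forall>h. h \<noteq> 0 \<and> cmod h \<le> 1 \<longrightarrow>
    hnorm (L2 a b) (scale (L2 a b) (1 / h) (ex \<nu> (z + h) - ex \<nu> z) - scale (L2 a b) (of_nat (Suc \<nu>)) (ex (Suc \<nu>) z)) \<le> K * cmod h"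
proof -
  define A where "A = max \<bar>a\<bar> \<bar>b\<bar>"
  define K where "K = A ^ \<nu> * exp (cmod z * A) * (exp A * A\<^sup>2)"
  have A: "0 \<le> A" by (simp add: A_def)
  have K: "0 \<le> K" using A by (simp add: K_def)
  have "hnorm (L2 a b) (scale (L2 a b) (1 / h) (ex \<nu> (z + h) - ex \<nu> z) - scale (L2 a b) (of_nat (Suc \<nu>)) (ex (Suc \<nu>) z)) \<le> K * cmod h * sqrt (b - a)"
    if h: "h \<noteq> 0" "cmod h \<le> 1" for h
  proof (rule hnorm_L2_le[OF _ \<open>a \<le> b\<close>])
    show "continuous_on UNIV (scale (L2 a b) (1 / h) (ex \<nu> (z + h) - ex \<nu> z) - scale (L2 a b) (of_nat (Suc \<nu>)) (ex (Suc \<nu>) z))"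
      by (simp add: fun_diff_def) (auto intro!: continuous_intros ex_continuous simp: h)
    fix t assume t: "t \<in> {a..b}"
    then have tA: "\<bar>t\<bar> \<le> A" by (auto simp: A_def)
    define w where "w = \<i> * h * of_real t"
    have w: "cmod w = cmod h * \<bar>t\<bar>" by (simp add: w_def norm_mult)
    have wA: "cmod w \<le> A" using mult_mono[OF h(2) tA] A by (simp add: w)
    have "cmod (exp w - (\<Sum>k\<le>1. w ^ k / fact k)) \<le> exp \<bar>Re w\<bar> * (cmod w) ^ Suc 1 / fact 1" by (rule Taylor_exp)
    then have ew: "cmod (exp w - 1 - w) \<le> exp \<bar>Re w\<bar> * (cmod w)\<^sup>2" by (simp add: power2_eq_square diff_diff_eq)
    have "exp \<bar>Re w\<bar> \<le> exp A" using abs_Re_le_cmod[of w] wA by simp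
    moreover have "(cmod w)\<^sup>2 \<le> (cmod h)\<^sup>2 * A\<^sup>2"
      unfolding w power_mult_distrib using tA by (intro mult_left_mono power_mono) auto
    ultimately have "exp \<bar>Re w\<bar> * (cmod w)\<^sup>2 \<le> exp A * ((cmod h)\<^sup>2 * A\<^sup>2)" by (intro mult_mono) auto
    then have ew': "cmod (exp w - 1 - w) \<le> (cmod h)\<^sup>2 * (exp A * A\<^sup>2)"
      using order.trans[OF ew] by (simp only: mult.left_commute)
    have "(scale (L2 a b) (1 / h) (ex \<nu> (z + h) - ex \<nu> z) - scale (L2 a b) (of_nat (Suc \<nu>)) (ex (Suc \<nu>) z)) t
        = (\<i> * of_real t) ^ \<nu> / fact \<nu> * exp (\<i> * z * of_real t) * ((exp w - 1 - w) / h)"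
    proof -
      have "ex \<nu> (z + h) t = (\<i> * of_real t) ^ \<nu> / fact \<nu> * (exp (\<i> * z * of_real t) * exp w)"
        by (simp add: ex_def w_def algebra_simps flip: exp_add)
      moreover have "of_nat (Suc \<nu>) * ex (Suc \<nu>) z t = (\<i> * of_real t) ^ \<nu> / fact \<nu> * (exp (\<i> * z * of_real t) * (w / h))"
        using h(1) by (simp add: ex_def w_def field_simps del: of_nat_Suc)
      ultimately show ?thesis using h(1) by (simp add: ex_def field_simps)
    qed
    then have "cmod ((scale (L2 a b) (1 / h) (ex \<nu> (z + h) - ex \<nu> z) - scale (L2 a b) (of_nat (Suc \<nu>)) (ex (Suc \<nu>) z)) t)
        = \<bar>t\<bar> ^ \<nu> / fact \<nu> * cmod (exp (\<i> * z * of_real t)) * (cmod (exp w - 1 - w) / cmod h)"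
      by (simp add: norm_mult norm_divide norm_power del: L2_simps norm_exp_eq_Re)
    also have "\<dots> \<le> A ^ \<nu> * exp (cmod z * A) * ((cmod h)\<^sup>2 * (exp A * A\<^sup>2) / cmod h)"
    proof (intro mult_mono)
      have "\<bar>t\<bar> ^ \<nu> / fact \<nu> \<le> \<bar>t\<bar> ^ \<nu> / 1" by (intro divide_left_mono) (auto simp: fact_ge_1)
      also have "\<dots> \<le> A ^ \<nu>" using tA by (simp add: power_mono)
      finally show "\<bar>t\<bar> ^ \<nu> / fact \<nu> \<le> A ^ \<nu>" .
      have "cmod (exp (\<i> * z * of_real t)) \<le> exp (cmod (\<i> * z * of_real t))" by (rule norm_exp)
      also have "\<dots> \<le> exp (cmod z * A)" using tA by (simp add: norm_mult mult_left_mono)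
      finally show "cmod (exp (\<i> * z * of_real t)) \<le> exp (cmod z * A)" .
      show "cmod (exp w - 1 - w) / cmod h \<le> (cmod h)\<^sup>2 * (exp A * A\<^sup>2) / cmod h" using ew' by (intro divide_right_mono) auto
    qed (use A in auto)
    also have "\<dots> = K * cmod h" using h(1) by (simp add: K_def power2_eq_square)
    finally show "cmod ((scale (L2 a b) (1 / h) (ex \<nu> (z + h) - ex \<nu> z) - scale (L2 a b) (of_nat (Suc \<nu>)) (ex (Suc \<nu>) z)) t) \<le> K * cmod h" .
  qed
  then show ?thesis using K \<open>a \<le> b\<close> by (intro exI[of _ "K * sqrt (b - a)"]) (auto simp: mult_ac)
qed

lemma functional_diff:
  assumes "L2.bounded_functional a b L" "f \<in> sq_integrable a b" "g \<in> sq_integrable a b"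
  shows "L (f - g) = L f - L g"
proof -
  have "L (f + (- g)) = L f + L (- g)" using assms L2.minus_closed[of g a b] unfolding L2.bounded_functional_def L2_simps by blast
  moreover have "L (scale (L2 a b) (-1) g) = - L g" using assms unfolding L2.bounded_functional_def by (metis L2_simps(1) mult_minus1)
  then have "L (- g) = - L g" by (simp only: L2.scale_minus_one)
  ultimately show ?thesis by simp
qed

text \<open>The difference quotients converge in norm, so a bounded functional commutes with their
  limit. Hence the transform of a functional is entire, with Taylor coefficients obtained from the
  functions \<open>ex\<close>.\<close>

lemma functional_ex_derivative:
  assumes L: "L2.bounded_functional a b L" and "a \<le> b"
  shows "((\<lambda>z. L (ex \<nu> z)) has_field_derivative of_nat (Suc \<nu>) * L (ex (Suc \<nu>) z)) (at z)"
proof -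
  obtain C where C: "C \<ge> 0" "\<And>f. f \<in> sq_integrable a b \<Longrightarrow> cmod (L f) \<le> C * hnorm (L2 a b) f"
    using L by (auto simp: L2.bounded_functional_def)
  obtain K where K: "K \<ge> 0" "\<And>h. h \<noteq> 0 \<Longrightarrow> cmod h \<le> 1 \<Longrightarrow>
     hnorm (L2 a b) (scale (L2 a b) (1 / h) (ex \<nu> (z + h) - ex \<nu> z) - scale (L2 a b) (of_nat (Suc \<nu>)) (ex (Suc \<nu>) z)) \<le> K * cmod h"
    using ex_quotient_bound[OF \<open>a \<le> b\<close>, of \<nu> z] by blast
  have scl: "L (scale (L2 a b) c f) = c * L f" if "f \<in> sq_integrable a b" for c f
    using L that unfolding L2.bounded_functional_def by simp
  have "cmod ((L (ex \<nu> (z + h)) - L (ex \<nu> z)) / h - of_nat (Suc \<nu>) * L (ex (Suc \<nu>) z)) \<le> C * K * cmod h" if h: "h \<noteq> 0" "cmod h \<le> 1" for h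
  proof -
    have e: "ex \<nu> (z + h) - ex \<nu> z \<in> sq_integrable a b" using L2.diff_closed[of "ex \<nu> (z + h)" a b "ex \<nu> z"] by (simp add: ex_sq_integrable)
    have s: "scale (L2 a b) (1 / h) (ex \<nu> (z + h) - ex \<nu> z) \<in> sq_integrable a b" "scale (L2 a b) (of_nat (Suc \<nu>)) (ex (Suc \<nu>) z) \<in> sq_integrable a b"
      using L2.scale_closed[of _ a b] e ex_sq_integrable by (simp_all del: L2_simps add: L2_simps(1))
    have "(L (ex \<nu> (z + h)) - L (ex \<nu> z)) / h - of_nat (Suc \<nu>) * L (ex (Suc \<nu>) z)
        = L (scale (L2 a b) (1 / h) (ex \<nu> (z + h) - ex \<nu> z) - scale (L2 a b) (of_nat (Suc \<nu>)) (ex (Suc \<nu>) z))"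
      unfolding functional_diff[OF L s] scl[OF e] scl[OF ex_sq_integrable] functional_diff[OF L ex_sq_integrable ex_sq_integrable] by simp
    also have "cmod \<dots> \<le> C * (K * cmod h)"
      using L2.diff_closed[of _ a b] s by (intro order.trans[OF C(2) mult_left_mono[OF K(2)]] h C) (simp_all del: L2_simps add: L2_simps(1))
    finally show ?thesis by simp
  qed
  then have "\<forall>\<^sub>F h in at 0. cmod ((L (ex \<nu> (z + h)) - L (ex \<nu> z)) / h - of_nat (Suc \<nu>) * L (ex (Suc \<nu>) z)) \<le> C * K * cmod h"
    unfolding eventually_at by (intro exI[of _ 1]) auto
  moreover have "((\<lambda>h. C * K * cmod h) \<longlongrightarrow> 0) (at 0)" by (auto intro!: tendsto_eq_intros)
  ultimately have "((\<lambda>h. (L (ex \<nu> (z + h)) - L (ex \<nu> z)) / h - of_nat (Suc \<nu>) * L (ex (Suc \<nu>) z)) \<longlongrightarrow> 0) (at 0)"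
    by (rule Lim_null_comparison)
  then show ?thesis unfolding DERIV_def by (simp only: Lim_null[symmetric])
qed

lemma functional_ex_taylor:
  assumes L: "L2.bounded_functional a b L" and "a \<le> b"
  shows "(\<lambda>z. L (ex 0 z)) holomorphic_on S" "taylor_coeff \<nu> (\<lambda>z. L (ex 0 z)) z = L (ex \<nu> z)"
proof -
  have "(deriv ^^ \<nu>) (\<lambda>z. L (ex 0 z)) = (\<lambda>z. fact \<nu> * L (ex \<nu> z))"
  proof (induction \<nu>)
    case (Suc \<nu>)
    have "deriv (\<lambda>z. fact \<nu> * L (ex \<nu> z)) z = fact \<nu> * (of_nat (Suc \<nu>) * L (ex (Suc \<nu>) z))" for z
      by (intro DERIV_imp_deriv DERIV_cmult functional_ex_derivative[OF assms])
    then show ?case by (intro ext) (simp only: funpow.simps o_apply Suc.IH fact_Suc mult_ac of_nat_mult of_nat_fact)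
  qed simp
  then show "taylor_coeff \<nu> (\<lambda>z. L (ex 0 z)) z = L (ex \<nu> z)" by (simp add: taylor_coeff_def)
  show "(\<lambda>z. L (ex 0 z)) holomorphic_on S"
    using functional_ex_derivative[OF assms, of 0] by (auto simp: holomorphic_on_def field_differentiable_def intro: has_field_derivative_at_within)
qed

text \<open>Derivatives with respect to the spectral parameter are limits of difference quotients, so
  the graph \<open>{(ex 0 z, D z)}\<close> contains \<open>(ex \<nu> z, D\<^bsup><\<nu>>\<^esup> z)\<close> in its closed linear span.\<close>

lemma graph_closed_span:
  assumes D: "D holomorphic_on UNIV" and "a \<le> b"
  shows "semi_ip.in_closed_span (direct_sum (L2 a b) Csp) (\<lambda>z. (ex 0 z, D z)) UNIV (ex \<nu> z, taylor_coeff \<nu> D z)"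
proof -
  interpret P: semi_ip "direct_sum (L2 a b) Csp" by (intro semi_ip_direct_sum L2.semi_ip_axioms Csp.semi_ip_axioms)
  have zc: "(ex \<nu> z, d) \<in> carrier (direct_sum (L2 a b) Csp)" for \<nu> z d by (simp add: ex_sq_integrable)
  show ?thesis
  proof (induction \<nu> arbitrary: z)
    case 0
    show ?case using P.in_closed_span_member[of z UNIV "\<lambda>z. (ex 0 z, D z)"] by (simp add: taylor_coeff_def)
  next
    case (Suc \<nu>)
    obtain K where K: "K \<ge> 0" "\<And>h. h \<noteq> 0 \<Longrightarrow> cmod h \<le> 1 \<Longrightarrow>
       hnorm (L2 a b) (scale (L2 a b) (1 / h) (ex \<nu> (z + h) - ex \<nu> z) - scale (L2 a b) (of_nat (Suc \<nu>)) (ex (Suc \<nu>) z)) \<le> K * cmod h"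
      using ex_quotient_bound[OF \<open>a \<le> b\<close>, of \<nu> z] by blast
    define T where "T = taylor_coeff \<nu> D"
    have dT: "(T has_field_derivative of_nat (Suc \<nu>) * taylor_coeff (Suc \<nu>) D z) (at z)"
    proof -
      have "(deriv ^^ \<nu>) D holomorphic_on UNIV" by (intro holomorphic_higher_deriv D) auto
      then have "((deriv ^^ \<nu>) D has_field_derivative (deriv ^^ Suc \<nu>) D z) (at z)"
        by (simp add: holomorphic_derivI)
      then have "((\<lambda>z. (deriv ^^ \<nu>) D z / fact \<nu>) has_field_derivative (deriv ^^ Suc \<nu>) D z / fact \<nu>) (at z)"
        by (rule DERIV_cdivide)
      moreover have "(deriv ^^ Suc \<nu>) D z / fact \<nu> = of_nat (Suc \<nu>) * taylor_coeff (Suc \<nu>) D z"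
        by (simp add: taylor_coeff_def del: of_nat_Suc)
      ultimately show ?thesis by (simp add: T_def taylor_coeff_def[abs_def] del: of_nat_Suc)
    qed
    define n where "n = complex_of_nat (Suc \<nu>)"
    \<comment> \<open>Since the modulus of \<open>n\<close> is at least 1, the error of the pair is
      at most \<open>n\<close> times that error, which is what the difference quotients
      estimate.\<close>
    have n: "n \<noteq> 0" "1 \<le> cmod n" unfolding n_def by (simp_all only: norm_of_nat) (simp_all del: of_nat_Suc)
    show ?case
    proof (rule P.in_closed_span_limit)
      show "(ex (Suc \<nu>) z, taylor_coeff (Suc \<nu>) D z) \<in> carrier (direct_sum (L2 a b) Csp)" by (rule zc)
      show "(ex 0 k, D k) \<in> carrier (direct_sum (L2 a b) Csp)" for k by (rule zc)
      fix \<epsilon> :: real assume \<epsilon>: "\<epsilon> > 0"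
      have "((\<lambda>h. (T (z + h) - T z) / h) \<longlongrightarrow> n * taylor_coeff (Suc \<nu>) D z) (at 0)"
        using dT unfolding DERIV_def n_def .
      then have "\<forall>\<^sub>F h in at 0. dist ((T (z + h) - T z) / h) (n * taylor_coeff (Suc \<nu>) D z) < \<epsilon> / 2"
        using \<epsilon> by (intro tendstoD) auto
      moreover have "\<forall>\<^sub>F h in at (0::complex). K * cmod h < \<epsilon> / 2"
      proof (rule order_tendstoD(2))
        show "((\<lambda>h::complex. K * cmod h) \<longlongrightarrow> 0) (at 0)" by (auto intro!: tendsto_eq_intros)
      qed (use \<epsilon> in simp)
      moreover have "\<forall>\<^sub>F h in at (0::complex). h \<noteq> 0 \<and> cmod h \<le> 1"
        unfolding eventually_at by (intro exI[of _ 1]) auto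
      ultimately have "\<forall>\<^sub>F h in at 0. dist ((T (z + h) - T z) / h) (n * taylor_coeff (Suc \<nu>) D z) < \<epsilon> / 2 \<and> K * cmod h < \<epsilon> / 2 \<and> h \<noteq> 0 \<and> cmod h \<le> 1"
        by eventually_elim simp
      then obtain h where h: "dist ((T (z + h) - T z) / h) (n * taylor_coeff (Suc \<nu>) D z) < \<epsilon> / 2" "K * cmod h < \<epsilon> / 2" "h \<noteq> 0" "cmod h \<le> 1"
        using eventually_happens'[of "at (0::complex)"] by (auto simp: trivial_limit_at)
      define g where "g = scale (direct_sum (L2 a b) Csp) (1 / (n * h)) ((ex \<nu> (z + h), T (z + h)) - (ex \<nu> z, T z))"
      have dc: "(ex \<nu> (z + h), T (z + h)) - (ex \<nu> z, T z) \<in> carrier (direct_sum (L2 a b) Csp)" by (intro P.diff_closed zc)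
      have gc: "g \<in> carrier (direct_sum (L2 a b) Csp)" unfolding g_def by (intro P.scale_closed dc)
      have "P.in_closed_span (\<lambda>z. (ex 0 z, D z)) UNIV ((ex \<nu> (z + h), T (z + h)) + scale (direct_sum (L2 a b) Csp) (-1) (ex \<nu> z, T z))"
        unfolding T_def by (intro P.in_closed_span_add P.in_closed_span_scale Suc.IH zc P.scale_closed)
      then have "P.in_closed_span (\<lambda>z. (ex 0 z, D z)) UNIV g"
          unfolding g_def by (intro P.in_closed_span_scale dc zc) (simp only: P.scale_minus_one add_uminus_conv_diff)
      moreover have "hnorm (direct_sum (L2 a b) Csp) ((ex (Suc \<nu>) z, taylor_coeff (Suc \<nu>) D z) - g) < \<epsilon>"
      proof -
        define q where "q = scale (L2 a b) (1 / h) (ex \<nu> (z + h) - ex \<nu> z) - scale (L2 a b) (of_nat (Suc \<nu>)) (ex (Suc \<nu>) z)"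
        define q' where "q' = (T (z + h) - T z) / h - n * taylor_coeff (Suc \<nu>) D z"
        have qc: "q \<in> carrier (L2 a b)" unfolding q_def
          by (intro L2.diff_closed L2.scale_closed) (simp_all add: ex_sq_integrable)
        have "scale (direct_sum (L2 a b) Csp) (-n) ((ex (Suc \<nu>) z, taylor_coeff (Suc \<nu>) D z) - g) = (q, q')"
          unfolding g_def q_def q'_def n_def[symmetric] using n(1) h(3)
          by (simp add: fun_eq_iff field_simps)
        then have "cmod (-n) * hnorm (direct_sum (L2 a b) Csp) ((ex (Suc \<nu>) z, taylor_coeff (Suc \<nu>) D z) - g) = hnorm (direct_sum (L2 a b) Csp) (q, q')"
          using P.N_scale[OF P.diff_closed[OF zc gc]] by metis
        moreover have "hnorm (direct_sum (L2 a b) Csp) (q, q') \<le> hnorm (L2 a b) q + hnorm Csp q'"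
          by (intro hnorm_direct_sum_le L2.semi_ip_axioms Csp.semi_ip_axioms qc) simp
        moreover have "hnorm (L2 a b) q \<le> K * cmod h" unfolding q_def by (intro K h)
        moreover have "hnorm Csp q' < \<epsilon> / 2" using h(1) by (simp add: q'_def dist_norm)
        moreover have "hnorm (direct_sum (L2 a b) Csp) ((ex (Suc \<nu>) z, taylor_coeff (Suc \<nu>) D z) - g)
            \<le> cmod (-n) * hnorm (direct_sum (L2 a b) Csp) ((ex (Suc \<nu>) z, taylor_coeff (Suc \<nu>) D z) - g)"
          using mult_right_mono[OF n(2) P.N_nonneg[OF P.diff_closed[OF zc[of "Suc \<nu>" z "taylor_coeff (Suc \<nu>) D z"] gc]]] by simp
        ultimately show ?thesis using h(2) by linarith
      qed
      ultimately show "\<exists>g\<in>carrier (direct_sum (L2 a b) Csp). P.in_closed_span (\<lambda>z. (ex 0 z, D z)) UNIV g \<and>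
          hnorm (direct_sum (L2 a b) Csp) ((ex (Suc \<nu>) z, taylor_coeff (Suc \<nu>) D z) - g) < \<epsilon>"
        using gc by blast
    qed
  qed
qed

lemma lincomb_L2: "lincomb (L2 a b) x c F = (\<lambda>t. \<Sum>j\<in>F. c j * x j t)"
  by (induction F rule: infinite_finite_induct) (auto simp: lincomb_def fun_eq_iff)

lemma sq_integrable_restrict:
  assumes f: "f \<in> sq_integrable a b" and "a \<le> c" "d \<le> b"
  shows "f \<in> sq_integrable c d" "hnorm (L2 c d) f \<le> hnorm (L2 a b) f"
proof -
  have sub: "{c<..<d} \<subseteq> {a<..<b}" using assms by auto
  have m: "f \<in> borel_measurable (lebesgue_on {c<..<d})"
    by (rule measurable_restrict_mono[OF sq_integrable_measurable[OF f] sub])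
  have i: "(\<lambda>t. (cmod (f t))\<^sup>2) integrable_on {a..b}"
    using sq_integrable_square[OF f] by (simp only: integrable_on_open_interval_real)
  have i': "(\<lambda>t. (cmod (f t))\<^sup>2) integrable_on {c..d}" using assms by (intro integrable_on_subinterval[OF i]) auto
  then have "(\<lambda>t. (cmod (f t))\<^sup>2) integrable_on {c<..<d}" by (simp only: integrable_on_open_interval_real)
  then have "(\<lambda>t. (cmod (f t))\<^sup>2) absolutely_integrable_on {c<..<d}" by (rule nonnegative_absolutely_integrable_1) simp
  then have "integrable (lebesgue_on {c<..<d}) (\<lambda>t. (cmod (f t))\<^sup>2)"
    unfolding set_integrable_def by (subst integrable_restrict_space) auto
  then show s: "f \<in> sq_integrable c d" using m by (simp add: sq_integrable_def)
  show "hnorm (L2 c d) f \<le> hnorm (L2 a b) f"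
  proof (rule power2_le_imp_le)
    show "(hnorm (L2 c d) f)\<^sup>2 \<le> (hnorm (L2 a b) f)\<^sup>2"
      unfolding hnorm_L2_sq[OF f] hnorm_L2_sq[OF s] using assms by (intro integral_subset_le i i') auto
    show "0 \<le> hnorm (L2 a b) f" using L2.N_nonneg[of f a b] f by simp
  qed
qed

lemma hnorm_L2_shift:
  assumes f: "continuous_on UNIV f"
  shows "hnorm (L2 a b) (\<lambda>t. f (t + s)) = hnorm (L2 (a + s) (b + s)) f"
proof -
  have c: "continuous_on UNIV (\<lambda>t. f (t + s))" by (intro continuous_on_compose2[OF f] continuous_intros) auto
  have "(hnorm (L2 a b) (\<lambda>t. f (t + s)))\<^sup>2 = integral {a..b} ((\<lambda>t. (cmod (f t))\<^sup>2) \<circ> (+) s)"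
    unfolding hnorm_L2_sq[OF continuous_sq_integrable[OF c]] by (simp add: o_def add.commute)
  also have "\<dots> = (hnorm (L2 (a + s) (b + s)) f)\<^sup>2"
    unfolding hnorm_L2_sq[OF continuous_sq_integrable[OF f]] by (rule integral_shift_Icc_real)
  finally show ?thesis
    using L2.N_nonneg[of f "a + s" "b + s"] L2.N_nonneg[of "\<lambda>t. f (t + s)" a b] f c
    by (simp add: continuous_sq_integrable power2_eq_iff_nonneg)
qed

section \<open>Exponential sums multiplied by the endpoint values of \<open>U\<close> and
  \<open>W\<close>\<close>

context pencil
begin

text \<open>The earlier estimate has a positive \<open>N\<close>; letting it decrease to the norm of
  the sum also covers a sum of norm 0.\<close>

lemma \<kappa>_bound:
  "\<exists>C>0. \<forall>(F::'i set) c \<mu>. finite F \<longrightarrow>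
     cmod (\<Sum>j\<in>F. c j * \<kappa>u (\<mu> j) pi) \<le> C * hnorm (L2 (- pi) pi) (\<lambda>t. \<Sum>j\<in>F. c j * ex 0 (\<mu> j) t) \<and>
     cmod (\<Sum>j\<in>F. c j * \<kappa>w (\<mu> j) pi) \<le> C * hnorm (L2 (- pi) pi) (\<lambda>t. \<Sum>j\<in>F. c j * ex 0 (\<mu> j) t)"
proof -
  obtain C where C: "C > 0" "\<And>(F::'i set) c \<mu> N. finite F \<Longrightarrow> 0 < N \<Longrightarrow>
     integral {-pi..pi} (\<lambda>t. (cmod (\<Sum>j\<in>F. c j * exp (\<i> * \<mu> j * of_real t)))\<^sup>2) \<le> N\<^sup>2 \<Longrightarrow>
     cmod (\<Sum>j\<in>F. c j * \<kappa>u (\<mu> j) pi) \<le> C * N \<and> cmod (\<Sum>j\<in>F. c j * \<kappa>w (\<mu> j) pi) \<le> C * N"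
    using \<kappa>_functional_bound[where 'i='i] by blast
  have "cmod (\<Sum>j\<in>F. c j * \<kappa>u (\<mu> j) pi) \<le> C * hnorm (L2 (- pi) pi) (\<lambda>t. \<Sum>j\<in>F. c j * ex 0 (\<mu> j) t) \<and>
     cmod (\<Sum>j\<in>F. c j * \<kappa>w (\<mu> j) pi) \<le> C * hnorm (L2 (- pi) pi) (\<lambda>t. \<Sum>j\<in>F. c j * ex 0 (\<mu> j) t)"
    if F: "finite F" for F :: "'i set" and c \<mu>
  proof -
    define n where "n = hnorm (L2 (- pi) pi) (\<lambda>t. \<Sum>j\<in>F. c j * ex 0 (\<mu> j) t)"
    have cont: "continuous_on UNIV (\<lambda>t. \<Sum>j\<in>F. c j * ex 0 (\<mu> j) t)" by (intro continuous_intros ex_continuous)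
    have n0: "0 \<le> n" unfolding n_def using L2.N_nonneg continuous_sq_integrable[OF cont] by simp
    have n2: "n\<^sup>2 = integral {-pi..pi} (\<lambda>t. (cmod (\<Sum>j\<in>F. c j * exp (\<i> * \<mu> j * of_real t)))\<^sup>2)"
      unfolding n_def hnorm_L2_sq[OF continuous_sq_integrable[OF cont]] by (simp add: ex_0)
    have *: "cmod (\<Sum>j\<in>F. c j * \<kappa>u (\<mu> j) pi) \<le> C * (n + \<delta>) \<and> cmod (\<Sum>j\<in>F. c j * \<kappa>w (\<mu> j) pi) \<le> C * (n + \<delta>)" if "\<delta> > 0" for \<delta>
    proof (rule C(2)[OF F])
      show "0 < n + \<delta>" using n0 that by simp
      have "n\<^sup>2 \<le> (n + \<delta>)\<^sup>2" using n0 that by (intro power_mono) auto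
      then show "integral {-pi..pi} (\<lambda>t. (cmod (\<Sum>j\<in>F. c j * exp (\<i> * \<mu> j * of_real t)))\<^sup>2) \<le> (n + \<delta>)\<^sup>2" by (simp add: n2)
    qed
    have lim: "x \<le> C * n" if "\<And>\<delta>. \<delta> > 0 \<Longrightarrow> x \<le> C * (n + \<delta>)" for x
    proof (rule field_le_epsilon)
      fix e :: real assume "e > 0"
      then have "x \<le> C * (n + e / C)" using C(1) by (intro that) simp
      also have "\<dots> = C * n + e" using C(1) by (simp add: field_simps)
      finally show "x \<le> C * n + e" .
    qed
    show ?thesis unfolding n_def[symmetric] using * lim by blast
  qed
  then show ?thesis using C(1) by blast
qed

text \<open>The main exponential of \<open>U\<close> or \<open>W\<close> shifts the sum by
  \<open>pi\<close> or \<open>- pi\<close>, which (-2 pi, 2 pi) accommodates. The remainder part at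
  \<open>t\<close> is a sum with coefficients \<open>c \<mu> * exp (\<i> \<mu> t)\<close>, so the
  remainder estimate bounds it by the norm of a shifted sum, uniformly in \<open>t\<close>.\<close>

lemma transfer_bound:
  "\<exists>C>0. \<forall>(F::complex set) c. finite F \<longrightarrow>
     hnorm (L2 (- pi) pi) (\<lambda>t. \<Sum>\<mu>\<in>F. c \<mu> * U \<mu> pi * ex 0 \<mu> t) \<le> C * hnorm (L2 (- 2 * pi) (2 * pi)) (\<lambda>t. \<Sum>\<mu>\<in>F. c \<mu> * ex 0 \<mu> t) \<and>
     hnorm (L2 (- pi) pi) (\<lambda>t. \<Sum>\<mu>\<in>F. c \<mu> * W \<mu> pi * ex 0 \<mu> t) \<le> C * hnorm (L2 (- 2 * pi) (2 * pi)) (\<lambda>t. \<Sum>\<mu>\<in>F. c \<mu> * ex 0 \<mu> t)"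
proof -
  obtain C where C: "C > 0" "\<And>(F::complex set) c \<mu>. finite F \<Longrightarrow>
     cmod (\<Sum>j\<in>F. c j * \<kappa>u (\<mu> j) pi) \<le> C * hnorm (L2 (- pi) pi) (\<lambda>t. \<Sum>j\<in>F. c j * ex 0 (\<mu> j) t) \<and>
     cmod (\<Sum>j\<in>F. c j * \<kappa>w (\<mu> j) pi) \<le> C * hnorm (L2 (- pi) pi) (\<lambda>t. \<Sum>j\<in>F. c j * ex 0 (\<mu> j) t)"
    using \<kappa>_bound[where 'i=complex] by blast
  define E where "E = max (cmod (exp (- ph pi))) (cmod (exp (ph pi)))"
  define C' where "C' = E + C * sqrt (2 * pi)"
  have E0: "0 < E" by (simp add: E_def less_max_iff_disj)
  have C': "C' > 0" unfolding C'_def using C(1) E0 by (intro add_pos_nonneg) simp_all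
  have main: "hnorm (L2 (- pi) pi) (\<lambda>t. \<Sum>\<mu>\<in>F. c \<mu> * V \<mu> * ex 0 \<mu> t) \<le> C' * hnorm (L2 (- 2 * pi) (2 * pi)) (\<lambda>t. \<Sum>\<mu>\<in>F. c \<mu> * ex 0 \<mu> t)"
    if F: "finite F" and s: "\<bar>s\<bar> \<le> pi" and w: "cmod w \<le> E" and V: "\<And>\<mu>. V \<mu> = w * ex 0 \<mu> s + k \<mu>"
      and k: "\<And>c \<mu>. cmod (\<Sum>j\<in>F. c j * k j) \<le> C * hnorm (L2 (- pi) pi) (\<lambda>t. \<Sum>j\<in>F. c j * ex 0 j t)"
    for F c V w k s
  proof -
    define \<phi> where "\<phi> t = (\<Sum>\<mu>\<in>F. c \<mu> * ex 0 \<mu> t)" for t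
    have \<phi>c: "continuous_on UNIV \<phi>" unfolding \<phi>_def[abs_def] by (intro continuous_intros ex_continuous)
    define n where "n = hnorm (L2 (- 2 * pi) (2 * pi)) \<phi>"
    have sh: "hnorm (L2 (- pi) pi) (\<lambda>t. \<phi> (t + r)) \<le> n" if "\<bar>r\<bar> \<le> pi" for r
      unfolding n_def hnorm_L2_shift[OF \<phi>c]
      using that by (intro sq_integrable_restrict(2)[OF continuous_sq_integrable[OF \<phi>c]]) auto
    have n0: "0 \<le> n" using L2.N_nonneg[of \<phi>] continuous_sq_integrable[OF \<phi>c] by (simp add: n_def)
    define K where "K t = (\<Sum>\<mu>\<in>F. c \<mu> * k \<mu> * ex 0 \<mu> t)" for t
    have Kc: "continuous_on UNIV K" unfolding K_def[abs_def] by (intro continuous_intros ex_continuous)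
    have shc: "continuous_on UNIV (\<lambda>t. \<phi> (t + s))" by (intro continuous_on_compose2[OF \<phi>c] continuous_intros) auto
    have exa: "ex 0 \<mu> t * ex 0 \<mu> r = ex 0 \<mu> (t + r)" for \<mu> t r by (simp add: ex_0 algebra_simps flip: exp_add)
    have Kb: "cmod (K t) \<le> C * n" if t: "t \<in> {- pi..pi}" for t
    proof -
      have "K t = (\<Sum>\<mu>\<in>F. (c \<mu> * ex 0 \<mu> t) * k \<mu>)" unfolding K_def by (simp add: mult_ac)
      also have "cmod \<dots> \<le> C * hnorm (L2 (- pi) pi) (\<lambda>r. \<Sum>\<mu>\<in>F. (c \<mu> * ex 0 \<mu> t) * ex 0 \<mu> r)" by (rule k)
      also have "(\<lambda>r. \<Sum>\<mu>\<in>F. (c \<mu> * ex 0 \<mu> t) * ex 0 \<mu> r) = (\<lambda>r. \<phi> (r + t))"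
        by (simp add: \<phi>_def mult.assoc exa add.commute)
      also have "C * hnorm (L2 (- pi) pi) (\<lambda>r. \<phi> (r + t)) \<le> C * n" using C(1) t by (intro mult_left_mono sh) auto
      finally show ?thesis .
    qed
    have eq: "(\<lambda>t. \<Sum>\<mu>\<in>F. c \<mu> * V \<mu> * ex 0 \<mu> t) = (\<lambda>t. w * \<phi> (t + s)) + K"
    proof
      fix t
      have "c \<mu> * V \<mu> * ex 0 \<mu> t = w * (c \<mu> * (ex 0 \<mu> t * ex 0 \<mu> s)) + c \<mu> * k \<mu> * ex 0 \<mu> t" for \<mu>
        by (simp add: V algebra_simps)
      then show "(\<Sum>\<mu>\<in>F. c \<mu> * V \<mu> * ex 0 \<mu> t) = ((\<lambda>t. w * \<phi> (t + s)) + K) t"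
        by (simp add: \<phi>_def K_def exa sum.distrib sum_distrib_left)
    qed
    have 1: "hnorm (L2 (- pi) pi) ((\<lambda>t. w * \<phi> (t + s)) + K) \<le> hnorm (L2 (- pi) pi) (\<lambda>t. w * \<phi> (t + s)) + hnorm (L2 (- pi) pi) K"
      by (intro L2.N_triangle) (auto intro!: continuous_sq_integrable Kc continuous_intros shc)
    have "hnorm (L2 (- pi) pi) (\<lambda>t. w * \<phi> (t + s)) = cmod w * hnorm (L2 (- pi) pi) (\<lambda>t. \<phi> (t + s))"
      using L2.N_scale[of "\<lambda>t. \<phi> (t + s)" "- pi" pi w] continuous_sq_integrable[OF shc] by simp
    also have "\<dots> \<le> E * n" using w n0 E0 L2.N_nonneg[of "\<lambda>t. \<phi> (t + s)" "- pi" pi] continuous_sq_integrable[OF shc]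
      by (intro mult_mono sh[OF s]) auto
    finally have 2: "hnorm (L2 (- pi) pi) (\<lambda>t. w * \<phi> (t + s)) \<le> E * n" .
    have 3: "hnorm (L2 (- pi) pi) K \<le> C * n * sqrt (pi - (- pi))" by (intro hnorm_L2_le Kc Kb) auto
    have "hnorm (L2 (- pi) pi) ((\<lambda>t. w * \<phi> (t + s)) + K) \<le> E * n + C * n * sqrt (pi - (- pi))" using 1 2 3 by linarith
    then show ?thesis unfolding eq by (simp add: n_def C'_def \<phi>_def[abs_def] algebra_simps)
  qed
  have "hnorm (L2 (- pi) pi) (\<lambda>t. \<Sum>\<mu>\<in>F. c \<mu> * U \<mu> pi * ex 0 \<mu> t) \<le> C' * hnorm (L2 (- 2 * pi) (2 * pi)) (\<lambda>t. \<Sum>\<mu>\<in>F. c \<mu> * ex 0 \<mu> t)"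
    "hnorm (L2 (- pi) pi) (\<lambda>t. \<Sum>\<mu>\<in>F. c \<mu> * W \<mu> pi * ex 0 \<mu> t) \<le> C' * hnorm (L2 (- 2 * pi) (2 * pi)) (\<lambda>t. \<Sum>\<mu>\<in>F. c \<mu> * ex 0 \<mu> t)"
    if F: "finite F" for F c
  proof -
    show "hnorm (L2 (- pi) pi) (\<lambda>t. \<Sum>\<mu>\<in>F. c \<mu> * U \<mu> pi * ex 0 \<mu> t) \<le> C' * hnorm (L2 (- 2 * pi) (2 * pi)) (\<lambda>t. \<Sum>\<mu>\<in>F. c \<mu> * ex 0 \<mu> t)"
    proof (rule main[OF F, where s=pi and w="exp (- ph pi)" and k="\<lambda>\<mu>. \<kappa>u \<mu> pi"])
      show "U \<mu> pi = exp (- ph pi) * ex 0 \<mu> pi + \<kappa>u \<mu> pi" for \<mu>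
        by (simp add: \<kappa>u_def ex_0 flip: exp_add)
      show "cmod (exp (- ph pi)) \<le> E" by (simp only: E_def max.cobounded1)
    qed (use C(2)[OF F, where \<mu>="\<lambda>x. x"] in auto)
    show "hnorm (L2 (- pi) pi) (\<lambda>t. \<Sum>\<mu>\<in>F. c \<mu> * W \<mu> pi * ex 0 \<mu> t) \<le> C' * hnorm (L2 (- 2 * pi) (2 * pi)) (\<lambda>t. \<Sum>\<mu>\<in>F. c \<mu> * ex 0 \<mu> t)"
    proof (rule main[OF F, where s="-pi" and w="exp (ph pi)" and k="\<lambda>\<mu>. \<kappa>w \<mu> pi"])
      show "W \<mu> pi = exp (ph pi) * ex 0 \<mu> (-pi) + \<kappa>w \<mu> pi" for \<mu>
        by (simp add: \<kappa>w_def ex_0 flip: exp_add)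
      show "cmod (exp (ph pi)) \<le> E" by (simp only: E_def max.cobounded2)
    qed (use C(2)[OF F, where \<mu>="\<lambda>x. x"] in auto)
  qed
  then show ?thesis using C' by blast
qed

end

lemma L2_pair_semi_ip: "semi_ip (direct_sum (L2 a b) Csp)"
  by (intro semi_ip_direct_sum L2.semi_ip_axioms Csp.semi_ip_axioms)

text \<open>Instead of the functional that extends \<open>exp (i z t) \<mapsto> D z\<close>, the closed linear span of its graph
  is used; \<open>C\<close> bounds the functional, so this span contains no pair \<open>(0, d)\<close> with \<open>d \<noteq> 0\<close>.\<close>

lemma bounded_on_exponentials_vanishes:
  assumes D: "D holomorphic_on UNIV" and "a \<le> b"
    and C: "\<And>F c. finite F \<Longrightarrow> cmod (\<Sum>\<mu>\<in>F. c \<mu> * D \<mu>) \<le> C * hnorm (L2 a b) (\<lambda>t. \<Sum>\<mu>\<in>F. c \<mu> * ex 0 \<mu> t)"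
    and C0: "0 \<le> C"
    and compl: "complete_system (L2 a b) J (\<lambda>j. ex (\<nu> j) (l j))"
    and van: "\<And>j. j \<in> J \<Longrightarrow> taylor_coeff (\<nu> j) D (l j) = 0"
  shows "D z = 0"
proof -
  interpret P: semi_ip "direct_sum (L2 a b) Csp" by (rule L2_pair_semi_ip)
  have ext: "cmod d \<le> C * hnorm (L2 a b) g"
    if g: "g \<in> sq_integrable a b" and cs: "P.in_closed_span (\<lambda>z. (ex 0 z, D z)) UNIV (g, d)" for g d
  proof (rule field_le_epsilon)
    fix e :: real assume e: "e > 0"
    define \<delta> where "\<delta> = e / (C + 1)"
    have \<delta>: "\<delta> > 0" using e C0 by (simp add: \<delta>_def)
    obtain F c where F: "finite F" "hnorm (direct_sum (L2 a b) Csp) ((g, d) - lincomb (direct_sum (L2 a b) Csp) (\<lambda>z. (ex 0 z, D z)) c F) < \<delta>"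
      using cs \<delta> unfolding P.in_closed_span_def by blast
    define \<phi> where "\<phi> = lincomb (L2 a b) (ex 0) c F"
    have \<phi>s: "\<phi> \<in> sq_integrable a b" using L2.lc_closed[of F "ex 0" a b c] by (simp add: \<phi>_def ex_sq_integrable)
    define v where "v = lincomb Csp D c F"
    have v: "v = (\<Sum>\<mu>\<in>F. c \<mu> * D \<mu>)" by (simp add: v_def lincomb_def)
    have "(g, d) - lincomb (direct_sum (L2 a b) Csp) (\<lambda>z. (ex 0 z, D z)) c F = (g - \<phi>, d - v)"
      by (simp add: lincomb_direct_sum[OF L2.semi_ip_axioms Csp.semi_ip_axioms] \<phi>_def v_def)
    moreover have s: "g - \<phi> \<in> carrier (L2 a b)" using g \<phi>s by (intro L2.diff_closed) auto
    ultimately have "hnorm (L2 a b) (g - \<phi>) < \<delta>" "cmod (d - v) < \<delta>"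
      using hnorm_direct_sum_le(2,3)[OF L2.semi_ip_axioms Csp.semi_ip_axioms s, of "d - v"] F(2) by auto
    moreover have "cmod v \<le> C * hnorm (L2 a b) \<phi>"
      using C[OF F(1), of c] by (simp add: v \<phi>_def lincomb_L2)
    moreover have "hnorm (L2 a b) \<phi> \<le> hnorm (L2 a b) g + hnorm (L2 a b) (g - \<phi>)"
      using L2.N_triangle_sub[of \<phi> a b g] L2.N_diff_commute[of \<phi> a b g] g \<phi>s by simp
    ultimately have n: "hnorm (L2 a b) \<phi> \<le> hnorm (L2 a b) g + \<delta>" by linarith
    have "cmod d \<le> cmod v + cmod (d - v)" using norm_triangle_ineq[of v "d - v"] by simp
    also have "\<dots> \<le> C * (hnorm (L2 a b) g + \<delta>) + \<delta>"
      using mult_left_mono[OF n C0] \<open>cmod v \<le> _\<close> \<open>cmod (d - v) < \<delta>\<close> by linarith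
    also have "\<dots> = C * hnorm (L2 a b) g + (C + 1) * \<delta>" by (simp add: algebra_simps)
    also have "(C + 1) * \<delta> = e" using C0 by (simp add: \<delta>_def add_nonneg_eq_0_iff)
    finally show "cmod d \<le> C * hnorm (L2 a b) g + e" .
  qed
  have zc: "(ex m w, d) \<in> carrier (direct_sum (L2 a b) Csp)" for m w d by (simp add: ex_sq_integrable)
  have "cmod (D z) \<le> 0"
  proof (rule field_le_epsilon)
    fix e :: real assume e: "e > 0"
    define \<delta> where "\<delta> = e / (C + 1)"
    have \<delta>: "\<delta> > 0" using e C0 by (simp add: \<delta>_def)
    have exc: "ex 0 z \<in> carrier (L2 a b)" by (simp add: ex_sq_integrable)
    obtain F c where F: "finite F" "F \<subseteq> J" "hnorm (L2 a b) (ex 0 z - lincomb (L2 a b) (\<lambda>j. ex (\<nu> j) (l j)) c F) < \<delta>"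
      using compl \<delta> exc unfolding complete_system_def by blast
    define \<phi> where "\<phi> = lincomb (L2 a b) (\<lambda>j. ex (\<nu> j) (l j)) c F"
    have \<phi>s: "\<phi> \<in> carrier (L2 a b)" unfolding \<phi>_def by (intro L2.lc_closed) (simp add: ex_sq_integrable)
    have v: "lincomb Csp (\<lambda>j. taylor_coeff (\<nu> j) D (l j)) c F = 0"
      using F van by (auto simp: lincomb_def intro!: sum.neutral)
    \<comment> \<open>The Taylor coefficients of \<open>D\<close> at the given points vanish, so a
      combination \<open>\<phi>\<close> of the given system is paired with 0. Subtracting it from
      \<open>(ex 0 z, D z)\<close> leaves \<open>D z\<close> paired with an arbitrarily small
      function.\<close>
    have "P.in_closed_span (\<lambda>z. (ex 0 z, D z)) UNIV
        (lincomb (direct_sum (L2 a b) Csp) (\<lambda>j. (ex (\<nu> j) (l j), taylor_coeff (\<nu> j) D (l j))) c F)"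
      using F(1) by (intro P.in_closed_span_lc conjI graph_closed_span D \<open>a \<le> b\<close> zc)
    then have "P.in_closed_span (\<lambda>z. (ex 0 z, D z)) UNIV (\<phi>, 0)"
      by (simp only: lincomb_direct_sum[OF L2.semi_ip_axioms Csp.semi_ip_axioms] v \<phi>_def)
    then have "P.in_closed_span (\<lambda>z. (ex 0 z, D z)) UNIV (scale (direct_sum (L2 a b) Csp) (-1) (\<phi>, 0))"
      using \<phi>s by (intro P.in_closed_span_scale zc) auto
    moreover have "scale (direct_sum (L2 a b) Csp) (-1) (\<phi>, 0) \<in> carrier (direct_sum (L2 a b) Csp)"
      using \<phi>s by (intro P.scale_closed) simp
    moreover have "P.in_closed_span (\<lambda>z. (ex 0 z, D z)) UNIV (ex 0 z, D z)" by (rule P.in_closed_span_member) simp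
    ultimately have "P.in_closed_span (\<lambda>z. (ex 0 z, D z)) UNIV ((ex 0 z, D z) + scale (direct_sum (L2 a b) Csp) (-1) (\<phi>, 0))"
      by (intro P.in_closed_span_add zc)
    moreover have "(ex 0 z, D z) + scale (direct_sum (L2 a b) Csp) (-1) (\<phi>, 0) = (ex 0 z - \<phi>, D z)"
      unfolding direct_sum_simps L2.scale_minus_one by simp
    ultimately have "cmod (D z) \<le> C * hnorm (L2 a b) (ex 0 z - \<phi>)"
      using L2.diff_closed[OF exc \<phi>s] by (intro ext) auto
    also have "\<dots> \<le> (C + 1) * \<delta>"
      using F(3) C0 L2.N_nonneg[OF L2.diff_closed[OF exc \<phi>s]] by (intro mult_mono) (auto simp: \<phi>_def)
    also have "\<dots> = e" using C0 by (simp add: \<delta>_def add_nonneg_eq_0_iff)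
    finally show "cmod (D z) \<le> 0 + e" by simp
  qed
  then show ?thesis by simp
qed

section \<open>Completeness\<close>

lemma taylor_coeff_mult:
  assumes "f holomorphic_on UNIV" "g holomorphic_on UNIV"
  shows "taylor_coeff n (\<lambda>w. f w * g w) z = (\<Sum>i\<le>n. taylor_coeff i f z * taylor_coeff (n - i) g z)"
proof -
  have "(deriv ^^ n) (\<lambda>w. f w * g w) z = (\<Sum>i = 0..n. of_nat (n choose i) * (deriv ^^ i) f z * (deriv ^^ (n-i)) g z)"
    by (rule higher_deriv_mult[OF assms]) auto
  moreover have "of_nat (n choose i) * (deriv ^^ i) f z * (deriv ^^ (n-i)) g z / fact n = taylor_coeff i f z * taylor_coeff (n - i) g z"
    if "i \<le> n" for i
    using that by (simp add: taylor_coeff_def binomial_fact)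
  ultimately show ?thesis
    by (simp add: taylor_coeff_def[of n] sum_divide_distrib atLeast0AtMost)
qed

lemma taylor_coeff_add:
  assumes "f holomorphic_on UNIV" "g holomorphic_on UNIV"
  shows "taylor_coeff n (\<lambda>w. f w + g w) z = taylor_coeff n f z + taylor_coeff n g z"
  using higher_deriv_add[OF assms, of z n] by (simp add: taylor_coeff_def add_divide_distrib)

lemma taylor_coeff_diff:
  assumes "f holomorphic_on UNIV" "g holomorphic_on UNIV"
  shows "taylor_coeff n (\<lambda>w. f w - g w) z = taylor_coeff n f z - taylor_coeff n g z"
  using higher_deriv_diff[OF assms, of z n] by (simp add: taylor_coeff_def diff_divide_distrib)

lemma taylor_coeff_0 [simp]: "taylor_coeff 0 f z = f z"
  by (simp add: taylor_coeff_def)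

text \<open>A zero of order at least \<open>n\<close>, in terms of Taylor coefficients so that
  identically vanishing functions are included.\<close>

definition vanishes :: "(complex \<Rightarrow> complex) \<Rightarrow> complex \<Rightarrow> nat \<Rightarrow> bool" where
  "vanishes f z n \<longleftrightarrow> (\<forall>\<nu><n. taylor_coeff \<nu> f z = 0)"

lemma vanishes_mult:
  assumes "f holomorphic_on UNIV" "g holomorphic_on UNIV" "vanishes f z a" "vanishes g z b"
  shows "vanishes (\<lambda>w. f w * g w) z (a + b)"
  unfolding vanishes_def
proof (intro allI impI)
  fix n assume n: "n < a + b"
  have "taylor_coeff i f z * taylor_coeff (n - i) g z = 0" if "i \<le> n" for i
    using assms(3,4) n that by (cases "i < a") (auto simp: vanishes_def)
  then show "taylor_coeff n (\<lambda>w. f w * g w) z = 0" unfolding taylor_coeff_mult[OF assms(1,2)] by (intro sum.neutral) auto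
qed

lemma vanishes_0 [simp]: "vanishes f z 0"
  by (simp add: vanishes_def)

lemma vanishes_diff:
  assumes "f holomorphic_on UNIV" "g holomorphic_on UNIV" "vanishes f z n" "vanishes g z n"
  shows "vanishes (\<lambda>w. f w - g w) z n"
  using assms by (simp add: vanishes_def taylor_coeff_diff)

text \<open>By induction on the order: the lower coefficients of \<open>g\<close> vanish already, so
  the Leibniz sum reduces to \<open>f z\<close> times the coefficient in question.\<close>

lemma vanishes_cancel:
  assumes "f holomorphic_on UNIV" "g holomorphic_on UNIV" "f z \<noteq> 0" "vanishes (\<lambda>w. f w * g w) z n"
  shows "vanishes g z n"
  unfolding vanishes_def
proof (intro allI impI)
  fix \<nu> show "\<nu> < n \<Longrightarrow> taylor_coeff \<nu> g z = 0"
  proof (induction \<nu> rule: less_induct)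
    case (less \<nu>)
    have "0 = (\<Sum>i\<le>\<nu>. taylor_coeff i f z * taylor_coeff (\<nu> - i) g z)"
      using assms(4) less.prems by (simp add: vanishes_def taylor_coeff_mult assms)
    also have "\<dots> = (\<Sum>i\<in>{0}. taylor_coeff i f z * taylor_coeff (\<nu> - i) g z)"
      by (intro sum.mono_neutral_right) (use less in auto)
    finally show ?case using assms(3) by simp
  qed
qed

lemma hnorm_ex_growth:
  assumes "Im z \<noteq> 0"
  shows "hnorm (L2 (- pi) pi) (ex 0 z) \<le> exp (pi * \<bar>Im z\<bar>) / sqrt \<bar>Im z\<bar>"
proof (rule power2_le_imp_le)
  have "(hnorm (L2 (- pi) pi) (ex 0 z))\<^sup>2 \<le> exp (2 * pi * \<bar>Im z\<bar>) / \<bar>Im z\<bar>"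
    using exp_square_integral[OF assms] by (simp add: hnorm_L2_sq ex_sq_integrable ex_0)
  also have "\<dots> = (exp (pi * \<bar>Im z\<bar>) / sqrt \<bar>Im z\<bar>)\<^sup>2"
    by (simp add: power_divide power2_eq_square[of "exp _"] mult_exp_exp algebra_simps)
  finally show "(hnorm (L2 (- pi) pi) (ex 0 z))\<^sup>2 \<le> (exp (pi * \<bar>Im z\<bar>) / sqrt \<bar>Im z\<bar>)\<^sup>2" .
qed simp

lemma hnorm_ex_strip:
  assumes "\<bar>Im z\<bar> \<le> R"
  shows "hnorm (L2 (- pi) pi) (ex 0 z) \<le> exp (pi * R) * sqrt (2 * pi)"
proof -
  have "hnorm (L2 (- pi) pi) (ex 0 z) \<le> exp (pi * R) * sqrt (pi - (- pi))"
  proof (rule hnorm_L2_le[OF ex_continuous])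
    fix t assume t: "t \<in> {- pi..pi}"
    have "- (Im z * t) \<le> \<bar>Im z\<bar> * \<bar>t\<bar>" using abs_ge_minus_self[of "Im z * t"] by (simp add: abs_mult)
    also have "\<dots> \<le> R * pi" using assms t by (intro mult_mono) auto
    finally show "cmod (ex 0 z t) \<le> exp (pi * R)" by (simp add: ex_0 mult.commute)
  qed simp
  then show ?thesis by simp
qed

context pencil
begin

text \<open>Above the real axis the exponential in \<open>W\<close> is the large one, below it that
  in \<open>U\<close>. The remainders carry an extra factor
  \<open>1 / sqrt \<bar>Im z\<bar>\<close>, and \<open>R\<close> is the threshold beyond which they
  take away at most half of the main term's lower bound.\<close>

lemma UW_growth:
  "\<exists>m>0. \<exists>R>0. \<forall>z. R \<le> \<bar>Im z\<bar> \<longrightarrow> m * exp (pi * \<bar>Im z\<bar>) \<le> max (cmod (U z pi)) (cmod (W z pi))"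
proof -
  obtain C where C: "C > 0" "\<And>z. Im z \<noteq> 0 \<Longrightarrow> cmod (\<kappa>u z pi) \<le> C * exp (pi * \<bar>Im z\<bar>) / sqrt \<bar>Im z\<bar> \<and>
     cmod (\<kappa>w z pi) \<le> C * exp (pi * \<bar>Im z\<bar>) / sqrt \<bar>Im z\<bar>"
    using \<kappa>_growth by blast
  define m where "m = min (exp (- Re (ph pi))) (exp (Re (ph pi)))"
  have m: "m > 0" "m \<le> exp (- Re (ph pi))" "m \<le> exp (Re (ph pi))" by (auto simp: m_def)
  define R where "R = (2 * C / m)\<^sup>2"
  have R: "R > 0" using C(1) m(1) by (simp add: R_def)
  have "m / 2 * exp (pi * \<bar>Im z\<bar>) \<le> max (cmod (U z pi)) (cmod (W z pi))" if z: "R \<le> \<bar>Im z\<bar>" for z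
  proof -
    define \<eta> where "\<eta> = Im z"
    have \<eta>: "\<eta> \<noteq> 0" "0 < sqrt \<bar>\<eta>\<bar>" using z R by (auto simp: \<eta>_def)
    have "2 * C / m \<le> sqrt \<bar>\<eta>\<bar>" using z C(1) m(1) by (intro real_le_rsqrt) (simp add: R_def \<eta>_def)
    then have "C / sqrt \<bar>\<eta>\<bar> \<le> m / 2" using \<eta> m(1) C(1) by (simp add: field_simps)
    then have "C / sqrt \<bar>\<eta>\<bar> * exp (pi * \<bar>\<eta>\<bar>) \<le> m / 2 * exp (pi * \<bar>\<eta>\<bar>)" by (intro mult_right_mono) auto
    then have e: "C * exp (pi * \<bar>\<eta>\<bar>) / sqrt \<bar>\<eta>\<bar> \<le> m / 2 * exp (pi * \<bar>\<eta>\<bar>)" by (simp only: times_divide_eq_left)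
    then have \<kappa>: "cmod (\<kappa>u z pi) \<le> m / 2 * exp (pi * \<bar>\<eta>\<bar>)" "cmod (\<kappa>w z pi) \<le> m / 2 * exp (pi * \<bar>\<eta>\<bar>)"
      using C(2)[of z] \<eta>(1) order_trans[OF _ e] unfolding \<eta>_def by blast+
    show ?thesis
    proof (cases "\<eta> > 0")
      case False
      have "m * exp (pi * \<bar>\<eta>\<bar>) \<le> exp (- Re (ph pi)) * exp (pi * \<bar>\<eta>\<bar>)" using m by (intro mult_right_mono) auto
      also have "\<dots> = cmod (exp (\<i> * z * of_real pi - ph pi))" using False
        by (simp add: \<eta>_def mult.commute flip: exp_add)
      also have "\<dots> \<le> cmod (U z pi) + cmod (\<kappa>u z pi)" unfolding \<kappa>u_def
        using norm_triangle_ineq4[of "U z pi" "U z pi - exp (\<i> * z * of_real pi - ph pi)"] by simp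
      finally show ?thesis using \<kappa> by (simp add: \<eta>_def)
    next
      case True
      have "m * exp (pi * \<bar>\<eta>\<bar>) \<le> exp (Re (ph pi)) * exp (pi * \<bar>\<eta>\<bar>)" using m by (intro mult_right_mono) auto
      also have "\<dots> = cmod (exp (ph pi - \<i> * z * of_real pi))" using True
        by (simp add: \<eta>_def mult.commute flip: exp_add)
      also have "\<dots> \<le> cmod (W z pi) + cmod (\<kappa>w z pi)" unfolding \<kappa>w_def
        using norm_triangle_ineq4[of "W z pi" "W z pi - exp (ph pi - \<i> * z * of_real pi)"] by simp
      finally show ?thesis using \<kappa> by (simp add: \<eta>_def)
    qed
  qed
  then show ?thesis using m(1) R by (intro exI[of _ "m / 2"] conjI exI[of _ R]) auto
qed

text \<open>The quotient \<open>G\<close> of the two sides by \<open>Y Y1\<close> is entire because \<open>Y\<close> and \<open>Y1\<close> have no common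
  zeros, and the asymptotics of \<open>U\<close> and \<open>W\<close> make it bounded and small along the imaginary axis.\<close>

lemma transforms_vanish:
  assumes L1: "L2.bounded_functional (- pi) pi L1" and L2': "L2.bounded_functional (- pi) pi L2'"
    and eq: "\<And>z. z * Y z pi * L1 (ex 0 z) = Y1 z pi * L2' (ex 0 z)"
    and at0: "L2' (ex 0 0) = 0"
  shows "L1 (ex 0 z) = 0" "L2' (ex 0 z) = 0"
proof -
  define H1 where "H1 z = L1 (ex 0 z)" for z
  define H2 where "H2 z = L2' (ex 0 z)" for z
  have H: "H1 holomorphic_on UNIV" "H2 holomorphic_on UNIV"
    unfolding H1_def[abs_def] H2_def[abs_def] by (rule functional_ex_taylor(1)[OF L1] functional_ex_taylor(1)[OF L2'], simp)+
  \<comment> \<open>\<open>H2 z / z\<close> with its removable singularity filled in, which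
    \<open>at0\<close> allows. Dividing the relation by \<open>z\<close> leaves the coefficients
    \<open>Y\<close> and \<open>Y1\<close>, which have no common zero, while \<open>z * Y\<close>
    and \<open>Y1\<close> could both vanish at 0.\<close>
  define K where "K z = (if z = 0 then deriv H2 0 else (H2 z - H2 0) / (z - 0))" for z
  have K: "K holomorphic_on UNIV" unfolding K_def[abs_def] by (rule pole_lemma[OF H(2)]) simp
  have H2K: "H2 z = z * K z" for z using at0 by (simp add: K_def H2_def)
  have Yh: "(\<lambda>z. Y z pi) holomorphic_on UNIV" "(\<lambda>z. Y1 z pi) holomorphic_on UNIV"
    by (auto intro!: Y_holomorphic)
  have YK: "Y z pi * H1 z = Y1 z pi * K z" for z
  proof -
    define f where "f z = Y z pi * H1 z - Y1 z pi * K z" for z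
    have fh: "f holomorphic_on UNIV" unfolding f_def[abs_def] by (intro holomorphic_intros Yh H K)
    have f0: "f z = 0" if "z \<noteq> 0" for z
      using eq[of z] that H2K[of z] by (simp add: f_def H1_def H2_def[symmetric])
    have "(f \<longlongrightarrow> f 0) (at 0)" using holomorphic_on_imp_continuous_on[OF fh] unfolding continuous_on_def by simp
    moreover have "(f \<longlongrightarrow> 0) (at 0)" using f0 by (intro tendsto_eventually) (auto simp: eventually_at_filter)
    ultimately have "f 0 = 0" by (rule tendsto_unique[OF at_neq_bot])
    then have "f z = 0" using f0[of z] by (cases "z = 0") simp_all
    then show ?thesis by (simp add: f_def)
  qed
  define G where "G z = (if Y1 z pi \<noteq> 0 then H1 z / Y1 z pi else K z / Y z pi)" for z
  have G2: "G z = K z / Y z pi" if "Y z pi \<noteq> 0" for z using YK[of z] that by (auto simp: G_def field_simps)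
  have GH1: "H1 z = Y1 z pi * G z" for z
    using YK[of z] Y_Y1_nonzero[of z] by (auto simp: G_def)
  have GH2: "H2 z = z * Y z pi * G z" for z
    using YK[of z] Y_Y1_nonzero[of z] by (auto simp: G_def H2K field_simps)
  have GU: "U z pi * G z = H1 z + \<i> * H2 z" and GW: "W z pi * G z = H1 z - \<i> * H2 z" for z
    by (simp_all add: GH1 GH2 U_def W_def algebra_simps)
  have o: "open {z. f z \<noteq> 0}" if f: "f holomorphic_on UNIV" for f :: "complex \<Rightarrow> complex"
    by (intro open_Collect_neq holomorphic_on_imp_continuous_on f continuous_on_const)
  have "G holomorphic_on {z. Y1 z pi \<noteq> 0} \<union> {z. Y z pi \<noteq> 0}"
  proof (rule holomorphic_on_Un)
    have "(\<lambda>z. H1 z / Y1 z pi) holomorphic_on {z. Y1 z pi \<noteq> 0}"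
      by (intro holomorphic_intros holomorphic_on_subset[OF H(1)] holomorphic_on_subset[OF Yh(2)]) auto
    then show "G holomorphic_on {z. Y1 z pi \<noteq> 0}" by (rule holomorphic_transform) (simp add: G_def)
    have "(\<lambda>z. K z / Y z pi) holomorphic_on {z. Y z pi \<noteq> 0}"
      by (intro holomorphic_intros holomorphic_on_subset[OF K] holomorphic_on_subset[OF Yh(1)]) auto
    then show "G holomorphic_on {z. Y z pi \<noteq> 0}" by (rule holomorphic_transform) (simp add: G2)
  qed (intro o Yh)+
  moreover have "{z. Y1 z pi \<noteq> 0} \<union> {z. Y z pi \<noteq> 0} = UNIV" using Y_Y1_nonzero by auto
  ultimately have Gh: "G holomorphic_on UNIV" by simp
  obtain K1 where K1: "K1 \<ge> 0" "\<And>f. f \<in> sq_integrable (- pi) pi \<Longrightarrow> cmod (L1 f) \<le> K1 * hnorm (L2 (- pi) pi) f"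
    using L1 by (auto simp: L2.bounded_functional_def)
  obtain K2 where K2: "K2 \<ge> 0" "\<And>f. f \<in> sq_integrable (- pi) pi \<Longrightarrow> cmod (L2' f) \<le> K2 * hnorm (L2 (- pi) pi) f"
    using L2' by (auto simp: L2.bounded_functional_def)
  have AB: "cmod (U z pi * G z) \<le> (K1 + K2) * B" "cmod (W z pi * G z) \<le> (K1 + K2) * B"
    if B: "hnorm (L2 (- pi) pi) (ex 0 z) \<le> B" for z B
  proof -
    have "cmod (H1 z) \<le> K1 * B" "cmod (H2 z) \<le> K2 * B"
      unfolding H1_def H2_def
      using K1(2)[OF ex_sq_integrable] K2(2)[OF ex_sq_integrable] mult_left_mono[OF B K1(1)] mult_left_mono[OF B K2(1)]
      by (meson order_trans)+
    moreover have "cmod (H1 z + \<i> * H2 z) \<le> cmod (H1 z) + cmod (H2 z)" "cmod (H1 z - \<i> * H2 z) \<le> cmod (H1 z) + cmod (H2 z)"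
      using norm_triangle_ineq[of "H1 z" "\<i> * H2 z"] norm_triangle_ineq4[of "H1 z" "\<i> * H2 z"] by (simp_all add: norm_mult)
    ultimately show "cmod (U z pi * G z) \<le> (K1 + K2) * B" "cmod (W z pi * G z) \<le> (K1 + K2) * B"
      unfolding GU GW by (simp_all add: algebra_simps)
  qed
  obtain m R where mR: "m > 0" "R > 0"
    "\<And>z. R \<le> \<bar>Im z\<bar> \<Longrightarrow> m * exp (pi * \<bar>Im z\<bar>) \<le> max (cmod (U z pi)) (cmod (W z pi))"
    using UW_growth by blast
  define M where "M = (K1 + K2) / m"
  have M0: "0 \<le> M" using K1 K2 mR by (simp add: M_def)
  have Gfar: "cmod (G z) \<le> M / sqrt \<bar>Im z\<bar>" if z: "R \<le> \<bar>Im z\<bar>" for z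
  proof -
    have "Im z \<noteq> 0" using z mR(2) by auto
    have "m * exp (pi * \<bar>Im z\<bar>) * cmod (G z) \<le> max (cmod (U z pi)) (cmod (W z pi)) * cmod (G z)"
      by (intro mult_right_mono mR(3) z) simp
    also have "\<dots> \<le> (K1 + K2) * (exp (pi * \<bar>Im z\<bar>) / sqrt \<bar>Im z\<bar>)"
      using AB[OF hnorm_ex_growth[OF \<open>Im z \<noteq> 0\<close>]] by (simp add: norm_mult max_def)
    also have "\<dots> = m * exp (pi * \<bar>Im z\<bar>) * (M / sqrt \<bar>Im z\<bar>)" using mR(1) by (simp add: M_def)
    finally show ?thesis using mR(1) by (simp only: mult_le_cancel_left_pos mult_pos_pos exp_gt_zero)
  qed
  obtain c where c: "c > 0" "\<And>z. \<bar>Im z\<bar> \<le> R \<Longrightarrow> c \<le> cmod (U z pi) + cmod (W z pi) + cmod (Y z pi)"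
    using strip_lower_bound[of R] mR(2) by auto
  define Q where "Q = (K1 + K2) * (exp (pi * R) * sqrt (2 * pi))"
  have Q0: "0 \<le> Q" using K1 K2 by (simp add: Q_def)
  \<comment> \<open>The lower bound in the strip involves \<open>Y\<close> too. Outside the unit
    disc \<open>Y\<close> is controlled by \<open>U - W = 2 \<i> z Y\<close>; the disc itself is
    handled by compactness.\<close>
  have Gstrip: "cmod (G z) \<le> 3 * Q / c" if z: "\<bar>Im z\<bar> \<le> R" "1 \<le> cmod z" for z
  proof -
    have "2 * (cmod z * cmod (Y z pi)) = cmod (U z pi - W z pi)" by (simp add: U_def W_def norm_mult)
    also have "\<dots> \<le> cmod (U z pi) + cmod (W z pi)" by (rule norm_triangle_ineq4)
    finally have "2 * (cmod z * cmod (Y z pi)) \<le> cmod (U z pi) + cmod (W z pi)" .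
    moreover have "1 * cmod (Y z pi) \<le> cmod z * cmod (Y z pi)" using z by (intro mult_right_mono) auto
    ultimately have "c \<le> 3 / 2 * (cmod (U z pi) + cmod (W z pi))" using c(2)[OF z(1)] by simp
    then have "c * cmod (G z) \<le> 3 / 2 * (cmod (U z pi) + cmod (W z pi)) * cmod (G z)" by (intro mult_right_mono) auto
    also have "\<dots> \<le> 3 * Q"
      using AB[OF hnorm_ex_strip[OF z(1)]] by (simp add: norm_mult Q_def algebra_simps)
    finally show ?thesis using c(1) by (simp add: field_simps)
  qed
  have "compact (G ` cball 0 1)"
    by (intro compact_continuous_image continuous_on_subset[OF holomorphic_on_imp_continuous_on[OF Gh]]) auto
  then obtain B where B: "\<And>z. cmod z \<le> 1 \<Longrightarrow> cmod (G z) \<le> B"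
    using compact_imp_bounded bounded_iff by (metis imageI mem_cball_0)
  have "cmod (G z) \<le> \<bar>B\<bar> + 3 * Q / c + M / sqrt R" for z
  proof -
    have n: "0 \<le> 3 * Q / c" "0 \<le> M / sqrt R" using Q0 M0 c(1) mR by auto
    consider "cmod z \<le> 1" | "\<bar>Im z\<bar> \<le> R" "1 \<le> cmod z" | "R \<le> \<bar>Im z\<bar>" by linarith
    then show ?thesis
    proof cases
      case 1
      then show ?thesis using B[of z] n by linarith
    next
      case 2
      then show ?thesis using Gstrip[of z] n by linarith
    next
      case 3
      have "M / sqrt \<bar>Im z\<bar> \<le> M / sqrt R" using 3 mR M0 by (intro divide_left_mono) auto
      then show ?thesis using Gfar[OF 3] n by linarith
    qed
  qed
  then have "bounded (range G)" unfolding bounded_iff by blast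
  then obtain g where g: "\<And>z. G z = g" using Liouville_theorem[OF Gh] unfolding constant_on_def by blast
  \<comment> \<open>The constant value of \<open>G\<close> is read off along
    \<open>\<i> * n\<close>, where the bound tends to 0.\<close>
  have "(\<lambda>n. M / sqrt (real n)) \<longlonglongrightarrow> 0"
    by (intro real_tendsto_divide_at_top[OF tendsto_const] filterlim_compose[OF sqrt_at_top filterlim_real_sequentially])
  moreover have "\<forall>\<^sub>F n in sequentially. cmod g \<le> M / sqrt (real n)"
  proof (rule eventually_mono[OF eventually_ge_at_top[of "nat \<lceil>R\<rceil>"]])
    fix n assume "nat \<lceil>R\<rceil> \<le> n"
    then have "R \<le> \<bar>Im (\<i> * of_nat n)\<bar>" by simp
    from Gfar[OF this] show "cmod g \<le> M / sqrt (real n)" by (simp add: g)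
  qed
  ultimately have "cmod g \<le> 0" by (intro tendsto_lowerbound) auto
  then have "G z = 0" for z using g by simp
  then show "L1 (ex 0 z) = 0" "L2' (ex 0 z) = 0" using GH1[of z] GH2[of z] by (simp_all add: H1_def H2_def)
qed

end

context semi_ip
begin

lemma functional_lincomb:
  assumes L: "bounded_functional L" and x: "\<And>j. j \<in> F \<Longrightarrow> x j \<in> carrier X"
  shows "L (lc x c F) = (\<Sum>j\<in>F. c j * L (x j))"
  using x
proof (induction F rule: infinite_finite_induct)
  case (infinite F)
  then show ?case using L zero_closed scale_zero_right by (auto simp: bounded_functional_def lincomb_def dest!: spec[of _ 0])
next
  case empty
  have "L (sc 0 0) = 0 * L 0" using L zero_closed unfolding bounded_functional_def by blast
  then show ?case by (simp add: lincomb_def scale_zero_right)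
next
  case (insert j F)
  have "lc x c (insert j F) = sc (c j) (x j) + lc x c F" using insert by (simp add: lincomb_def)
  moreover have "sc (c j) (x j) \<in> carrier X" "lc x c F \<in> carrier X"
    using insert.prems by (auto intro!: scale_closed lc_closed)
  then have "L (sc (c j) (x j) + lc x c F) = L (sc (c j) (x j)) + L (lc x c F)"
    using L unfolding bounded_functional_def by blast
  moreover have "L (sc (c j) (x j)) = c j * L (x j)" using L insert unfolding bounded_functional_def by auto
  ultimately show ?case using insert by simp
qed

lemma functional_zero:
  assumes L: "bounded_functional L" and x: "complete_system X J x" "\<And>j. j \<in> J \<Longrightarrow> L (x j) = 0" and f: "f \<in> carrier X"
  shows "L f = 0"
proof -
  obtain K where K: "K \<ge> 0" "\<And>f. f \<in> carrier X \<Longrightarrow> cmod (L f) \<le> K * N f"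
    using L by (auto simp: bounded_functional_def)
  have "cmod (L f) \<le> 0"
  proof (rule field_le_epsilon)
    fix e :: real assume e: "e > 0"
    then have "e / (K + 1) > 0" using K(1) by simp
    then obtain F c where F: "finite F" "F \<subseteq> J" "N (f - lc x c F) < e / (K + 1)"
      using x(1) f unfolding complete_system_def by blast
    have xc: "x j \<in> carrier X" if "j \<in> F" for j using x(1) F that by (auto simp: complete_system_def)
    have lcc: "lc x c F \<in> carrier X" using xc by (rule lc_closed)
    have 0: "L (lc x c F) = 0" using functional_lincomb[of L F x c, OF L xc] x(2) F(2) by (simp add: subset_iff)
    have "L (f - lc x c F + lc x c F) = L (f - lc x c F) + L (lc x c F)"
      using L f lcc diff_closed unfolding bounded_functional_def by blast
    then have "cmod (L f) = cmod (L (f - lc x c F))" using 0 by simp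
    also have "\<dots> \<le> K * N (f - lc x c F)" using f lcc by (intro K(2) diff_closed)
    also have "\<dots> \<le> (K + 1) * (e / (K + 1))" using K(1) F(3) N_nonneg[OF diff_closed[OF f lcc]] by (intro mult_mono) auto
    also have "\<dots> = e" using K(1) by simp
    finally show "cmod (L f) \<le> 0 + e" by simp
  qed
  then show ?thesis by simp
qed

end

section \<open>Passing to a smaller interval\<close>

lemma sq_integrable_extend:
  assumes f: "f \<in> sq_integrable c d" and "a \<le> c" "d \<le> b"
  shows "(\<lambda>t. if t \<in> {c<..<d} then f t else 0) \<in> sq_integrable a b"
proof -
  define g where "g t = (if t \<in> {c<..<d} then f t else 0)" for t
  have m: "g \<in> borel_measurable lebesgue"
    unfolding g_def[abs_def] using sq_integrable_measurable[OF f] by (subst borel_measurable_if) simp_all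
  have "integrable (lebesgue_on {c<..<d}) (\<lambda>t. (cmod (f t))\<^sup>2)" using f by (simp add: sq_integrable_def)
  then have "integrable lebesgue (\<lambda>t. indicator {c<..<d} t *\<^sub>R (cmod (f t))\<^sup>2)"
    by (subst (asm) integrable_restrict_space) auto
  moreover have "indicator {c<..<d} t *\<^sub>R (cmod (f t))\<^sup>2 = indicator {a<..<b} t *\<^sub>R (cmod (g t))\<^sup>2" for t
    using assms by (auto simp: g_def indicator_def)
  ultimately have "integrable (lebesgue_on {a<..<b}) (\<lambda>t. (cmod (g t))\<^sup>2)"
    by (subst integrable_restrict_space) auto
  then show ?thesis using measurable_restrict_space1[OF m, of "{a<..<b}"]
    unfolding sq_integrable_def g_def[abs_def, symmetric] by simp
qed

lemma hnorm_L2_cong: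
  assumes "\<And>t. t \<in> {a<..<b} \<Longrightarrow> f t = g t"
  shows "hnorm (L2 a b) f = hnorm (L2 a b) g"
proof -
  have "ip (L2 a b) f f = ip (L2 a b) g g"
    unfolding L2_simps using assms by (intro Bochner_Integration.integral_cong) auto
  then show ?thesis by (simp add: hnorm_def)
qed

text \<open>The extension by zero is approximated on the large interval, and restriction does not
  increase the error.\<close>

lemma complete_system_restrict:
  assumes x: "complete_system (L2 a b) J x" and "a \<le> c" "d \<le> b"
  shows "complete_system (L2 c d) J x"
  unfolding complete_system_def
proof (intro conjI ballI allI impI)
  have xs: "x j \<in> sq_integrable a b" if "j \<in> J" for j using x that by (auto simp: complete_system_def)
  then show "x j \<in> carrier (L2 c d)" if "j \<in> J" for j
    using sq_integrable_restrict(1)[OF xs[OF that] assms(2,3)] by simp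
  fix f and e :: real assume f: "f \<in> carrier (L2 c d)" and e: "e > 0"
  define g where "g t = (if t \<in> {c<..<d} then f t else 0)" for t
  have g: "g \<in> carrier (L2 a b)" using sq_integrable_extend[OF _ assms(2,3), of f] f by (simp add: g_def[abs_def])
  obtain F k where F: "finite F" "F \<subseteq> J" "hnorm (L2 a b) (g - lincomb (L2 a b) x k F) < e"
    using x g e unfolding complete_system_def by blast
  have s: "g - lincomb (L2 a b) x k F \<in> sq_integrable a b"
    using L2.diff_closed[OF g L2.lc_closed[of F x a b k]] xs F(2) by auto
  have "hnorm (L2 c d) (f - lincomb (L2 c d) x k F) = hnorm (L2 c d) (g - lincomb (L2 a b) x k F)"
    by (intro hnorm_L2_cong) (simp add: g_def lincomb_L2)
  also have "\<dots> < e" using sq_integrable_restrict(2)[OF s assms(2,3)] F(3) by simp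
  finally show "\<exists>F k. finite F \<and> F \<subseteq> J \<and> hnorm (L2 c d) (f - lincomb (L2 c d) x k F) < e" using F by blast
qed

lemma vanishes_zero_multiplicity:
  assumes "enat m \<le> zero_multiplicity f z"
  shows "vanishes f z m"
  unfolding vanishes_def
proof (intro allI impI)
  fix \<nu> assume "\<nu> < m"
  have "\<not> (deriv ^^ \<nu>) f z \<noteq> 0"
  proof
    assume "(deriv ^^ \<nu>) f z \<noteq> 0"
    then have "zero_multiplicity f z \<le> enat \<nu>" unfolding zero_multiplicity_def by (intro INF_lower) simp
    then have "enat m \<le> enat \<nu>" using assms by (rule order_trans[rotated])
    then show False using \<open>\<nu> < m\<close> by simp
  qed
  then show "taylor_coeff \<nu> f z = 0" by (simp add: taylor_coeff_def)
qed

lemma ecard_insert: "x \<notin> A \<Longrightarrow> ecard (insert x A) = eSuc (ecard A)"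
  by (simp add: ecard_def eSuc_enat)

section \<open>The subspectrum, and zeros of the determinant \<open>D\<close>\<close>

locale subspectrum_data = pencil p \<sigma> for p \<sigma> +
  fixes f1 f2 :: "complex \<Rightarrow> complex" and lam :: "nat \<Rightarrow> complex"
  assumes f1: "f1 holomorphic_on UNIV" and f2: "f2 holomorphic_on UNIV"
    and sub: "subspectrum p \<sigma> f1 f2 lam" and lam_0: "lam 0 = 0" and consec: "equal_consecutive lam"
    and f_nonzero: "\<And>n. n \<ge> 1 \<Longrightarrow> \<not> (f1 (lam n) = 0 \<and> f2 (lam n) = 0)"
begin

abbreviation v :: "nat \<Rightarrow> (real \<Rightarrow> complex) \<times> (real \<Rightarrow> complex)" where "v \<equiv> v_seq f1 f2 lam"
abbreviation \<Delta> :: "complex \<Rightarrow> complex" where "\<Delta> \<equiv> char_fun p \<sigma> f1 f2"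

lemma \<Delta>_eq: "\<Delta> z = f1 z * Y1 z pi + f2 z * Y z pi"
  using S_pair_eq[of pi z] by (simp add: char_fun_def)

lemma \<Delta>_holomorphic: "\<Delta> holomorphic_on UNIV"
  unfolding \<Delta>_eq[abs_def] by (intro holomorphic_intros f1 f2 Y_holomorphic) auto

lemma E_system_eq: "E_system lam j = ex (snd j) (lam (fst j))"
  by (cases j) (simp add: E_system_def taylor_coeff_exp fun_eq_iff)

lemma S_index_lam_0: "n \<in> S_index lam \<Longrightarrow> lam n = 0 \<longleftrightarrow> n = 0"
  using lam_0 by (cases "n = 0") (auto simp: S_index_def)

text \<open>Off by one at the origin: the index 0 counts for \<open>mult_at\<close> but is not a
  member of the subspectrum, so in the block of \<open>n = 0\<close> the guaranteed order of the
  zero of \<open>\<Delta>\<close> is one less than elsewhere.\<close>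

lemma \<Delta>_vanishes:
  assumes "(n, \<nu>) \<in> E_index lam"
  shows "vanishes \<Delta> (lam n) (if n = 0 then \<nu> else Suc \<nu>)"
proof (intro vanishes_zero_multiplicity)
  have n: "n \<in> S_index lam" and \<nu>: "enat \<nu> < mult_at lam n" using assms by (auto simp: E_index_def)
  have *: "ecard {k. k \<ge> 1 \<and> lam k = lam n} \<le> zero_multiplicity \<Delta> (lam n)"
    using sub by (simp add: subspectrum_def)
  have "enat (if n = 0 then \<nu> else Suc \<nu>) \<le> ecard {k. k \<ge> 1 \<and> lam k = lam n}"
  proof (cases "n = 0")
    case True
    have "{k. lam k = lam n} = insert 0 {k. k \<ge> 1 \<and> lam k = lam n}" using True by (auto simp: Suc_le_eq)
    then have "mult_at lam n = eSuc (ecard {k. k \<ge> 1 \<and> lam k = lam n})" by (simp add: mult_at_def ecard_insert)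
    then show ?thesis using \<nu> True by simp
  next
    case False
    then have "lam n \<noteq> 0" using S_index_lam_0[OF n] by simp
    then have "{k. lam k = lam n} = {k. k \<ge> 1 \<and> lam k = lam n}" using lam_0 by (auto simp: Suc_le_eq intro!: gr0I)
    then show ?thesis using \<nu> False by (simp add: mult_at_def Suc_ile_eq)
  qed
  then show "enat (if n = 0 then \<nu> else Suc \<nu>) \<le> zero_multiplicity \<Delta> (lam n)" using * by (rule order_trans)
qed

text \<open>Leibniz rule. Functionals known on the functions \<open>ex\<close> can thus be evaluated
  on \<open>v\<close>; the interval is free because combinations in \<open>L2\<close> are formed
  pointwise.\<close>

lemma v_coeff_eq:
  "v_coeff f1 f2 \<nu> w =
     (lincomb (L2 a b) (\<lambda>i. ex (\<nu> - i) w) (\<lambda>i. taylor_coeff i (\<lambda>z. z * f1 z) w) {..\<nu>},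
      lincomb (L2 a b) (\<lambda>i. ex (\<nu> - i) w) (\<lambda>i. taylor_coeff i f2 w) {..\<nu>})"
proof -
  have e: "(\<lambda>z. exp (\<i> * z * of_real t)) holomorphic_on UNIV" for t by (intro holomorphic_intros)
  have z: "(\<lambda>z. z * f1 z) holomorphic_on UNIV" by (intro holomorphic_intros f1)
  show ?thesis
    unfolding v_coeff_def lincomb_L2 taylor_coeff_mult[OF z e] taylor_coeff_mult[OF f2 e] taylor_coeff_exp by simp
qed

lemma v_coeff_closed: "v_coeff f1 f2 \<nu> w \<in> carrier \<H>"
  unfolding v_coeff_eq[of _ _ "- pi" pi] \<H>_def direct_sum_simps
  by (intro SigmaI L2.lc_closed) (simp_all add: ex_sq_integrable)

lemma v_closed: "v k \<in> carrier \<H>"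
proof (cases "k = 0")
  case True
  have "(\<lambda>t. 0) \<in> sq_integrable (- pi) pi" "(\<lambda>t. 1) \<in> sq_integrable (- pi) pi"
    by (intro continuous_sq_integrable continuous_intros)+
  then show ?thesis using True by (simp add: v_seq_def \<H>_def)
next
  case False
  then show ?thesis by (simp add: v_seq_def Let_def v_coeff_closed)
qed

theorem v_complete:
  assumes compl: "complete_system (L2 (- 2 * pi) (2 * pi)) (E_index lam) (E_system lam)"
  shows "complete_system \<H> UNIV v"
proof (rule H.complete_system_functional[OF v_closed])
  fix L f assume L: "H.bounded_functional L" and Lv: "\<And>k. k \<in> UNIV \<Longrightarrow> L (v k) = 0" and f: "f \<in> carrier \<H>"
  define L1 where "L1 g = L (g, 0)" for g
  define L2' where "L2' g = L (0, g)" for g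
  have car: "(g, h) \<in> carrier \<H> \<longleftrightarrow> g \<in> sq_integrable (- pi) pi \<and> h \<in> sq_integrable (- pi) pi" for g h
    by (simp add: \<H>_def)
  have zs: "0 \<in> sq_integrable (- pi) pi" using L2.zero_closed by simp
  obtain K where K: "K \<ge> 0" "\<And>g. g \<in> carrier \<H> \<Longrightarrow> cmod (L g) \<le> K * hnorm \<H> g"
    using L by (auto simp: H.bounded_functional_def)
  have Ladd: "L (g + h) = L g + L h" if "g \<in> carrier \<H>" "h \<in> carrier \<H>" for g h
    using L that unfolding H.bounded_functional_def by blast
  have Lsc: "L (scale \<H> c g) = c * L g" if "g \<in> carrier \<H>" for g c
    using L that unfolding H.bounded_functional_def by blast
  have N0: "hnorm (L2 (- pi) pi) 0 = 0" using hnorm_L2_cong[of "- pi" pi 0 "\<lambda>_. 0"] by (simp add: hnorm_def)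
  have L1: "L2.bounded_functional (- pi) pi L1" and L2': "L2.bounded_functional (- pi) pi L2'"
    unfolding L2.bounded_functional_def L1_def L2'_def
  proof (safe del: exI)
    show "L (g + h, 0) = L (g, 0) + L (h, 0)" "L (0, g + h) = L (0, g) + L (0, h)"
      if "g \<in> carrier (L2 (- pi) pi)" "h \<in> carrier (L2 (- pi) pi)" for g h
      using Ladd[of "(g, 0)" "(h, 0)"] Ladd[of "(0, g)" "(0, h)"] that zs by (simp_all add: car)
    show "L (scale (L2 (- pi) pi) c g, 0) = c * L (g, 0)" "L (0, scale (L2 (- pi) pi) c g) = c * L (0, g)"
      if "g \<in> carrier (L2 (- pi) pi)" for g c
      using Lsc[of "(g, 0)" c] Lsc[of "(0, g)" c] that zs by (simp_all add: car \<H>_def zero_fun_def)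
    have "cmod (L (g, 0)) \<le> K * hnorm (L2 (- pi) pi) g" "cmod (L (0, g)) \<le> K * hnorm (L2 (- pi) pi) g"
      if g: "g \<in> sq_integrable (- pi) pi" for g
    proof -
      have "hnorm \<H> (g, 0) \<le> hnorm (L2 (- pi) pi) g" "hnorm \<H> (0, g) \<le> hnorm (L2 (- pi) pi) g"
        using hnorm_direct_sum_le(1)[OF L2.semi_ip_axioms L2.semi_ip_axioms, of g "- pi" pi 0 "- pi" pi]
          hnorm_direct_sum_le(1)[OF L2.semi_ip_axioms L2.semi_ip_axioms, of 0 "- pi" pi g "- pi" pi] g zs N0
        by (simp_all add: \<H>_def)
      then have "K * hnorm \<H> (g, 0) \<le> K * hnorm (L2 (- pi) pi) g" "K * hnorm \<H> (0, g) \<le> K * hnorm (L2 (- pi) pi) g"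
        by (intro mult_left_mono K(1); simp)+
      then show "cmod (L (g, 0)) \<le> K * hnorm (L2 (- pi) pi) g" "cmod (L (0, g)) \<le> K * hnorm (L2 (- pi) pi) g"
        using K(2)[of "(g, 0)"] K(2)[of "(0, g)"] g zs by (simp_all add: car)
    qed
    then show "\<exists>K\<ge>0. \<forall>g\<in>carrier (L2 (- pi) pi). cmod (L (g, 0)) \<le> K * hnorm (L2 (- pi) pi) g"
      "\<exists>K\<ge>0. \<forall>g\<in>carrier (L2 (- pi) pi). cmod (L (0, g)) \<le> K * hnorm (L2 (- pi) pi) g"
      using K(1) by auto
  qed
  have split: "L (g, h) = L1 g + L2' h" if "g \<in> sq_integrable (- pi) pi" "h \<in> sq_integrable (- pi) pi" for g h
    using Ladd[of "(g, 0)" "(0, h)"] that zs by (simp add: car L1_def L2'_def)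
  define H1 where "H1 z = L1 (ex 0 z)" for z
  define H2 where "H2 z = L2' (ex 0 z)" for z
  have H: "H1 holomorphic_on UNIV" "H2 holomorphic_on UNIV"
    unfolding H1_def[abs_def] H2_def[abs_def]
    by (rule functional_ex_taylor(1)[OF L1] functional_ex_taylor(1)[OF L2'], simp)+
  have tc: "taylor_coeff j H1 z = L1 (ex j z)" "taylor_coeff j H2 z = L2' (ex j z)" for j z
    using functional_ex_taylor(2)[OF L1] functional_ex_taylor(2)[OF L2'] by (simp_all add: H1_def[abs_def] H2_def[abs_def])
  \<comment> \<open>By the Leibniz rule \<open>L\<close> maps the Taylor coefficients of the family
    behind \<open>v\<close> to those of \<open>\<Phi>\<close>, so vanishing on \<open>v\<close>
    yields zeros of \<open>\<Phi>\<close> at the values \<open>lam n\<close>. At index 0, where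
    \<open>v 0 = (0, 1)\<close>, it yields \<open>H2 0 = 0\<close> instead.\<close>
  define \<Phi> where "\<Phi> z = z * f1 z * H1 z + f2 z * H2 z" for z
  have zf1: "(\<lambda>z. z * f1 z) holomorphic_on UNIV" by (intro holomorphic_intros f1)
  have \<Phi>h: "\<Phi> holomorphic_on UNIV" unfolding \<Phi>_def[abs_def] by (intro holomorphic_intros f1 f2 H)
  have L\<Phi>: "L (v_coeff f1 f2 j w) = taylor_coeff j \<Phi> w" for j w
  proof -
    have "L (v_coeff f1 f2 j w) = L1 (lincomb (L2 (- pi) pi) (\<lambda>i. ex (j - i) w) (\<lambda>i. taylor_coeff i (\<lambda>z. z * f1 z) w) {..j})
        + L2' (lincomb (L2 (- pi) pi) (\<lambda>i. ex (j - i) w) (\<lambda>i. taylor_coeff i f2 w) {..j})"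
      unfolding v_coeff_eq[of _ _ "- pi" pi] using v_coeff_closed[of j w]
      by (intro split) (simp_all add: v_coeff_eq[of _ _ "- pi" pi] car)
    also have "\<dots> = (\<Sum>i\<le>j. taylor_coeff i (\<lambda>z. z * f1 z) w * L1 (ex (j - i) w)) + (\<Sum>i\<le>j. taylor_coeff i f2 w * L2' (ex (j - i) w))"
      by (subst L2.functional_lincomb[OF L1] L2.functional_lincomb[OF L2'], simp add: ex_sq_integrable)+ simp
    also have "\<dots> = taylor_coeff j \<Phi> w"
      unfolding \<Phi>_def[abs_def] tc[symmetric]
      by (simp add: taylor_coeff_add taylor_coeff_mult holomorphic_intros zf1 f1 f2 H)
    finally show ?thesis .
  qed
  have H20: "H2 0 = 0"
  proof -
    have "v 0 = (0, ex 0 0)" by (simp add: v_seq_def ex_0 fun_eq_iff)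
    then show ?thesis using Lv[of 0] by (simp add: H2_def L2'_def)
  qed
  have \<Phi>van: "vanishes \<Phi> (lam n) (Suc \<nu>)" if n\<nu>: "(n, \<nu>) \<in> E_index lam" for n \<nu>
    unfolding vanishes_def
  proof (intro allI impI)
    fix j assume "j < Suc \<nu>"
    then have "enat j \<le> enat \<nu>" by simp
    have n: "n \<in> S_index lam" "enat \<nu> < mult_at lam n" using n\<nu> by (auto simp: E_index_def)
    note j = n(1) le_less_trans[OF \<open>enat j \<le> enat \<nu>\<close> n(2)]
    show "taylor_coeff j \<Phi> (lam n) = 0"
    proof (cases "n + j > 0")
      case True
      then show ?thesis using v_seq_eq[OF consec j True, of f1 f2] Lv[of "n + j"] by (simp add: L\<Phi>)
    next
      case False
      then show ?thesis using H20 lam_0 by (simp add: \<Phi>_def)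
    qed
  qed
  define D where "D z = z * Y z pi * H1 z - Y1 z pi * H2 z" for z
  have Yh: "(\<lambda>z. Y z pi) holomorphic_on UNIV" "(\<lambda>z. Y1 z pi) holomorphic_on UNIV"
    by (auto intro!: Y_holomorphic)
  have Dh: "D holomorphic_on UNIV" unfolding D_def[abs_def] by (intro holomorphic_intros Yh H)
  \<comment> \<open>Cramer's rule for \<open>\<Delta> = f1 Y1 + f2 Y\<close> and
    \<open>\<Phi> = f1 (z H1) + f2 H2\<close>, read as a linear system for \<open>f1\<close>,
    \<open>f2\<close> with determinant \<open>- D\<close>.\<close>
  have fD: "f1 z * D z = Y z pi * \<Phi> z - H2 z * \<Delta> z" "f2 z * D z = z * H1 z * \<Delta> z - Y1 z pi * \<Phi> z" for z
    by (simp_all add: D_def \<Phi>_def \<Delta>_eq algebra_simps)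
  have Dvan: "vanishes D (lam n) (Suc \<nu>)" if n\<nu>: "(n, \<nu>) \<in> E_index lam" for n \<nu>
  proof (cases "n = 0 \<and> \<nu> = 0")
    case True
    then show ?thesis using H20 lam_0 by (simp add: vanishes_def D_def)
  next
    case False
    have S: "n \<in> S_index lam" "enat \<nu> < mult_at lam n" using n\<nu> by (auto simp: E_index_def)
    \<comment> \<open>At 0 the factor \<open>H2\<close>, and in the second identity the factor
      \<open>z\<close>, supplies the order that \<open>\<Delta>\<close> lacks there.\<close>
    have H2van: "vanishes H2 (lam n) (if n = 0 then 1 else 0)" using H20 lam_0 by (simp add: vanishes_def)
    have zH1: "(\<lambda>z. z * H1 z) holomorphic_on UNIV" by (intro holomorphic_intros H)
    have zH1van: "vanishes (\<lambda>z. z * H1 z) (lam n) (if n = 0 then 1 else 0)" using lam_0 by (simp add: vanishes_def)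
    have s: "(if n = 0 then 1 else 0) + (if n = 0 then \<nu> else Suc \<nu>) = Suc \<nu>" by simp
    have v1: "vanishes (\<lambda>z. f1 z * D z) (lam n) (Suc \<nu>)" unfolding fD
      using vanishes_mult[OF Yh(1) \<Phi>h vanishes_0 \<Phi>van[OF n\<nu>]] vanishes_mult[OF H(2) \<Delta>_holomorphic H2van \<Delta>_vanishes[OF n\<nu>]]
      unfolding s by (intro vanishes_diff holomorphic_intros Yh H \<Phi>h \<Delta>_holomorphic) simp_all
    have v2: "vanishes (\<lambda>z. f2 z * D z) (lam n) (Suc \<nu>)" unfolding fD
      using vanishes_mult[OF Yh(2) \<Phi>h vanishes_0 \<Phi>van[OF n\<nu>]] vanishes_mult[OF zH1 \<Delta>_holomorphic zH1van \<Delta>_vanishes[OF n\<nu>]]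
      unfolding s by (intro vanishes_diff holomorphic_intros Yh H \<Phi>h \<Delta>_holomorphic) simp_all
    \<comment> \<open>\<open>f_nonzero\<close> starts at index 1. For \<open>n = 0\<close> it is
      applied to the next index, which has the same value because \<open>\<nu> \<ge> 1\<close> means
      that 0 is repeated; the pair \<open>(0, 0)\<close> was settled by
      \<open>D 0 = 0\<close>.\<close>
    have "f1 (lam n) \<noteq> 0 \<or> f2 (lam n) \<noteq> 0"
    proof (cases "n = 0")
      case True
      then have "enat 1 \<le> enat \<nu>" using False by simp
      then have "enat 1 < mult_at lam n" using S(2) by (rule le_less_trans)
      then have "lam (n + 1) = lam n" using consec S(1) unfolding equal_consecutive_def by blast
      then show ?thesis using f_nonzero[of "n + 1"] by auto
    next
      case False
      then show ?thesis using f_nonzero[of n] by auto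
    qed
    then show ?thesis using vanishes_cancel[OF f1 Dh _ v1] vanishes_cancel[OF f2 Dh _ v2] by blast
  qed
  obtain C where C: "C > 0" "\<And>(F::complex set) c. finite F \<Longrightarrow>
     hnorm (L2 (- pi) pi) (\<lambda>t. \<Sum>\<mu>\<in>F. c \<mu> * U \<mu> pi * ex 0 \<mu> t) \<le> C * hnorm (L2 (- 2 * pi) (2 * pi)) (\<lambda>t. \<Sum>\<mu>\<in>F. c \<mu> * ex 0 \<mu> t) \<and>
     hnorm (L2 (- pi) pi) (\<lambda>t. \<Sum>\<mu>\<in>F. c \<mu> * W \<mu> pi * ex 0 \<mu> t) \<le> C * hnorm (L2 (- 2 * pi) (2 * pi)) (\<lambda>t. \<Sum>\<mu>\<in>F. c \<mu> * ex 0 \<mu> t)"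
    using transfer_bound by blast
  obtain K1 where K1: "K1 \<ge> 0" "\<And>f. f \<in> sq_integrable (- pi) pi \<Longrightarrow> cmod (L1 f) \<le> K1 * hnorm (L2 (- pi) pi) f"
    using L1 by (auto simp: L2.bounded_functional_def)
  obtain K2 where K2: "K2 \<ge> 0" "\<And>f. f \<in> sq_integrable (- pi) pi \<Longrightarrow> cmod (L2' f) \<le> K2 * hnorm (L2 (- pi) pi) f"
    using L2' by (auto simp: L2.bounded_functional_def)
  have Dbound: "cmod (\<Sum>\<mu>\<in>F. c \<mu> * D \<mu>) \<le> (K1 + K2) * C * hnorm (L2 (- 2 * pi) (2 * pi)) (\<lambda>t. \<Sum>\<mu>\<in>F. c \<mu> * ex 0 \<mu> t)"
    if F: "finite F" for F c
  proof -
    define n where "n = hnorm (L2 (- 2 * pi) (2 * pi)) (\<lambda>t. \<Sum>\<mu>\<in>F. c \<mu> * ex 0 \<mu> t)"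
    have b: "cmod (\<Sum>\<mu>\<in>F. c \<mu> * V \<mu> * M (ex 0 \<mu>)) \<le> B * (C * n)"
      if M: "L2.bounded_functional (- pi) pi M" and B: "B \<ge> 0" "\<And>f. f \<in> sq_integrable (- pi) pi \<Longrightarrow> cmod (M f) \<le> B * hnorm (L2 (- pi) pi) f"
        and V: "hnorm (L2 (- pi) pi) (\<lambda>t. \<Sum>\<mu>\<in>F. c \<mu> * V \<mu> * ex 0 \<mu> t) \<le> C * n" for M V B
    proof -
      have "(\<Sum>\<mu>\<in>F. c \<mu> * V \<mu> * M (ex 0 \<mu>)) = M (\<lambda>t. \<Sum>\<mu>\<in>F. c \<mu> * V \<mu> * ex 0 \<mu> t)"
        using L2.functional_lincomb[OF M, of F "ex 0" "\<lambda>\<mu>. c \<mu> * V \<mu>"] by (simp add: lincomb_L2 ex_sq_integrable)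
      also have "cmod \<dots> \<le> B * hnorm (L2 (- pi) pi) (\<lambda>t. \<Sum>\<mu>\<in>F. c \<mu> * V \<mu> * ex 0 \<mu> t)"
        by (intro B(2) continuous_sq_integrable continuous_intros ex_continuous)
      also have "\<dots> \<le> B * (C * n)" by (intro mult_left_mono V B(1))
      finally show ?thesis .
    qed
    have CU: "hnorm (L2 (- pi) pi) (\<lambda>t. \<Sum>\<mu>\<in>F. c \<mu> * U \<mu> pi * ex 0 \<mu> t) \<le> C * n"
      and CW: "hnorm (L2 (- pi) pi) (\<lambda>t. \<Sum>\<mu>\<in>F. c \<mu> * W \<mu> pi * ex 0 \<mu> t) \<le> C * n"
      using C(2)[OF F, of c] by (simp_all add: n_def)
    note b = b[OF L1 K1 CU] b[OF L1 K1 CW] b[OF L2' K2 CU] b[OF L2' K2 CW]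
    define A1 B1 A2 B2 where "A1 = (\<Sum>\<mu>\<in>F. c \<mu> * U \<mu> pi * L1 (ex 0 \<mu>))" and "B1 = (\<Sum>\<mu>\<in>F. c \<mu> * W \<mu> pi * L1 (ex 0 \<mu>))"
      and "A2 = (\<Sum>\<mu>\<in>F. c \<mu> * U \<mu> pi * L2' (ex 0 \<mu>))" and "B2 = (\<Sum>\<mu>\<in>F. c \<mu> * W \<mu> pi * L2' (ex 0 \<mu>))"
    \<comment> \<open>\<open>z * Y\<close> and \<open>Y1\<close> are expressed through
      \<open>U\<close> and \<open>W\<close>, for which the mapping bound is available.\<close>
    have e: "2 * (c \<mu> * D \<mu>) = - \<i> * (c \<mu> * U \<mu> pi * L1 (ex 0 \<mu>)) + \<i> * (c \<mu> * W \<mu> pi * L1 (ex 0 \<mu>))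
        - c \<mu> * U \<mu> pi * L2' (ex 0 \<mu>) - c \<mu> * W \<mu> pi * L2' (ex 0 \<mu>)" for \<mu>
      by (simp add: D_def U_def W_def H1_def H2_def algebra_simps)
    have "2 * (\<Sum>\<mu>\<in>F. c \<mu> * D \<mu>) = - \<i> * A1 + \<i> * B1 - A2 - B2"
      unfolding sum_distrib_left e A1_def B1_def A2_def B2_def by (simp only: sum.distrib sum_subtractf sum_distrib_left)
    then have "2 * cmod (\<Sum>\<mu>\<in>F. c \<mu> * D \<mu>) = cmod (- \<i> * A1 + \<i> * B1 - A2 - B2)"
      by (metis norm_mult norm_numeral)
    also have "\<dots> \<le> cmod A1 + cmod B1 + cmod A2 + cmod B2"
      using norm_triangle_ineq4[of "- \<i> * A1 + \<i> * B1 - A2" B2] norm_triangle_ineq4[of "- \<i> * A1 + \<i> * B1" A2]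
        norm_triangle_ineq[of "- \<i> * A1" "\<i> * B1"] by (simp add: norm_mult)
    also have "\<dots> \<le> 2 * ((K1 + K2) * C * n)"
      using b unfolding A1_def B1_def A2_def B2_def by (simp add: algebra_simps)
    finally show ?thesis by (simp add: n_def)
  qed
  have "D z = 0" for z
  proof (rule bounded_on_exponentials_vanishes[OF Dh _ Dbound])
    show "complete_system (L2 (- 2 * pi) (2 * pi)) (E_index lam) (\<lambda>j. ex (snd j) (lam (fst j)))"
      using compl by (simp add: E_system_eq[abs_def])
    show "0 \<le> (K1 + K2) * C" using K1(1) K2(1) C(1) by simp
    show "taylor_coeff (snd j) D (lam (fst j)) = 0" if "j \<in> E_index lam" for j
      using Dvan[of "fst j" "snd j"] that by (simp add: vanishes_def)
  qed simp_all
  then have eq: "z * Y z pi * L1 (ex 0 z) = Y1 z pi * L2' (ex 0 z)" for z by (simp add: D_def H1_def H2_def)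
  have "H1 = (\<lambda>z. 0)" "H2 = (\<lambda>z. 0)"
    using transforms_vanish[OF L1 L2' eq] H20 by (auto simp: H1_def H2_def)
  then have "L1 (ex j z) = 0" "L2' (ex j z) = 0" for j z
    unfolding tc[symmetric] by (simp_all add: taylor_coeff_def)
  moreover have "complete_system (L2 (- pi) pi) (E_index lam) (E_system lam)"
    by (rule complete_system_restrict[OF compl]) auto
  ultimately have "L1 g = 0" "L2' g = 0" if "g \<in> sq_integrable (- pi) pi" for g
    using L2.functional_zero[OF L1, of "E_index lam" "E_system lam" g] L2.functional_zero[OF L2', of "E_index lam" "E_system lam" g] that
    by (simp_all add: E_system_eq)
  then show "L f = 0" using f split by (cases f) (simp add: car)
qed

end

section \<open>The unconditional basis property\<close>

context semi_ip
begin

lemma reindex_riesz: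
  assumes h: "bij_betw h A B"
  shows "complete_system X B z \<Longrightarrow> complete_system X A (\<lambda>k. z (h k))"
    and "lower_riesz B z c \<Longrightarrow> lower_riesz A (\<lambda>k. z (h k)) c"
    and "upper_riesz B z C \<Longrightarrow> upper_riesz A (\<lambda>k. z (h k)) C"
proof -
  define h' where "h' = inv_into A h"
  have h': "h' (h k) = k" if "k \<in> A" for k using h that by (simp add: h'_def bij_betw_inv_into_left)
  have inj: "inj_on h F" if "F \<subseteq> A" for F using h that by (meson bij_betw_def inj_on_subset)
  have im: "h ` F \<subseteq> B" if "F \<subseteq> A" for F using h that by (auto simp: bij_betw_def)
  have lc: "lc (\<lambda>k. z (h k)) a F = lc z (\<lambda>j. a (h' j)) (h ` F)" if "F \<subseteq> A" for a F
    unfolding lincomb_def sum.reindex[OF inj[OF that]] using h' that by (intro sum.cong) auto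
  have l2: "l2 (\<lambda>j. a (h' j)) (h ` F) = l2 a F" if "F \<subseteq> A" for a :: "_ \<Rightarrow> complex" and F
    unfolding L2_set_def sum.reindex[OF inj[OF that]] using h' that by (intro arg_cong[of _ _ sqrt] sum.cong) auto
  show "lower_riesz A (\<lambda>k. z (h k)) c" if "lower_riesz B z c"
    unfolding lower_riesz_def
  proof (intro allI impI)
    fix F and a :: "_ \<Rightarrow> complex" assume F: "finite F \<and> F \<subseteq> A"
    then have "c * l2 (\<lambda>j. a (h' j)) (h ` F) \<le> N (lc z (\<lambda>j. a (h' j)) (h ` F))"
      using that[unfolded lower_riesz_def, rule_format, of "h ` F" "\<lambda>j. a (h' j)"] im[of F] by simp
    then show "c * l2 a F \<le> N (lc (\<lambda>k. z (h k)) a F)" using F by (simp add: lc l2)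
  qed
  show "upper_riesz A (\<lambda>k. z (h k)) C" if "upper_riesz B z C"
    unfolding upper_riesz_def
  proof (intro allI impI)
    fix F and a :: "_ \<Rightarrow> complex" assume F: "finite F \<and> F \<subseteq> A"
    then have "N (lc z (\<lambda>j. a (h' j)) (h ` F)) \<le> C * l2 (\<lambda>j. a (h' j)) (h ` F)"
      using that[unfolded upper_riesz_def, rule_format, of "h ` F" "\<lambda>j. a (h' j)"] im[of F] by simp
    then show "N (lc (\<lambda>k. z (h k)) a F) \<le> C * l2 a F" using F by (simp add: lc l2)
  qed
  show "complete_system X A (\<lambda>k. z (h k))" if "complete_system X B z"
  proof (rule complete_system_trans[OF that])
    show "z (h k) \<in> carrier X" if "k \<in> A" for k
      using \<open>complete_system X B z\<close> im[of "{k}"] that by (simp add: complete_system_def)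
    show "in_closed_span (\<lambda>k. z (h k)) A (z j)" if "j \<in> B" for j
    proof -
      have "h' j \<in> A" "h (h' j) = j" using h that by (simp_all add: h'_def bij_betw_def inv_into_into f_inv_into_f)
      then show ?thesis using in_closed_span_member[of "h' j" A "\<lambda>k. z (h k)"] by simp
    qed
  qed
qed

end

lemma hnorm_H:
  "f \<in> sq_integrable (- pi) pi \<Longrightarrow> g \<in> sq_integrable (- pi) pi \<Longrightarrow>
     (hnorm \<H> (f, g))\<^sup>2 = (hnorm (L2 (- pi) pi) f)\<^sup>2 + (hnorm (L2 (- pi) pi) g)\<^sup>2"
  using hnorm_direct_sum[OF L2.semi_ip_axioms L2.semi_ip_axioms] by (simp add: \<H>_def)

lemma hnorm_L2_split:
  assumes f: "continuous_on UNIV f" and "a \<le> b" "b \<le> c"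
  shows "(hnorm (L2 a c) f)\<^sup>2 = (hnorm (L2 a b) f)\<^sup>2 + (hnorm (L2 b c) f)\<^sup>2"
  unfolding hnorm_L2_sq[OF continuous_sq_integrable[OF f]]
  by (rule Henstock_Kurzweil_Integration.integral_combine[symmetric])
    (use assms in \<open>auto intro!: integrable_continuous_interval continuous_intros continuous_on_subset[OF f]\<close>)

section \<open>The isomorphism \<open>J\<close> between the two spaces\<close>

context pencil
begin

text \<open>The leading terms of \<open>(z Y exp (i z t), - Y1 exp (i z t))\<close> at \<open>x = \<pi>\<close> involve \<open>exp (i z (t \<plusminus> \<pi>))\<close>;
  replacing these shifted exponentials by shifts of an arbitrary function gives \<open>J\<close>.\<close>

definition J :: "(real \<Rightarrow> complex) \<Rightarrow> (real \<Rightarrow> complex) \<times> (real \<Rightarrow> complex)" where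
  "J \<phi> = ((\<lambda>t. (exp (- ph pi) * \<phi> (t + pi) - exp (ph pi) * \<phi> (t - pi)) / (2 * \<i>)),
          (\<lambda>t. - (exp (- ph pi) * \<phi> (t + pi) + exp (ph pi) * \<phi> (t - pi)) / 2))"

lemma J_lincomb: "lincomb \<H> (\<lambda>k. J (x k)) c F = J (lincomb (L2 a b) x c F)"
  unfolding J_def \<H>_def lincomb_direct_sum[OF L2.semi_ip_axioms L2.semi_ip_axioms] lincomb_L2
  by (simp add: fun_eq_iff sum_distrib_left sum_subtractf sum.distrib diff_divide_distrib add_divide_distrib
      right_diff_distrib distrib_left sum_divide_distrib mult_ac sum_negf)

lemma J_continuous:
  assumes "continuous_on UNIV \<phi>"
  shows "continuous_on UNIV (fst (J \<phi>))" "continuous_on UNIV (snd (J \<phi>))"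
proof -
  have "continuous_on UNIV (\<lambda>t. \<phi> (t + pi))" "continuous_on UNIV (\<lambda>t. \<phi> (t - pi))"
    by (intro continuous_on_compose2[OF assms] continuous_intros; simp)+
  then show "continuous_on UNIV (fst (J \<phi>))" "continuous_on UNIV (snd (J \<phi>))"
    unfolding J_def fst_conv snd_conv by (intro continuous_intros; simp)+
qed

lemma J_closed: "continuous_on UNIV \<phi> \<Longrightarrow> J \<phi> \<in> carrier \<H>"
  using J_continuous[of \<phi>] by (cases "J \<phi>") (simp add: \<H>_def continuous_sq_integrable)

lemma parallelogram: "(cmod (u - w))\<^sup>2 + (cmod (u + w))\<^sup>2 = 2 * ((cmod u)\<^sup>2 + (cmod w)\<^sup>2)"
  unfolding cmod_power2 by (simp add: power2_eq_square algebra_simps)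

text \<open>The parallelogram law removes the cross terms. The shifts by \<open>pi\<close> and
  \<open>- pi\<close> carry (-pi, pi) onto the two halves of (-2 pi, 2 pi), so the halves contribute
  separately, each with its own phase weight.\<close>

lemma hnorm_J:
  assumes \<phi>: "continuous_on UNIV \<phi>"
  shows "(hnorm \<H> (J \<phi>))\<^sup>2 = ((cmod (exp (- ph pi)))\<^sup>2 * (hnorm (L2 0 (2 * pi)) \<phi>)\<^sup>2
     + (cmod (exp (ph pi)))\<^sup>2 * (hnorm (L2 (- 2 * pi) 0) \<phi>)\<^sup>2) / 2"
proof -
  define u where "u t = exp (- ph pi) * \<phi> (t + pi)" for t
  define w where "w t = exp (ph pi) * \<phi> (t + - pi)" for t
  have sh: "continuous_on UNIV (\<lambda>t. \<phi> (t + pi))" "continuous_on UNIV (\<lambda>t. \<phi> (t + - pi))"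
    by (intro continuous_on_compose2[OF \<phi>] continuous_intros; simp)+
  have uw: "continuous_on UNIV u" "continuous_on UNIV w"
    unfolding u_def[abs_def] w_def[abs_def] by (intro continuous_intros sh)+
  have nu: "hnorm (L2 (- pi) pi) u = cmod (exp (- ph pi)) * hnorm (L2 0 (2 * pi)) \<phi>"
    using L2.N_scale[of "\<lambda>t. \<phi> (t + pi)" "- pi" pi "exp (- ph pi)"] hnorm_L2_shift[OF \<phi>, of "- pi" pi pi] continuous_sq_integrable[OF sh(1)]
    by (simp add: u_def[abs_def])
  have nw: "hnorm (L2 (- pi) pi) w = cmod (exp (ph pi)) * hnorm (L2 (- 2 * pi) 0) \<phi>"
    using L2.N_scale[of "\<lambda>t. \<phi> (t + - pi)" "- pi" pi "exp (ph pi)"] hnorm_L2_shift[OF \<phi>, of "- pi" pi "- pi"] continuous_sq_integrable[OF sh(2)]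
    by (simp add: w_def[abs_def])
  have J: "J \<phi> = ((\<lambda>t. (u t - w t) / (2 * \<i>)), (\<lambda>t. - (u t + w t) / 2))" by (simp add: J_def u_def w_def)
  have i: "(\<lambda>t. (cmod (f t))\<^sup>2) integrable_on {- pi..pi}" if "continuous_on UNIV f" for f :: "real \<Rightarrow> complex"
    by (intro integrable_continuous_interval continuous_intros continuous_on_subset[OF that]) auto
  have c: "continuous_on UNIV (\<lambda>t. (u t - w t) / (2 * \<i>))" "continuous_on UNIV (\<lambda>t. - (u t + w t) / 2)"
    by (intro continuous_intros uw; simp)+
  have "(hnorm \<H> (J \<phi>))\<^sup>2 = integral {-pi..pi} (\<lambda>t. (cmod ((u t - w t) / (2 * \<i>)))\<^sup>2) + integral {-pi..pi} (\<lambda>t. (cmod (- (u t + w t) / 2))\<^sup>2)"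
    unfolding J using c by (simp add: hnorm_H hnorm_L2_sq continuous_sq_integrable)
  also have "\<dots> = integral {-pi..pi} (\<lambda>t. (cmod ((u t - w t) / (2 * \<i>)))\<^sup>2 + (cmod (- (u t + w t) / 2))\<^sup>2)"
    by (rule Henstock_Kurzweil_Integration.integral_add[symmetric]) (intro i c)+
  also have "(\<lambda>t. (cmod ((u t - w t) / (2 * \<i>)))\<^sup>2 + (cmod (- (u t + w t) / 2))\<^sup>2) = (\<lambda>t. (1 / 2) * ((cmod (u t))\<^sup>2 + (cmod (w t))\<^sup>2))"
  proof
    fix t show "(cmod ((u t - w t) / (2 * \<i>)))\<^sup>2 + (cmod (- (u t + w t) / 2))\<^sup>2 = (1 / 2) * ((cmod (u t))\<^sup>2 + (cmod (w t))\<^sup>2)"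
      using parallelogram[of "u t" "w t"] by (simp add: norm_divide norm_mult power_divide add.commute norm_minus_commute minus_add_distrib[symmetric] del: minus_add_distrib)
  qed
  also have "integral {-pi..pi} \<dots> = (1 / 2) * (integral {-pi..pi} (\<lambda>t. (cmod (u t))\<^sup>2) + integral {-pi..pi} (\<lambda>t. (cmod (w t))\<^sup>2))"
    by (simp only: integral_mult_right Henstock_Kurzweil_Integration.integral_add[OF i i] uw)
  also have "\<dots> = ((hnorm (L2 (- pi) pi) u)\<^sup>2 + (hnorm (L2 (- pi) pi) w)\<^sup>2) / 2"
    by (simp add: hnorm_L2_sq continuous_sq_integrable uw)
  finally show ?thesis by (simp add: nu nw power_mult_distrib)
qed

lemma J_bounds:
  "\<exists>m>0. \<exists>M>0. \<forall>\<phi>. continuous_on UNIV \<phi> \<longrightarrow>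
     m * hnorm (L2 (- 2 * pi) (2 * pi)) \<phi> \<le> hnorm \<H> (J \<phi>) \<and> hnorm \<H> (J \<phi>) \<le> M * hnorm (L2 (- 2 * pi) (2 * pi)) \<phi>"
proof -
  define \<alpha> \<beta> where "\<alpha> = cmod (exp (- ph pi))" and "\<beta> = cmod (exp (ph pi))"
  define m M where "m = min \<alpha> \<beta> / 2" and "M = max \<alpha> \<beta>"
  have pos: "0 < \<alpha>" "0 < \<beta>" by (simp_all add: \<alpha>_def \<beta>_def)
  have mM: "0 < m" "0 < M" using pos by (auto simp: m_def M_def)
  have "m * hnorm (L2 (- 2 * pi) (2 * pi)) \<phi> \<le> hnorm \<H> (J \<phi>) \<and> hnorm \<H> (J \<phi>) \<le> M * hnorm (L2 (- 2 * pi) (2 * pi)) \<phi>"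
    if \<phi>: "continuous_on UNIV \<phi>" for \<phi>
  proof -
    define a b where "a = (hnorm (L2 0 (2 * pi)) \<phi>)\<^sup>2" and "b = (hnorm (L2 (- 2 * pi) 0) \<phi>)\<^sup>2"
    have ab: "0 \<le> a" "0 \<le> b" by (simp_all add: a_def b_def)
    have n: "(hnorm (L2 (- 2 * pi) (2 * pi)) \<phi>)\<^sup>2 = a + b"
      using hnorm_L2_split[OF \<phi>, of "- 2 * pi" 0 "2 * pi"] by (simp add: a_def b_def)
    have j: "(hnorm \<H> (J \<phi>))\<^sup>2 = (\<alpha>\<^sup>2 * a + \<beta>\<^sup>2 * b) / 2" using hnorm_J[OF \<phi>] by (simp add: \<alpha>_def \<beta>_def a_def b_def)
    have sq: "(2 * m)\<^sup>2 \<le> \<alpha>\<^sup>2" "(2 * m)\<^sup>2 \<le> \<beta>\<^sup>2" "\<alpha>\<^sup>2 \<le> M\<^sup>2" "\<beta>\<^sup>2 \<le> M\<^sup>2"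
      using pos by (auto simp: m_def M_def intro!: power_mono)
    have nn: "0 \<le> hnorm (L2 (- 2 * pi) (2 * pi)) \<phi>" "0 \<le> hnorm \<H> (J \<phi>)"
      using L2.N_nonneg[of \<phi> "- 2 * pi" "2 * pi"] H.N_nonneg[OF J_closed[OF \<phi>]] continuous_sq_integrable[OF \<phi>] by simp_all
    have "(m * hnorm (L2 (- 2 * pi) (2 * pi)) \<phi>)\<^sup>2 \<le> (hnorm \<H> (J \<phi>))\<^sup>2"
      unfolding power_mult_distrib n j
      using mult_right_mono[OF sq(1) ab(1)] mult_right_mono[OF sq(2) ab(2)] mult_nonneg_nonneg[OF zero_le_power2[of m] ab(1)] mult_nonneg_nonneg[OF zero_le_power2[of m] ab(2)]
      by (simp add: algebra_simps)
    moreover have "(hnorm \<H> (J \<phi>))\<^sup>2 \<le> (M * hnorm (L2 (- 2 * pi) (2 * pi)) \<phi>)\<^sup>2"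
      unfolding power_mult_distrib n j
      using mult_right_mono[OF sq(3) ab(1)] mult_right_mono[OF sq(4) ab(2)] mult_nonneg_nonneg[OF zero_le_power2[of M] ab(1)] mult_nonneg_nonneg[OF zero_le_power2[of M] ab(2)]
      by (simp add: algebra_simps)
    ultimately show ?thesis using nn mM by (auto intro: power2_le_imp_le)
  qed
  then show ?thesis using mM by blast
qed

text \<open>The two components are solved for the shifted functions \<open>u\<close> and
  \<open>w\<close>, which are glued to a function \<open>\<phi>\<close> on (-2 pi, 2 pi). It may
  jump at 0, but \<open>J\<close> is applied only to the continuous combination \<open>P\<close>
  approximating it.\<close>

lemma J_onto:
  assumes x: "complete_system (L2 (- 2 * pi) (2 * pi)) K x" and xc: "\<And>j. j \<in> K \<Longrightarrow> continuous_on UNIV (x j)"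
    and g: "continuous_on UNIV g" "continuous_on UNIV h"
  shows "H.in_closed_span (\<lambda>j. J (x j)) K (g, h)"
  unfolding H.in_closed_span_def
proof (intro allI impI)
  fix e :: real assume e: "e > 0"
  define \<alpha> \<beta> where "\<alpha> = exp (- ph pi)" and "\<beta> = exp (ph pi)"
  have \<alpha>\<beta>: "\<alpha> \<noteq> 0" "\<beta> \<noteq> 0" by (simp_all add: \<alpha>_def \<beta>_def)
  define u w where "u t = (- h t + \<i> * g t) / \<alpha>" and "w t = (- h t - \<i> * g t) / \<beta>" for t
  have uw: "continuous_on UNIV u" "continuous_on UNIV w"
    unfolding u_def[abs_def] w_def[abs_def] using \<alpha>\<beta> by (intro continuous_intros g; simp)+
  define \<phi> where "\<phi> t = (if t \<in> {0<..<2*pi} then u (t - pi) else 0) + (if t \<in> {-2*pi<..<0} then w (t + pi) else 0)" for t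
  have us: "continuous_on UNIV (\<lambda>t. u (t - pi))" and ws: "continuous_on UNIV (\<lambda>t. w (t + pi))"
    by (rule continuous_on_compose2[OF uw(1)] continuous_on_compose2[OF uw(2)], auto intro!: continuous_intros)+
  have "(\<lambda>t. if t \<in> {0<..<2*pi} then u (t - pi) else 0) \<in> sq_integrable (- 2 * pi) (2 * pi)"
    "(\<lambda>t. if t \<in> {-2*pi<..<0} then w (t + pi) else 0) \<in> sq_integrable (- 2 * pi) (2 * pi)"
    by (intro sq_integrable_extend continuous_sq_integrable us ws; simp)+
  then have \<phi>: "\<phi> \<in> carrier (L2 (- 2 * pi) (2 * pi))"
    using sq_integrable_add[of _ "- 2 * pi" "2 * pi"] by (simp add: \<phi>_def[abs_def] plus_fun_def)
  define \<delta> where "\<delta> = e / (2 * (cmod \<alpha> + cmod \<beta>))"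
  have \<delta>: "\<delta> > 0" using e \<alpha>\<beta> by (auto simp: \<delta>_def intro!: divide_pos_pos add_pos_pos)
  obtain F c where F: "finite F" "F \<subseteq> K" "hnorm (L2 (- 2 * pi) (2 * pi)) (\<phi> - lincomb (L2 (- 2 * pi) (2 * pi)) x c F) < \<delta>"
    using x \<phi> \<delta> unfolding complete_system_def by blast
  define P where "P = lincomb (L2 (- 2 * pi) (2 * pi)) x c F"
  have Pc: "continuous_on UNIV P" using xc F(2) by (auto simp: P_def lincomb_L2 intro!: continuous_intros)
  have dc: "\<phi> - P \<in> sq_integrable (- 2 * pi) (2 * pi)" using L2.diff_closed[OF \<phi>, of P] continuous_sq_integrable[OF Pc] by simp
  have Ps: "continuous_on UNIV (\<lambda>t. P (t + pi))" "continuous_on UNIV (\<lambda>t. P (t + - pi))"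
    by (intro continuous_on_compose2[OF Pc] continuous_intros; simp)+
  define a where "a t = u t - P (t + pi)" for t
  define b where "b t = w t - P (t + - pi)" for t
  have ab: "continuous_on UNIV a" "continuous_on UNIV b"
    unfolding a_def[abs_def] b_def[abs_def] by (intro continuous_intros uw Ps)+
  have "hnorm (L2 (- pi) pi) (\<lambda>t. (\<lambda>t. u (t - pi) - P t) (t + pi)) = hnorm (L2 (- pi + pi) (pi + pi)) (\<lambda>t. u (t - pi) - P t)"
    by (intro hnorm_L2_shift continuous_intros us Pc)
  also have "\<dots> = hnorm (L2 (- pi + pi) (pi + pi)) (\<phi> - P)" by (intro hnorm_L2_cong) (auto simp: \<phi>_def)
  also have "\<dots> \<le> hnorm (L2 (- 2 * pi) (2 * pi)) (\<phi> - P)" by (rule sq_integrable_restrict(2)[OF dc]) auto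
  finally have na: "hnorm (L2 (- pi) pi) a < \<delta>" using F(3) by (simp add: a_def[abs_def] P_def)
  have "hnorm (L2 (- pi) pi) (\<lambda>t. (\<lambda>t. w (t + pi) - P t) (t + - pi)) = hnorm (L2 (- pi + - pi) (pi + - pi)) (\<lambda>t. w (t + pi) - P t)"
    by (intro hnorm_L2_shift continuous_intros ws Pc)
  also have "\<dots> = hnorm (L2 (- pi + - pi) (pi + - pi)) (\<phi> - P)" by (intro hnorm_L2_cong) (auto simp: \<phi>_def)
  also have "\<dots> \<le> hnorm (L2 (- 2 * pi) (2 * pi)) (\<phi> - P)" by (rule sq_integrable_restrict(2)[OF dc]) auto
  finally have nb: "hnorm (L2 (- pi) pi) b < \<delta>" using F(3) by (simp add: b_def[abs_def] P_def)
  have lin: "(\<lambda>t. r * a t + s * b t) \<in> sq_integrable (- pi) pi \<and> hnorm (L2 (- pi) pi) (\<lambda>t. r * a t + s * b t) \<le> (cmod r + cmod s) * \<delta>" for r s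
  proof -
    have s: "a \<in> sq_integrable (- pi) pi" "b \<in> sq_integrable (- pi) pi" by (intro continuous_sq_integrable ab)+
    note s' = sq_integrable_scale[OF s(1), of r] sq_integrable_scale[OF s(2), of s]
    have "hnorm (L2 (- pi) pi) (\<lambda>t. r * a t) = cmod r * hnorm (L2 (- pi) pi) a" "hnorm (L2 (- pi) pi) (\<lambda>t. s * b t) = cmod s * hnorm (L2 (- pi) pi) b"
      using L2.N_scale[of a "- pi" pi r] L2.N_scale[of b "- pi" pi s] s by simp_all
    moreover have "cmod r * hnorm (L2 (- pi) pi) a \<le> cmod r * \<delta>" "cmod s * hnorm (L2 (- pi) pi) b \<le> cmod s * \<delta>"
      using na nb by (auto intro!: mult_left_mono)
    ultimately show ?thesis using L2.N_triangle[of "\<lambda>t. r * a t" "- pi" pi "\<lambda>t. s * b t"] sq_integrable_add[OF s'] s'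
      by (simp add: plus_fun_def algebra_simps)
  qed
  have "lincomb \<H> (\<lambda>j. J (x j)) c F = J P" unfolding P_def by (rule J_lincomb)
  moreover have "(g, h) - J P = ((\<lambda>t. (\<alpha> / (2 * \<i>)) * a t + (- \<beta> / (2 * \<i>)) * b t), (\<lambda>t. (- \<alpha> / 2) * a t + (- \<beta> / 2) * b t))"
    using \<alpha>\<beta> by (simp add: J_def fun_eq_iff a_def b_def u_def w_def \<alpha>_def[symmetric] \<beta>_def[symmetric] field_simps)
  moreover have "hnorm \<H> ((\<lambda>t. (\<alpha> / (2 * \<i>)) * a t + (- \<beta> / (2 * \<i>)) * b t), (\<lambda>t. (- \<alpha> / 2) * a t + (- \<beta> / 2) * b t))
      \<le> (cmod (\<alpha> / (2 * \<i>)) + cmod (- \<beta> / (2 * \<i>))) * \<delta> + (cmod (- \<alpha> / 2) + cmod (- \<beta> / 2)) * \<delta>"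
    using lin[of "\<alpha> / (2 * \<i>)" "- \<beta> / (2 * \<i>)"] lin[of "- \<alpha> / 2" "- \<beta> / 2"] unfolding \<H>_def
    by (intro order_trans[OF hnorm_direct_sum_le(1)[OF L2.semi_ip_axioms L2.semi_ip_axioms]] add_mono) simp_all
  moreover have "(cmod (\<alpha> / (2 * \<i>)) + cmod (- \<beta> / (2 * \<i>))) * \<delta> + (cmod (- \<alpha> / 2) + cmod (- \<beta> / 2)) * \<delta> = (cmod \<alpha> + cmod \<beta>) * \<delta>"
    by (simp add: norm_divide norm_mult field_simps)
  moreover have "(cmod \<alpha> + cmod \<beta>) * \<delta> < e" using e \<alpha>\<beta> by (simp add: \<delta>_def add_pos_pos field_simps)
  ultimately have "hnorm \<H> ((g, h) - lincomb \<H> (\<lambda>j. J (x j)) c F) < e" by simp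
  then show "\<exists>F a. finite F \<and> F \<subseteq> K \<and> hnorm \<H> ((g, h) - lincomb \<H> (\<lambda>j. J (x j)) a F) < e" using F(1,2) by blast
qed

text \<open>Two stages: the components of \<open>f\<close> are approximated on (-pi, pi) by
  combinations of the \<open>x j\<close>, which are continuous, and continuous pairs are reached by
  \<open>J_onto\<close>.\<close>

lemma J_complete:
  assumes x: "complete_system (L2 (- 2 * pi) (2 * pi)) K x" and xc: "\<And>j. j \<in> K \<Longrightarrow> continuous_on UNIV (x j)"
  shows "complete_system \<H> K (\<lambda>j. J (x j))"
  unfolding H.complete_system_iff
proof (intro conjI ballI)
  show "J (x j) \<in> carrier \<H>" if "j \<in> K" for j using J_closed[OF xc[OF that]] .
  have x': "complete_system (L2 (- pi) pi) K x" by (rule complete_system_restrict[OF x]) auto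
  fix f assume f: "f \<in> carrier \<H>"
  obtain f1 f2 where f12: "f = (f1, f2)" by (cases f)
  have fc: "f1 \<in> carrier (L2 (- pi) pi)" "f2 \<in> carrier (L2 (- pi) pi)" using f by (simp_all add: f12 \<H>_def)
  show "H.in_closed_span (\<lambda>j. J (x j)) K f"
  proof (rule H.in_closed_span_limit[OF f])
    show "J (x k) \<in> carrier \<H>" if "k \<in> K" for k using J_closed[OF xc[OF that]] .
    fix e :: real assume "e > 0"
    then have e: "e / 2 > 0" by simp
    obtain F c where F: "finite F" "F \<subseteq> K" "hnorm (L2 (- pi) pi) (f1 - lincomb (L2 (- pi) pi) x c F) < e / 2"
      using x' fc(1) e unfolding complete_system_def by blast
    obtain G d where G: "finite G" "G \<subseteq> K" "hnorm (L2 (- pi) pi) (f2 - lincomb (L2 (- pi) pi) x d G) < e / 2"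
      using x' fc(2) e unfolding complete_system_def by blast
    define P Q where "P = lincomb (L2 (- pi) pi) x c F" and "Q = lincomb (L2 (- pi) pi) x d G"
    have PQ: "continuous_on UNIV P" "continuous_on UNIV Q"
      using xc F(2) G(2) by (auto simp: P_def Q_def lincomb_L2 intro!: continuous_intros)
    note s = continuous_sq_integrable[OF PQ(1)] continuous_sq_integrable[OF PQ(2)]
    have "f1 - P \<in> carrier (L2 (- pi) pi)" "f2 - Q \<in> carrier (L2 (- pi) pi)"
      by (intro L2.diff_closed fc; simp add: s)+
    then have "hnorm \<H> (f1 - P, f2 - Q) \<le> hnorm (L2 (- pi) pi) (f1 - P) + hnorm (L2 (- pi) pi) (f2 - Q)"
      unfolding \<H>_def by (intro hnorm_direct_sum_le(1) L2.semi_ip_axioms)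
    then have "hnorm \<H> (f - (P, Q)) < e" using F(3) G(3) by (simp add: f12 P_def Q_def)
    moreover have "(P, Q) \<in> carrier \<H>" by (simp add: \<H>_def s)
    moreover have "H.in_closed_span (\<lambda>j. J (x j)) K (P, Q)" by (rule J_onto[OF x xc PQ])
    ultimately show "\<exists>g\<in>carrier \<H>. H.in_closed_span (\<lambda>j. J (x j)) K g \<and> hnorm \<H> (f - g) < e" by blast
  qed
qed

end

section \<open>Enumeration of the exponentials and comparison with \<open>v\<close>\<close>

context subspectrum_data
begin

text \<open>The inverse of \<open>(n, \<nu>) \<mapsto> n + \<nu>\<close>, which aligns the
  exponentials, indexed by pairs, with the sequence \<open>v\<close>.\<close>

definition idx :: "nat \<Rightarrow> nat \<times> nat" where
  "idx k = (LEAST n. lam n = lam k, k - (LEAST n. lam n = lam k))"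

lemma idx_eq:
  assumes "(n, \<nu>) \<in> E_index lam"
  shows "idx (n + \<nu>) = (n, \<nu>)"
proof -
  have n: "n \<in> S_index lam" "enat \<nu> < mult_at lam n" using assms by (auto simp: E_index_def)
  have eq: "lam (n + \<nu>) = lam n" using n consec by (simp add: equal_consecutive_def)
  have "(LEAST m. lam m = lam (n + \<nu>)) = n"
    using n(1) eq by (intro Least_equality) (auto simp: S_index_def not_less[symmetric])
  then show ?thesis by (simp add: idx_def)
qed

lemma idx_in: "idx k \<in> E_index lam" and idx_sum: "fst (idx k) + snd (idx k) = k" and lam_idx: "lam (fst (idx k)) = lam k"
proof -
  define n where "n = (LEAST n. lam n = lam k)"
  have le: "n \<le> k" unfolding n_def by (rule Least_le) simp
  show eq: "lam (fst (idx k)) = lam k" unfolding idx_def fst_conv by (rule LeastI[of _ k]) simp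
  show "fst (idx k) + snd (idx k) = k" using le by (simp add: idx_def n_def)
  have eq: "lam n = lam k" using eq by (simp add: idx_def n_def)
  have S: "n \<in> S_index lam"
    unfolding S_index_def
  proof (intro CollectI allI impI)
    fix j assume "j < n"
    then have "lam j \<noteq> lam k" unfolding n_def by (rule not_less_Least)
    then show "lam n \<noteq> lam j" using eq by simp
  qed
  have "enat (k - n) < mult_at lam n"
  proof (cases "finite {j. lam j = lam n}")
    case True
    define m where "m = card {j. lam j = lam n}"
    have m: "mult_at lam n = enat m" using True by (simp add: mult_at_def ecard_def m_def)
    \<comment> \<open>The block of \<open>m\<close> consecutive indices has as many elements as the
      whole set, hence exhausts it and contains \<open>k\<close>.\<close>
    have "(\<lambda>\<nu>. n + \<nu>) ` {..<m} \<subseteq> {j. lam j = lam n}"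
      using consec S m unfolding equal_consecutive_def by auto
    moreover have "card ((\<lambda>\<nu>. n + \<nu>) ` {..<m}) = m" by (simp add: card_image)
    ultimately have "(\<lambda>\<nu>. n + \<nu>) ` {..<m} = {j. lam j = lam n}"
      using True unfolding m_def by (intro card_subset_eq) simp_all
    then have "k \<in> (\<lambda>\<nu>. n + \<nu>) ` {..<m}" using eq by simp
    then show ?thesis unfolding m by auto
  next
    case False
    then show ?thesis by (simp add: mult_at_def ecard_def)
  qed
  then show "idx k \<in> E_index lam" using S by (simp add: E_index_def idx_def n_def)
qed

lemma idx_bij: "bij_betw idx UNIV (E_index lam)"
  unfolding bij_betw_def
proof
  show "inj idx" by (rule inj_on_inverseI[of _ "\<lambda>j. fst j + snd j"]) (rule idx_sum)
  show "range idx = E_index lam"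
  proof
    show "range idx \<subseteq> E_index lam" using idx_in by blast
    show "E_index lam \<subseteq> range idx"
    proof
      fix j assume "j \<in> E_index lam"
      then have "idx (fst j + snd j) = j" using idx_eq[of "fst j" "snd j"] by simp
      then show "j \<in> range idx" by (metis rangeI)
    qed
  qed
qed

lemma idx_simple:
  assumes "mult_at lam k = 1"
  shows "idx k = (k, 0)"
proof -
  have "enat (snd (idx k)) < mult_at lam (fst (idx k))" using idx_in[of k] by (auto simp: E_index_def split: prod.splits)
  also have "mult_at lam (fst (idx k)) = enat 1" using assms lam_idx[of k] by (simp add: mult_at_def one_enat_def)
  finally have "snd (idx k) = 0" by simp
  then show ?thesis using idx_sum[of k] by (metis add.right_neutral prod.collapse)
qed

text \<open>\<open>\<Delta> (lam k) = 0\<close> is a bilinear orthogonality between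
  \<open>(f1, f2)\<close> and \<open>(Y1, Y)\<close>; in dimension two, and with neither pair zero,
  it determines \<open>(f1, f2)\<close> up to a nonzero factor.\<close>

lemma f_proportional:
  assumes k: "k \<ge> 1"
  shows "\<exists>\<gamma>. \<gamma> \<noteq> 0 \<and> f1 (lam k) = \<gamma> * Y (lam k) pi \<and> f2 (lam k) = - \<gamma> * Y1 (lam k) pi"
proof -
  have \<Delta>0: "f1 (lam k) * Y1 (lam k) pi + f2 (lam k) * Y (lam k) pi = 0"
    using sub k by (simp add: subspectrum_def \<Delta>_eq)
  show ?thesis
  proof (cases "Y (lam k) pi = 0")
    case True
    then have Y1: "Y1 (lam k) pi \<noteq> 0" using Y_Y1_nonzero[of "lam k"] by simp
    then have "f1 (lam k) = 0" using \<Delta>0 True by simp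
    then show ?thesis using True Y1 f_nonzero[OF k] by (intro exI[of _ "- f2 (lam k) / Y1 (lam k) pi"]) auto
  next
    case False
    then have "f2 (lam k) = - (f1 (lam k) / Y (lam k) pi) * Y1 (lam k) pi"
      using \<Delta>0 by (simp add: field_simps add_eq_0_iff)
    then show ?thesis using False f_nonzero[OF k] by (intro exI[of _ "f1 (lam k) / Y (lam k) pi"]) auto
  qed
qed

lemma v_simple:
  assumes "mult_at lam k = 1" "k \<ge> 1"
  shows "v k = ((\<lambda>t. lam k * f1 (lam k) * ex 0 (lam k) t), (\<lambda>t. f2 (lam k) * ex 0 (lam k) t))"
proof -
  have "v k = v_coeff f1 f2 (snd (idx k)) (lam (fst (idx k)))" using assms by (simp add: v_seq_def idx_def Let_def)
  then show ?thesis unfolding idx_simple[OF assms(1)] by (simp add: v_coeff_def ex_0)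
qed

text \<open>What remains of \<open>v k\<close>, for an index with \<open>mult_at lam k = 1\<close>,
  after its scalar factor is divided out; its main exponential part is
  \<open>J (ex 0 z)\<close>.\<close>

definition approx :: "complex \<Rightarrow> (real \<Rightarrow> complex) \<times> (real \<Rightarrow> complex)" where
  "approx z = ((\<lambda>t. z * Y z pi * ex 0 z t), (\<lambda>t. - Y1 z pi * ex 0 z t))"

lemma approx_closed: "approx z \<in> carrier \<H>"
  unfolding approx_def \<H>_def direct_sum_simps L2_simps
  by (intro SigmaI sq_integrable_scale ex_sq_integrable)

text \<open>An equality, since the main exponentials cancel; the parallelogram law decouples the two
  remainders.\<close>

lemma hnorm_approx_diff:
  "(hnorm \<H> (approx z - J (ex 0 z)))\<^sup>2 = ((cmod (\<kappa>u z pi))\<^sup>2 + (cmod (\<kappa>w z pi))\<^sup>2) / 2 * (hnorm (L2 (- pi) pi) (ex 0 z))\<^sup>2"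
proof -
  define a b where "a = \<kappa>u z pi" and "b = \<kappa>w z pi"
  have e: "exp (- ph pi) * ex 0 z (t + pi) = exp (\<i> * z * of_real pi - ph pi) * ex 0 z t"
    "exp (ph pi) * ex 0 z (t - pi) = exp (ph pi - \<i> * z * of_real pi) * ex 0 z t" for t
    by (simp_all add: ex_0 algebra_simps flip: exp_add)
  have U: "z * Y z pi = (exp (\<i> * z * of_real pi - ph pi) + a - (exp (ph pi - \<i> * z * of_real pi) + b)) / (2 * \<i>)"
    and Y1: "Y1 z pi = (exp (\<i> * z * of_real pi - ph pi) + a + (exp (ph pi - \<i> * z * of_real pi) + b)) / 2"
    by (simp_all add: a_def b_def \<kappa>u_def \<kappa>w_def U_def W_def)
  have "approx z - J (ex 0 z) = ((\<lambda>t. (a - b) / (2 * \<i>) * ex 0 z t), (\<lambda>t. - (a + b) / 2 * ex 0 z t))"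
    unfolding approx_def J_def e U Y1 by (simp add: fun_eq_iff field_simps)
  moreover have "hnorm (L2 (- pi) pi) (\<lambda>t. c * ex 0 z t) = cmod c * hnorm (L2 (- pi) pi) (ex 0 z)" for c
    using L2.N_scale[of "ex 0 z" "- pi" pi c] by (simp add: ex_sq_integrable)
  ultimately have "(hnorm \<H> (approx z - J (ex 0 z)))\<^sup>2
      = ((cmod ((a - b) / (2 * \<i>)))\<^sup>2 + (cmod (- (a + b) / 2))\<^sup>2) * (hnorm (L2 (- pi) pi) (ex 0 z))\<^sup>2"
    by (simp only: hnorm_H ex_sq_integrable sq_integrable_scale power_mult_distrib distrib_right)
  also have "(cmod ((a - b) / (2 * \<i>)))\<^sup>2 + (cmod (- (a + b) / 2))\<^sup>2 = ((cmod (a - b))\<^sup>2 + (cmod (a + b))\<^sup>2) / 4"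
    by (simp only: norm_divide norm_minus_cancel power_divide norm_mult norm_ii norm_numeral) (simp add: power2_eq_square)
  also have "\<dots> = ((cmod a)\<^sup>2 + (cmod b)\<^sup>2) / 2" by (simp add: parallelogram)
  finally show ?thesis by (simp add: a_def b_def)
qed

lemma bounded_square_sum:
  fixes s C :: real
  assumes "s\<^sup>2 \<le> C * s" "0 \<le> s" "0 \<le> C"
  shows "s\<^sup>2 \<le> C\<^sup>2"
proof (cases "s = 0")
  case False
  then have "s \<le> C" using assms(1,2) by (simp add: power2_eq_square)
  then show ?thesis using assms(2) by (intro power_mono)
qed simp

theorem v_unconditional_basis:
  assumes riesz: "riesz_basis (L2 (- 2 * pi) (2 * pi)) (E_index lam) (E_system lam)"
    and Im: "(\<lambda>n. Im (lam n)) \<in> O(\<lambda>_. 1)"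
    and simple: "\<exists>n0\<ge>1. \<forall>n\<ge>n0. mult_at lam n = 1"
  shows "unconditional_basis \<H> v"
proof -
  let ?X = "L2 (- 2 * pi) (2 * pi)"
  obtain c C where c: "c > 0" "L2.lower_riesz (- 2 * pi) (2 * pi) (E_index lam) (E_system lam) c"
    and C: "C > 0" "L2.upper_riesz (- 2 * pi) (2 * pi) (E_index lam) (E_system lam) C"
    using L2.riesz_basis_bounds(2,3)[OF riesz] by blast
  note compl = L2.riesz_basis_bounds(1)[OF riesz]
  have vcompl: "complete_system \<H> UNIV v" by (rule v_complete[OF compl])
  define \<epsilon> where "\<epsilon> k = E_system lam (idx k)" for k
  have \<epsilon>: "complete_system ?X UNIV \<epsilon>" "L2.lower_riesz (- 2 * pi) (2 * pi) UNIV \<epsilon> c" "L2.upper_riesz (- 2 * pi) (2 * pi) UNIV \<epsilon> C"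
    unfolding \<epsilon>_def[abs_def]
    by (rule L2.reindex_riesz[OF idx_bij] compl c(2) C(2))+
  have \<epsilon>c: "continuous_on UNIV (\<epsilon> k)" for k unfolding \<epsilon>_def E_system_eq by (rule ex_continuous)
  have lcc: "continuous_on UNIV (lincomb ?X \<epsilon> a F)" for a F
    unfolding lincomb_L2 by (intro continuous_intros \<epsilon>c)
  \<comment> \<open>The image of the Riesz basis of exponentials under \<open>J\<close>. The bounds
    for \<open>J\<close> are applied to finite sums, which are continuous.\<close>
  define x where "x k = J (\<epsilon> k)" for k
  have xcompl: "complete_system \<H> UNIV x" unfolding x_def[abs_def] by (rule J_complete[OF \<epsilon>(1) \<epsilon>c])
  obtain m M where mM: "m > 0" "M > 0" "\<And>\<phi>. continuous_on UNIV \<phi> \<Longrightarrow>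
     m * hnorm ?X \<phi> \<le> hnorm \<H> (J \<phi>) \<and> hnorm \<H> (J \<phi>) \<le> M * hnorm ?X \<phi>"
    using J_bounds by blast
  have lcx: "lincomb \<H> x a F = J (lincomb ?X \<epsilon> a F)" for a F
    unfolding x_def[abs_def] by (rule J_lincomb)
  have xlow: "H.lower_riesz UNIV x (m * c)"
    unfolding H.lower_riesz_def
  proof (intro allI impI)
    fix F :: "nat set" and a :: "nat \<Rightarrow> complex" assume "finite F \<and> F \<subseteq> UNIV"
    then have "c * L2_set (\<lambda>j. cmod (a j)) F \<le> hnorm ?X (lincomb ?X \<epsilon> a F)" using \<epsilon>(2) by (simp add: L2.lower_riesz_def)
    then have "m * (c * L2_set (\<lambda>j. cmod (a j)) F) \<le> m * hnorm ?X (lincomb ?X \<epsilon> a F)" using mM(1) by (intro mult_left_mono) auto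
    also have "\<dots> \<le> hnorm \<H> (lincomb \<H> x a F)" unfolding lcx using mM(3)[OF lcc] by blast
    finally show "m * c * L2_set (\<lambda>j. cmod (a j)) F \<le> hnorm \<H> (lincomb \<H> x a F)" by (simp add: mult.assoc)
  qed
  have xup: "H.upper_riesz UNIV x (M * C)"
    unfolding H.upper_riesz_def
  proof (intro allI impI)
    fix F :: "nat set" and a :: "nat \<Rightarrow> complex" assume "finite F \<and> F \<subseteq> UNIV"
    then have u: "hnorm ?X (lincomb ?X \<epsilon> a F) \<le> C * L2_set (\<lambda>j. cmod (a j)) F" using \<epsilon>(3) by (simp add: L2.upper_riesz_def)
    have "hnorm \<H> (lincomb \<H> x a F) \<le> M * hnorm ?X (lincomb ?X \<epsilon> a F)" unfolding lcx using mM(3)[OF lcc] by blast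
    also have "\<dots> \<le> M * (C * L2_set (\<lambda>j. cmod (a j)) F)" using u mM(2) by (intro mult_left_mono) auto
    finally show "hnorm \<H> (lincomb \<H> x a F) \<le> M * C * L2_set (\<lambda>j. cmod (a j)) F" by (simp add: mult.assoc)
  qed
  obtain n0 where n0: "n0 \<ge> 1" "\<And>n. n \<ge> n0 \<Longrightarrow> mult_at lam n = 1" using simple by blast
  obtain R where "\<forall>\<^sub>F n in sequentially. norm (Im (lam n)) \<le> R * norm (1::real)"
    using Im by (elim landau_o.bigE)
  then obtain n1 where n1: "\<And>n. n \<ge> n1 \<Longrightarrow> \<bar>Im (lam n)\<bar> \<le> R" by (auto simp: eventually_sequentially)
  define N where "N = max n0 n1"
  have N: "k \<ge> 1" "mult_at lam k = 1" "\<bar>Im (lam k)\<bar> \<le> R" if "k \<ge> N" for k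
    using that n0 n1 by (auto simp: N_def)
  have \<epsilon>N: "\<epsilon> k = ex 0 (lam k)" if "k \<ge> N" for k
    unfolding \<epsilon>_def E_system_eq idx_simple[OF N(2)[OF that]] by simp
  have "\<forall>k. k \<ge> N \<longrightarrow> (\<exists>\<gamma>. \<gamma> \<noteq> 0 \<and> f1 (lam k) = \<gamma> * Y (lam k) pi \<and> f2 (lam k) = - \<gamma> * Y1 (lam k) pi)"
    using f_proportional N(1) by blast
  then obtain \<gamma> where \<gamma>: "\<And>k. k \<ge> N \<Longrightarrow> \<gamma> k \<noteq> 0 \<and> f1 (lam k) = \<gamma> k * Y (lam k) pi \<and> f2 (lam k) = - \<gamma> k * Y1 (lam k) pi"
    by metis
  \<comment> \<open>Before \<open>N\<close> the elements of \<open>v\<close> are kept. From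
    \<open>N\<close> on the factor \<open>\<gamma> k\<close>, whose size is not controlled, is split
    off, so that \<open>g\<close> can be compared with \<open>x\<close>.\<close>
  define w where "w k = (if k < N then 1 else \<gamma> k)" for k
  define g where "g k = (if k < N then v k else approx (lam k))" for k
  have w0: "w k \<noteq> 0" for k using \<gamma>[of k] by (simp add: w_def)
  have vg: "v k = scale \<H> (w k) (g k)" for k
  proof (cases "k < N")
    case True
    then show ?thesis by (simp add: w_def g_def H.scale_one)
  next
    case False
    then show ?thesis using v_simple[OF N(2,1), of k] \<gamma>[of k]
      by (simp add: w_def g_def approx_def \<H>_def fun_eq_iff)
  qed
  have gc: "g k \<in> carrier \<H>" for k by (simp add: g_def approx_closed v_closed)
  have gcompl: "complete_system \<H> UNIV g"
  proof (rule H.complete_system_trans[OF vcompl gc])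
    show "H.in_closed_span g UNIV (v k)" for k
      unfolding vg by (intro H.in_closed_span_scale H.in_closed_span_member gc) simp
  qed
  define B where "B = exp (pi * R) * sqrt (2 * pi)"
  have eB: "(hnorm (L2 (- pi) pi) (ex 0 (lam k)))\<^sup>2 \<le> B\<^sup>2" if "k \<ge> N" for k
    unfolding B_def using hnorm_ex_strip[OF N(3)[OF that]] L2.N_nonneg[of "ex 0 (lam k)" "- pi" pi]
    by (intro power_mono) (auto simp: ex_sq_integrable)
  obtain K where K: "K > 0" "\<And>(F::nat set) c \<mu>. finite F \<Longrightarrow>
     cmod (\<Sum>j\<in>F. c j * \<kappa>u (\<mu> j) pi) \<le> K * hnorm (L2 (- pi) pi) (\<lambda>t. \<Sum>j\<in>F. c j * ex 0 (\<mu> j) t) \<and>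
     cmod (\<Sum>j\<in>F. c j * \<kappa>w (\<mu> j) pi) \<le> K * hnorm (L2 (- pi) pi) (\<lambda>t. \<Sum>j\<in>F. c j * ex 0 (\<mu> j) t)"
    using \<kappa>_bound[where 'i=nat] by blast
  \<comment> \<open>Duality: with coefficients \<open>cnj (\<kappa> (lam j))\<close> the left side
    of the remainder estimate is the square sum \<open>s^2\<close> itself, and the upper Riesz bound
    turns the right side into a multiple of \<open>s\<close>. Hence \<open>s\<close> is bounded
    independently of \<open>F\<close>.\<close>
  have sq: "(\<Sum>j\<in>F. (cmod (\<kappa> (lam j)))\<^sup>2) \<le> (K * C)\<^sup>2"
    if F: "finite F" "\<And>j. j \<in> F \<Longrightarrow> j \<ge> N"
      and \<kappa>: "\<And>c. cmod (\<Sum>j\<in>F. c j * \<kappa> (lam j)) \<le> K * hnorm (L2 (- pi) pi) (\<lambda>t. \<Sum>j\<in>F. c j * ex 0 (lam j) t)"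
    for F \<kappa>
  proof -
    define a where "a j = cnj (\<kappa> (lam j))" for j
    define s where "s = L2_set (\<lambda>j. cmod (a j)) F"
    have s2: "s\<^sup>2 = (\<Sum>j\<in>F. (cmod (\<kappa> (lam j)))\<^sup>2)" by (simp add: s_def L2_set_def a_def sum_nonneg)
    have lc: "(\<lambda>t. \<Sum>j\<in>F. a j * ex 0 (lam j) t) = lincomb ?X \<epsilon> a F"
      unfolding lincomb_L2 using \<epsilon>N F(2) by (intro ext sum.cong) auto
    have "(\<Sum>j\<in>F. a j * \<kappa> (lam j)) = of_real (s\<^sup>2)"
      unfolding s2 of_real_sum a_def by (intro sum.cong refl) (metis complex_norm_square mult.commute)
    then have "s\<^sup>2 \<le> K * hnorm (L2 (- pi) pi) (lincomb ?X \<epsilon> a F)" using \<kappa>[of a] by (simp add: lc norm_power)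
    also have "\<dots> \<le> K * hnorm ?X (lincomb ?X \<epsilon> a F)"
      using K(1) sq_integrable_restrict(2)[OF continuous_sq_integrable[OF lcc], of "- 2 * pi" "- pi" pi "2 * pi"]
      by (intro mult_left_mono) auto
    also have "\<dots> \<le> K * (C * s)"
      using K(1) \<epsilon>(3) F(1) unfolding s_def L2.upper_riesz_def by (intro mult_left_mono) auto
    finally have "s\<^sup>2 \<le> (K * C) * s" by simp
    then have "s\<^sup>2 \<le> (K * C)\<^sup>2"
      using K(1) C(1) by (intro bounded_square_sum) (auto simp: s_def L2_set_nonneg)
    then show ?thesis unfolding s2 .
  qed
  \<comment> \<open>\<open>B\<close> bounds the norms of the exponentials in the strip, so square
    summable remainders give square summable distances.\<close>
  have close: "summable (\<lambda>k. (hnorm \<H> (g (k + N) - x (k + N)))\<^sup>2)"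
  proof (rule summableI_nonneg_bounded)
    fix n
    define F where "F = (\<lambda>k. k + N) ` {..<n}"
    have F: "finite F" "\<And>j. j \<in> F \<Longrightarrow> j \<ge> N" by (auto simp: F_def)
    have "(\<Sum>k<n. (hnorm \<H> (g (k + N) - x (k + N)))\<^sup>2) = (\<Sum>j\<in>F. (hnorm \<H> (g j - x j))\<^sup>2)"
      unfolding F_def by (subst sum.reindex) auto
    also have "\<dots> \<le> (\<Sum>j\<in>F. ((cmod (\<kappa>u (lam j) pi))\<^sup>2 + (cmod (\<kappa>w (lam j) pi))\<^sup>2) / 2 * B\<^sup>2)"
    proof (rule sum_mono)
      fix j assume "j \<in> F"
      then have j: "j \<ge> N" by (rule F(2))
      then have "(hnorm \<H> (g j - x j))\<^sup>2 = (hnorm \<H> (approx (lam j) - J (ex 0 (lam j))))\<^sup>2"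
        by (simp add: g_def x_def \<epsilon>N)
      also have "\<dots> \<le> ((cmod (\<kappa>u (lam j) pi))\<^sup>2 + (cmod (\<kappa>w (lam j) pi))\<^sup>2) / 2 * B\<^sup>2"
        unfolding hnorm_approx_diff by (intro mult_left_mono eB j) simp
      finally show "(hnorm \<H> (g j - x j))\<^sup>2 \<le> ((cmod (\<kappa>u (lam j) pi))\<^sup>2 + (cmod (\<kappa>w (lam j) pi))\<^sup>2) / 2 * B\<^sup>2" .
    qed
    also have "\<dots> = ((\<Sum>j\<in>F. (cmod (\<kappa>u (lam j) pi))\<^sup>2) + (\<Sum>j\<in>F. (cmod (\<kappa>w (lam j) pi))\<^sup>2)) / 2 * B\<^sup>2"
      by (simp only: sum.distrib flip: sum_distrib_right sum_divide_distrib)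
    also have "\<dots> \<le> ((K * C)\<^sup>2 + (K * C)\<^sup>2) / 2 * B\<^sup>2"
      using sq[OF F, of "\<lambda>z. \<kappa>u z pi"] sq[OF F, of "\<lambda>z. \<kappa>w z pi"] K(2)[OF F(1), of _ lam]
      by (intro mult_right_mono divide_right_mono add_mono) auto
    finally show "(\<Sum>k<n. (hnorm \<H> (g (k + N) - x (k + N)))\<^sup>2) \<le> ((K * C)\<^sup>2 + (K * C)\<^sup>2) / 2 * B\<^sup>2" .
  qed simp
  have "(\<exists>c>0. H.lower_riesz UNIV g c) \<and> (\<exists>C>0. H.upper_riesz UNIV g C)"
    using mM(1,2) c(1) C(1)
    by (intro H.quadratically_close_riesz[OF xcompl _ xlow _ xup gcompl close]) simp_all
  then obtain c' C' where c': "0 < c'" "H.lower_riesz UNIV g c'" and C': "0 < C'" "H.upper_riesz UNIV g C'" by blast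
  have "unconditional_basis \<H> (\<lambda>k. scale \<H> (w k) (g k))"
    by (rule H.unconditional_basisI[OF gcompl c' C' w0])
  then show ?thesis by (simp only: vg[symmetric])
qed

end

theorem theorem2:
  fixes p \<sigma> :: "real \<Rightarrow> complex"
    and f1 f2 :: "complex \<Rightarrow> complex"
    and lam :: "nat \<Rightarrow> complex"
  assumes "p \<in> sq_integrable 0 pi" and "\<sigma> \<in> sq_integrable 0 pi"
    and "f1 holomorphic_on UNIV" and "f2 holomorphic_on UNIV"
    and "subspectrum p \<sigma> f1 f2 lam"
    and "lam 0 = 0"
    and "equal_consecutive lam"
    and "\<And>n. n \<ge> 1 \<Longrightarrow> \<not> (f1 (lam n) = 0 \<and> f2 (lam n) = 0)"
  shows "(complete_system (L2 (- 2 * pi) (2 * pi)) (E_index lam) (E_system lam)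
            \<longrightarrow> complete_system \<H> UNIV (v_seq f1 f2 lam)) \<and>
         (riesz_basis (L2 (- 2 * pi) (2 * pi)) (E_index lam) (E_system lam) \<and>
          (\<lambda>n. Im (lam n)) \<in> O(\<lambda>_. 1) \<and>
          (\<exists>n0\<ge>1. \<forall>n\<ge>n0. mult_at lam n = 1)
            \<longrightarrow> unconditional_basis \<H> (v_seq f1 f2 lam))"
proof -
  interpret subspectrum_data p \<sigma> f1 f2 lam
    by (intro subspectrum_data.intro pencil.intro subspectrum_data_axioms.intro assms)
  show ?thesis using v_complete v_unconditional_basis by blast
qed

end
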